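(* Let $\Delta$ be a tropical surface which is locally connected through codimension~$1$. Then the $\mathbb R$-span of the image of $H^0(\Delta, \mathcal{D})$ in $H^1(\Delta, \mathbb R)$ has codimension at most~$1$. Moreover, if there exists a divisor on~$\Delta$ with positive self-intersection, then the $\mathbb R$-span is all of $H^1(\Delta, \mathbb R)$.
   Context: A weak tropical surface $\Delta$ is a finite connected $\Delta$-complex of dimension at most $2$ with integers $\alpha(v,e)$ for endpoints $v$ of edges $e$ satisfying $\alpha(v,e)+\alpha(w,e)=\#\operatorname{link}_\Delta(e)$ for endpoints $v,w$ of $e$. Its local intersection matrix $M_v$ at a vertex $v$ is indexed by vertices of $\operatorname{link}_\Delta(v)$, with off-diagonal entries the number of edges between the two link vertices and diagonal entry $-\alpha(w,e)+2\cdot\#\{\text{loops}\}$ at the link vertex corresponding to $e$ ($w$ the other endpoint of $e$). It is a tropical surface if every $M_v$ has exactly one positive eigenvalue, and locally connected through codimension $1$ if every vertex link is connected. PL functions are continuous, piecewise linear with integral slopes on facets identified with unimodular simplices; each has a divisor (formal sum of segments), and linear functions are PL functions with trivial divisor. Let $\mathcal A$ be the sheaf of linear functions, $\mathbb R$ the sheaf of locally constant real functions and $\mathcal{D}=\mathcal A/\mathbb R$; the map $H^0(\Delta,\mathcal{D})\to H^1(\Delta,\mathbb R)$ is the connecting map of the long exact cohomology sequence of $0\to\mathbb R\to\mathcal A\to\mathcal{D}\to 0$. Divisors are formal sums of segments locally equal to a rational multiple of the divisor of a PL function; self-intersection is the degree of $D\cdot D$, computed locally as the sum over segments of $D$ of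 coefficient times outgoing slope of a local defining function of $D$. *)

theory Defs
  imports "HOL-Analysis.Analysis" "Jordan_Normal_Form.Char_Poly"
begin

section \<open>Two-dimensional Delta-complexes and their realizations\<close>

text \<open>
  A Delta-complex of dimension at most 2 is given by its cells and face maps.  The endpoints of an
  edge are numbered 0, 1 and the vertices of a triangle 0, 1, 2; the side numbered k of a triangle
  is the one opposite to the vertex k.  Gluings preserve the numbering: side 0 runs from vertex 1 to
  vertex 2, side 1 from vertex 0 to vertex 2, and side 2 from vertex 0 to vertex 1.  Loops and
  triangles with identified sides or vertices are allowed.
\<close>

record ('v, 'e, 'f) delta_complex =
  verts :: "'v set"
  edges :: "'e set"
  tris :: "'f set"
  endpt :: "'e \<Rightarrow> nat \<Rightarrow> 'v"
  side :: "'f \<Rightarrow> nat \<Rightarrow> 'e"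

definition finite_delta_complex :: "('v, 'e, 'f) delta_complex \<Rightarrow> bool" where
  "finite_delta_complex X \<longleftrightarrow>
     finite (verts X) \<and> finite (edges X) \<and> finite (tris X) \<and>
     (\<forall>e\<in>edges X. \<forall>i<2. endpt X e i \<in> verts X) \<and>
     (\<forall>f\<in>tris X. (\<forall>k<3. side X f k \<in> edges X) \<and>
        endpt X (side X f 1) 0 = endpt X (side X f 2) 0 \<and>
        endpt X (side X f 0) 0 = endpt X (side X f 2) 1 \<and>
        endpt X (side X f 0) 1 = endpt X (side X f 1) 1)"

text \<open>
  The realization is the disjoint union of the open cells.  An edge is parametrized by the unit
  interval, and a triangle by the unimodular simplex with vertices (0,0), (1,0), (0,1), in this
  order.  The characteristic maps are only meaningful on these closed simplices.
\<close>

datatype ('v, 'e, 'f) pt = VPt 'v | EPt 'e real | FPt 'f "real \<times> real"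

definition std_triangle :: "(real \<times> real) set" where
  "std_triangle = {(s, t). 0 \<le> s \<and> 0 \<le> t \<and> s + t \<le> 1}"

definition echar :: "('v, 'e, 'f) delta_complex \<Rightarrow> 'e \<Rightarrow> real \<Rightarrow> ('v, 'e, 'f) pt" where
  "echar X e t =
     (if t = 0 then VPt (endpt X e 0) else if t = 1 then VPt (endpt X e 1) else EPt e t)"

definition fchar :: "('v, 'e, 'f) delta_complex \<Rightarrow> 'f \<Rightarrow> real \<times> real \<Rightarrow> ('v, 'e, 'f) pt" where
  "fchar X f p =
     (if snd p = 0 then echar X (side X f 2) (fst p)
      else if fst p = 0 then echar X (side X f 1) (snd p)
      else if fst p + snd p = 1 then echar X (side X f 0) (snd p)
      else FPt f p)"

definition points :: "('v, 'e, 'f) delta_complex \<Rightarrow> ('v, 'e, 'f) pt set" where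
  "points X = VPt ` verts X \<union> (\<Union>e\<in>edges X. EPt e ` {0<..<1}) \<union>
     (\<Union>f\<in>tris X. FPt f ` interior std_triangle)"

text \<open>The quotient topology of the disjoint union of the closed simplices.\<close>

definition open_in_realization :: "('v, 'e, 'f) delta_complex \<Rightarrow> ('v, 'e, 'f) pt set \<Rightarrow> bool" where
  "open_in_realization X U \<longleftrightarrow> U \<subseteq> points X \<and>
     (\<forall>e\<in>edges X. openin (top_of_set {0..1}) {t\<in>{0..1}. echar X e t \<in> U}) \<and>
     (\<forall>f\<in>tris X. openin (top_of_set std_triangle) {p\<in>std_triangle. fchar X f p \<in> U})"

definition realization :: "('v, 'e, 'f) delta_complex \<Rightarrow> ('v, 'e, 'f) pt topology" where
  "realization X = topology (open_in_realization X)"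

lemma istopology_open_in_realization: "istopology (open_in_realization X)"
  unfolding istopology_def
proof (intro conjI allI impI)
  fix U V assume U: "open_in_realization X U" and V: "open_in_realization X V"
  have e: "{t\<in>A. g t \<in> U \<inter> V} = {t\<in>A. g t \<in> U} \<inter> {t\<in>A. g t \<in> V}"
    for A and g :: "'z \<Rightarrow> ('a, 'b, 'c) pt" by blast
  from U V show "open_in_realization X (U \<inter> V)"
    unfolding open_in_realization_def e
    by (meson openin_Int inf.coboundedI1)
next
  fix K assume K: "\<forall>U\<in>K. open_in_realization X U"
  have e: "{t\<in>A. g t \<in> \<Union>K} = \<Union>((\<lambda>U. {t\<in>A. g t \<in> U}) ` K)"
    for A and g :: "'z \<Rightarrow> ('a, 'b, 'c) pt" by blast
  show "open_in_realization X (\<Union>K)"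
    unfolding open_in_realization_def e
  proof (intro conjI ballI openin_Union)
    show "\<Union>K \<subseteq> points X"
      using K unfolding open_in_realization_def by blast
  qed (use K in \<open>unfold open_in_realization_def, blast\<close>)+
qed

lemma openin_realization: "openin (realization X) = open_in_realization X"
  unfolding realization_def by (rule topology_inverse'[OF istopology_open_in_realization])


section \<open>Links and tropical surfaces\<close>

text \<open>
  The link vertices at v are the pairs (e, i) such that the endpoint i of e is v, so a loop of the
  complex contributes two of them.  The link edges at v are the pairs (f, k) such that the vertex k
  of f is v.  A link edge (f, k) joins the link vertices given by the two sides of f meeting at the
  vertex k; they are listed in \<open>corner\<close> as (side number, number of the endpoint of that side).
\<close>

definition corner :: "nat \<Rightarrow> nat \<Rightarrow> nat \<times> nat" where
  "corner k i = [[(2, 0), (1, 0)], [(2, 1), (0, 0)], [(1, 1), (0, 1)]] ! k ! i"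

definition tri_vert :: "('v, 'e, 'f) delta_complex \<Rightarrow> 'f \<Rightarrow> nat \<Rightarrow> 'v" where
  "tri_vert X f k = (case corner k 0 of (j, b) \<Rightarrow> endpt X (side X f j) b)"

definition vertex_link :: "('v, 'e, 'f) delta_complex \<Rightarrow> 'v \<Rightarrow>
    ('e \<times> nat, 'f \<times> nat, unit) delta_complex" where
  "vertex_link X v = \<lparr>
     verts = {(e, i). e \<in> edges X \<and> i < 2 \<and> endpt X e i = v},
     edges = {(f, k). f \<in> tris X \<and> k < 3 \<and> tri_vert X f k = v},
     tris = {},
     endpt = (\<lambda>(f, k) i. case corner k i of (j, b) \<Rightarrow> (side X f j, b)),
     side = (\<lambda>_. undefined) \<rparr>"

definition edge_link :: "('v, 'e, 'f) delta_complex \<Rightarrow> 'e \<Rightarrow> ('f \<times> nat) set" where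
  "edge_link X e = {(f, k). f \<in> tris X \<and> k < 3 \<and> side X f k = e}"

text \<open>The integer attached to the endpoint i of the edge e is \<open>\<alpha> e i\<close>.\<close>

definition weak_tropical_surface ::
    "('v, 'e, 'f) delta_complex \<Rightarrow> ('e \<Rightarrow> nat \<Rightarrow> int) \<Rightarrow> bool" where
  "weak_tropical_surface X \<alpha> \<longleftrightarrow>
     finite_delta_complex X \<and> connected_space (realization X) \<and>
     (\<forall>e\<in>edges X. \<alpha> e 0 + \<alpha> e 1 = int (card (edge_link X e)))"

definition local_intersection_entry :: "('v, 'e, 'f) delta_complex \<Rightarrow> ('e \<Rightarrow> nat \<Rightarrow> int) \<Rightarrow>
    'v \<Rightarrow> 'e \<times> nat \<Rightarrow> 'e \<times> nat \<Rightarrow> int" where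
  "local_intersection_entry X \<alpha> v a b = (let L = vertex_link X v in
     if a = b
     then - \<alpha> (fst a) (1 - snd a) + 2 * int (card {l \<in> edges L. endpt L l 0 = a \<and> endpt L l 1 = a})
     else int (card {l \<in> edges L. {endpt L l 0, endpt L l 1} = {a, b}}))"

definition local_intersection_matrix :: "('v, 'e, 'f) delta_complex \<Rightarrow> ('e \<Rightarrow> nat \<Rightarrow> int) \<Rightarrow>
    'v \<Rightarrow> ('e \<times> nat) list \<Rightarrow> real Matrix.mat" where
  "local_intersection_matrix X \<alpha> v xs = Matrix.mat (length xs) (length xs)
     (\<lambda>(i, j). of_int (local_intersection_entry X \<alpha> v (xs ! i) (xs ! j)))"

definition num_pos_eigenvalues :: "real Matrix.mat \<Rightarrow> nat" where
  "num_pos_eigenvalues A = (\<Sum>r | eigenvalue A r \<and> r > 0. Polynomial.order r (char_poly A))"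

text \<open>The rows and columns are labeled by the link vertices, listed in any order.\<close>

definition tropical_surface ::
    "('v, 'e, 'f) delta_complex \<Rightarrow> ('e \<Rightarrow> nat \<Rightarrow> int) \<Rightarrow> bool" where
  "tropical_surface X \<alpha> \<longleftrightarrow> weak_tropical_surface X \<alpha> \<and>
     (\<forall>v\<in>verts X. \<forall>xs. distinct xs \<and> set xs = verts (vertex_link X v) \<longrightarrow>
        num_pos_eigenvalues (local_intersection_matrix X \<alpha> v xs) = 1)"

definition loc_connected_codim1 :: "('v, 'e, 'f) delta_complex \<Rightarrow> bool" where
  "loc_connected_codim1 X \<longleftrightarrow> (\<forall>v\<in>verts X. connected_space (realization (vertex_link X v)))"


section \<open>Piecewise linear functions and their divisors\<close>

definition int_affine_on :: "'a::euclidean_space set \<Rightarrow> ('a \<Rightarrow> real) \<Rightarrow> bool" where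
  "int_affine_on S g \<longleftrightarrow> (\<exists>w c. (\<forall>b\<in>Basis. inner w b \<in> \<int>) \<and> (\<forall>y\<in>S. g y = inner w y + c))"

definition int_pl_near :: "'a::euclidean_space set \<Rightarrow> 'a \<Rightarrow> ('a \<Rightarrow> real) \<Rightarrow> bool" where
  "int_pl_near T p g \<longleftrightarrow> (\<exists>N \<P>. open N \<and> p \<in> N \<and> finite \<P> \<and> (\<forall>P\<in>\<P>. polyhedron P) \<and>
     N \<inter> T \<subseteq> \<Union>\<P> \<and> (\<forall>P\<in>\<P>. int_affine_on (P \<inter> N \<inter> T) g))"

text \<open>
  Functions on an open set U are represented by total functions whose values outside U are
  irrelevant.  The condition on the edges follows from the one on the triangles, except for edges
  that are themselves facets.
\<close>

definition pl_on :: "('v, 'e, 'f) delta_complex \<Rightarrow> ('v, 'e, 'f) pt set \<Rightarrow>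
    (('v, 'e, 'f) pt \<Rightarrow> real) \<Rightarrow> bool" where
  "pl_on X U \<phi> \<longleftrightarrow> continuous_map (subtopology (realization X) U) euclideanreal \<phi> \<and>
     (\<forall>e\<in>edges X. \<forall>t\<in>{0..1}. echar X e t \<in> U \<longrightarrow> int_pl_near {0..1} t (\<phi> \<circ> echar X e)) \<and>
     (\<forall>f\<in>tris X. \<forall>p\<in>std_triangle. fchar X f p \<in> U \<longrightarrow>
        int_pl_near std_triangle p (\<phi> \<circ> fchar X f))"

definition primitive_vec :: "real \<times> real \<Rightarrow> bool" where
  "primitive_vec u \<longleftrightarrow> (\<exists>a b :: int. coprime a b \<and> u = (of_int a, of_int b))"

definition tri_corner :: "nat \<Rightarrow> real \<times> real" where
  "tri_corner k = [(0, 0), (1, 0), (0, 1)] ! k"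

definition tri_side :: "nat \<Rightarrow> real \<Rightarrow> real \<times> real" where
  "tri_side k t = [(1 - t, t), (0, t), (t, 0)] ! k"

lemma fchar_tri_side:
  assumes "finite_delta_complex X" "f \<in> tris X" "k < 3" "0 \<le> t" "t \<le> 1"
  shows "fchar X f (tri_side k t) = echar X (side X f k) t"
proof -
  have v: "endpt X (side X f 1) 0 = endpt X (side X f 2) 0"
    "endpt X (side X f 0) 0 = endpt X (side X f 2) 1"
    "endpt X (side X f 0) 1 = endpt X (side X f 1) 1"
    using assms(1,2) unfolding finite_delta_complex_def by blast+
  consider "k = 0" | "k = 1" | "k = 2" using assms(3) by linarith
  then show ?thesis
    by cases (simp_all add: fchar_def echar_def tri_side_def v[simplified])
qed

text \<open>
  The coefficient m of the divisor of \<open>\<phi>\<close> at a general point of the realization.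

  Inside a triangle, \<open>\<phi>\<close> is affine on both sides of a line through the point, and m is the change
  of slope measured by the primitive linear form n that vanishes along the line.

  Inside an edge e, \<open>\<phi>\<close> is affine on e and on each triangle containing e.  Extend these affine
  functions to the entire simplices.  Then m is the sum of the values at the vertices opposite to
  e, minus the sum over the endpoints of e of the value there times \<open>\<alpha>\<close>.  This is the obstruction
  to factoring \<open>\<phi>\<close> through the map sending the endpoints v, w of e and the opposite vertices to the
  standard generators of \<open>\<int>^(2+d)\<close> modulo \<open>(\<alpha>(v,e), \<alpha>(w,e), -1, ..., -1)\<close>, where d is the
  number of points of the link of e.
\<close>

definition tri_coeff :: "('v, 'e, 'f) delta_complex \<Rightarrow> (('v, 'e, 'f) pt \<Rightarrow> real) \<Rightarrow>
    'f \<Rightarrow> real \<times> real \<Rightarrow> int \<Rightarrow> bool" where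
  "tri_coeff X \<phi> f p m \<longleftrightarrow> (\<exists>w c n. primitive_vec n \<and>
     (\<forall>\<^sub>F y in nhds p. \<phi> (fchar X f y) = inner w y + c + of_int m * max 0 (inner n (y - p))))"

definition edge_coeff :: "('v, 'e, 'f) delta_complex \<Rightarrow> ('e \<Rightarrow> nat \<Rightarrow> int) \<Rightarrow>
    (('v, 'e, 'f) pt \<Rightarrow> real) \<Rightarrow> 'e \<Rightarrow> real \<Rightarrow> int \<Rightarrow> bool" where
  "edge_coeff X \<alpha> \<phi> e t m \<longleftrightarrow> (\<exists>a b w c.
     (\<forall>\<^sub>F s in nhds t. \<phi> (echar X e s) = a * s + b) \<and>
     (\<forall>(f, k)\<in>edge_link X e. \<forall>\<^sub>F y in inf (nhds (tri_side k t)) (principal std_triangle).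
        \<phi> (fchar X f y) = inner (w (f, k)) y + c (f, k)) \<and>
     of_int m = (\<Sum>(f, k)\<in>edge_link X e. inner (w (f, k)) (tri_corner k) + c (f, k))
       - of_int (\<alpha> e 0) * b - of_int (\<alpha> e 1) * (a + b))"

definition div_coeff :: "('v, 'e, 'f) delta_complex \<Rightarrow> ('e \<Rightarrow> nat \<Rightarrow> int) \<Rightarrow>
    (('v, 'e, 'f) pt \<Rightarrow> real) \<Rightarrow> ('v, 'e, 'f) pt \<Rightarrow> int \<Rightarrow> bool" where
  "div_coeff X \<alpha> \<phi> x m = (case x of
     VPt v \<Rightarrow> False | EPt e t \<Rightarrow> edge_coeff X \<alpha> \<phi> e t m | FPt f p \<Rightarrow> tri_coeff X \<phi> f p m)"

text \<open>
  A formal sum of segments is a finitely supported coefficient function on the set of segments.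
  Formal sums are considered up to subdivision of the segments, so that two of them agree on an open
  set if their multiplicities agree there outside of a locally finite set of points.
\<close>

definition segments :: "('v, 'e, 'f) delta_complex \<Rightarrow> ('v, 'e, 'f) pt set set" where
  "segments X =
     {echar X e ` {s..t} |e s t. e \<in> edges X \<and> 0 \<le> s \<and> s < t \<and> t \<le> 1} \<union>
     {fchar X f ` closed_segment p q |f p q.
        f \<in> tris X \<and> p \<in> std_triangle \<and> q \<in> std_triangle \<and> p \<noteq> q}"

definition formal_sum ::
    "('v, 'e, 'f) delta_complex \<Rightarrow> (('v, 'e, 'f) pt set \<Rightarrow> rat) \<Rightarrow> bool" where
  "formal_sum X D \<longleftrightarrow> finite {S. D S \<noteq> 0} \<and> {S. D S \<noteq> 0} \<subseteq> segments X"

definition multiplicity_at :: "('p set \<Rightarrow> rat) \<Rightarrow> 'p \<Rightarrow> rat" where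
  "multiplicity_at D x = (\<Sum>S | D S \<noteq> 0 \<and> x \<in> S. D S)"

text \<open>On the open set U, the formal sum D is q times the divisor of the PL function \<open>\<phi>\<close>.\<close>

definition eq_mult_div_on :: "('v, 'e, 'f) delta_complex \<Rightarrow> ('e \<Rightarrow> nat \<Rightarrow> int) \<Rightarrow>
    ('v, 'e, 'f) pt set \<Rightarrow> (('v, 'e, 'f) pt set \<Rightarrow> rat) \<Rightarrow> rat \<Rightarrow>
    (('v, 'e, 'f) pt \<Rightarrow> real) \<Rightarrow> bool" where
  "eq_mult_div_on X \<alpha> U D q \<phi> \<longleftrightarrow> (\<forall>x\<in>U. \<exists>N. openin (realization X) N \<and> x \<in> N \<and> N \<subseteq> U \<and>
     finite {y\<in>N. \<not> (\<exists>m. div_coeff X \<alpha> \<phi> y m \<and> multiplicity_at D y = q * of_int m)})"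

text \<open>The sheaf of linear functions: the PL functions with trivial divisor.\<close>

definition linear_functions :: "('v, 'e, 'f) delta_complex \<Rightarrow> ('e \<Rightarrow> nat \<Rightarrow> int) \<Rightarrow>
    ('v, 'e, 'f) pt set \<Rightarrow> (('v, 'e, 'f) pt \<Rightarrow> real) set" where
  "linear_functions X \<alpha> U = {\<phi>. pl_on X U \<phi> \<and> eq_mult_div_on X \<alpha> U (\<lambda>_. 0) 1 \<phi>}"


section \<open>Divisors and self-intersection\<close>

definition local_equation :: "('v, 'e, 'f) delta_complex \<Rightarrow> ('e \<Rightarrow> nat \<Rightarrow> int) \<Rightarrow>
    (('v, 'e, 'f) pt set \<Rightarrow> rat) \<Rightarrow> ('v, 'e, 'f) pt \<Rightarrow> (('v, 'e, 'f) pt \<Rightarrow> real) \<Rightarrow> bool" where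
  "local_equation X \<alpha> D p \<psi> \<longleftrightarrow> (\<exists>U q \<phi>. openin (realization X) U \<and> p \<in> U \<and> pl_on X U \<phi> \<and>
     eq_mult_div_on X \<alpha> U D q \<phi> \<and> \<psi> = (\<lambda>x. of_rat q * \<phi> x))"

definition divisor_on :: "('v, 'e, 'f) delta_complex \<Rightarrow> ('e \<Rightarrow> nat \<Rightarrow> int) \<Rightarrow>
    (('v, 'e, 'f) pt set \<Rightarrow> rat) \<Rightarrow> bool" where
  "divisor_on X \<alpha> D \<longleftrightarrow> formal_sum X D \<and> (\<forall>p\<in>points X. \<exists>\<psi>. local_equation X \<alpha> D p \<psi>)"

text \<open>
  The outgoing directions of rational slope at a point p, as rays parametrized by multiples of the
  primitive vector.  If p is on the boundary of a triangle, then a ray in that triangle is required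
  to point to its interior, and the remaining directions are those along the edges.
\<close>

definition rays :: "('v, 'e, 'f) delta_complex \<Rightarrow> ('v, 'e, 'f) pt \<Rightarrow>
    (real \<Rightarrow> ('v, 'e, 'f) pt) set" where
  "rays X p = {\<gamma>. \<gamma> 0 = p \<and>
     ((\<exists>e\<in>edges X. \<exists>t\<in>{0..1}. \<exists>u\<in>{1, -1}.
         (\<forall>\<^sub>F \<epsilon> in at_right 0. t + \<epsilon> * u \<in> {0<..<1}) \<and> \<gamma> = (\<lambda>\<epsilon>. echar X e (t + \<epsilon> * u))) \<or>
      (\<exists>f\<in>tris X. \<exists>a\<in>std_triangle. \<exists>u. primitive_vec u \<and>
         (\<forall>\<^sub>F \<epsilon> in at_right 0. a + \<epsilon> *\<^sub>R u \<in> interior std_triangle) \<and>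
         \<gamma> = (\<lambda>\<epsilon>. fchar X f (a + \<epsilon> *\<^sub>R u))))}"

definition coeff_along :: "('p set \<Rightarrow> rat) \<Rightarrow> (real \<Rightarrow> 'p) \<Rightarrow> real" where
  "coeff_along D \<gamma> = Lim (at_right 0) (\<lambda>\<epsilon>. of_rat (multiplicity_at D (\<gamma> \<epsilon>)))"

definition outgoing_slope :: "('p \<Rightarrow> real) \<Rightarrow> (real \<Rightarrow> 'p) \<Rightarrow> real" where
  "outgoing_slope \<psi> \<gamma> = Lim (at_right 0) (\<lambda>\<epsilon>. (\<psi> (\<gamma> \<epsilon>) - \<psi> (\<gamma> 0)) / \<epsilon>)"

definition local_self_intersection :: "('v, 'e, 'f) delta_complex \<Rightarrow>
    (('v, 'e, 'f) pt set \<Rightarrow> rat) \<Rightarrow> (('v, 'e, 'f) pt \<Rightarrow> real) \<Rightarrow> ('v, 'e, 'f) pt \<Rightarrow> real" where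
  "local_self_intersection X D \<psi> p =
     (\<Sum>\<gamma> | \<gamma> \<in> rays X p \<and> coeff_along D \<gamma> \<noteq> 0. coeff_along D \<gamma> * outgoing_slope \<psi> \<gamma>)"

text \<open>
  The degree does not depend on the chosen local equations, and only finitely many points have a
  non-zero contribution.
\<close>

definition has_self_intersection :: "('v, 'e, 'f) delta_complex \<Rightarrow> ('e \<Rightarrow> nat \<Rightarrow> int) \<Rightarrow>
    (('v, 'e, 'f) pt set \<Rightarrow> rat) \<Rightarrow> real \<Rightarrow> bool" where
  "has_self_intersection X \<alpha> D m \<longleftrightarrow> (\<exists>\<psi>. (\<forall>p\<in>points X. local_equation X \<alpha> D p (\<psi> p)) \<and>
     m = (\<Sum>p | p \<in> points X \<and> local_self_intersection X D (\<psi> p) p \<noteq> 0.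
            local_self_intersection X D (\<psi> p) p))"


section \<open>First cohomology with real coefficients\<close>

text \<open>
  Let \<open>\<G>\<close> be a sheaf of real-valued functions on the space T that contains the sheaf \<open>\<real>\<close> of locally
  constant functions.  The stalk at x of the quotient sheaf \<open>\<G>/\<real>\<close> consists of germs of functions
  modulo germs of constant functions; such a class is represented by the set of all functions
  belonging to it.  A section of \<open>\<G>/\<real>\<close> over T is a family of elements of the stalks that is locally
  induced by sections of \<open>\<G>\<close>.
\<close>

definition const_near :: "'p topology \<Rightarrow> 'p \<Rightarrow> ('p \<Rightarrow> real) \<Rightarrow> bool" where
  "const_near T x h \<longleftrightarrow> (\<exists>N c. openin T N \<and> x \<in> N \<and> (\<forall>y\<in>N. h y = c))"

definition germ_mod_const :: "'p topology \<Rightarrow> 'p \<Rightarrow> ('p \<Rightarrow> real) \<Rightarrow> ('p \<Rightarrow> real) set" where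
  "germ_mod_const T x g = {h. const_near T x (\<lambda>y. h y - g y)}"

definition quotient_sections :: "'p topology \<Rightarrow> ('p set \<Rightarrow> ('p \<Rightarrow> real) set) \<Rightarrow>
    ('p \<Rightarrow> ('p \<Rightarrow> real) set) set" where
  "quotient_sections T \<G> = {\<sigma>. (\<forall>x. x \<notin> topspace T \<longrightarrow> \<sigma> x = {}) \<and>
     (\<forall>x\<in>topspace T. \<exists>U g. openin T U \<and> x \<in> U \<and> g \<in> \<G> U \<and>
        (\<forall>y\<in>U. \<sigma> y = germ_mod_const T y g))}"

text \<open>
  The Godement resolution of \<open>\<real>\<close> starts with the sheaf \<open>C\<close> of all real-valued functions, and the
  first cohomology group of T is the cokernel of \<open>H\<^sup>0(C) \<rightarrow> H\<^sup>0(C/\<real>)\<close>.  Its elements are represented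
  as the equivalence classes in \<open>H\<^sup>0(C/\<real>)\<close>.
\<close>

definition Z1 :: "'p topology \<Rightarrow> ('p \<Rightarrow> ('p \<Rightarrow> real) set) set" where
  "Z1 T = quotient_sections T (\<lambda>U. UNIV)"

definition H1_class :: "'p topology \<Rightarrow> ('p \<Rightarrow> ('p \<Rightarrow> real) set) \<Rightarrow>
    ('p \<Rightarrow> ('p \<Rightarrow> real) set) set" where
  "H1_class T \<sigma> = {\<tau>\<in>Z1 T. \<exists>h. \<forall>x\<in>topspace T. \<forall>f\<in>\<sigma> x. \<forall>g\<in>\<tau> x.
     const_near T x (\<lambda>y. g y - f y - h y)}"

definition H1 :: "'p topology \<Rightarrow> ('p \<Rightarrow> ('p \<Rightarrow> real) set) set set" where
  "H1 T = H1_class T ` Z1 T"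

text \<open>
  The inclusion of \<open>\<G>\<close> into \<open>C\<close> maps \<open>0 \<rightarrow> \<real> \<rightarrow> \<G> \<rightarrow> \<G>/\<real> \<rightarrow> 0\<close> to \<open>0 \<rightarrow> \<real> \<rightarrow> C \<rightarrow> C/\<real> \<rightarrow> 0\<close>, so by
  naturality the connecting map sends a section of \<open>\<G>/\<real>\<close> to the class of the same section
  considered as a section of \<open>C/\<real>\<close>.
\<close>

definition connecting_map :: "'p topology \<Rightarrow> ('p set \<Rightarrow> ('p \<Rightarrow> real) set) \<Rightarrow>
    ('p \<Rightarrow> ('p \<Rightarrow> real) set) \<Rightarrow> ('p \<Rightarrow> ('p \<Rightarrow> real) set) set" where
  "connecting_map T \<G> = (\<lambda>\<sigma>\<in>quotient_sections T \<G>. H1_class T \<sigma>)"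

text \<open>The vector space operations, in the form of linear combinations of sections of \<open>C/\<real>\<close>.\<close>

definition lin_comb :: "'p topology \<Rightarrow> nat \<Rightarrow> (nat \<Rightarrow> real) \<Rightarrow>
    (nat \<Rightarrow> 'p \<Rightarrow> ('p \<Rightarrow> real) set) \<Rightarrow> 'p \<Rightarrow> ('p \<Rightarrow> real) set" where
  "lin_comb T n r \<sigma> x = (if x \<in> topspace T
     then \<Union>{germ_mod_const T x (\<lambda>y. \<Sum>i<n. r i * f i y) |f. \<forall>i<n. f i \<in> \<sigma> i x} else {})"

definition H1_span :: "'p topology \<Rightarrow> ('p \<Rightarrow> ('p \<Rightarrow> real) set) set set \<Rightarrow>
    ('p \<Rightarrow> ('p \<Rightarrow> real) set) set set" where
  "H1_span T A = {H1_class T (lin_comb T n r \<sigma>) |n r \<sigma>. \<forall>i<n. \<sigma> i \<in> Z1 T \<and> H1_class T (\<sigma> i) \<in> A}"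

text \<open>
  A subspace W of \<open>H\<^sup>1\<close> has codimension at most k if the quotient of \<open>H\<^sup>1\<close> by W is generated by at
  most k elements.
\<close>

definition H1_codim_le :: "'p topology \<Rightarrow> ('p \<Rightarrow> ('p \<Rightarrow> real) set) set set \<Rightarrow> nat \<Rightarrow> bool" where
  "H1_codim_le T W k \<longleftrightarrow> (\<exists>B. B \<subseteq> H1 T \<and> finite B \<and> card B \<le> k \<and> H1_span T (W \<union> B) = H1 T)"

end

theory Submission
  imports Defs
begin

text \<open>
  The periods of a class in the first cohomology along the edges form a cocycle c, and the class lies in
  the span of the image as soon as c can be changed by a coboundary so that the functions with slopes c
  have trivial divisor: this is a linear condition on c with integral coefficients.  By
  Perron--Frobenius, the form of each local intersection matrix is negative semidefinite on the
  complement of a positive vector w(v), and there it vanishes only on the kernel.  The forms at all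
  vertices, applied to c, add up to zero, so it suffices to make c orthogonal to every w(v).  This is a
  Poisson equation for the Laplacian of a connected weighted graph; it is solvable up to one dimension.

  A divisor D removes this obstruction.  Subtracting from its local equations a common piecewise linear
  function \<open>\<theta>\<close> leaves functions that are affine on simplices, and their slopes h at the vertices have
  equal divisor coefficients y at both ends of every edge.  Summation by parts for \<open>\<theta>\<close> along D shows that
  the forms applied to h add up to the self-intersection of D.  The pairing of h with c vanishes, so if
  the self-intersection is positive, then the obstruction of c would violate the signature.
\<close>

section \<open>Symmetric forms with one positive eigenvalue\<close>

text \<open>Local equations may bend anywhere inside triangles and along edges, while the eigenvalue
  condition sees only finitely many slopes at the vertices; most of the work bridges this gap. Every
  edge lies in a triangle, so topology, charts and periods can be tested on triangles alone. These
  are convex, hence compatible local choices glue there; this yields primitives of cohomology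
  classes and also \<open>theta\<close>.

  The self-intersection localizes at the vertices because of a reciprocity. Around a point, the
  break coefficients of a PL function, paired with the slopes of an affine function, reduce by
  summation by parts across the rays to determinants on the sides of triangles, antisymmetric in the
  two functions. Summed over the triangles at an edge, they exchange the divisor coefficients of the
  two functions. The slopes of \<open>theta\<close> that remain add up to zero on each segment of D
  and on each edge, because the slopes in both directions at all points of a segment
  telescope.\<close>

definition qform :: "'a set => ('a => 'a => real) => ('a => real) => ('a => real) => real" where
 "qform I A x y = (\<Sum>i\<in>I. x i * (\<Sum>j\<in>I. A i j * y j))"

definition inner_on :: "'a set => ('a => real) => ('a => real) => real" where
 "inner_on I x y = (\<Sum>i\<in>I. x i * y i)"

definition eigen_on :: "'a set => ('a => 'a => real) => real => ('a => real) => bool" where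
 "eigen_on I A r x \<longleftrightarrow> (\<forall>i\<in>I. (\<Sum>j\<in>I. A i j * x j) = r * x i)"

lemma qform_sym:
 assumes "\<And>i j. i \<in> I ==> j \<in> I ==> A i j = A j i"
 shows "qform I A x y = qform I A y x"
proof -
 have "qform I A x y = (\<Sum>i\<in>I. \<Sum>j\<in>I. x i * A i j * y j)"
  by (simp add: qform_def sum_distrib_left mult.assoc)
 also have "\<dots> = (\<Sum>j\<in>I. \<Sum>i\<in>I. x i * A i j * y j)" by (rule sum.swap)
 also have "\<dots> = qform I A y x"
  unfolding qform_def sum_distrib_left
  by (intro sum.cong refl) (simp add: assms mult_ac)
 finally show ?thesis .
qed

lemma qform_add_right: "qform I A x (%i. y i + t * z i) = qform I A x y + t * qform I A x z"
 unfolding qform_def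
 by (simp add: algebra_simps sum.distrib sum_distrib_left)

lemma qform_add_left: "qform I A (%i. y i + t * z i) x = qform I A y x + t * qform I A z x"
 unfolding qform_def by (simp add: algebra_simps sum.distrib sum_distrib_left)

lemma inner_on_add_right: "inner_on I x (%i. y i + t * z i) = inner_on I x y + t * inner_on I x z"
 unfolding inner_on_def by (simp add: algebra_simps sum.distrib sum_distrib_left)

lemma inner_on_commute: "inner_on I x y = inner_on I y x"
 unfolding inner_on_def by (simp add: mult.commute)

lemma inner_on_self_ge: "0 \<le> inner_on I x x"
 unfolding inner_on_def by (simp add: sum_nonneg)

lemma inner_on_self_eq_0: "finite I ==> inner_on I x x = 0 \<longleftrightarrow> (\<forall>i\<in>I. x i = 0)"
 unfolding inner_on_def by (subst sum_nonneg_eq_0_iff) auto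

lemma qform_eigen: "eigen_on I A r y ==> qform I A x y = r * inner_on I x y"
 unfolding qform_def eigen_on_def inner_on_def
 by (simp add: sum_distrib_left mult_ac cong: sum.cong)

lemma linear_term_zero:
 fixes a b :: real
 assumes "\<And>t. 0 \<le> a * t + b * t\<^sup>2"
 shows "a = 0"
proof (rule ccontr)
 assume "a \<noteq> 0"
 define B where "B = \<bar>b\<bar> + 1"
 have B: "B > 0" "b \<le> B" by (auto simp: B_def)
 \<comment> \<open>The minimizer of the larger polynomial with leading coefficient \<open>B\<close>,
   whose minimum is negative unless \<open>a\<close> is 0. \<open>B\<close> is positive, while
   \<open>b\<close> may have any sign.\<close>
 define t where "t = - a / (2 * B)"
 have "a * t + b * t\<^sup>2 \<le> a * t + B * t\<^sup>2" using B by (intro add_left_mono mult_right_mono) auto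
 also have "\<dots> = - (a\<^sup>2 / (4 * B))"
 proof -
  have "a * t = - (a\<^sup>2 / (2 * B))" "B * t\<^sup>2 = a\<^sup>2 / (4 * B)"
   using B(1) by (simp_all add: t_def power2_eq_square)
  moreover have "a\<^sup>2 / (2 * B) = 2 * (a\<^sup>2 / (4 * B))" by simp
  ultimately show ?thesis by linarith
 qed
 also have "\<dots> < 0" using \<open>a \<noteq> 0\<close> B(1) by simp
 finally show False using assms[of t] by linarith
qed

text \<open>Lagrange's condition. The first variation vanishes in all directions orthogonal to
  \<open>b\<close>, and the residual of the eigenvalue equation is itself such a direction because
  \<open>b\<close> is an eigenvector; so the residual has norm zero. With \<open>b = 0\<close> there
  is no constraint.\<close>

lemma extremal_eigen:
 assumes fin: "finite I" and sym: "\<And>i j. i \<in> I ==> j \<in> I ==> A i j = A j i"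
  and b: "eigen_on I A l b"
  and max: "\<And>y. inner_on I b y = 0 ==> qform I A y y \<le> \<mu> * inner_on I y y"
  and x: "inner_on I b x = 0" "qform I A x x = \<mu> * inner_on I x x"
 shows "eigen_on I A \<mu> x"
proof -
 have orth: "\<mu> * inner_on I x y - qform I A x y = 0" if y: "inner_on I b y = 0" for y
 proof -
  have "0 \<le> (2 * (\<mu> * inner_on I x y - qform I A x y)) * t
    + (\<mu> * inner_on I y y - qform I A y y) * t\<^sup>2" for t
  proof -
   have "inner_on I b (%i. x i + t * y i) = 0" using x y by (simp add: inner_on_add_right)
   from max[OF this] have "0 \<le> \<mu> * inner_on I (%i. x i + t * y i) (%i. x i + t * y i)
     - qform I A (%i. x i + t * y i) (%i. x i + t * y i)" by simp
   also have "\<dots> = (2 * (\<mu> * inner_on I x y - qform I A x y)) * t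
    + (\<mu> * inner_on I y y - qform I A y y) * t\<^sup>2"
    using x(2) qform_sym[where x=y and y=x, OF sym]
    by (simp add: qform_add_right qform_add_left inner_on_add_right
      inner_on_commute[of I "%i. x i + t * y i"] inner_on_commute[of I y x]
      algebra_simps power2_eq_square)
   finally show ?thesis .
  qed
  from linear_term_zero[OF this] show ?thesis by simp
 qed
 define z where "z i = (\<Sum>j\<in>I. A i j * x j) - \<mu> * x i" for i
 have zx: "inner_on I y z = qform I A y x - \<mu> * inner_on I y x" for y
  unfolding z_def inner_on_def qform_def by (simp add: algebra_simps sum_subtractf sum_distrib_left)
 have "inner_on I b z = 0"
  using qform_eigen[where x=x, OF b] x(1) qform_sym[where x=b and y=x, OF sym] inner_on_commute[of I b x]
  by (simp add: zx)
 from orth[OF this] have "inner_on I z z = 0"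
  using qform_sym[where x=x and y=z, OF sym] inner_on_commute[of I x z] by (simp add: zx)
 then show ?thesis
  using inner_on_self_eq_0[OF fin, of z] unfolding eigen_on_def z_def by auto
qed

text \<open>Vectors are functions on the whole type. Fixing them to be 0 outside \<open>I\<close>
  puts the sphere into a product of intervals and points, which is compact by Tychonoff's theorem
  whatever the index type is.\<close>

lemma compact_sphere_on:
 fixes b :: "'a => real"
 assumes fin: "finite I"
 shows "compact {x. (\<forall>i. i \<notin> I --> x i = 0) \<and> inner_on I x x = 1 \<and> inner_on I b x = 0}"
  (is "compact ?S")
proof -
 let ?K = "PiE UNIV (%i. if i \<in> I then {-1..1::real} else {0})"
 have "compactin (product_topology (%i. euclidean) UNIV) ?K"
  by (subst compactin_PiE) (auto simp: compactin_euclidean_iff)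
 then have K: "compact ?K"
  by (simp add: euclidean_product_topology compactin_euclidean_iff)
 have c: "continuous_on UNIV (%x::'a => real. x i)" for i
  by (rule continuous_on_product_coordinates)
 have "closed {x::'a => real. inner_on I x x = 1}" "closed {x. inner_on I b x = 0}"
  unfolding inner_on_def
  by (intro closed_Collect_eq continuous_intros c)+
 then have "compact (?K \<inter> ({x. inner_on I x x = 1} \<inter> {x. inner_on I b x = 0}))"
  by (intro compact_Int_closed K closed_Int)
 moreover have "?K \<inter> ({x. inner_on I x x = 1} \<inter> {x. inner_on I b x = 0}) = ?S"
 proof -
  have "x i \<in> {-1..1}" if "inner_on I x x = 1" "i \<in> I" for x i
  proof -
   have "(x i)\<^sup>2 \<le> inner_on I x x"
    unfolding inner_on_def power2_eq_square using that(2) fin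
    by (intro member_le_sum[of i I "%i. x i * x i"]) auto
   then have "\<bar>x i\<bar> \<le> 1" using that(1) by (simp add: abs_square_le_1)
   then show ?thesis by auto
  qed
  then show ?thesis by (auto simp: PiE_def Pi_def split: if_splits)
 qed
 ultimately show ?thesis by simp
qed

lemma continuous_qform: "continuous_on S (%x. qform I A x x)"
 unfolding qform_def
 by (intro continuous_intros continuous_on_product_then_coordinatewise[where f="%x. x"] continuous_on_id)

text \<open>The Rayleigh quotient attains its maximum on the compact unit sphere in the complement
  of \<open>b\<close>; \<open>x0\<close> witnesses that this sphere is not empty.\<close>

lemma max_eigen:
 assumes fin: "finite I" and sym: "\<And>i j. i \<in> I ==> j \<in> I ==> A i j = A j i"
  and b: "eigen_on I A l b"
  and x0: "inner_on I b x0 = 0" "inner_on I x0 x0 \<noteq> 0"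
 obtains \<mu> x where "inner_on I b x = 0" "inner_on I x x = 1" "eigen_on I A \<mu> x"
  "\<And>y. inner_on I b y = 0 ==> qform I A y y \<le> \<mu> * inner_on I y y"
proof -
 let ?S = "{x. (\<forall>i. i \<notin> I --> x i = 0) \<and> inner_on I x x = 1 \<and> inner_on I b x = 0}"
 define nrm where "nrm y i = (if i \<in> I then y i / sqrt (inner_on I y y) else 0)" for y i
 have nrm: "nrm y \<in> ?S" "qform I A (nrm y) (nrm y) = qform I A y y / inner_on I y y"
  if y: "inner_on I b y = 0" "inner_on I y y \<noteq> 0" for y
 proof -
  have p: "inner_on I y y > 0" using y(2) inner_on_self_ge[of I y] by linarith
  have s: "sqrt (inner_on I y y) * sqrt (inner_on I y y) = inner_on I y y" "\<bar>inner_on I y y\<bar> = inner_on I y y" using p by simp_all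
  have "inner_on I (nrm y) (nrm y) = inner_on I y y / inner_on I y y"
   unfolding inner_on_def[of I "nrm y"] nrm_def
   using p by (simp add: sum_divide_distrib[symmetric] inner_on_def[symmetric] cong: sum.cong)
  moreover have "inner_on I b (nrm y) = inner_on I b y / sqrt (inner_on I y y)"
   unfolding inner_on_def[of I b] nrm_def by (simp add: sum_divide_distrib)
  moreover have "nrm y i = 0" if "i \<notin> I" for i using that by (simp add: nrm_def)
  ultimately show "nrm y \<in> ?S" using y by simp
  show "qform I A (nrm y) (nrm y) = qform I A y y / inner_on I y y"
  proof -
   define q where "q = sqrt (inner_on I y y)"
   have "qform I A (nrm y) (nrm y) = (\<Sum>i\<in>I. y i * (\<Sum>j\<in>I. A i j * y j) / (q * q))"
    unfolding qform_def nrm_def q_def[symmetric]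
   proof (rule sum.cong[OF refl])
    fix i assume "i \<in> I"
    have "(\<Sum>j\<in>I. A i j * (if j \<in> I then y j / q else 0)) = (\<Sum>j\<in>I. A i j * y j) / q"
     unfolding sum_divide_distrib by (intro sum.cong) auto
    then show "(if i \<in> I then y i / q else 0) * (\<Sum>j\<in>I. A i j * (if j \<in> I then y j / q else 0))
     = y i * (\<Sum>j\<in>I. A i j * y j) / (q * q)" using \<open>i \<in> I\<close> by simp
   qed
   then show ?thesis unfolding q_def s(1) qform_def sum_divide_distrib .
  qed
 qed
 have "compact ?S" by (rule compact_sphere_on[OF fin])
 moreover have "?S \<noteq> {}" using nrm(1)[OF x0] by blast
 ultimately have "\<exists>x\<in>?S. \<forall>y\<in>?S. qform I A y y \<le> qform I A x x"
  by (rule continuous_attains_sup[OF _ _ continuous_qform])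
 then obtain x where x: "x \<in> ?S" and x2: "\<forall>y\<in>?S. qform I A y y \<le> qform I A x x" ..
 define \<mu> where "\<mu> = qform I A x x"
 have m: "qform I A y y \<le> \<mu> * inner_on I y y" if y: "inner_on I b y = 0" for y
 proof (cases "inner_on I y y = 0")
  case True
  then have "\<forall>i\<in>I. y i = 0" using inner_on_self_eq_0[OF fin] by blast
  then have "qform I A y y = 0" by (simp add: qform_def)
  then show ?thesis using True by simp
 next
  case False
  then have p: "inner_on I y y > 0" using inner_on_self_ge[of I y] by linarith
  show ?thesis using bspec[OF x2 nrm(1)[OF y False]] nrm(2)[OF y False] p
   by (simp add: \<mu>_def field_simps)
 qed
 show ?thesis
 proof (rule that[of x \<mu>])
  show "eigen_on I A \<mu> x"
   by (rule extremal_eigen[OF fin sym b m]) (use x(1) \<mu>_def in auto)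
 qed (use x(1) m in auto)
qed

text \<open>At a zero of \<open>x\<close> the row sum is zero although none of its terms is
  negative, the diagonal term being 0. By irreducibility some zero has a neighbour outside the zero
  set, and the term of that neighbour is positive.\<close>

lemma nonneg_eigen_pos:
 assumes fin: "finite I"
  and nonneg: "\<And>i j. i \<in> I ==> j \<in> I ==> i \<noteq> j ==> A i j \<ge> 0"
  and irr: "\<And>S. S \<subseteq> I ==> S \<noteq> {} ==> S \<noteq> I ==> \<exists>i\<in>S. \<exists>j\<in>I - S. A i j > 0"
  and x: "eigen_on I A r x" "\<And>i. i \<in> I ==> x i \<ge> 0" "\<exists>i\<in>I. x i \<noteq> 0"
 shows "\<forall>i\<in>I. x i > 0"
proof (rule ccontr)
 assume n: "\<not> (\<forall>i\<in>I. x i > 0)"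
 define S where "S = {i\<in>I. x i = 0}"
 have "S \<noteq> {}" "S \<noteq> I" "S \<subseteq> I"
  using n x(2,3) unfolding S_def by (auto simp: not_less) (meson antisym)
 then obtain i j where ij: "i \<in> S" "j \<in> I - S" "A i j > 0" using irr by blast
 have "(\<Sum>j\<in>I. A i j * x j) = 0" using x(1) ij(1) unfolding eigen_on_def S_def by auto
 moreover have "A i k * x k \<ge> 0" if "k \<in> I" for k
  using ij(1) that x(2)[OF that] nonneg[of i k] by (cases "i = k") (auto simp: S_def)
 moreover have "A i j * x j > 0" using ij x(2)[of j] by (auto simp: S_def le_less)
 ultimately show False
  using sum_nonneg_eq_0_iff[OF fin, of "%j. A i j * x j"] ij(2) by auto
qed

lemma qform_abs_ge:
 assumes nonneg: "\<And>i j. i \<in> I ==> j \<in> I ==> i \<noteq> j ==> A i j \<ge> 0"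
 shows "qform I A x x \<le> qform I A (%i. \<bar>x i\<bar>) (%i. \<bar>x i\<bar>)"
 unfolding qform_def sum_distrib_left
proof (intro sum_mono)
 fix i j assume ij: "i \<in> I" "j \<in> I"
 show "x i * (A i j * x j) \<le> \<bar>x i\<bar> * (A i j * \<bar>x j\<bar>)"
 proof (cases "i = j")
  case True
  have "\<bar>x j\<bar> * \<bar>x j\<bar> = x j * x j" by (simp add: abs_mult_self)
  then show ?thesis using True by (metis abs_mult_self mult.left_commute order_refl)
 next
  case False
  have "x i * x j \<le> \<bar>x i\<bar> * \<bar>x j\<bar>" by (metis abs_ge_self abs_mult)
  from mult_left_mono[OF this nonneg[OF ij False]] show ?thesis by (simp add: mult_ac)
 qed
qed

text \<open>
 Perron--Frobenius: the maximal eigenvector is positive, and it spans its eigenspace because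
 otherwise adding a multiple of it to another eigenvector would give a non-negative eigenvector
 with a zero entry.
\<close>

lemma one_positive_eigenvalue_hyperbolic:
 assumes fin: "finite I" and sym: "\<And>i j. i \<in> I ==> j \<in> I ==> A i j = A j i"
  and nonneg: "\<And>i j. i \<in> I ==> j \<in> I ==> i \<noteq> j ==> A i j \<ge> 0"
  and irr: "\<And>S. S \<subseteq> I ==> S \<noteq> {} ==> S \<noteq> I ==> \<exists>i\<in>S. \<exists>j\<in>I - S. A i j > 0"
  and ex: "r > 0" "eigen_on I A r x0" "\<exists>i\<in>I. x0 i \<noteq> 0"
  and uniq: "\<And>r x. r > 0 ==> eigen_on I A r x ==> \<exists>i\<in>I. x i \<noteq> 0 ==> r = r0"
 obtains u where "\<And>i. i \<in> I ==> u i > 0"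
  "\<And>x. inner_on I u x = 0 ==> qform I A x x \<le> 0"
  "\<And>x. inner_on I u x = 0 ==> qform I A x x = 0 ==> eigen_on I A 0 x"
proof -
 \<comment> \<open>With the zero vector as the given eigenvector, the constrained maximum becomes
   the unconstrained one.\<close>
 have z: "eigen_on I A 0 (%_. 0)" by (simp add: eigen_on_def)
 have i0: "inner_on I (%_. 0) y = 0" for y by (simp add: inner_on_def)
 have x0: "inner_on I x0 x0 \<noteq> 0" using ex(3) inner_on_self_eq_0[OF fin] by blast
 obtain \<mu> y where y: "inner_on I y y = 1" "eigen_on I A \<mu> y"
  and m: "\<And>y. qform I A y y \<le> \<mu> * inner_on I y y"
  using max_eigen[OF fin sym z i0 x0] i0 by metis
 have "r * inner_on I x0 x0 \<le> \<mu> * inner_on I x0 x0"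
  using m[of x0] qform_eigen[where x=x0, OF ex(2)] by simp
 then have \<mu>: "\<mu> > 0" using x0 inner_on_self_ge[of I x0] ex(1) by (simp add: less_le mult_le_cancel_right)
 \<comment> \<open>Passing to absolute values does not lower the form, since its off-diagonal
   entries are non-negative. So this is again a maximizer, hence an eigenvector.\<close>
 define u where "u i = \<bar>y i\<bar>" for i
 have u1: "inner_on I u u = 1" using y(1) by (simp add: inner_on_def u_def abs_mult_self)
 have ab: "qform I A y y \<le> qform I A u u" unfolding u_def by (rule qform_abs_ge) (rule nonneg)
 have "qform I A u u = \<mu> * inner_on I u u"
  using m[of u] ab qform_eigen[where x=y, OF y(2)] y(1) u1 by simp
 then have eu: "eigen_on I A \<mu> u" using extremal_eigen[OF fin sym z m i0] by blast
 have une: "\<exists>i\<in>I. u i \<noteq> 0" using u1 inner_on_self_eq_0[OF fin, of u] by auto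
 have up: "\<forall>i\<in>I. u i > 0"
  by (rule nonneg_eigen_pos[OF fin nonneg irr eu _ une]) (auto simp: u_def)
 have I: "I \<noteq> {}" using une by blast
 have neg: "qform I A x x \<le> 0" if x: "inner_on I u x = 0" for x
 proof (cases "inner_on I x x = 0")
  case True
  then show ?thesis using m[of x] by simp
 next
  case False
  obtain \<nu> w where w: "inner_on I u w = 0" "inner_on I w w = 1" "eigen_on I A \<nu> w"
   and mw: "\<And>y. inner_on I u y = 0 ==> qform I A y y \<le> \<nu> * inner_on I y y"
   using max_eigen[OF fin sym eu x False] by metis
  have wne: "\<exists>i\<in>I. w i \<noteq> 0" using w(2) inner_on_self_eq_0[OF fin, of w] by auto
  have "\<nu> \<le> 0"
  proof (rule ccontr)
   assume "\<not> \<nu> \<le> 0"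
   \<comment> \<open>A positive maximum on the complement is a second occurrence of the only
     positive eigenvalue, so \<open>w\<close> lies in the eigenspace of \<open>u\<close>.\<close>
   then have \<nu>: "\<nu> = \<mu>" using uniq[OF _ w(3) wne] uniq[OF \<mu> eu une] by simp
   \<comment> \<open>The least \<open>s\<close> for which \<open>w + s * u\<close> has no negative
     entry; the entry at an index where the maximum is attained is then 0.\<close>
   define s where "s = Max ((%i. - w i / u i) ` I)"
   have "s \<in> (%i. - w i / u i) ` I" unfolding s_def using fin I by (intro Max_in) auto
   then obtain k where k: "k \<in> I" "s = - w k / u k" by blast
   have ge: "w i + s * u i \<ge> 0" if "i \<in> I" for i
   proof -
    have "- w i / u i \<le> s" unfolding s_def using fin that by (intro Max_ge) auto
    then show ?thesis using up that by (simp add: field_simps)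
   qed
   have "u k > 0" using up k(1) by blast
   then have k0: "w k + s * u k = 0" using k(2) by simp
   have e: "eigen_on I A \<mu> (%i. w i + s * u i)"
    using w(3) eu unfolding eigen_on_def \<nu>
    by (simp add: algebra_simps sum.distrib) (simp add: sum_distrib_left[symmetric] mult_ac)
   have "\<exists>i\<in>I. w i + s * u i \<noteq> 0"
   proof (rule ccontr)
    assume "\<not> (\<exists>i\<in>I. w i + s * u i \<noteq> 0)"
    then have "inner_on I w (%i. w i + s * u i) = 0" by (simp add: inner_on_def)
    then show False using w(1,2) inner_on_commute[of I u w] by (simp add: inner_on_add_right)
   qed
   from nonneg_eigen_pos[OF fin nonneg irr e ge this] k k0 show False by force
  qed
  then show ?thesis using mw[OF x] inner_on_self_ge[of I x]
   by (meson mult_nonpos_nonneg order_trans)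
 qed
 show ?thesis
 proof (rule that[of u])
  fix x assume x: "inner_on I u x = 0" "qform I A x x = 0"
  show "eigen_on I A 0 x"
   by (rule extremal_eigen[OF fin sym eu]) (use neg x in auto)
 qed (use up neg in auto)
qed

section \<open>Eigenvalues of matrices in terms of functions on an index set\<close>

lemma eigenvalue_mat_iff:
 assumes xs: "distinct xs" "set xs = I"
 shows "eigenvalue (Matrix.mat (length xs) (length xs) (%(i, j). A (xs ! i) (xs ! j))) r \<longleftrightarrow>
  (\<exists>x. eigen_on I A r x \<and> (\<exists>i\<in>I. x i \<noteq> (0::real)))" (is "eigenvalue ?M r \<longleftrightarrow> _")
proof -
 define n where "n = length xs"
 have bij: "bij_betw (%i. xs ! i) {..<n} I"
  using xs bij_betw_nth unfolding n_def by blast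
 have s: "(\<Sum>j<n. A i (xs ! j) * x (xs ! j)) = (\<Sum>j\<in>I. A i j * x j)" for i x
  by (rule sum.reindex_bij_betw[OF bij, of "%j. A i j * x j"])
 have row: "vec_index (?M *\<^sub>v v) i = (\<Sum>j<n. A (xs ! i) (xs ! j) * vec_index v j)"
  if "v \<in> carrier_vec n" "i < n" for v i
  using that by (simp add: scalar_prod_def n_def lessThan_atLeast0)
 show ?thesis
 proof
  assume "eigenvalue ?M r"
  then obtain v where v: "v \<in> carrier_vec n" "v \<noteq> 0\<^sub>v n" "?M *\<^sub>v v = r \<cdot>\<^sub>v v"
   unfolding eigenvalue_def eigenvector_def n_def by auto
  define x where "x a = vec_index v (inv_into {..<n} (%i. xs ! i) a)" for a
  have x: "x (xs ! i) = vec_index v i" if "i < n" for i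
   unfolding x_def using that bij by (simp add: bij_betw_def inv_into_f_f)
  have "eigen_on I A r x" unfolding eigen_on_def
  proof
   fix a assume "a \<in> I"
   then obtain i where i: "i < n" "a = xs ! i" using bij unfolding bij_betw_def by auto
   have "(\<Sum>j\<in>I. A a j * x j) = (\<Sum>j<n. A a (xs ! j) * vec_index v j)"
    unfolding s[symmetric] by (simp add: x)
   also have "\<dots> = vec_index (r \<cdot>\<^sub>v v) i" using row[OF v(1) i(1)] v(3) i(2) by simp
   finally show "(\<Sum>j\<in>I. A a j * x j) = r * x a" using v(1) i x by simp
  qed
  moreover have "\<exists>i\<in>I. x i \<noteq> 0"
  proof -
   obtain i where "i < n" "vec_index v i \<noteq> 0" using v(1,2) by (metis carrier_vecD eq_vecI index_zero_vec)
   then show ?thesis using x bij unfolding bij_betw_def by fastforce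
  qed
  ultimately show "\<exists>x. eigen_on I A r x \<and> (\<exists>i\<in>I. x i \<noteq> 0)" by blast
 next
  assume "\<exists>x. eigen_on I A r x \<and> (\<exists>i\<in>I. x i \<noteq> 0)"
  then obtain x a where x: "eigen_on I A r x" "a \<in> I" "x a \<noteq> 0" by blast
  define v where "v = Matrix.vec n (%i. x (xs ! i))"
  have v: "v \<in> carrier_vec n" by (simp add: v_def)
  obtain k where k: "k < n" "a = xs ! k" using x(2) bij unfolding bij_betw_def by auto
  have "vec_index v k \<noteq> 0" using k x(3) by (simp add: v_def)
  then have "v \<noteq> 0\<^sub>v n" using k by auto
  moreover have "?M *\<^sub>v v = r \<cdot>\<^sub>v v"
  proof (rule eq_vecI)
   fix i assume "i < dim_vec (r \<cdot>\<^sub>v v)"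
   then have i: "i < n" by (simp add: v_def)
   have "vec_index (?M *\<^sub>v v) i = (\<Sum>j<n. A (xs ! i) (xs ! j) * x (xs ! j))"
    unfolding row[OF v i] by (simp add: v_def)
   also have "\<dots> = r * x (xs ! i)"
    unfolding s using x(1) i bij unfolding eigen_on_def bij_betw_def by blast
   finally show "vec_index (?M *\<^sub>v v) i = vec_index (r \<cdot>\<^sub>v v) i" using i by (simp add: v_def)
  qed (simp add: v_def n_def)
  ultimately show "eigenvalue ?M r" using v unfolding eigenvalue_def eigenvector_def n_def by auto
 qed
qed

text \<open>Every positive eigenvalue contributes at least 1 to the count. The multiplicity is
  dropped here; that the eigenspace is a line comes back from Perron--Frobenius.\<close>

lemma one_num_pos_eigenvalues:
 assumes M: "M \<in> carrier_mat n n" and one: "num_pos_eigenvalues M = 1"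
 obtains r0 where "eigenvalue M r0" "r0 > 0" "\<And>r. eigenvalue M r ==> r > 0 ==> r = r0"
proof -
 have nz: "char_poly M \<noteq> 0" using degree_monic_char_poly[OF M] by (metis coeff_0 zero_neq_one)
 have root: "eigenvalue M r \<longleftrightarrow> poly (char_poly M) r = 0" for r
  by (rule eigenvalue_root_char_poly[OF M])
 let ?E = "{r. eigenvalue M r \<and> r > 0}"
 have fin: "finite ?E" unfolding root using poly_roots_finite[OF nz] by (rule rev_finite_subset) auto
 have pos: "Polynomial.order r (char_poly M) \<ge> 1" if "r \<in> ?E" for r
  using that root order_root[of "char_poly M" r] nz by auto
 have "card ?E = (\<Sum>r\<in>?E. 1)" by simp
 also have "\<dots> \<le> num_pos_eigenvalues M" unfolding num_pos_eigenvalues_def by (rule sum_mono[OF pos])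
 finally have le: "card ?E \<le> 1" unfolding one .
 have "?E \<noteq> {}" using one unfolding num_pos_eigenvalues_def by force
 then obtain r0 where "r0 \<in> ?E" by blast
 then show ?thesis using that[of r0] le fin card_le_Suc0_iff_eq[OF fin] by simp
qed

section \<open>The standard triangle and the topology of the realization\<close>

lemma interior_std_triangle:
 "interior std_triangle = {(s, t). 0 < s \<and> 0 < t \<and> s + t < 1}" (is "_ = ?I")
proof (rule interior_unique)
 have "?I = {p. fst p > 0} \<inter> {p. snd p > 0} \<inter> {p. fst p + snd p < 1}" by auto
 moreover have "open \<dots>" by (intro open_Int open_Collect_less continuous_intros)
 ultimately show "open ?I" by simp
 fix T :: "(real \<times> real) set" assume T: "T \<subseteq> std_triangle" "open T"
 show "T \<subseteq> ?I"
 proof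
  fix p assume "p \<in> T"
  then obtain d where d: "d > 0" "cball p d \<subseteq> T" using T(2) open_contains_cball by blast
  have "p + (- d, 0) \<in> cball p d" "p + (0, - d) \<in> cball p d" "p + (d, 0) \<in> cball p d"
   using d(1) by (auto simp: dist_norm norm_Pair)
  then have "p + (- d, 0) \<in> std_triangle" "p + (0, - d) \<in> std_triangle" "p + (d, 0) \<in> std_triangle"
   using d(2) T(1) by blast+
  with d(1) show "p \<in> ?I" by (cases p) (auto simp: std_triangle_def)
 qed
qed (auto simp: std_triangle_def)

lemma fchar_interior: "p \<in> interior std_triangle ==> fchar X f p = FPt f p"
 by (cases p) (auto simp: interior_std_triangle fchar_def)

lemma std_triangle_cases:
 assumes "p \<in> std_triangle"
 obtains "p \<in> interior std_triangle" | k t where "k < 3" "0 \<le> t" "t \<le> 1" "p = tri_side k t"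
proof -
 obtain x y where p: "p = (x, y)" by (cases p)
 consider "p \<in> interior std_triangle" | "x = 0" | "y = 0" | "x + y = 1"
  using assms unfolding interior_std_triangle p by (force simp: std_triangle_def less_le)
 then show ?thesis
 proof cases
  case 2 then show ?thesis using assms by (intro that(2)[of 1 y]) (auto simp: p std_triangle_def tri_side_def)
 next
  case 3 then show ?thesis using assms by (intro that(2)[of 2 x]) (auto simp: p std_triangle_def tri_side_def)
 next
  case 4 then show ?thesis using assms by (intro that(2)[of 0 y]) (auto simp: p std_triangle_def tri_side_def)
 qed (use that in blast)
qed

lemma tri_side_in: "k < 3 ==> 0 \<le> t ==> t \<le> 1 ==> tri_side k t \<in> std_triangle"
 by (auto simp: tri_side_def std_triangle_def less_Suc_eq numeral_3_eq_3)

lemma echar_in_points: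
 assumes "finite_delta_complex X" "e \<in> edges X" "0 \<le> t" "t \<le> 1"
 shows "echar X e t \<in> points X"
proof -
 have "endpt X e 0 \<in> verts X" "endpt X e 1 \<in> verts X"
  using assms(1,2) unfolding finite_delta_complex_def by auto
 then show ?thesis using assms by (cases "t = 0 \<or> t = 1") (auto simp: echar_def points_def image_iff less_le)
qed

lemma fchar_in_points:
 assumes "finite_delta_complex X" "f \<in> tris X" "p \<in> std_triangle"
 shows "fchar X f p \<in> points X"
 using assms(3)
proof (cases rule: std_triangle_cases)
 case 1
 then show ?thesis using assms by (auto simp: fchar_interior points_def)
next
 case (2 k t)
 have "side X f k \<in> edges X" using assms 2 unfolding finite_delta_complex_def by blast
 then show ?thesis using fchar_tri_side[OF assms(1,2) 2(1,2,3)] echar_in_points[OF assms(1)] 2 by simp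
qed

lemma openin_realizationI:
 assumes "U \<subseteq> points X"
  "\<And>e. e \<in> edges X ==> openin (top_of_set {0..1}) {t\<in>{0..1}. echar X e t \<in> U}"
  "\<And>f. f \<in> tris X ==> openin (top_of_set std_triangle) {p\<in>std_triangle. fchar X f p \<in> U}"
 shows "openin (realization X) U"
 using assms unfolding openin_realization open_in_realization_def by blast

lemma topspace_realization: "finite_delta_complex X ==> topspace (realization X) = points X"
proof
 assume X: "finite_delta_complex X"
 have e: "{t\<in>{0..1}. echar X e t \<in> points X} = {0..1}" if "e \<in> edges X" for e
  using echar_in_points[OF X that] by auto
 have f: "{p\<in>std_triangle. fchar X f p \<in> points X} = std_triangle" if "f \<in> tris X" for f
  using fchar_in_points[OF X that] by auto
 have "openin (realization X) (points X)"
  by (rule openin_realizationI) (simp_all add: e f del: atLeastAtMost_iff)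
 then show "points X \<subseteq> topspace (realization X)" by (rule openin_subset)
 show "topspace (realization X) \<subseteq> points X"
  using openin_topspace[of "realization X"] unfolding openin_realization open_in_realization_def by blast
qed

text \<open>The vertices of a cell lie all in \<open>S\<close> or all outside. The cells of the
  first kind form an open set, because membership is constant on every closed cell, and so do the
  cells of the second kind; connectedness leaves only one kind.\<close>

lemma connected_realization_verts:
 assumes X: "finite_delta_complex X" and conn: "connected_space (realization X)"
  and S: "S \<subseteq> verts X" "S \<noteq> {}"
  and cl: "\<And>e. e \<in> edges X ==> endpt X e 0 \<in> S \<longleftrightarrow> endpt X e 1 \<in> S"
 shows "S = verts X"
proof -
 define W where "W S = VPt ` S \<union> (\<Union>e\<in>{e\<in>edges X. endpt X e 0 \<in> S}. EPt e ` {0<..<1}) \<union>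
  (\<Union>f\<in>{f\<in>tris X. endpt X (side X f 2) 0 \<in> S}. FPt f ` interior std_triangle)" for S
 have ev: "endpt X e 0 \<in> verts X" "endpt X e 1 \<in> verts X" if "e \<in> edges X" for e
  using X that unfolding finite_delta_complex_def by auto
 have fs: "\<And>k. k < 3 ==> side X f k \<in> edges X" "endpt X (side X f 1) 0 = endpt X (side X f 2) 0"
   "endpt X (side X f 0) 0 = endpt X (side X f 2) 1"
   "endpt X (side X f 0) 1 = endpt X (side X f 1) 1" if "f \<in> tris X" for f
  using X that unfolding finite_delta_complex_def by blast+
 have e: "echar X e t \<in> W S \<longleftrightarrow> endpt X e 0 \<in> S"
  if "e \<in> edges X" "t \<in> {0..1}" "endpt X e 0 \<in> S \<longleftrightarrow> endpt X e 1 \<in> S" for e t S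
  using that by (auto simp: echar_def W_def)
 have f: "fchar X f p \<in> W S \<longleftrightarrow> endpt X (side X f 2) 0 \<in> S"
  if f: "f \<in> tris X" and p: "p \<in> std_triangle"
   and S: "\<And>e. e \<in> edges X ==> endpt X e 0 \<in> S \<longleftrightarrow> endpt X e 1 \<in> S" for f p S
  using p
 proof (cases rule: std_triangle_cases)
  case 1
  then show ?thesis using f by (auto simp: fchar_interior W_def)
 next
  case (2 k t)
  have "endpt X (side X f k) 0 \<in> S \<longleftrightarrow> endpt X (side X f 2) 0 \<in> S"
  proof -
   consider "k = 0" | "k = 1" | "k = 2" using 2(1) by linarith
   then show ?thesis using fs[OF f] S by cases (auto simp del: One_nat_def)
  qed
  then show ?thesis
   using fchar_tri_side[OF X f 2(1,2,3)] e[OF fs(1)[OF f 2(1)], of t S] 2 S fs(1)[OF f 2(1)]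
   by auto
 qed
 have op: "openin (realization X) (W S)"
  if S: "S \<subseteq> verts X" "\<And>e. e \<in> edges X ==> endpt X e 0 \<in> S \<longleftrightarrow> endpt X e 1 \<in> S" for S
 proof (rule openin_realizationI)
  show "W S \<subseteq> points X" using S(1) by (auto simp: W_def points_def)
  fix e' assume e': "e' \<in> edges X"
  have "{t\<in>{0..1}. echar X e' t \<in> W S} = (if endpt X e' 0 \<in> S then {0..1} else {})"
   using e[OF e' _ S(2)[OF e']] by auto
  then show "openin (top_of_set {0..1}) {t\<in>{0..1}. echar X e' t \<in> W S}" by simp
 next
  fix f' assume f': "f' \<in> tris X"
  have "{t\<in>std_triangle. fchar X f' t \<in> W S} = (if endpt X (side X f' 2) 0 \<in> S then std_triangle else {})"
   using f[OF f' _ S(2)] by auto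
  then show "openin (top_of_set std_triangle) {t\<in>std_triangle. fchar X f' t \<in> W S}" by simp
 qed
 have cl': "endpt X e 0 \<in> verts X - S \<longleftrightarrow> endpt X e 1 \<in> verts X - S" if "e \<in> edges X" for e
  using cl[OF that] ev[OF that] by auto
 have o1: "openin (realization X) (W S)" "openin (realization X) (W (verts X - S))"
  using op[OF S(1) cl] op[OF Diff_subset cl'] by auto
 have cov: "topspace (realization X) \<subseteq> W S \<union> W (verts X - S)"
 proof
  fix x assume "x \<in> topspace (realization X)"
  then consider v where "x = VPt v" "v \<in> verts X"
   | e t where "x = EPt e t" "e \<in> edges X" "t \<in> {0<..<1}"
   | f p where "x = FPt f p" "f \<in> tris X" "p \<in> interior std_triangle"
   unfolding topspace_realization[OF X] points_def by blast
  then show "x \<in> W S \<union> W (verts X - S)"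
  proof cases
   case 1
   then show ?thesis by (auto simp: W_def)
  next
   case (2 e t)
   then show ?thesis using ev[OF 2(2)] unfolding W_def by blast
  next
   case (3 f p)
   let ?T = "%S. \<Union>f\<in>{f\<in>tris X. endpt X (side X f 2) 0 \<in> S}. FPt f ` interior std_triangle"
   have "x \<in> ?T S \<or> x \<in> ?T (verts X - S)"
    using 3 ev(1)[OF fs(1)[OF 3(2), of 2, simplified]]
    by (cases "endpt X (side X f 2) 0 \<in> S") (simp_all add: image_iff)
   then show ?thesis unfolding W_def by blast
  qed
 qed
 have dis: "W S \<inter> W (verts X - S) = {}" by (auto simp: W_def)
 have "W S \<noteq> {}" using S(2) by (auto simp: W_def)
 then have "W (verts X - S) = {}" using conn o1 cov dis unfolding connected_space_def by blast
 then have "verts X - S = {}" by (auto simp: W_def)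
 then show ?thesis using S(1) by blast
qed

lemma finite_delta_complex_link:
 assumes X: "finite_delta_complex X"
 shows "finite_delta_complex (vertex_link X v)"
proof -
 have fs: "\<And>k. k < 3 ==> side X f k \<in> edges X" "endpt X (side X f 1) 0 = endpt X (side X f 2) 0"
   "endpt X (side X f 0) 0 = endpt X (side X f 2) 1"
   "endpt X (side X f 0) 1 = endpt X (side X f 1) 1" if "f \<in> tris X" for f
  using X that unfolding finite_delta_complex_def by blast+
 have fin: "finite (edges X)" "finite (tris X)" using X unfolding finite_delta_complex_def by auto
 have "finite {(e, i). e \<in> edges X \<and> i < 2 \<and> endpt X e i = v}"
  by (rule finite_subset[of _ "edges X \<times> {..<2}"]) (use fin in auto)
 moreover have "finite {(f, k). f \<in> tris X \<and> k < 3 \<and> tri_vert X f k = v}"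
  by (rule finite_subset[of _ "tris X \<times> {..<3}"]) (use fin in auto)
 moreover have "(case corner k i of (j, b) => (side X f j, b)) \<in> {(e, i). e \<in> edges X \<and> i < 2 \<and> endpt X e i = v}"
  if "f \<in> tris X" "k < 3" "tri_vert X f k = v" "i < 2" for f k i
 proof -
  have "i = 0 \<or> i = 1" "k = 0 \<or> k = 1 \<or> k = 2" using that by linarith+
  then show ?thesis using that(3) fs[OF that(1)]
   by (auto simp: corner_def tri_vert_def)
 qed
 ultimately show ?thesis
  unfolding finite_delta_complex_def vertex_link_def by auto
qed

section \<open>Square linear systems on a finite index set\<close>

lemma linear_bij_on:
 fixes K :: "'a => 'a => real"
 assumes V: "finite V"
  and inj: "\<And>\<phi>. \<forall>v\<in>V. (\<Sum>w\<in>V. K v w * \<phi> w) = 0 ==> \<forall>v\<in>V. \<phi> v = 0"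
 shows "\<exists>\<phi>. \<forall>v\<in>V. (\<Sum>w\<in>V. K v w * \<phi> w) = x v"
proof -
 obtain xs where xs: "distinct xs" "set xs = V" using V finite_distinct_list by blast
 define n where "n = length xs"
 let ?M = "Matrix.mat n n (%(i, j). K (xs ! i) (xs ! j))"
 have M: "?M \<in> carrier_mat n n" by simp
 \<comment> \<open>Injectivity means that 0 is not an eigenvalue, which is the non-vanishing of the
   determinant.\<close>
 have "\<not> eigenvalue ?M 0"
  unfolding n_def using eigenvalue_mat_iff[OF xs, of K 0] inj unfolding eigen_on_def by auto
 then have "Determinant.det ?M \<noteq> 0"
  unfolding det_0_iff_vec_prod_zero[OF M] eigenvalue_def eigenvector_def by force
 then obtain B where B: "B \<in> carrier_mat n n" "?M * B = 1\<^sub>m n"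
  using det_non_zero_imp_unit[OF M, of "TYPE(real)"] unfolding Units_def ring_mat_def by auto
 define y where "y = B *\<^sub>v Matrix.vec n (%i. x (xs ! i))"
 have y: "y \<in> carrier_vec n" using B(1) by (simp add: y_def)
 have My: "?M *\<^sub>v y = Matrix.vec n (%i. x (xs ! i))"
 proof -
  have "?M *\<^sub>v y = (?M * B) *\<^sub>v Matrix.vec n (%i. x (xs ! i))"
   unfolding y_def by (rule assoc_mult_mat_vec[symmetric, OF M B(1)]) simp
  then show ?thesis unfolding B(2) by simp
 qed
 have bij: "bij_betw (%i. xs ! i) {..<n} V"
  using xs bij_betw_nth unfolding n_def by blast
 define \<phi> where "\<phi> a = vec_index y (inv_into {..<n} (%i. xs ! i) a)" for a
 have \<phi>: "\<phi> (xs ! i) = vec_index y i" if "i < n" for i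
  unfolding \<phi>_def using that bij by (simp add: bij_betw_def inv_into_f_f)
 have "(\<Sum>w\<in>V. K v w * \<phi> w) = x v" if v: "v \<in> V" for v
 proof -
  obtain i where i: "i < n" "v = xs ! i" using v bij unfolding bij_betw_def by auto
  have "(\<Sum>w\<in>V. K v w * \<phi> w) = (\<Sum>j<n. K v (xs ! j) * \<phi> (xs ! j))"
   by (rule sum.reindex_bij_betw[OF bij, symmetric])
  also have "\<dots> = (\<Sum>j<n. K (xs ! i) (xs ! j) * vec_index y j)"
   unfolding i(2) by (intro sum.cong) (auto simp: \<phi>)
  also have "\<dots> = vec_index (?M *\<^sub>v y) i"
   using y i by (simp add: scalar_prod_def lessThan_atLeast0)
  also have "\<dots> = x v" using My i by simp
  finally show ?thesis .
 qed
 then show ?thesis by blast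
qed

text \<open>
 The side k of a triangle has its endpoint i in common with one other side; \<open>adj k i\<close> is the number
 of that side together with the number of the common vertex as an endpoint of it.
\<close>

lemma sum_lessThan_3: "(\<Sum>k<3. g k) = g 0 + g 1 + g (2::nat)"
 by (simp add: numeral_3_eq_3 numeral_2_eq_2)

definition adj :: "nat => nat => nat \<times> nat" where
 "adj k i = [[(2, 1), (1, 1)], [(2, 0), (0, 1)], [(1, 0), (0, 0)]] ! k ! i"

definition adj_germ :: "('v, 'e, 'f) delta_complex => nat => 'f \<times> nat => 'e \<times> nat" where
 "adj_germ X i fk = (case fk of (f, k) => (side X f (fst (adj k i)), snd (adj k i)))"

section \<open>Link vertices and the rows of a local intersection matrix\<close>

definition germs :: "('v, 'e, 'f) delta_complex => 'v => ('e \<times> nat) set" where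
 "germs X v = {(e, i). e \<in> edges X \<and> i < 2 \<and> endpt X e i = v}"

lemma verts_vertex_link: "verts (vertex_link X v) = germs X v"
 by (simp add: vertex_link_def germs_def)

lemma finite_germs: "finite_delta_complex X ==> finite (germs X v)"
 unfolding verts_vertex_link[symmetric]
 using finite_delta_complex_link[of X v] unfolding finite_delta_complex_def by blast

lemma finite_edge_link:
 assumes "finite_delta_complex X" shows "finite (edge_link X e)"
 by (rule finite_subset[of _ "tris X \<times> {..<3}"])
  (use assms in \<open>auto simp: edge_link_def finite_delta_complex_def\<close>)

text \<open>Counting oriented link edges treats both cases of the definition alike: an edge between
  different vertices has one orientation from \<open>a\<close> to \<open>b\<close>, and a loop is
  counted in both orientations, which is the factor 2 on the diagonal.\<close>

lemma local_intersection_entry_eq: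
 assumes X: "finite_delta_complex X"
 shows "local_intersection_entry X \<alpha> v a b =
  (if a = b then - \<alpha> (fst a) (1 - snd a) else 0)
   + int (card {l \<in> edges (vertex_link X v). endpt (vertex_link X v) l 0 = a \<and> endpt (vertex_link X v) l 1 = b})
   + int (card {l \<in> edges (vertex_link X v). endpt (vertex_link X v) l 1 = a \<and> endpt (vertex_link X v) l 0 = b})"
proof -
 let ?L = "vertex_link X v"
 have fin: "finite (edges ?L)" using finite_delta_complex_link[OF X] unfolding finite_delta_complex_def by blast
 show ?thesis
 proof (cases "a = b")
  case True
  have "{l \<in> edges ?L. endpt ?L l 1 = b \<and> endpt ?L l 0 = b} = {l \<in> edges ?L. endpt ?L l 0 = b \<and> endpt ?L l 1 = b}"
   by auto
  then show ?thesis using True by (simp add: local_intersection_entry_def Let_def)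
 next
  case False
  have "{l \<in> edges ?L. {endpt ?L l 0, endpt ?L l 1} = {a, b}} =
    {l \<in> edges ?L. endpt ?L l 0 = a \<and> endpt ?L l 1 = b} \<union>
    {l \<in> edges ?L. endpt ?L l 1 = a \<and> endpt ?L l 0 = b}"
   by (auto simp: doubleton_eq_iff)
  moreover have "card \<dots> = card {l \<in> edges ?L. endpt ?L l 0 = a \<and> endpt ?L l 1 = b} +
    card {l \<in> edges ?L. endpt ?L l 1 = a \<and> endpt ?L l 0 = b}"
   by (rule card_Un_disjoint) (use fin False in auto)
  ultimately show ?thesis using False by (simp add: local_intersection_entry_def Let_def)
 qed
qed

lemma sum_card_fibre:
 assumes "finite L" "finite I" "\<And>l. l \<in> L ==> g l \<in> I"
 shows "(\<Sum>b\<in>I. real (card {l\<in>L. P l \<and> g l = b}) * x b) = (\<Sum>l\<in>L. if P l then x (g l) else 0)"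
proof -
 have "real (card {l\<in>L. P l \<and> g l = b}) * x b = (\<Sum>l\<in>L. if g l = b then (if P l then x b else 0) else 0)" for b
 proof -
  have "real (card {l\<in>L. P l \<and> g l = b}) * x b = (\<Sum>l\<in>{l\<in>L. P l \<and> g l = b}. x b)" by simp
  also have "\<dots> = (\<Sum>l\<in>L. if P l \<and> g l = b then x b else 0)"
   by (subst sum.inter_filter[OF assms(1), symmetric]) simp
  finally show ?thesis by (simp add: if_distrib cong: if_cong) (rule sum.cong; auto)
 qed
 then have "(\<Sum>b\<in>I. real (card {l\<in>L. P l \<and> g l = b}) * x b) =
  (\<Sum>l\<in>L. \<Sum>b\<in>I. if g l = b then (if P l then x b else 0) else 0)"
  by (simp add: sum.swap[of _ L I])
 also have "\<dots> = (\<Sum>l\<in>L. if P l then x (g l) else 0)"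
  using assms(2,3) by (intro sum.cong) (auto simp: sum.delta')
 finally show ?thesis .
qed

text \<open>The link edges at \<open>(e, i)\<close> correspond to the occurrences of
  \<open>e\<close> as a side of a triangle, and \<open>adj_germ\<close> is their other end. In this
  form the row no longer mentions the link, and the rows at the two endpoints of \<open>e\<close>
  become comparable.\<close>

lemma local_intersection_row:
 assumes X: "finite_delta_complex X" and a: "(e, i) \<in> germs X v"
 shows "(\<Sum>b\<in>germs X v. real_of_int (local_intersection_entry X \<alpha> v (e, i) b) * x b) =
  (\<Sum>fk\<in>edge_link X e. x (adj_germ X i fk)) - of_int (\<alpha> e (1 - i)) * x (e, i)"
proof -
 let ?L = "vertex_link X v"
 have L: "finite_delta_complex ?L" by (rule finite_delta_complex_link[OF X])
 have fin: "finite (edges ?L)" using L unfolding finite_delta_complex_def by blast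
 have en: "endpt ?L l j \<in> germs X v" if "l \<in> edges ?L" "j < 2" for l j
  using L that unfolding finite_delta_complex_def verts_vertex_link by blast
 have fs: "\<And>k. k < 3 ==> side X f k \<in> edges X" "endpt X (side X f 1) 0 = endpt X (side X f 2) 0"
   "endpt X (side X f 0) 0 = endpt X (side X f 2) 1"
   "endpt X (side X f 0) 1 = endpt X (side X f 1) 1" if "f \<in> tris X" for f
  using X that unfolding finite_delta_complex_def by blast+
 have finf: "finite (tris X)" using X unfolding finite_delta_complex_def by auto
 have i: "i = 0 \<or> i = 1" and v: "endpt X e i = v" using a unfolding germs_def by auto
 note fg = finite_germs[OF X, of v]
 \<comment> \<open>The sum may run over all corners of all triangles, because a corner with
   \<open>(e, i)\<close> as one of its two ends is automatically a corner at
   \<open>v\<close>.\<close>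
 have conv: "(\<Sum>l\<in>edges ?L. if endpt ?L l j = (e, i) then x (endpt ?L l (1 - j)) else 0) =
   (\<Sum>f\<in>tris X. \<Sum>k<3. if endpt ?L (f, k) j = (e, i) then x (endpt ?L (f, k) (1 - j)) else 0)"
  if j: "j < 2" for j
 proof -
  have j': "j = 0 \<or> j = 1" using j by linarith
  have "(\<Sum>l\<in>edges ?L. if endpt ?L l j = (e, i) then x (endpt ?L l (1 - j)) else 0) =
   (\<Sum>l\<in>tris X \<times> {..<3}. if endpt ?L l j = (e, i) then x (endpt ?L l (1 - j)) else 0)"
  proof (rule sum.mono_neutral_left)
   show "edges ?L \<subseteq> tris X \<times> {..<3}" by (auto simp: vertex_link_def)
   show "\<forall>l\<in>tris X \<times> {..<3} - edges ?L. (if endpt ?L l j = (e, i) then x (endpt ?L l (1 - j)) else 0) = 0"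
   proof (clarsimp)
    fix f k assume fk: "f \<in> tris X" "k < (3::nat)" "(f, k) \<notin> edges ?L" "endpt ?L (f, k) j = (e, i)"
    have "k = 0 \<or> k = 1 \<or> k = 2" using fk(2) by linarith
    then have "tri_vert X f k = v"
     using v fk(4) fs[OF fk(1)] j'
     by (auto simp: vertex_link_def corner_def tri_vert_def)
    then show "x (endpt ?L (f, k) (Suc 0 - j)) = 0" using fk by (simp add: vertex_link_def)
   qed
  qed (use finf in auto)
  also have "\<dots> = (\<Sum>f\<in>tris X. \<Sum>k<3. if endpt ?L (f, k) j = (e, i) then x (endpt ?L (f, k) (1 - j)) else 0)"
   by (simp add: sum.cartesian_product)
  finally show ?thesis .
 qed
 have "(\<Sum>b\<in>germs X v. real_of_int (local_intersection_entry X \<alpha> v (e, i) b) * x b) =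
   (\<Sum>b\<in>germs X v. if (e, i) = b then - of_int (\<alpha> e (1 - i)) * x (e, i) else 0)
  + (\<Sum>b\<in>germs X v. real (card {l \<in> edges ?L. endpt ?L l 0 = (e, i) \<and> endpt ?L l 1 = b}) * x b)
  + (\<Sum>b\<in>germs X v. real (card {l \<in> edges ?L. endpt ?L l 1 = (e, i) \<and> endpt ?L l 0 = b}) * x b)"
  unfolding local_intersection_entry_eq[OF X] sum.distrib[symmetric]
  by (intro sum.cong refl) (auto simp: algebra_simps)
 also have "\<dots> = - of_int (\<alpha> e (1 - i)) * x (e, i)
   + (\<Sum>f\<in>tris X. (\<Sum>k<3. if endpt ?L (f, k) 0 = (e, i) then x (endpt ?L (f, k) 1) else 0)
    + (\<Sum>k<3. if endpt ?L (f, k) 1 = (e, i) then x (endpt ?L (f, k) 0) else 0))"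
  using conv[of 0] conv[of 1] fg a en
  by (simp add: sum_card_fibre[OF fin fg] sum.distrib cong: if_cong)
 \<comment> \<open>In one triangle, the three corners with their two orientations are the six pairs
   of a side and an endpoint; for fixed \<open>i\<close> one pair per side remains.\<close>
 also have "(\<Sum>f\<in>tris X. (\<Sum>k<3. if endpt ?L (f, k) 0 = (e, i) then x (endpt ?L (f, k) 1) else 0)
    + (\<Sum>k<3. if endpt ?L (f, k) 1 = (e, i) then x (endpt ?L (f, k) 0) else 0))
   = (\<Sum>f\<in>tris X. \<Sum>k<3. if side X f k = e then x (adj_germ X i (f, k)) else 0)"
  using i by (intro sum.cong refl)
   (auto simp: vertex_link_def corner_def adj_germ_def adj_def sum_lessThan_3)
 also have "\<dots> = (\<Sum>fk\<in>tris X \<times> {..<3}. if side X (fst fk) (snd fk) = e then x (adj_germ X i fk) else 0)"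
  unfolding sum.cartesian_product by (intro sum.cong) auto
 also have "\<dots> = (\<Sum>fk\<in>{fk\<in>tris X \<times> {..<3}. side X (fst fk) (snd fk) = e}. x (adj_germ X i fk))"
  by (rule sum.inter_filter[symmetric]) (use finf in auto)
 also have "{fk\<in>tris X \<times> {..<3}. side X (fst fk) (snd fk) = e} = edge_link X e"
  by (auto simp: edge_link_def)
 finally show ?thesis by simp
qed

section \<open>Cocycles, divisors and the Laplacian\<close>

text \<open>The slope of \<open>c\<close> in the direction leaving the vertex: at its endpoint 1 an
  edge is left against its orientation.\<close>

definition cval :: "('e => real) => 'e \<times> nat => real" where
 "cval c a = (if snd a = 0 then c (fst a) else - c (fst a))"

definition cocycle :: "('v, 'e, 'f) delta_complex => ('e => real) => bool" where
 "cocycle X c \<longleftrightarrow> (\<forall>f\<in>tris X. c (side X f 1) = c (side X f 2) + c (side X f 0))"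

definition coboundary :: "('v, 'e, 'f) delta_complex => ('v => real) => 'e => real" where
 "coboundary X \<phi> e = \<phi> (endpt X e 1) - \<phi> (endpt X e 0)"

locale trop_surface =
 fixes X :: "('v, 'e, 'f) delta_complex" and \<alpha> :: "'e => nat => int"
 assumes tropical: "tropical_surface X \<alpha>" and locally_connected: "loc_connected_codim1 X"
begin

lemma finite_X: "finite_delta_complex X"
 using tropical unfolding tropical_surface_def weak_tropical_surface_def by blast

lemma finite_cells: "finite (verts X)" "finite (edges X)" "finite (tris X)"
 using finite_X unfolding finite_delta_complex_def by auto

lemma endpt_in: "e \<in> edges X ==> i < 2 ==> endpt X e i \<in> verts X"
 using finite_X unfolding finite_delta_complex_def by blast

lemma side_in: "f \<in> tris X ==> k < 3 ==> side X f k \<in> edges X"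
 using finite_X unfolding finite_delta_complex_def by blast

lemma tri_verts:
 assumes "f \<in> tris X"
 shows "endpt X (side X f 1) 0 = endpt X (side X f 2) 0"
  "endpt X (side X f 0) 0 = endpt X (side X f 2) 1"
  "endpt X (side X f 0) 1 = endpt X (side X f 1) 1"
 using finite_X assms unfolding finite_delta_complex_def by blast+

lemma alpha_sum: "e \<in> edges X ==> \<alpha> e 0 + \<alpha> e 1 = int (card (edge_link X e))"
 using tropical unfolding tropical_surface_def weak_tropical_surface_def by blast

lemma fin_germs: "finite (germs X v)" by (rule finite_germs[OF finite_X])

lemma fin_edge_link: "finite (edge_link X e)" by (rule finite_edge_link[OF finite_X])

definition lmat :: "'v => 'e \<times> nat => 'e \<times> nat => real" where
 "lmat v a b = of_int (local_intersection_entry X \<alpha> v a b)"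

lemma lmat_sym: "lmat v a b = lmat v b a"
 unfolding lmat_def local_intersection_entry_eq[OF finite_X] by (simp add: conj_commute)

lemma lmat_nonneg: "a \<noteq> b ==> lmat v a b \<ge> 0"
 unfolding lmat_def local_intersection_entry_eq[OF finite_X] by simp

text \<open>Irreducibility is connectedness of the link: a proper non-empty set of link vertices
  must be left by some link edge, and that edge gives a positive entry.\<close>

lemma lmat_irreducible:
 assumes v: "v \<in> verts X" and S: "S \<subseteq> germs X v" "S \<noteq> {}" "S \<noteq> germs X v"
 shows "\<exists>a\<in>S. \<exists>b\<in>germs X v - S. lmat v a b > 0"
proof -
 let ?L = "vertex_link X v"
 have L: "finite_delta_complex ?L" by (rule finite_delta_complex_link[OF finite_X])
 have "connected_space (realization ?L)" using locally_connected v unfolding loc_connected_codim1_def by blast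
 then obtain l where l: "l \<in> edges ?L" "(endpt ?L l 0 \<in> S) \<noteq> (endpt ?L l 1 \<in> S)"
  using connected_realization_verts[OF L _ _ S(2)] S unfolding verts_vertex_link by blast
 have en: "endpt ?L l 0 \<in> germs X v" "endpt ?L l 1 \<in> germs X v"
  using L l(1) unfolding finite_delta_complex_def verts_vertex_link by auto
 have fin: "finite (edges ?L)" using L unfolding finite_delta_complex_def by blast
 have pos: "lmat v (endpt ?L l 0) (endpt ?L l 1) > 0"
 proof -
  have "card {l' \<in> edges ?L. endpt ?L l' 0 = endpt ?L l 0 \<and> endpt ?L l' 1 = endpt ?L l 1} > 0"
   using fin l(1) by (simp only: card_gt_0_iff) (rule conjI, blast, simp)
  moreover have "endpt ?L l 0 \<noteq> endpt ?L l 1" using l(2) by metis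
  ultimately show ?thesis unfolding lmat_def local_intersection_entry_eq[OF finite_X] by simp
 qed
 show ?thesis
 proof (cases "endpt ?L l 0 \<in> S")
  case True
  then show ?thesis using pos en l(2) by blast
 next
  case False
  then have "endpt ?L l 1 \<in> S" "endpt ?L l 0 \<in> germs X v - S" using en l(2) by auto
  moreover have "lmat v (endpt ?L l 1) (endpt ?L l 0) > 0" using pos by (simp only: lmat_sym[of v "endpt ?L l 1"])
  ultimately show ?thesis by blast
 qed
qed

lemma one_positive_eigenvalue:
 assumes "v \<in> verts X"
 obtains r0 x0 where "r0 > 0" "eigen_on (germs X v) (lmat v) r0 x0" "\<exists>a\<in>germs X v. x0 a \<noteq> 0"
  "\<And>r x. r > 0 ==> eigen_on (germs X v) (lmat v) r x ==> \<exists>a\<in>germs X v. x a \<noteq> 0 ==> r = r0"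
proof -
 obtain xs where xs: "distinct xs" "set xs = germs X v" using fin_germs finite_distinct_list by blast
 have one: "num_pos_eigenvalues (local_intersection_matrix X \<alpha> v xs) = 1"
  using tropical assms xs unfolding tropical_surface_def verts_vertex_link by blast
 have m: "local_intersection_matrix X \<alpha> v xs =
   Matrix.mat (length xs) (length xs) (%(i, j). lmat v (xs ! i) (xs ! j))"
  by (simp add: local_intersection_matrix_def lmat_def)
 obtain r0 where r0: "eigenvalue (local_intersection_matrix X \<alpha> v xs) r0" "r0 > 0"
  "\<And>r. eigenvalue (local_intersection_matrix X \<alpha> v xs) r ==> r > 0 ==> r = r0"
 proof (rule one_num_pos_eigenvalues[OF _ one, of "length xs"])
  show "local_intersection_matrix X \<alpha> v xs \<in> carrier_mat (length xs) (length xs)" by (simp add: m)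
 qed (rule that)
 note iff = eigenvalue_mat_iff[OF xs, of "lmat v", folded m]
 obtain x0 where "eigen_on (germs X v) (lmat v) r0 x0" "\<exists>a\<in>germs X v. x0 a \<noteq> 0"
  using r0(1) unfolding iff by blast
 then show ?thesis
  by (rule that[OF r0(2)]) (use r0(3) iff in blast)
qed

lemma lmat_row:
 assumes "(e, i) \<in> germs X v"
 shows "(\<Sum>b\<in>germs X v. lmat v (e, i) b * x b) =
  (\<Sum>fk\<in>edge_link X e. x (adj_germ X i fk)) - of_int (\<alpha> e (1 - i)) * x (e, i)"
 unfolding lmat_def by (rule local_intersection_row[OF finite_X assms])

text \<open>
 An edge without triangles would be the only vertex of the links of both of its endpoints, and its
 two integers \<open>\<alpha>\<close> would be negative with sum zero.
\<close>

lemma edge_link_nonempty: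
 assumes e: "e \<in> edges X"
 shows "edge_link X e \<noteq> {}"
proof
 assume empty: "edge_link X e = {}"
 have neg: "\<alpha> e (1 - i) < 0" if i: "i < 2" for i
 proof -
  define v where "v = endpt X e i"
  have v: "v \<in> verts X" using endpt_in[OF e i] by (simp add: v_def)
  have a: "(e, i) \<in> germs X v" using e i by (simp add: germs_def v_def)
  have row: "(\<Sum>b\<in>germs X v. lmat v (e, i) b * x b) = - of_int (\<alpha> e (1 - i)) * x (e, i)" for x
   using lmat_row[OF a, of x] empty by simp
  \<comment> \<open>Testing the row with an indicator function isolates one entry. A row that is
    zero off the diagonal contradicts irreducibility unless the matrix has size 1, and its only
    entry is then the positive eigenvalue.\<close>
  have z: "lmat v (e, i) b = 0" if "b \<in> germs X v" "b \<noteq> (e, i)" for b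
   using row[of "%b'. if b' = b then 1 else 0"] that fin_germs[of v]
   by (simp add: if_distrib[of "%t. _ * t"] cong: if_cong)
  have "germs X v = {(e, i)}"
  proof (rule ccontr)
   assume "germs X v \<noteq> {(e, i)}"
   then obtain b where "b \<in> germs X v - {(e, i)}" "lmat v (e, i) b > 0"
    using lmat_irreducible[OF v, of "{(e, i)}"] a by auto
   then show False using z[of b] by simp
  qed
  moreover obtain r x where "r > 0" "eigen_on (germs X v) (lmat v) r x" "\<exists>a\<in>germs X v. x a \<noteq> 0"
   by (rule one_positive_eigenvalue[OF v], rule that)
  ultimately have "- of_int (\<alpha> e (1 - i)) * x (e, i) = r * x (e, i)" "x (e, i) \<noteq> 0" "r > 0"
   using row[of x] unfolding eigen_on_def by auto
  then have "(of_int (\<alpha> e (1 - i)) + r) * x (e, i) = 0" by (simp add: distrib_right)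
  with \<open>r > 0\<close> \<open>x (e, i) \<noteq> 0\<close> show ?thesis by simp
 qed
 show False using neg[of 0] neg[of 1] alpha_sum[OF e] empty by simp
qed

lemma exists_weights:
 "\<exists>u. (\<forall>v\<in>verts X. (\<forall>a\<in>germs X v. u a > 0) \<and>
   (\<forall>x. inner_on (germs X v) u x = 0 --> qform (germs X v) (lmat v) x x \<le> 0 \<and>
    (qform (germs X v) (lmat v) x x = 0 --> eigen_on (germs X v) (lmat v) 0 x)))"
proof -
 have "\<exists>u. (\<forall>a\<in>germs X v. u a > 0) \<and>
   (\<forall>x. inner_on (germs X v) u x = 0 --> qform (germs X v) (lmat v) x x \<le> 0 \<and>
    (qform (germs X v) (lmat v) x x = 0 --> eigen_on (germs X v) (lmat v) 0 x))" if v: "v \<in> verts X" for v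
 proof -
  obtain r0 x0 where r: "r0 > 0" "eigen_on (germs X v) (lmat v) r0 x0" "\<exists>a\<in>germs X v. x0 a \<noteq> 0"
   "\<And>r x. r > 0 ==> eigen_on (germs X v) (lmat v) r x ==> \<exists>a\<in>germs X v. x a \<noteq> 0 ==> r = r0"
   by (rule one_positive_eigenvalue[OF v], rule that)
  show ?thesis
  proof (rule one_positive_eigenvalue_hyperbolic[OF fin_germs lmat_sym lmat_nonneg
     lmat_irreducible[OF v] r])
   fix u assume u: "\<And>a. a \<in> germs X v ==> u a > 0"
    "\<And>x. inner_on (germs X v) u x = 0 ==> qform (germs X v) (lmat v) x x \<le> 0"
    "\<And>x. inner_on (germs X v) u x = 0 ==> qform (germs X v) (lmat v) x x = 0 ==>
     eigen_on (germs X v) (lmat v) 0 x"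
   show ?thesis by (intro exI[of _ u] conjI ballI allI impI u)
  qed
 qed
 then obtain u where u: "\<And>v. v \<in> verts X ==> (\<forall>a\<in>germs X v. u v a > 0) \<and>
   (\<forall>x. inner_on (germs X v) (u v) x = 0 --> qform (germs X v) (lmat v) x x \<le> 0 \<and>
    (qform (germs X v) (lmat v) x x = 0 --> eigen_on (germs X v) (lmat v) 0 x))" by metis
 \<comment> \<open>A germ determines its vertex, so the positive vectors chosen at the vertices
   combine into one function on all germs.\<close>
 define w where "w a = u (endpt X (fst a) (snd a)) a" for a
 have w: "w a = u v a" if "a \<in> germs X v" for a v using that by (auto simp: w_def germs_def)
 have "inner_on (germs X v) w x = inner_on (germs X v) (u v) x" for v x
  unfolding inner_on_def by (intro sum.cong refl) (simp add: w)
 then show ?thesis using u w by (intro exI[of _ w]) simp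
qed

definition weight :: "'e \<times> nat => real" where
 "weight = (SOME u. (\<forall>v\<in>verts X. (\<forall>a\<in>germs X v. u a > 0) \<and>
   (\<forall>x. inner_on (germs X v) u x = 0 --> qform (germs X v) (lmat v) x x \<le> 0 \<and>
    (qform (germs X v) (lmat v) x x = 0 --> eigen_on (germs X v) (lmat v) 0 x))))"

lemma weight_pos: "v \<in> verts X ==> a \<in> germs X v ==> weight a > 0"
 and weight_neg: "v \<in> verts X ==> inner_on (germs X v) weight x = 0 ==>
  qform (germs X v) (lmat v) x x \<le> 0"
 and weight_null: "v \<in> verts X ==> inner_on (germs X v) weight x = 0 ==>
  qform (germs X v) (lmat v) x x = 0 ==> eigen_on (germs X v) (lmat v) 0 x"
 using someI_ex[OF exists_weights, folded weight_def] by blast+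

text \<open>The divisor coefficient along \<open>e\<close> of a function with slopes
  \<open>c\<close>: the row of the local intersection matrix at the endpoint 0 of \<open>e\<close>,
  applied to the outgoing slopes.\<close>

definition ldiv :: "('e => real) => 'e => real" where
 "ldiv c e = (\<Sum>fk\<in>edge_link X e. cval c (adj_germ X 0 fk)) - of_int (\<alpha> e 1) * c e"

text \<open>The path from the start of \<open>e\<close> to the opposite vertex of the triangle may
  be taken directly or through the end of \<open>e\<close>.\<close>

lemma cval_adj_germ:
 assumes "cocycle X c" "fk \<in> edge_link X e"
 shows "cval c (adj_germ X 0 fk) = c e + cval c (adj_germ X 1 fk)"
proof -
 obtain f k where fk: "fk = (f, k)" "f \<in> tris X" "k < 3" "e = side X f k"
  using assms(2) by (auto simp: edge_link_def)
 have "k = 0 \<or> k = 1 \<or> k = 2" using fk(3) by linarith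
 moreover have "c (side X f 1) = c (side X f 2) + c (side X f 0)"
  using assms(1) fk(2) unfolding cocycle_def by blast
 ultimately show ?thesis by (auto simp: fk adj_germ_def adj_def cval_def)
qed

text \<open>Moving from one endpoint of \<open>e\<close> to the other changes the summand of each
  triangle by \<open>c e\<close>. The total change is absorbed by the diagonal term, because the two
  integers at \<open>e\<close> add up to the number of these triangles.\<close>

lemma lmat_row_cocycle:
 assumes c: "cocycle X c" and a: "(e, i) \<in> germs X v"
 shows "(\<Sum>b\<in>germs X v. lmat v (e, i) b * cval c b) = ldiv c e"
proof -
 have e: "e \<in> edges X" "i = 0 \<or> i = 1" using a by (auto simp: germs_def)
 show ?thesis
 proof (cases "i = 0")
  case True
  then show ?thesis using lmat_row[OF a, of "cval c"] by (simp add: ldiv_def cval_def)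
 next
  case False
  then have i: "i = 1" using e by simp
  have "(\<Sum>fk\<in>edge_link X e. cval c (adj_germ X 0 fk)) =
    (\<Sum>fk\<in>edge_link X e. c e + cval c (adj_germ X 1 fk))"
   by (intro sum.cong refl cval_adj_germ[OF c])
  also have "\<dots> = of_int (\<alpha> e 0 + \<alpha> e 1) * c e + (\<Sum>fk\<in>edge_link X e. cval c (adj_germ X 1 fk))"
   unfolding alpha_sum[OF e(1)] by (simp add: sum.distrib)
  finally show ?thesis using lmat_row[OF a, of "cval c"] i
   by (simp add: ldiv_def cval_def algebra_simps)
 qed
qed

lemma sum_germs:
 "(\<Sum>v\<in>verts X. \<Sum>a\<in>germs X v. F a) = (\<Sum>e\<in>edges X. F (e, 0) + (F (e, 1) :: real))"
proof -
 have "(\<Sum>v\<in>verts X. \<Sum>a\<in>germs X v. F a) = (\<Sum>a\<in>(\<Union>v\<in>verts X. germs X v). F a)"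
  by (rule sum.UNION_disjoint[symmetric]) (use finite_cells fin_germs in \<open>auto simp: germs_def\<close>)
 also have "(\<Union>v\<in>verts X. germs X v) = edges X \<times> {0, 1}"
  using endpt_in by (auto simp: germs_def)
 also have "(\<Sum>a\<in>edges X \<times> {0, 1}. F a) = (\<Sum>e\<in>edges X. F (e, 0) + F (e, 1))"
  by (simp add: sum.cartesian_product[symmetric, of "%e i. F (e, i)", simplified case_prod_eta])
 finally show ?thesis .
qed

text \<open>Each edge occurs at both of its ends, with opposite outgoing slopes of \<open>c\<close>
  and with the same factor \<open>y e\<close>.\<close>

lemma global_pairing_zero:
 assumes h: "\<And>v e i. v \<in> verts X ==> (e, i) \<in> germs X v ==> (\<Sum>b\<in>germs X v. lmat v (e, i) b * h b) = y e"
 shows "(\<Sum>v\<in>verts X. qform (germs X v) (lmat v) (cval c) h) = 0"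
proof -
 have "(\<Sum>v\<in>verts X. qform (germs X v) (lmat v) (cval c) h) =
   (\<Sum>v\<in>verts X. \<Sum>a\<in>germs X v. cval c a * y (fst a))"
  unfolding qform_def by (intro sum.cong refl) (use h in auto)
 also have "\<dots> = 0" unfolding sum_germs by (simp add: cval_def)
 finally show ?thesis .
qed

lemma ldiv_zero:
 assumes c: "cocycle X c" and u: "\<And>v. v \<in> verts X ==> inner_on (germs X v) weight (cval c) = 0"
  and e: "e \<in> edges X"
 shows "ldiv c e = 0"
proof -
 have "(\<Sum>v\<in>verts X. qform (germs X v) (lmat v) (cval c) (cval c)) = 0"
  by (rule global_pairing_zero) (rule lmat_row_cocycle[OF c])
 then have "qform (germs X v) (lmat v) (cval c) (cval c) = 0" if "v \<in> verts X" for v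
  using sum_nonneg_eq_0_iff[OF finite_cells(1), of "%v. - qform (germs X v) (lmat v) (cval c) (cval c)"]
   weight_neg[OF _ u] that by (simp add: sum_negf)
 then have "eigen_on (germs X v) (lmat v) 0 (cval c)" if "v \<in> verts X" for v
  using weight_null[OF that u[OF that]] that by blast
 from this[OF endpt_in[OF e, of 0]] have "(\<Sum>b\<in>germs X (endpt X e 0). lmat (endpt X e 0) (e, 0) b * cval c b) = 0"
  using e unfolding eigen_on_def by (auto simp: germs_def)
 then show ?thesis using lmat_row_cocycle[OF c, of e 0 "endpt X e 0"] e by (simp add: germs_def)
qed

text \<open>A Laplacian whose weights at the two ends of an edge are unrelated. It need not be
  symmetric, which is why solvability is derived from a minimum principle rather than from
  self-adjointness.\<close>

definition lap :: "('v => real) => 'v => real" where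
 "lap \<phi> v = (\<Sum>a\<in>germs X v. weight a * (\<phi> (endpt X (fst a) (1 - snd a)) - \<phi> v))"

lemma lap_coboundary: "inner_on (germs X v) weight (cval (coboundary X \<phi>)) = lap \<phi> v"
 unfolding inner_on_def lap_def
proof (intro sum.cong refl)
 fix a assume "a \<in> germs X v"
 then have "snd a = 0 \<or> snd a = 1" "endpt X (fst a) (snd a) = v" by (auto simp: germs_def)
 then show "weight a * cval (coboundary X \<phi>) a = weight a * (\<phi> (endpt X (fst a) (1 - snd a)) - \<phi> v)"
  by (auto simp: cval_def coboundary_def)
qed

lemma verts_nonempty_connected:
 assumes "S \<subseteq> verts X" "S \<noteq> {}" "\<And>e. e \<in> edges X ==> endpt X e 0 \<in> S \<longleftrightarrow> endpt X e 1 \<in> S"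
 shows "S = verts X"
 using connected_realization_verts[OF finite_X _ assms] tropical
 unfolding tropical_surface_def weak_tropical_surface_def by blast

text \<open>Minimum principle: at a minimum all terms of the Laplacian are non-negative while their
  sum is not positive, so every neighbour is a minimum too, and the graph is connected.\<close>

lemma superharmonic_constant:
 assumes lap: "\<And>v. v \<in> verts X ==> lap \<phi> v \<le> 0" and v: "v \<in> verts X" "w \<in> verts X"
 shows "\<phi> v = \<phi> w"
proof -
 define m where "m = Min (\<phi> ` verts X)"
 have min: "m \<le> \<phi> v" if "v \<in> verts X" for v unfolding m_def using finite_cells that by (intro Min_le) auto
 define S where "S = {v\<in>verts X. \<phi> v = m}"
 have "m \<in> \<phi> ` verts X" unfolding m_def using finite_cells v by (intro Min_in) auto
 then have "S \<noteq> {}" by (auto simp: S_def)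
 have nb: "endpt X e (1 - i) \<in> S" if e: "e \<in> edges X" "i < 2" "endpt X e i \<in> S" for e i
 proof -
  let ?v = "endpt X e i"
  have v: "?v \<in> verts X" "\<phi> ?v = m" using e by (auto simp: S_def)
  have nn: "weight a * (\<phi> (endpt X (fst a) (1 - snd a)) - \<phi> ?v) \<ge> 0" if a: "a \<in> germs X ?v" for a
  proof -
   have "endpt X (fst a) (1 - snd a) \<in> verts X" using a by (intro endpt_in) (auto simp: germs_def)
   from min[OF this] show ?thesis using weight_pos[OF v(1) a] v(2) by simp
  qed
  have "(\<Sum>a\<in>germs X ?v. weight a * (\<phi> (endpt X (fst a) (1 - snd a)) - \<phi> ?v)) = 0"
   (is "?s = 0")
  proof (rule antisym)
   show "?s \<le> 0" using lap[OF v(1)] unfolding lap_def .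
  qed (intro sum_nonneg nn)
  then have "weight (e, i) * (\<phi> (endpt X e (1 - i)) - \<phi> ?v) = 0"
  proof -
   have "\<forall>a\<in>germs X ?v. weight a * (\<phi> (endpt X (fst a) (1 - snd a)) - \<phi> ?v) = 0"
    using sum_nonneg_eq_0_iff[of "germs X ?v" "%a. weight a * (\<phi> (endpt X (fst a) (1 - snd a)) - \<phi> ?v)"]
     fin_germs nn \<open>?s = 0\<close> by blast
   moreover have "(e, i) \<in> germs X ?v" using e by (simp add: germs_def)
   ultimately show ?thesis by fastforce
  qed
  moreover have "weight (e, i) > 0" using weight_pos[OF v(1)] e by (simp add: germs_def)
  ultimately show ?thesis using v endpt_in[OF e(1), of "1 - i"] by (auto simp: S_def)
 qed
 have "S = verts X"
 proof (rule verts_nonempty_connected[OF _ \<open>S \<noteq> {}\<close>])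
  show "S \<subseteq> verts X" by (auto simp: S_def)
  show "endpt X e 0 \<in> S \<longleftrightarrow> endpt X e 1 \<in> S" if "e \<in> edges X" for e
   using nb[OF that, of 0] nb[OF that, of 1] by (simp del: One_nat_def) blast
 qed
 then have "v \<in> S" "w \<in> S" using v by auto
 then show ?thesis by (simp add: S_def)
qed

text \<open>Adding the value at \<open>v0\<close> in the equation at \<open>v0\<close> makes the
  operator injective. A kernel element is, up to sign, superharmonic, hence constant, hence 0 by the
  equation at \<open>v0\<close>. The value \<open>\<phi> v0\<close> measures how far the pure
  Laplace equation is from being solvable.\<close>

lemma lap_solve:
 assumes v0: "v0 \<in> verts X"
 shows "\<exists>\<phi>. \<forall>v\<in>verts X. lap \<phi> v + (if v = v0 then \<phi> v0 else 0) = x v"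
proof -
 define K where "K v w = (\<Sum>a\<in>germs X v. weight a * ((if endpt X (fst a) (1 - snd a) = w then 1 else 0)
   - (if v = w then 1 else 0))) + (if v = v0 \<and> w = v0 then 1 else 0)" for v w
 have K: "(\<Sum>w\<in>verts X. K v w * \<phi> w) = lap \<phi> v + (if v = v0 then \<phi> v0 else 0)" if v: "v \<in> verts X" for v \<phi>
 proof -
  have "(\<Sum>w\<in>verts X. K v w * \<phi> w) =
    (\<Sum>w\<in>verts X. \<Sum>a\<in>germs X v. weight a * ((if endpt X (fst a) (1 - snd a) = w then \<phi> w else 0)
     - (if v = w then \<phi> w else 0))) + (\<Sum>w\<in>verts X. if v0 = w then (if v = v0 then \<phi> w else 0) else 0)"
   unfolding sum.distrib[symmetric] K_def distrib_right sum_distrib_right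
   by (intro sum.cong arg_cong2[where f="(+)"]) auto
  also have "\<dots> = (\<Sum>a\<in>germs X v. \<Sum>w\<in>verts X. weight a * ((if endpt X (fst a) (1 - snd a) = w then \<phi> w else 0)
     - (if v = w then \<phi> w else 0))) + (if v = v0 then \<phi> v0 else 0)"
   using v0 finite_cells by (subst sum.swap) simp
  also have "(\<Sum>a\<in>germs X v. \<Sum>w\<in>verts X. weight a * ((if endpt X (fst a) (1 - snd a) = w then \<phi> w else 0)
     - (if v = w then \<phi> w else 0))) = lap \<phi> v"
   unfolding lap_def
  proof (intro sum.cong refl)
   fix a assume a: "a \<in> germs X v"
   have "endpt X (fst a) (1 - snd a) \<in> verts X" using a by (intro endpt_in) (auto simp: germs_def)
   then show "(\<Sum>w\<in>verts X. weight a * ((if endpt X (fst a) (1 - snd a) = w then \<phi> w else 0)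
     - (if v = w then \<phi> w else 0))) = weight a * (\<phi> (endpt X (fst a) (1 - snd a)) - \<phi> v)"
    using v finite_cells by (simp add: sum_distrib_left[symmetric] sum_subtractf)
  qed
  finally show ?thesis .
 qed
 have inj0: "\<forall>v\<in>verts X. \<phi> v = 0"
  if z: "\<And>v. v \<in> verts X ==> lap \<phi> v + (if v = v0 then \<phi> v0 else 0) = 0" and p: "\<phi> v0 \<ge> 0" for \<phi>
 proof -
  have "lap \<phi> v \<le> 0" if "v \<in> verts X" for v using z[OF that] p by (auto split: if_splits)
  then have c: "\<phi> v = \<phi> v0" if "v \<in> verts X" for v using superharmonic_constant that v0 by blast
  have "lap \<phi> v0 = 0" unfolding lap_def
  proof (intro sum.neutral ballI)
   fix a assume a: "a \<in> germs X v0"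
   have "endpt X (fst a) (1 - snd a) \<in> verts X" using a by (intro endpt_in) (auto simp: germs_def)
   then show "weight a * (\<phi> (endpt X (fst a) (1 - snd a)) - \<phi> v0) = 0" using c by simp
  qed
  then have "\<phi> v0 = 0" using z[OF v0] by simp
  then show ?thesis using c by simp
 qed
 have neg: "lap (%v. - \<phi> v) v = - lap \<phi> v" for \<phi> v
  unfolding lap_def sum_negf[symmetric] by (intro sum.cong) (auto simp: algebra_simps)
 have "\<exists>\<phi>. \<forall>v\<in>verts X. (\<Sum>w\<in>verts X. K v w * \<phi> w) = x v"
 proof (rule linear_bij_on[OF finite_cells(1)])
  fix \<phi> assume "\<forall>v\<in>verts X. (\<Sum>w\<in>verts X. K v w * \<phi> w) = 0"
  then have z: "lap \<phi> v + (if v = v0 then \<phi> v0 else 0) = 0" if "v \<in> verts X" for v using K that by simp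
  show "\<forall>v\<in>verts X. \<phi> v = 0"
  proof (cases "\<phi> v0 \<ge> 0")
   case True
   then show ?thesis using inj0 z by blast
  next
   case False
   have "lap (%v. - \<phi> v) v + (if v = v0 then - \<phi> v0 else 0) = 0" if "v \<in> verts X" for v
    using z[OF that] unfolding neg by (simp split: if_splits)
   from inj0[of "%v. - \<phi> v", OF this] False show ?thesis by simp
  qed
 qed
 then show ?thesis using K by simp
qed

lemma cocycle_coboundary: "cocycle X (coboundary X \<phi>)"
 unfolding cocycle_def coboundary_def using tri_verts by simp

lemma cocycle_lin: "cocycle X c ==> cocycle X c' ==> cocycle X (%e. c e + t * c' e)"
 unfolding cocycle_def by (simp add: algebra_simps)

lemma cval_lin: "cval (%e. c e + t * c' e) = (%a. cval c a + t * cval c' a)"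
 by (auto simp: cval_def)

text \<open>All pairings with the weights can be concentrated at one vertex. The number
  \<open>a\<close> left over there is the one-dimensional obstruction.\<close>

lemma normalize_cocycle:
 assumes v0: "v0 \<in> verts X"
 obtains \<phi> a where "\<And>v. v \<in> verts X ==>
  inner_on (germs X v) weight (cval (%e. c e - coboundary X \<phi> e)) = (if v = v0 then a else 0)"
proof -
 obtain \<phi> where \<phi>: "\<And>v. v \<in> verts X ==> lap \<phi> v + (if v = v0 then \<phi> v0 else 0) = inner_on (germs X v) weight (cval c)"
  using lap_solve[OF v0, of "%v. inner_on (germs X v) weight (cval c)"] by blast
 have "inner_on (germs X v) weight (cval (%e. c e - coboundary X \<phi> e)) = (if v = v0 then \<phi> v0 else 0)"
  if "v \<in> verts X" for v
 proof -
  have "inner_on (germs X v) weight (cval (%e. c e + (-1) * coboundary X \<phi> e)) = (if v = v0 then \<phi> v0 else 0)"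
   unfolding cval_lin inner_on_add_right lap_coboundary \<phi>[OF that, symmetric] by simp
  then show ?thesis by simp
 qed
 then show ?thesis using that by blast
qed

text \<open>If \<open>a\<close> were not 0, a cocycle \<open>b\<close> with the same pairings with
  the weights as \<open>h\<close> would exist. Then \<open>h - b\<close> lies in the negative
  semidefinite part at every vertex, but the global form of \<open>h - b\<close> equals that of
  \<open>h\<close>, since the mixed terms and the form of \<open>b\<close> vanish in the
  sum.\<close>

lemma positive_divisor_obstruction:
 assumes h: "\<And>v e i. v \<in> verts X ==> (e, i) \<in> germs X v ==> (\<Sum>b\<in>germs X v. lmat v (e, i) b * h b) = y e"
  and pos: "(\<Sum>v\<in>verts X. qform (germs X v) (lmat v) h h) > 0"
  and v0: "v0 \<in> verts X" and c: "cocycle X c"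
  and norm: "\<And>v. v \<in> verts X ==> inner_on (germs X v) weight (cval c) = (if v = v0 then a else 0)"
 shows "a = 0"
proof (rule ccontr)
 assume a: "a \<noteq> 0"
 obtain \<phi> where \<phi>: "\<And>v. v \<in> verts X ==> lap \<phi> v + (if v = v0 then \<phi> v0 else 0) = inner_on (germs X v) weight h"
  using lap_solve[OF v0, of "%v. inner_on (germs X v) weight h"] by blast
 \<comment> \<open>The coboundary matches \<open>h\<close> except at \<open>v0\<close>, and the
   factor of \<open>c\<close> is chosen to supply the missing amount \<open>\<phi> v0\<close>
   there.\<close>
 define b where "b e = coboundary X \<phi> e + \<phi> v0 / a * c e" for e
 have b: "cocycle X b" unfolding b_def by (intro cocycle_lin cocycle_coboundary c)
 have ib: "inner_on (germs X v) weight (cval b) = inner_on (germs X v) weight h" if "v \<in> verts X" for v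
  unfolding b_def cval_lin inner_on_add_right lap_coboundary norm[OF that] \<phi>[OF that, symmetric]
  using a by simp
 define z where "z i = h i + (-1) * cval b i" for i
 have "qform (germs X v) (lmat v) z z \<le> 0" if "v \<in> verts X" for v
  by (rule weight_neg[OF that]) (unfold z_def inner_on_add_right ib[OF that], simp)
 then have le: "(\<Sum>v\<in>verts X. qform (germs X v) (lmat v) z z) \<le> 0" by (rule sum_nonpos)
 have "qform (germs X v) (lmat v) z z = qform (germs X v) (lmat v) h h
   - 2 * qform (germs X v) (lmat v) (cval b) h + qform (germs X v) (lmat v) (cval b) (cval b)" for v
  unfolding z_def qform_add_left qform_add_right
  using qform_sym[where A="lmat v" and I="germs X v", OF lmat_sym] by (simp add: algebra_simps)
 then have "(\<Sum>v\<in>verts X. qform (germs X v) (lmat v) z z) =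
   (\<Sum>v\<in>verts X. qform (germs X v) (lmat v) h h)
   - 2 * (\<Sum>v\<in>verts X. qform (germs X v) (lmat v) (cval b) h)
   + (\<Sum>v\<in>verts X. qform (germs X v) (lmat v) (cval b) (cval b))"
  by (simp add: sum.distrib sum_subtractf sum_distrib_left)
 moreover have "(\<Sum>v\<in>verts X. qform (germs X v) (lmat v) (cval b) h) = 0"
  by (rule global_pairing_zero) (rule h)
 moreover have "(\<Sum>v\<in>verts X. qform (germs X v) (lmat v) (cval b) (cval b)) = 0"
  by (rule global_pairing_zero) (rule lmat_row_cocycle[OF b])
 ultimately show False using le pos by simp
qed

end

section \<open>Gluing germs of functions on convex sets\<close>

text \<open>Unlike \<open>at p within K\<close>, this filter includes the point itself, so values at
  \<open>p\<close> can be read off from eventual statements.\<close>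

abbreviation near :: "'a::topological_space set => 'a => 'a filter" where
 "near K p \<equiv> inf (nhds p) (principal K)"

lemma eventually_near_metric:
 "eventually P (near K p) \<longleftrightarrow> (\<exists>r>0. \<forall>z\<in>K. dist z p < r --> P z)"
 unfolding eventually_inf_principal eventually_nhds_metric by blast

lemma eventually_near_self: "eventually P (near K p) ==> p \<in> K ==> P p"
 unfolding eventually_inf_principal by (auto dest: eventually_nhds_x_imp_x)

lemma eventually_near_eventually:
 "eventually P (near K p) ==> eventually (%z. eventually P (near K z)) (near K p)"
 unfolding eventually_inf_principal by (subst (asm) eventually_eventually[symmetric]) (auto elim: eventually_mono)

lemma openin_iff_near:
 assumes "S \<subseteq> K"
 shows "openin (top_of_set K) S \<longleftrightarrow> (\<forall>p\<in>S. eventually (%z. z \<in> S) (near K p))"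
proof
 assume "openin (top_of_set K) S"
 then obtain T where T: "open T" "S = K \<inter> T" unfolding openin_open by blast
 show "\<forall>p\<in>S. eventually (%z. z \<in> S) (near K p)"
 proof
  fix p assume "p \<in> S"
  then have "eventually (%z. z \<in> T) (nhds p)" using T by (auto intro: eventually_nhds_in_open)
  then show "eventually (%z. z \<in> S) (near K p)"
   unfolding eventually_inf_principal by eventually_elim (simp add: T)
 qed
next
 assume ev: "\<forall>p\<in>S. eventually (%z. z \<in> S) (near K p)"
 show "openin (top_of_set K) S"
 proof (subst openin_subopen, intro ballI)
  fix p assume p: "p \<in> S"
  with ev have "eventually (%z. z \<in> K --> z \<in> S) (nhds p)" unfolding eventually_inf_principal by (rule bspec)
  then obtain T where T: "open T" "p \<in> T" "\<forall>z\<in>T. z \<in> K --> z \<in> S" unfolding eventually_nhds by metis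
  show "\<exists>T. openin (top_of_set K) T \<and> p \<in> T \<and> T \<subseteq> S"
  proof (intro exI conjI)
   show "openin (top_of_set K) (K \<inter> T)" using T(1) by (rule openin_open_Int)
   show "p \<in> K \<inter> T" using T(2) p assms by blast
   show "K \<inter> T \<subseteq> S" using T(3) by blast
  qed
 qed
qed

lemma near_local_const:
 assumes "connected A" "a \<in> A" "b \<in> A" "\<And>x. x \<in> A ==> eventually (%y. f x = f y) (near A x)"
 shows "f a = f b"
proof (rule connected_local_const[OF assms(1-3)], rule ballI)
 fix x assume "x \<in> A"
 from assms(4)[OF this] show "eventually (%y. f x = f y) (at x within A)"
  by (rule filter_leD[rotated]) (auto simp: at_within_def intro: le_infI2)
qed

text \<open>
 \<open>G p\<close> is the set of functions admissible at p.  Two of them differ near p by an element of a set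
 \<open>L\<close> of functions having unique continuation.
\<close>

locale germ_torsor =
 fixes K :: "(real \<times> real) set" and G :: "real \<times> real => (real \<times> real => real) set"
  and L :: "(real \<times> real => real) set"
 assumes convex_K: "convex K" and closed_K: "closed K" and K_box: "K \<subseteq> {0..1} \<times> {0..1}"
  and G_local: "\<And>p \<phi> \<psi>. p \<in> K ==> \<phi> \<in> G p ==> eventually (%z. \<psi> z = \<phi> z) (near K p) ==> \<psi> \<in> G p"
  and G_diff: "\<And>p \<phi> \<psi>. p \<in> K ==> \<phi> \<in> G p ==> \<psi> \<in> G p ==>
    \<exists>l\<in>L. eventually (%z. \<psi> z - \<phi> z = l z) (near K p)"
  and G_sub: "\<And>p \<phi> l. p \<in> K ==> \<phi> \<in> G p ==> l \<in> L ==> (%z. \<phi> z - l z) \<in> G p"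
  and L_unique: "\<And>p l l'. p \<in> K ==> l \<in> L ==> l' \<in> L ==> eventually (%z. l z = l' z) (near K p) ==> l = l'"
  and G_ex: "\<And>p. p \<in> K ==> \<exists>\<phi>. eventually (%z. \<phi> \<in> G z) (near K p)"
begin

definition solvable :: "(real \<times> real) set => bool" where
 "solvable U \<longleftrightarrow> (\<exists>\<phi>. \<forall>p\<in>K \<inter> U. \<phi> \<in> G p)"

lemma solvable_mono: "solvable U ==> K \<inter> V \<subseteq> U ==> solvable V"
 unfolding solvable_def by blast

text \<open>The overlap within \<open>K\<close> is convex, hence connected, so by unique
  continuation the two solutions differ there by a single element of \<open>L\<close>. Subtracting
  it from the second solution makes them agree.\<close>

lemma solvable_Un:
 assumes UV: "open U" "open V" "convex U" "convex V" and sU: "solvable U" and sV: "solvable V"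
 shows "solvable (U \<union> V)"
proof -
 obtain \<phi> \<psi> where \<phi>: "\<And>p. p \<in> K ==> p \<in> U ==> \<phi> \<in> G p" and \<psi>: "\<And>p. p \<in> K ==> p \<in> V ==> \<psi> \<in> G p"
  using sU sV unfolding solvable_def by blast
 let ?C = "K \<inter> U \<inter> V"
 have "\<exists>l\<in>L. eventually (%z. \<psi> z - \<phi> z = l z) (near K p)" if "p \<in> ?C" for p
  using G_diff \<phi> \<psi> that by blast
 then obtain l where l: "\<And>p. p \<in> ?C ==> l p \<in> L"
   "\<And>p. p \<in> ?C ==> eventually (%z. \<psi> z - \<phi> z = l p z) (near K p)" by metis
 have const: "l p = l q" if "p \<in> ?C" "q \<in> ?C" for p q
 proof (rule near_local_const[OF _ that])
  show "connected ?C" by (intro convex_connected convex_Int convex_K UV)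
  fix x assume x: "x \<in> ?C"
  have "near ?C x \<le> near K x" by (intro inf_mono) auto
  from filter_leD[OF this eventually_near_eventually[OF l(2)[OF x]]]
  have "eventually (%y. eventually (%z. \<psi> z - \<phi> z = l x z) (near K y)) (near ?C x)" .
  moreover have "eventually (%y. y \<in> ?C) (near ?C x)" by (simp add: eventually_inf_principal)
  ultimately show "eventually (%y. l x = l y) (near ?C x)"
  proof eventually_elim
   case (elim y)
   have "eventually (%z. l x z = l y z) (near K y)"
    using elim(1) l(2)[OF elim(2)] by eventually_elim simp
   then show ?case using L_unique l(1) x elim(2) by blast
  qed
 qed
 have evo: "eventually (%z. z \<in> W) (near K p)" if "open W" "p \<in> W" for W p
  using eventually_nhds_in_open[OF that] unfolding eventually_inf_principal by eventually_elim simp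
 have evK: "eventually (%z. z \<in> K) (near K p)" for p by (simp add: eventually_inf_principal)
 show ?thesis
 proof (cases "?C = {}")
  case True
  define \<theta> where "\<theta> z = (if z \<in> U then \<phi> z else \<psi> z)" for z
  have "\<theta> \<in> G p" if "p \<in> K" "p \<in> U \<union> V" for p
  proof (cases "p \<in> U")
   case True
   have "eventually (%z. \<theta> z = \<phi> z) (near K p)"
    using evo[OF UV(1) True] by eventually_elim (simp add: \<theta>_def)
   then show ?thesis using G_local \<phi> True that by blast
  next
   case False
   then have p: "p \<in> V" using that by blast
   have "eventually (%z. \<theta> z = \<psi> z) (near K p)"
    using evo[OF UV(2) p] evK by eventually_elim (use True in \<open>auto simp: \<theta>_def\<close>)
   then show ?thesis using G_local \<psi> p that by blast
  qed
  then show ?thesis unfolding solvable_def by blast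
 next
  case False
  then obtain c where c: "c \<in> ?C" by blast
  define \<theta> where "\<theta> z = (if z \<in> U then \<phi> z else \<psi> z - l c z)" for z
  have "\<theta> \<in> G p" if "p \<in> K" "p \<in> U \<union> V" for p
  proof (cases "p \<in> U")
   case True
   have "eventually (%z. \<theta> z = \<phi> z) (near K p)"
    using evo[OF UV(1) True] by eventually_elim (simp add: \<theta>_def)
   then show ?thesis using G_local \<phi> True that by blast
  next
   case False
   then have p: "p \<in> V" using that by blast
   have "eventually (%z. \<theta> z = \<psi> z - l c z) (near K p)"
    using evo[OF UV(2) p] evK
   proof eventually_elim
    case (elim z)
    show ?case
    proof (cases "z \<in> U")
     case True
     then have z: "z \<in> ?C" using elim by blast
     have "\<psi> z - \<phi> z = l z z" using eventually_near_self[OF l(2)[OF z]] elim by blast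
     then show ?thesis using const[OF z c] True by (simp add: \<theta>_def)
    qed (simp add: \<theta>_def)
   qed
   moreover have "(%z. \<psi> z - l c z) \<in> G p" using G_sub \<psi> p that l(1)[OF c] by blast
   ultimately show ?thesis using G_local that by blast
  qed
  then show ?thesis unfolding solvable_def by blast
 qed
qed

lemma solvable_small_box:
 obtains r where "r > 0" "solvable ({x - r<..<x + r} \<times> {y - r<..<y + r})"
proof -
 obtain e where e: "e > 0" "solvable (ball (x, y) e)"
 proof (cases "(x, y) \<in> K")
  case True
  then obtain \<phi> r where r: "r > 0" "\<And>z. z \<in> K ==> dist z (x, y) < r ==> \<phi> \<in> G z"
   using G_ex[OF True] unfolding eventually_near_metric by blast
  have "solvable (ball (x, y) r)" unfolding solvable_def
   by (intro exI[of _ \<phi>]) (use r(2) in \<open>auto simp: dist_commute\<close>)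
  with r show ?thesis using that by blast
 next
  case False
  then obtain r where r: "r > 0" "ball (x, y) r \<subseteq> - K" using closed_K
   by (meson ComplI open_Compl open_contains_ball)
  then have "solvable (ball (x, y) r)" unfolding solvable_def by blast
  then show ?thesis using that r by blast
 qed
 have "{x - e/2<..<x + e/2} \<times> {y - e/2<..<y + e/2} \<subseteq> ball (x, y) e"
 proof
  fix z assume z: "z \<in> {x - e/2<..<x + e/2} \<times> {y - e/2<..<y + e/2}"
  have "dist (x, y) z \<le> dist x (fst z) + dist y (snd z)"
   using sqrt_sum_squares_le_sum_abs[of "dist x (fst z)" "dist y (snd z)"] by (simp add: dist_prod_def)
  also have "\<dots> < e" using z by (auto simp: dist_real_def abs_if)
  finally show "z \<in> ball (x, y) e" by simp
 qed
 then have "solvable ({x - e/2<..<x + e/2} \<times> {y - e/2<..<y + e/2})"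
  by (intro solvable_mono[OF e(2)]) blast
 then show ?thesis using that[of "e/2"] e(1) by simp
qed

text \<open>Compactness by bisection in one coordinate at a time: every union that occurs is then
  one of two boxes with a common factor, to which the gluing of two convex sets applies.\<close>

lemma solvable_strip:
 obtains d where "d > 0" "solvable ({x - d<..<x + d} \<times> UNIV)"
proof -
 have "\<exists>d>0. solvable ({x - d<..<x + d} \<times> {0 - d<..<1 + d})"
 proof (rule Bolzano[of 0 1 "%a b. \<exists>d>0. solvable ({x - d<..<x + d} \<times> {a - d<..<b + d})"])
  fix a b c :: real
  assume "\<exists>d>0. solvable ({x - d<..<x + d} \<times> {a - d<..<b + d})"
   "\<exists>d>0. solvable ({x - d<..<x + d} \<times> {b - d<..<c + d})" and ab: "a \<le> b" "b \<le> c"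
  then obtain d d' where d: "d > 0" "solvable ({x - d<..<x + d} \<times> {a - d<..<b + d})"
   "d' > 0" "solvable ({x - d'<..<x + d'} \<times> {b - d'<..<c + d'})" by blast
  \<comment> \<open>The margin lets neighbouring boxes overlap, so that no points are missing at the
    common endpoint \<open>b\<close>.\<close>
  define m where "m = min d d'"
  have "solvable ({x - m<..<x + m} \<times> {a - m<..<b + m} \<union> {x - m<..<x + m} \<times> {b - m<..<c + m})"
   by (intro solvable_Un open_Times convex_Times solvable_mono[OF d(2)] solvable_mono[OF d(4)])
    (auto simp: m_def)
  then have "solvable ({x - m<..<x + m} \<times> {a - m<..<c + m})"
   by (rule solvable_mono) (use ab d in \<open>auto simp: m_def\<close>)
  then show "\<exists>d>0. solvable ({x - d<..<x + d} \<times> {a - d<..<c + d})" using d by (intro exI[of _ m]) (simp add: m_def)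
 next
  fix y :: real
  obtain r where r: "r > 0" "solvable ({x - r<..<x + r} \<times> {y - r<..<y + r})" by (rule solvable_small_box)
  have "solvable ({x - r/2<..<x + r/2} \<times> {a - r/2<..<b + r/2})" if "a \<le> y" "y \<le> b" "b - a < r / 2" for a b
   by (rule solvable_mono[OF r(2)]) (use that r(1) in auto)
  then show "\<exists>d>0. \<forall>a b. a \<le> y \<and> y \<le> b \<and> b - a < d -->
    (\<exists>d>0. solvable ({x - d<..<x + d} \<times> {a - d<..<b + d}))"
   using r(1) by (intro exI[of _ "r/2"]) (meson half_gt_zero)
 qed simp
 then obtain d where d: "d > 0" "solvable ({x - d<..<x + d} \<times> {0 - d<..<1 + d})" by blast
 have "solvable ({x - d<..<x + d} \<times> UNIV)"
  by (rule solvable_mono[OF d(2)]) (use K_box d(1) in fastforce)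
 then show ?thesis using that d by blast
qed

theorem global_solution: "\<exists>\<phi>. \<forall>p\<in>K. \<phi> \<in> G p"
proof -
 have "\<exists>d>0. solvable ({0 - d<..<1 + d} \<times> UNIV)"
 proof (rule Bolzano[of 0 1 "%a b. \<exists>d>0. solvable ({a - d<..<b + d} \<times> UNIV)"])
  fix a b c :: real
  assume "\<exists>d>0. solvable ({a - d<..<b + d} \<times> UNIV)"
   "\<exists>d>0. solvable ({b - d<..<c + d} \<times> UNIV)" and ab: "a \<le> b" "b \<le> c"
  then obtain d d' where d: "d > 0" "solvable ({a - d<..<b + d} \<times> UNIV)"
   "d' > 0" "solvable ({b - d'<..<c + d'} \<times> UNIV)" by blast
  define m where "m = min d d'"
  have "solvable ({a - m<..<b + m} \<times> UNIV \<union> {b - m<..<c + m} \<times> UNIV)"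
   by (intro solvable_Un open_Times convex_Times solvable_mono[OF d(2)] solvable_mono[OF d(4)])
    (auto simp: m_def)
  then have "solvable ({a - m<..<c + m} \<times> UNIV)"
   by (rule solvable_mono) (use ab d in \<open>auto simp: m_def\<close>)
  then show "\<exists>d>0. solvable ({a - d<..<c + d} \<times> UNIV)" using d by (intro exI[of _ m]) (simp add: m_def)
 next
  fix x :: real
  obtain r where r: "r > 0" "solvable ({x - r<..<x + r} \<times> UNIV)" by (rule solvable_strip)
  have "solvable ({a - r/2<..<b + r/2} \<times> UNIV)" if "a \<le> x" "x \<le> b" "b - a < r / 2" for a b
   by (rule solvable_mono[OF r(2)]) (use that r(1) in auto)
  then show "\<exists>d>0. \<forall>a b. a \<le> x \<and> x \<le> b \<and> b - a < d --> (\<exists>d>0. solvable ({a - d<..<b + d} \<times> UNIV))"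
   using r(1) by (intro exI[of _ "r/2"]) (meson half_gt_zero)
 qed simp
 then obtain d where d: "d > 0" "solvable ({0 - d<..<1 + d} \<times> UNIV)" by blast
 then obtain \<phi> where \<phi>: "\<And>p. p \<in> K ==> p \<in> {0 - d<..<1 + d} \<times> UNIV ==> \<phi> \<in> G p" unfolding solvable_def by blast
 have "p \<in> {0 - d<..<1 + d} \<times> UNIV" if "p \<in> K" for p using subsetD[OF K_box that] d(1) by auto
 then show ?thesis using \<phi> by blast
qed

end

lemma convex_std_triangle: "convex std_triangle"
proof -
 have h: "std_triangle = {p. inner (-1, 0) p \<le> 0} \<inter> {p. inner (0, -1) p \<le> 0} \<inter> {p. inner (1, 1) p \<le> (1::real)}"
  by (auto simp: std_triangle_def)
 show ?thesis unfolding h by (intro convex_Int convex_halfspace_le)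
qed

lemma closed_std_triangle: "closed std_triangle"
proof -
 have h: "std_triangle = {p. inner (-1, 0) p \<le> 0} \<inter> {p. inner (0, -1) p \<le> 0} \<inter> {p. inner (1, 1) p \<le> (1::real)}"
  by (auto simp: std_triangle_def)
 show ?thesis unfolding h by (intro closed_Int closed_halfspace_le)
qed

lemma std_triangle_box: "std_triangle \<subseteq> {0..1} \<times> {0..1}"
 by (auto simp: std_triangle_def)

lemma near_tri_side:
 assumes "k < 3" "0 \<le> t" "t \<le> 1" "eventually P (near std_triangle (tri_side k t))"
 shows "eventually (%s. P (tri_side k s)) (near {0..1} t)"
proof -
 have "k = 0 \<or> k = 1 \<or> k = 2" using assms(1) by linarith
 then have "continuous_on UNIV (tri_side k)" unfolding tri_side_def by (auto intro!: continuous_intros)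
 then have "filterlim (tri_side k) (nhds (tri_side k t)) (nhds t)"
  unfolding continuous_on_def by (simp add: tendsto_nhds_iff[symmetric] tendsto_at_iff_tendsto_nhds)
 moreover have "eventually (%z. z \<in> std_triangle --> P z) (nhds (tri_side k t))"
  using assms(4) unfolding eventually_inf_principal .
 ultimately have "eventually (%s. tri_side k s \<in> std_triangle --> P (tri_side k s)) (nhds t)"
  by (rule eventually_compose_filterlim[rotated])
 then show ?thesis unfolding eventually_inf_principal
  by eventually_elim (use tri_side_in[OF assms(1)] in auto)
qed

section \<open>First cohomology and periods\<close>

lemma const_nearD:
 assumes "const_near T x h"
 obtains N where "openin T N" "x \<in> N" "\<And>y. y \<in> N ==> h y = h x"
 using assms unfolding const_near_def by metis

lemma const_near_lin:
 assumes "const_near T x h" "const_near T x h'"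
 shows "const_near T x (%y. h y + r * h' y)"
proof -
 obtain M where M: "openin T M" "x \<in> M" "\<And>y. y \<in> M ==> h y = h x" by (rule const_nearD[OF assms(1)], rule that)
 obtain N where N: "openin T N" "x \<in> N" "\<And>y. y \<in> N ==> h' y = h' x" by (rule const_nearD[OF assms(2)], rule that)
 show ?thesis unfolding const_near_def
 proof (intro exI conjI ballI)
  show "openin T (M \<inter> N)" using M(1) N(1) by (rule openin_Int)
  show "x \<in> M \<inter> N" using M(2) N(2) by blast
  show "h y + r * h' y = h x + r * h' x" if "y \<in> M \<inter> N" for y using M(3)[of y] N(3)[of y] that by simp
 qed
qed

lemma const_near_add: "const_near T x h ==> const_near T x h' ==> const_near T x (%y. h y + h' y)"
 using const_near_lin[of T x h h' 1] by simp

lemma const_near_diff: "const_near T x h ==> const_near T x h' ==> const_near T x (%y. h y - h' y)"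
 using const_near_lin[of T x h h' "-1"] by simp

lemma const_near_const: "x \<in> topspace T ==> const_near T x (%_. c)"
 unfolding const_near_def by (intro exI[of _ "topspace T"] exI[of _ c]) simp

lemma const_near_sum:
 fixes n :: nat
 assumes "x \<in> topspace T" "\<And>i. i < n ==> const_near T x (h i)"
 shows "const_near T x (%y. \<Sum>i<n. r i * h i y)"
 using assms(2)
proof (induction n)
 case 0
 then show ?case using const_near_const[OF assms(1), of 0] by simp
next
 case (Suc n)
 then show ?case using const_near_lin[of T x "%y. \<Sum>i<n. r i * h i y" "h n" "r n"] by simp
qed

lemma germ_mod_const_self: "x \<in> topspace T ==> g \<in> germ_mod_const T x g"
 unfolding germ_mod_const_def using const_near_const[of x T 0] by simp

lemma germ_mod_const_eqI:
 assumes "const_near T x (%y. g y - g' y)"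
 shows "germ_mod_const T x g = germ_mod_const T x g'"
 unfolding germ_mod_const_def
proof (intro Collect_cong iffI)
 fix h
 show "const_near T x (%y. h y - g' y)" if "const_near T x (%y. h y - g y)"
  using const_near_add[OF that assms] by simp
 show "const_near T x (%y. h y - g y)" if "const_near T x (%y. h y - g' y)"
  using const_near_diff[OF that assms] by simp
qed

lemma Z1_rep:
 assumes "\<sigma> \<in> Z1 T" "x \<in> topspace T"
 obtains U g where "openin T U" "x \<in> U" "\<And>y. y \<in> U ==> \<sigma> y = germ_mod_const T y g"
proof -
 have "\<exists>U g. openin T U \<and> x \<in> U \<and> (\<forall>y\<in>U. \<sigma> y = germ_mod_const T y g)"
  using assms unfolding Z1_def quotient_sections_def by simp
 then show ?thesis by (elim exE conjE) (rule that, auto)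
qed

lemma Z1_nonempty: "\<sigma> \<in> Z1 T ==> x \<in> topspace T ==> \<exists>g. g \<in> \<sigma> x"
 by (erule (1) Z1_rep) (metis germ_mod_const_self)

lemma Z1_diff:
 assumes "\<sigma> \<in> Z1 T" "x \<in> topspace T" "g \<in> \<sigma> x" "g' \<in> \<sigma> x"
 shows "const_near T x (%y. g y - g' y)"
proof -
 obtain U h where "openin T U" "x \<in> U" "\<And>y. y \<in> U ==> \<sigma> y = germ_mod_const T y h" by (rule Z1_rep[OF assms(1,2)], rule that)
 then have "\<sigma> x = germ_mod_const T x h" by blast
 then have "const_near T x (%y. g y - h y)" "const_near T x (%y. g' y - h y)"
  using assms(3,4) unfolding germ_mod_const_def by auto
 from const_near_diff[OF this] show ?thesis by simp
qed

text \<open>The relation is symmetric (replace \<open>h\<close> by its negative) and transitive (add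
  the functions), so one inclusion, proved for arbitrary sections, is enough.\<close>

lemma H1_class_eqI:
 assumes \<sigma>: "\<sigma> \<in> Z1 T" and \<tau>: "\<tau> \<in> Z1 T"
  and h: "\<And>x f g. x \<in> topspace T ==> f \<in> \<sigma> x ==> g \<in> \<tau> x ==> const_near T x (%y. g y - f y - h y)"
 shows "H1_class T \<sigma> = H1_class T \<tau>"
proof -
 have sub: "H1_class T \<tau> \<subseteq> H1_class T \<sigma>"
  if s: "\<sigma> \<in> Z1 T" and t: "\<tau> \<in> Z1 T"
   and h: "\<And>x f g. x \<in> topspace T ==> f \<in> \<sigma> x ==> g \<in> \<tau> x ==> const_near T x (%y. g y - f y - h y)"
  for \<sigma> \<tau> h
 proof
  fix \<rho> assume "\<rho> \<in> H1_class T \<tau>"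
  then obtain h' where r: "\<rho> \<in> Z1 T"
   and h': "\<And>x f g. x \<in> topspace T ==> f \<in> \<tau> x ==> g \<in> \<rho> x ==> const_near T x (%y. g y - f y - h' y)"
   unfolding H1_class_def by blast
  have hh: "const_near T x (%y. g y - f y - (h y + h' y))" if x: "x \<in> topspace T" "f \<in> \<sigma> x" "g \<in> \<rho> x" for x f g
  proof -
   obtain k where k: "k \<in> \<tau> x" using Z1_nonempty[OF t x(1)] by blast
   from const_near_add[OF h[OF x(1,2) k] h'[OF x(1) k x(3)]] show ?thesis by (simp add: algebra_simps)
  qed
  show "\<rho> \<in> H1_class T \<sigma>" unfolding H1_class_def
   by (intro CollectI conjI exI[of _ "%y. h y + h' y"] ballI r hh)
 qed
 have h': "const_near T x (%y. g y - f y - (- h y))" if x: "x \<in> topspace T" "f \<in> \<tau> x" "g \<in> \<sigma> x" for x f g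
  using const_near_diff[OF const_near_const[OF x(1), of 0] h[OF x(1,3,2)]] by (simp add: algebra_simps)
 show ?thesis
 proof
  show "H1_class T \<sigma> \<subseteq> H1_class T \<tau>" by (rule sub[OF \<tau> \<sigma>]) (rule h')
  show "H1_class T \<tau> \<subseteq> H1_class T \<sigma>" by (rule sub[OF \<sigma> \<tau>]) (rule h)
 qed
qed

text \<open>\<open>lin_comb\<close> takes the union over all choices of representatives. Different
  choices differ by locally constant functions, so all of them yield the same germ class.\<close>

lemma lin_comb_germ:
 assumes \<sigma>: "\<And>i. i < n ==> \<sigma> i \<in> Z1 T" and x: "x \<in> topspace T" and f: "\<And>i. i < n ==> f i \<in> \<sigma> i x"
 shows "lin_comb T n r \<sigma> x = germ_mod_const T x (%y. \<Sum>i<n. r i * f i y)"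
proof -
 have "germ_mod_const T x (%y. \<Sum>i<n. r i * f' i y) = germ_mod_const T x (%y. \<Sum>i<n. r i * f i y)"
  if f': "\<forall>i<n. f' i \<in> \<sigma> i x" for f'
 proof (rule germ_mod_const_eqI)
  have "const_near T x (%y. \<Sum>i<n. r i * (f' i y - f i y))"
   by (rule const_near_sum[OF x]) (use Z1_diff[OF \<sigma> x] f f' in blast)
  then show "const_near T x (%y. (\<Sum>i<n. r i * f' i y) - (\<Sum>i<n. r i * f i y))"
   by (simp add: sum_subtractf right_diff_distrib)
 qed
 then have "{germ_mod_const T x (%y. \<Sum>i<n. r i * f i y) |f. \<forall>i<n. f i \<in> \<sigma> i x} =
   {germ_mod_const T x (%y. \<Sum>i<n. r i * f i y)}" using f by blast
 then show ?thesis using x unfolding lin_comb_def by simp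
qed

lemma lin_comb_Z1:
 assumes \<sigma>: "\<And>i. i < n ==> \<sigma> i \<in> Z1 T"
 shows "lin_comb T n r \<sigma> \<in> Z1 T"
 unfolding Z1_def quotient_sections_def mem_Collect_eq
proof (intro conjI allI impI ballI)
 show "lin_comb T n r \<sigma> x = {}" if "x \<notin> topspace T" for x using that by (simp add: lin_comb_def)
 fix x assume x: "x \<in> topspace T"
 have "\<exists>U g. openin T U \<and> x \<in> U \<and> (\<forall>y\<in>U. \<sigma> i y = germ_mod_const T y g)" if "i < n" for i
  by (rule Z1_rep[OF \<sigma>[OF that] x]) blast
 then obtain U g where U: "\<And>i. i < n ==> openin T (U i)" "\<And>i. i < n ==> x \<in> U i"
  "\<And>i y. i < n ==> y \<in> U i ==> \<sigma> i y = germ_mod_const T y (g i)" by metis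
 define V where "V = topspace T \<inter> (\<Inter>i\<in>{..<n}. U i)"
 have "openin T V"
  unfolding V_def using U(1) by (cases "n = 0") (auto intro!: openin_Int openin_INT)
 moreover have "x \<in> V" using U(2) x by (simp add: V_def)
 moreover have "lin_comb T n r \<sigma> y = germ_mod_const T y (%z. \<Sum>i<n. r i * g i z)" if y: "y \<in> V" for y
 proof (rule lin_comb_germ[OF \<sigma>])
  show yT: "y \<in> topspace T" using y by (simp add: V_def)
  show "g i \<in> \<sigma> i y" if "i < n" for i
   using U(3)[OF that, of y] y that germ_mod_const_self[OF yT, of "g i"] by (auto simp: V_def)
 qed
 ultimately show "\<exists>U g. openin T U \<and> x \<in> U \<and> g \<in> UNIV \<and> (\<forall>y\<in>U. lin_comb T n r \<sigma> y = germ_mod_const T y g)"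
  by blast
qed

section \<open>Primitives on triangles and periods along edges\<close>

context trop_surface
begin

abbreviation "T \<equiv> realization X"

lemma topspace_T: "topspace T = points X" by (rule topspace_realization[OF finite_X])

lemma fchar_points: "f \<in> tris X ==> p \<in> std_triangle ==> fchar X f p \<in> points X"
 by (rule fchar_in_points[OF finite_X])

lemma echar_points: "e \<in> edges X ==> 0 \<le> t ==> t \<le> 1 ==> echar X e t \<in> points X"
 by (rule echar_in_points[OF finite_X])

lemma edge_linkE:
 assumes "e \<in> edges X"
 obtains f k where "f \<in> tris X" "k < 3" "side X f k = e"
 using edge_link_nonempty[OF assms] by (auto simp: edge_link_def)

lemma fchar_side: "f \<in> tris X ==> k < 3 ==> 0 \<le> t ==> t \<le> 1 ==>
  fchar X f (tri_side k t) = echar X (side X f k) t"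
 by (rule fchar_tri_side[OF finite_X])

lemma near_fchar:
 assumes "openin T U" "f \<in> tris X" "p \<in> std_triangle" "fchar X f p \<in> U"
 shows "eventually (%z. fchar X f z \<in> U) (near std_triangle p)"
proof -
 have "openin (top_of_set std_triangle) {p\<in>std_triangle. fchar X f p \<in> U}"
  using assms unfolding openin_realization open_in_realization_def by blast
 then have "\<forall>p\<in>{p\<in>std_triangle. fchar X f p \<in> U}. eventually (%z. z \<in> {p\<in>std_triangle. fchar X f p \<in> U}) (near std_triangle p)"
  by (subst (asm) openin_iff_near) auto
 then have "eventually (%z. z \<in> {p\<in>std_triangle. fchar X f p \<in> U}) (near std_triangle p)" using assms by blast
 then show ?thesis by eventually_elim simp
qed

lemma near_echar:
 assumes "openin T U" "e \<in> edges X" "0 \<le> t" "t \<le> 1" "echar X e t \<in> U"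
 shows "eventually (%s. echar X e s \<in> U) (near {0..1} t)"
proof -
 obtain f k where fk: "f \<in> tris X" "k < 3" "side X f k = e" by (rule edge_linkE[OF assms(2)])
 have "eventually (%s. fchar X f (tri_side k s) \<in> U) (near {0..1} t)"
  by (rule near_tri_side[OF fk(2) assms(3,4)], rule near_fchar[OF assms(1) fk(1) tri_side_in])
   (use fk assms fchar_side in auto)
 moreover have "eventually (%s. s \<in> {0..1}) (near {0..1} t)" by (simp add: eventually_inf_principal)
 ultimately show ?thesis by eventually_elim (use fk fchar_side in auto)
qed

text \<open>Every edge is a side of some triangle, and the inclusion of that side is continuous; so
  the condition on triangles implies the one on edges.\<close>

lemma openin_T_I:
 assumes "U \<subseteq> points X"
  "\<And>f p. f \<in> tris X ==> p \<in> std_triangle ==> fchar X f p \<in> U ==>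
   eventually (%z. fchar X f z \<in> U) (near std_triangle p)"
 shows "openin T U"
proof (rule openin_realizationI[OF assms(1)])
 fix f assume f: "f \<in> tris X"
 show "openin (top_of_set std_triangle) {p\<in>std_triangle. fchar X f p \<in> U}"
 proof (subst openin_iff_near, blast, intro ballI)
  fix p assume "p \<in> {p\<in>std_triangle. fchar X f p \<in> U}"
  then have "eventually (%z. fchar X f z \<in> U) (near std_triangle p)" using assms(2) f by blast
  moreover have "eventually (%z. z \<in> std_triangle) (near std_triangle p)" by (simp add: eventually_inf_principal)
  ultimately show "eventually (%z. z \<in> {p\<in>std_triangle. fchar X f p \<in> U}) (near std_triangle p)"
   by eventually_elim simp
 qed
next
 fix e assume e: "e \<in> edges X"
 show "openin (top_of_set {0..1}) {t\<in>{0..1}. echar X e t \<in> U}"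
 proof (subst openin_iff_near, blast, intro ballI)
  fix t assume t: "t \<in> {t\<in>{0..1}. echar X e t \<in> U}"
  obtain f k where fk: "f \<in> tris X" "k < 3" "side X f k = e" by (rule edge_linkE[OF e])
  have "eventually (%s. fchar X f (tri_side k s) \<in> U) (near {0..1} t)"
   by (rule near_tri_side[OF fk(2)], use t in simp, use t in simp, rule assms(2)[OF fk(1) tri_side_in])
    (use fk t fchar_side in auto)
  moreover have "eventually (%s. s \<in> {0..1}) (near {0..1} t)" by (simp add: eventually_inf_principal)
  ultimately show "eventually (%s. s \<in> {t\<in>{0..1}. echar X e t \<in> U}) (near {0..1} t)"
   by eventually_elim (use fk fchar_side in auto)
 qed
qed

lemma const_near_fchar:
 assumes "const_near T (fchar X f p) h" "f \<in> tris X" "p \<in> std_triangle"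
 shows "eventually (%z. h (fchar X f z) = h (fchar X f p)) (near std_triangle p)"
proof -
 obtain N where N: "openin T N" "fchar X f p \<in> N" "\<And>y. y \<in> N ==> h y = h (fchar X f p)"
  by (rule const_nearD[OF assms(1)], rule that)
 show ?thesis using near_fchar[OF N(1) assms(2,3) N(2)] by eventually_elim (use N in blast)
qed

text \<open>Inside \<open>U\<close>, the set where \<open>h\<close> has the value \<open>h x\<close>
  is open, because on every triangle \<open>h\<close> is locally constant.\<close>

lemma const_near_T_I:
 assumes U: "openin T U" "x \<in> U"
  and loc: "\<And>f p. f \<in> tris X ==> p \<in> std_triangle ==> fchar X f p \<in> U ==>
   eventually (%z. h (fchar X f z) = h (fchar X f p)) (near std_triangle p)"
 shows "const_near T x h"
proof -
 have "openin T {y\<in>U. h y = h x}"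
 proof (rule openin_T_I)
  show "{y\<in>U. h y = h x} \<subseteq> points X" using openin_subset[OF U(1)] topspace_T by blast
  fix f p assume fp: "f \<in> tris X" "p \<in> std_triangle" "fchar X f p \<in> {y\<in>U. h y = h x}"
  then have fpU: "fchar X f p \<in> U" by blast
  show "eventually (%z. fchar X f z \<in> {y\<in>U. h y = h x}) (near std_triangle p)"
   using loc[OF fp(1,2) fpU] near_fchar[OF U(1) fp(1,2) fpU] by eventually_elim (use fp(3) in simp)
 qed
 then show ?thesis unfolding const_near_def using U(2) by blast
qed

text \<open>A lift to an honest function of the section pulled back to the closed triangle. The
  pull-back matters: a triangle with identified sides may carry a loop on which no such function
  exists downstairs.\<close>

definition is_primitive :: "(('v, 'e, 'f) pt => (('v, 'e, 'f) pt => real) set) => 'f => (real \<times> real => real) => bool" where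
 "is_primitive \<sigma> f F \<longleftrightarrow> (\<forall>p\<in>std_triangle. \<forall>h\<in>\<sigma> (fchar X f p).
   eventually (%z. F z - h (fchar X f z) = F p - h (fchar X f p)) (near std_triangle p))"

text \<open>Near each point a representative of \<open>\<sigma>\<close> composed with the
  characteristic map is a primitive, and two primitives differ locally by a constant; this is the
  gluing problem for the group of constants.\<close>

lemma primitive_exists:
 assumes \<sigma>: "\<sigma> \<in> Z1 T" and f: "f \<in> tris X"
 shows "\<exists>F. is_primitive \<sigma> f F"
proof -
 define G where "G p = {F. \<forall>h\<in>\<sigma> (fchar X f p).
   eventually (%z. F z - h (fchar X f z) = F p - h (fchar X f p)) (near std_triangle p)}" for p
 interpret germ_torsor std_triangle G "range (%c _. c)"
 proof
  show "convex std_triangle" "closed std_triangle" "std_triangle \<subseteq> {0..1} \<times> {0..1}"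
   by (rule convex_std_triangle closed_std_triangle std_triangle_box)+
  fix p \<phi> \<psi> assume p: "p \<in> std_triangle" "\<phi> \<in> G p" and e: "eventually (%z. \<psi> z = \<phi> z) (near std_triangle p)"
  show "\<psi> \<in> G p" unfolding G_def
  proof (intro CollectI ballI)
   fix h assume "h \<in> \<sigma> (fchar X f p)"
   then have "eventually (%z. \<phi> z - h (fchar X f z) = \<phi> p - h (fchar X f p)) (near std_triangle p)"
    using p(2) unfolding G_def by blast
   then show "eventually (%z. \<psi> z - h (fchar X f z) = \<psi> p - h (fchar X f p)) (near std_triangle p)"
    using e by eventually_elim (use eventually_near_self[OF e p(1)] in simp)
  qed
 next
  fix p \<phi> \<psi> assume p: "p \<in> std_triangle" "\<phi> \<in> G p" "\<psi> \<in> G p"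
  obtain h where h: "h \<in> \<sigma> (fchar X f p)" using Z1_nonempty[OF \<sigma>] fchar_points[OF f p(1)] topspace_T by blast
  have "eventually (%z. \<psi> z - \<phi> z = \<psi> p - \<phi> p) (near std_triangle p)"
  proof -
   have "eventually (%z. \<phi> z - h (fchar X f z) = \<phi> p - h (fchar X f p)) (near std_triangle p)"
    "eventually (%z. \<psi> z - h (fchar X f z) = \<psi> p - h (fchar X f p)) (near std_triangle p)"
    using p h unfolding G_def by blast+
   then show ?thesis by eventually_elim linarith
  qed
  then show "\<exists>l\<in>range (%c _. c). eventually (%z. \<psi> z - \<phi> z = l z) (near std_triangle p)"
   by (intro bexI[of _ "%_. \<psi> p - \<phi> p"]) auto
 next
  fix p \<phi> l assume "p \<in> std_triangle" "\<phi> \<in> G p" "l \<in> range (%c (_ :: real \<times> real). c :: real)"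
  then show "(%z. \<phi> z - l z) \<in> G p" unfolding G_def by (fastforce elim: eventually_mono)
 next
  fix p l l' assume "p \<in> std_triangle" "l \<in> range (%c (_ :: real \<times> real). c :: real)" "l' \<in> range (%c (_ :: real \<times> real). c :: real)"
   "eventually (%z. l z = l' z) (near std_triangle p)"
  then show "l = l'" using eventually_near_self by blast
 next
  fix p assume p: "p \<in> std_triangle"
  obtain U g where U: "openin T U" "fchar X f p \<in> U" "\<And>y. y \<in> U ==> \<sigma> y = germ_mod_const T y g"
  proof (rule Z1_rep[OF \<sigma>, of "fchar X f p"])
   show "fchar X f p \<in> topspace T" using fchar_points[OF f p] topspace_T by blast
  qed (rule that)
  have "eventually (%z. z \<in> std_triangle) (near std_triangle p)" by (simp add: eventually_inf_principal)
  with near_fchar[OF U(1) f p U(2)] have "eventually (%z. (%z. g (fchar X f z)) \<in> G z) (near std_triangle p)"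
  proof eventually_elim
   case (elim z)
   show ?case unfolding G_def
   proof (intro CollectI ballI)
    fix h assume "h \<in> \<sigma> (fchar X f z)"
    then have "const_near T (fchar X f z) (%y. h y - g y)" using U(3)[OF elim(1)] by (simp add: germ_mod_const_def)
    from const_near_fchar[OF this f elim(2)]
    show "eventually (%w. g (fchar X f w) - h (fchar X f w) = g (fchar X f z) - h (fchar X f z)) (near std_triangle z)"
     by eventually_elim linarith
   qed
  qed
  then show "\<exists>\<phi>. eventually (%z. \<phi> \<in> G z) (near std_triangle p)" by blast
 qed
 show ?thesis using global_solution unfolding G_def is_primitive_def by blast
qed

text \<open>Along the common edge both primitives lift the same section, so their difference is
  locally constant. This makes periods independent of the triangle, the side and the
  primitive.\<close>

lemma primitive_side_diff:
 assumes \<sigma>: "\<sigma> \<in> Z1 T"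
  and F: "is_primitive \<sigma> f F" "f \<in> tris X" "k < 3" and F': "is_primitive \<sigma> f' F'" "f' \<in> tris X" "k' < 3"
  and e: "side X f k = side X f' k'" and st: "s \<in> {0..1}" "t \<in> {0..1}"
 shows "F (tri_side k t) - F (tri_side k s) = F' (tri_side k' t) - F' (tri_side k' s)"
proof -
 have "F (tri_side k s) - F' (tri_side k' s) = F (tri_side k t) - F' (tri_side k' t)"
 proof (rule near_local_const[OF _ st])
  show "connected {0..1::real}" by simp
  fix u :: real assume u: "u \<in> {0..1}"
  define x where "x = echar X (side X f k) u"
  have x: "fchar X f (tri_side k u) = x" "fchar X f' (tri_side k' u) = x"
   using fchar_side F F' e u by (auto simp: x_def)
  have "x \<in> topspace T" unfolding topspace_T x(1)[symmetric] using fchar_points[OF F(2) tri_side_in] F(3) u by simp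
  then obtain h where h: "h \<in> \<sigma> x" using Z1_nonempty[OF \<sigma>] by blast
  have "eventually (%z. F z - h (fchar X f z) = F (tri_side k u) - h x) (near std_triangle (tri_side k u))"
   using F(1) h x tri_side_in[OF F(3)] u unfolding is_primitive_def by fastforce
  moreover have "eventually (%z. F' z - h (fchar X f' z) = F' (tri_side k' u) - h x) (near std_triangle (tri_side k' u))"
   using F'(1) h x tri_side_in[OF F'(3)] u unfolding is_primitive_def by fastforce
  ultimately have "eventually (%v. F (tri_side k v) - h (fchar X f (tri_side k v)) = F (tri_side k u) - h x) (near {0..1} u)"
   "eventually (%v. F' (tri_side k' v) - h (fchar X f' (tri_side k' v)) = F' (tri_side k' u) - h x) (near {0..1} u)"
   using near_tri_side[OF F(3), of u "%z. F z - h (fchar X f z) = F (tri_side k u) - h x"]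
    near_tri_side[OF F'(3), of u "%z. F' z - h (fchar X f' z) = F' (tri_side k' u) - h x"] u by auto
  moreover have "eventually (%v. v \<in> {0..1}) (near {0..1} u)" by (simp add: eventually_inf_principal)
  ultimately show "eventually (%v. F (tri_side k u) - F' (tri_side k' u) = F (tri_side k v) - F' (tri_side k' v)) (near {0..1} u)"
  proof eventually_elim
   case (elim v)
   have "fchar X f (tri_side k v) = fchar X f' (tri_side k' v)" using fchar_side F F' e elim(3) by auto
   then show ?case using elim by simp
  qed
 qed
 then show ?thesis by simp
qed

definition period :: "(('v, 'e, 'f) pt => (('v, 'e, 'f) pt => real) set) => 'e => real" where
 "period \<sigma> e = (SOME c. \<exists>f k F. (f, k) \<in> edge_link X e \<and> is_primitive \<sigma> f F \<and> c = F (tri_side k 1) - F (tri_side k 0))"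

lemma period_eq:
 assumes \<sigma>: "\<sigma> \<in> Z1 T" and F: "is_primitive \<sigma> f F" "f \<in> tris X" "k < 3"
 shows "period \<sigma> (side X f k) = F (tri_side k 1) - F (tri_side k 0)"
 unfolding period_def
proof (rule some_equality)
 show "\<exists>f' k' F'. (f', k') \<in> edge_link X (side X f k) \<and> is_primitive \<sigma> f' F' \<and>
   F (tri_side k 1) - F (tri_side k 0) = F' (tri_side k' 1) - F' (tri_side k' 0)"
  using F by (auto simp: edge_link_def)
 fix c assume "\<exists>f' k' F'. (f', k') \<in> edge_link X (side X f k) \<and> is_primitive \<sigma> f' F' \<and>
   c = F' (tri_side k' 1) - F' (tri_side k' 0)"
 then show "c = F (tri_side k 1) - F (tri_side k 0)"
  using primitive_side_diff[OF \<sigma> _ _ _ F, where s=0 and t=1] by (auto simp: edge_link_def)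
qed

lemma tri_side_corners:
 "tri_side 2 0 = (0, 0)" "tri_side 2 1 = (1, 0)" "tri_side 1 0 = (0, 0)" "tri_side 1 1 = (0, 1)"
 "tri_side 0 0 = (1, 0)" "tri_side 0 1 = (0, 1)"
 by (simp_all add: tri_side_def)

lemma period_cocycle:
 assumes \<sigma>: "\<sigma> \<in> Z1 T"
 shows "cocycle X (period \<sigma>)"
 unfolding cocycle_def
proof
 fix f assume f: "f \<in> tris X"
 obtain F where F: "is_primitive \<sigma> f F" using primitive_exists[OF \<sigma> f] by blast
 show "period \<sigma> (side X f 1) = period \<sigma> (side X f 2) + period \<sigma> (side X f 0)"
  using period_eq[OF \<sigma> F f, of 0] period_eq[OF \<sigma> F f, of 1] period_eq[OF \<sigma> F f, of 2]
  by (simp add: tri_side_corners del: One_nat_def)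
qed

lemma period_lin_comb:
 assumes \<sigma>: "\<And>i. i < n ==> \<sigma> i \<in> Z1 T" and e: "e \<in> edges X"
 shows "period (lin_comb T n r \<sigma>) e = (\<Sum>i<n. r i * period (\<sigma> i) e)"
proof -
 obtain f k where fk: "f \<in> tris X" "k < 3" "side X f k = e" by (rule edge_linkE[OF e])
 obtain F where F: "\<And>i. i < n ==> is_primitive (\<sigma> i) f (F i)"
  using primitive_exists[OF \<sigma> fk(1)] by metis
 have "is_primitive (lin_comb T n r \<sigma>) f (%p. \<Sum>i<n. r i * F i p)"
  unfolding is_primitive_def
 proof (intro ballI)
  fix p h assume p: "p \<in> std_triangle" and h: "h \<in> lin_comb T n r \<sigma> (fchar X f p)"
  have x: "fchar X f p \<in> topspace T" using fchar_points[OF fk(1) p] topspace_T by blast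
  obtain g where g: "\<And>i. i < n ==> g i \<in> \<sigma> i (fchar X f p)" using Z1_nonempty[OF \<sigma> x] by metis
  have "const_near T (fchar X f p) (%y. h y - (\<Sum>i<n. r i * g i y))"
  proof -
   have "lin_comb T n r \<sigma> (fchar X f p) = germ_mod_const T (fchar X f p) (%y. \<Sum>i<n. r i * g i y)"
    by (rule lin_comb_germ[OF \<sigma> x g])
   then show ?thesis using h by (simp add: germ_mod_const_def)
  qed
  from const_near_fchar[OF this fk(1) p]
  have 1: "eventually (%z. h (fchar X f z) - (\<Sum>i<n. r i * g i (fchar X f z)) =
    h (fchar X f p) - (\<Sum>i<n. r i * g i (fchar X f p))) (near std_triangle p)" .
  have "\<forall>i\<in>{..<n}. eventually (%z. F i z - g i (fchar X f z) = F i p - g i (fchar X f p)) (near std_triangle p)"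
   using F g p unfolding is_primitive_def by blast
  then have "eventually (%z. \<forall>i\<in>{..<n}. F i z - g i (fchar X f z) = F i p - g i (fchar X f p)) (near std_triangle p)"
   by (subst eventually_ball_finite_distrib) auto
  with 1 show "eventually (%z. (\<Sum>i<n. r i * F i z) - h (fchar X f z) = (\<Sum>i<n. r i * F i p) - h (fchar X f p)) (near std_triangle p)"
  proof eventually_elim
   case (elim z)
   have "(\<Sum>i<n. r i * (F i z - g i (fchar X f z))) = (\<Sum>i<n. r i * (F i p - g i (fchar X f p)))"
    using elim(2) by (intro sum.cong) auto
   then show ?case using elim(1) by (simp add: right_diff_distrib sum_subtractf)
  qed
 qed
 from period_eq[OF lin_comb_Z1[OF \<sigma>] this fk(1,2)] fk(3)
 have "period (lin_comb T n r \<sigma>) e = (\<Sum>i<n. r i * (F i (tri_side k 1) - F i (tri_side k 0)))"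
  by (simp add: right_diff_distrib sum_subtractf)
 also have "\<dots> = (\<Sum>i<n. r i * period (\<sigma> i) e)"
  using period_eq[OF \<sigma> F fk(1,2)] fk(3) by (intro sum.cong) auto
 finally show ?thesis .
qed

text \<open>Injectivity of the comparison with simplicial cohomology. The differences of the
  primitives on the triangles, normalized by \<open>\<phi>\<close> at the vertices, agree on common
  sides and descend to one function on the surface.\<close>

lemma H1_class_eq_of_period:
 assumes \<sigma>: "\<sigma> \<in> Z1 T" and \<tau>: "\<tau> \<in> Z1 T"
  and per: "\<And>e. e \<in> edges X ==> period \<tau> e = period \<sigma> e + coboundary X \<phi> e"
 shows "H1_class T \<sigma> = H1_class T \<tau>"
proof -
 obtain F where F: "\<And>f. f \<in> tris X ==> is_primitive \<sigma> f (F f)" using primitive_exists[OF \<sigma>] by metis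
 obtain F' where F': "\<And>f. f \<in> tris X ==> is_primitive \<tau> f (F' f)" using primitive_exists[OF \<tau>] by metis
 define D where "D f p = F' f p - F f p" for f p
 define wing where "wing e = (SOME fk. fk \<in> edge_link X e)" for e
 \<comment> \<open>On each cell the difference of primitives is shifted so that the initial vertex
   gets its value of \<open>\<phi>\<close>; the relation between the periods then gives the right
   values at the other vertices.\<close>
 define h where "h x = (case x of VPt v => \<phi> v
   | EPt e t => \<phi> (endpt X e 0) + D (fst (wing e)) (tri_side (snd (wing e)) t) - D (fst (wing e)) (tri_side (snd (wing e)) 0)
   | FPt f p => \<phi> (endpt X (side X f 2) 0) + D f p - D f (0, 0))" for x
 have Dside: "D f (tri_side k t) - D f (tri_side k s) = D f' (tri_side k' t) - D f' (tri_side k' s)"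
  if "f \<in> tris X" "k < 3" "f' \<in> tris X" "k' < 3" "side X f k = side X f' k'" "s \<in> {0..1}" "t \<in> {0..1}" for f k f' k' s t
  using primitive_side_diff[OF \<sigma> F _ _ F _ _ _ that(6,7), of f k f' k']
   primitive_side_diff[OF \<tau> F' _ _ F' _ _ _ that(6,7), of f k f' k'] that unfolding D_def by simp
 have Dend: "D f (tri_side k 1) - D f (tri_side k 0) = coboundary X \<phi> (side X f k)" if "f \<in> tris X" "k < 3" for f k
  using period_eq[OF \<sigma> F[OF that(1)] that] period_eq[OF \<tau> F'[OF that(1)] that] per[OF side_in[OF that]] that
  unfolding D_def by simp
 have h_side: "h (echar X (side X f k) t) = \<phi> (endpt X (side X f k) 0) + D f (tri_side k t) - D f (tri_side k 0)"
  if f: "f \<in> tris X" "k < 3" "0 \<le> t" "t \<le> 1" for f k t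
 proof -
  let ?e = "side X f k"
  have "wing ?e \<in> edge_link X ?e" unfolding wing_def using edge_link_nonempty[OF side_in[OF f(1,2)]] by (simp add: some_in_eq)
  then have w: "fst (wing ?e) \<in> tris X" "snd (wing ?e) < 3" "side X (fst (wing ?e)) (snd (wing ?e)) = ?e"
   by (auto simp: edge_link_def)
  consider "t = 0" | "t = 1" | "t \<noteq> 0" "t \<noteq> 1" by blast
  then show ?thesis
  proof cases
   case 1
   then show ?thesis by (simp add: echar_def h_def)
  next
   case 2
   then show ?thesis using Dend[OF f(1,2)] by (simp add: echar_def h_def coboundary_def)
  next
   case 3
   then show ?thesis using Dside[OF w(1,2) f(1,2) w(3), of 0 t] f(3,4) by (simp add: echar_def h_def)
  qed
 qed
 have h_tri: "h (fchar X f p) = \<phi> (endpt X (side X f 2) 0) + D f p - D f (0, 0)"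
  if f: "f \<in> tris X" and p: "p \<in> std_triangle" for f p
  using p
 proof (cases rule: std_triangle_cases)
  case 1
  then show ?thesis by (simp add: fchar_interior h_def)
 next
  case (2 k t)
  have "k = 0 \<or> k = 1 \<or> k = 2" using 2(1) by linarith
  then show ?thesis
   using h_side[OF f 2(1,2,3)] fchar_side[OF f 2(1,2,3)] 2(4) tri_verts[OF f] Dend[OF f, of 2]
   by (auto simp: tri_side_corners tri_side_corners(3)[unfolded One_nat_def] coboundary_def)
 qed
 show ?thesis
 proof (rule H1_class_eqI[OF \<sigma> \<tau>])
  fix x g g' assume x: "x \<in> topspace T" "g \<in> \<sigma> x" "g' \<in> \<tau> x"
  obtain U k where U: "openin T U" "x \<in> U" "\<And>y. y \<in> U ==> \<sigma> y = germ_mod_const T y k" by (rule Z1_rep[OF \<sigma> x(1)], rule that)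
  obtain U' k' where U': "openin T U'" "x \<in> U'" "\<And>y. y \<in> U' ==> \<tau> y = germ_mod_const T y k'" by (rule Z1_rep[OF \<tau> x(1)], rule that)
  have "const_near T x (%y. k' y - k y - h y)"
  proof (rule const_near_T_I[of "U \<inter> U'"])
   fix f p assume fp: "f \<in> tris X" "p \<in> std_triangle" "fchar X f p \<in> U \<inter> U'"
   have top: "fchar X f p \<in> topspace T" using fchar_points[OF fp(1,2)] topspace_T by blast
   have "k \<in> \<sigma> (fchar X f p)" "k' \<in> \<tau> (fchar X f p)"
    using germ_mod_const_self[OF top] U(3)[OF IntD1[OF fp(3)]] U'(3)[OF IntD2[OF fp(3)]] by simp_all
   then have "eventually (%z. F f z - k (fchar X f z) = F f p - k (fchar X f p)) (near std_triangle p)"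
    "eventually (%z. F' f z - k' (fchar X f z) = F' f p - k' (fchar X f p)) (near std_triangle p)"
    using F[OF fp(1)] F'[OF fp(1)] fp(2) unfolding is_primitive_def by blast+
   moreover have "eventually (%z. z \<in> std_triangle) (near std_triangle p)" by (simp add: eventually_inf_principal)
   ultimately show "eventually (%z. k' (fchar X f z) - k (fchar X f z) - h (fchar X f z) =
      k' (fchar X f p) - k (fchar X f p) - h (fchar X f p)) (near std_triangle p)"
    by eventually_elim (simp add: h_tri fp(1,2) D_def)
  qed (use U U' in auto)
  note n1 = this
  have n2: "const_near T x (%y. g' y - k' y)" "const_near T x (%y. g y - k y)"
   using x(2,3) U(3)[OF U(2)] U'(3)[OF U'(2)] by (simp_all add: germ_mod_const_def)
  from const_near_diff[OF const_near_add[OF n1 n2(1)] n2(2)]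
  show "const_near T x (%y. g' y - g y - h y)" by (simp add: algebra_simps)
 qed
qed

end

section \<open>Linear functions with a given cocycle\<close>

lemma eventually_near_nhds:
 assumes "p \<in> interior K" "eventually P (near K p)"
 shows "eventually P (nhds p)"
proof -
 have "eventually (%z. z \<in> interior K) (nhds p)" by (rule eventually_nhds_in_open) (use assms in auto)
 then show ?thesis using assms(2) unfolding eventually_inf_principal
  by eventually_elim (use interior_subset in blast)
qed

lemma eventually_near_in: "eventually (%z. z \<in> K) (near K p)"
 by (simp add: eventually_inf_principal)

lemma eventually_near_open: "open R ==> p \<in> R ==> eventually (%z. z \<in> R) (near K p)"
 using eventually_nhds_in_open[of R p] unfolding eventually_inf_principal by (auto elim: eventually_mono)

lemma int_pl_near_affine:
 assumes "eventually (%y. g y = inner w y + c) (near T p)" "\<And>b. b \<in> Basis ==> inner w b \<in> \<int>"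
 shows "int_pl_near T p g"
proof -
 obtain N where N: "open N" "p \<in> N" "\<forall>y\<in>N. y \<in> T --> g y = inner w y + c"
  using assms(1) unfolding eventually_inf_principal eventually_nhds by metis
 show ?thesis unfolding int_pl_near_def
  by (rule exI[of _ N], rule exI[of _ "{UNIV}"]) (use N assms(2) in \<open>auto simp: int_affine_on_def\<close>)
qed

lemma finite_common_denominator:
 fixes S :: "rat set"
 assumes "finite S"
 obtains N :: nat where "N > 0" "\<And>x. x \<in> S ==> of_nat N * x \<in> \<int>"
proof -
 have "\<exists>N::nat. N > 0 \<and> (\<forall>x\<in>S. of_nat N * x \<in> \<int>)" using assms
 proof induction
  case (insert x S)
  then obtain N :: nat where N: "N > 0" "\<forall>x\<in>S. of_nat N * x \<in> \<int>" by blast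
  obtain a b where ab: "quotient_of x = (a, b)" by fastforce
  have b: "b > 0" "x = of_int a / of_int b" using quotient_of_denom_pos[OF ab] quotient_of_div[OF ab] by auto
  define M where "M = N * nat b"
  have bb: "of_nat (nat b) * x = of_int a" using b by simp
  have "of_nat M * y \<in> \<int>" if "y \<in> insert x S" for y
  proof (cases "y = x")
   case True
   have "of_nat M * x = of_nat N * (of_nat (nat b) * x)" by (simp add: M_def)
   then show ?thesis using True bb by simp
  next
   case False
   then have "of_nat N * y \<in> \<int>" using that N by blast
   then have "of_nat (nat b) * (of_nat N * y) \<in> \<int>" by (rule Ints_mult[OF Ints_of_nat])
   moreover have "of_nat M * y = of_nat (nat b) * (of_nat N * y)" by (simp add: M_def)
   ultimately show ?thesis by (simp only:)
  qed
  then show ?case using N b by (intro exI[of _ M]) (auto simp: M_def)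
 qed (auto intro: exI[of _ 1])
 then show ?thesis using that by blast
qed

context trop_surface
begin

text \<open>The linear function on the triangle that is 0 at the vertex 0 and has increments
  \<open>c\<close> along the sides 2 and 1. The cocycle condition makes the increment along side 0
  correct as well.\<close>

definition tri_lin :: "('e => real) => 'f => real \<times> real => real" where
 "tri_lin c f p = inner (c (side X f 2), c (side X f 1)) p"

lemma tri_lin_side:
 assumes "cocycle X c" "f \<in> tris X" "k < 3"
 shows "tri_lin c f (tri_side k t) = tri_lin c f (tri_side k 0) + c (side X f k) * t"
proof -
 have "k = 0 \<or> k = 1 \<or> k = 2" using assms(3) by linarith
 moreover have "c (side X f 1) = c (side X f 2) + c (side X f 0)"
  using assms unfolding cocycle_def by blast
 ultimately show ?thesis by (auto simp: tri_lin_def tri_side_def algebra_simps)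
qed

lemma tri_lin_corner:
 assumes "k < 3"
 shows "tri_lin c f (tri_corner k) - tri_lin c f (tri_side k 0) = cval c (adj_germ X 0 (f, k))"
proof -
 have "k = 0 \<or> k = 1 \<or> k = 2" using assms by linarith
 then show ?thesis by (auto simp: tri_lin_def tri_side_def tri_corner_def cval_def adj_germ_def adj_def)
qed

text \<open>A local function with slopes \<open>c\<close> on every triangle. Its value at a point is
  free, so two charts differ by local constants and define the same germ modulo constants.\<close>

definition linear_chart :: "('e => real) => ('v, 'e, 'f) pt set => (('v, 'e, 'f) pt => real) => bool" where
 "linear_chart c U g \<longleftrightarrow> openin T U \<and> (\<forall>f\<in>tris X. \<forall>p\<in>std_triangle. fchar X f p \<in> U -->
   eventually (%z. g (fchar X f z) - tri_lin c f z = g (fchar X f p) - tri_lin c f p) (near std_triangle p))"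

lemma linear_chartD:
 assumes "linear_chart c U g" "f \<in> tris X" "p \<in> std_triangle" "fchar X f p \<in> U"
 shows "eventually (%z. g (fchar X f z) - tri_lin c f z = g (fchar X f p) - tri_lin c f p) (near std_triangle p)"
 using assms unfolding linear_chart_def by simp

lemma linear_chart_compat:
 assumes "linear_chart c U g" "linear_chart c U' g'" "x \<in> U" "x \<in> U'"
 shows "const_near T x (%y. g y - g' y)"
proof (rule const_near_T_I[of "U \<inter> U'"])
 show "openin T (U \<inter> U')" using assms(1,2) unfolding linear_chart_def by blast
 fix f p assume fp: "f \<in> tris X" "p \<in> std_triangle" "fchar X f p \<in> U \<inter> U'"
 show "eventually (%z. g (fchar X f z) - g' (fchar X f z) = g (fchar X f p) - g' (fchar X f p)) (near std_triangle p)"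
  using linear_chartD[OF assms(1) fp(1,2) IntD1[OF fp(3)]] linear_chartD[OF assms(2) fp(1,2) IntD2[OF fp(3)]]
  by eventually_elim simp
qed (use assms in blast)

lemma linear_chartI:
 assumes U: "U \<subseteq> points X"
  and loc: "\<And>f p. f \<in> tris X ==> p \<in> std_triangle ==> fchar X f p \<in> U ==>
    \<exists>R b. open R \<and> p \<in> R \<and> (\<forall>z\<in>R. z \<in> std_triangle --> fchar X f z \<in> U \<and> g (fchar X f z) = tri_lin c f z + b)"
 shows "linear_chart c U g"
proof -
 have ev: "eventually (%z. fchar X f z \<in> U) (near std_triangle p) \<and>
  eventually (%z. g (fchar X f z) - tri_lin c f z = g (fchar X f p) - tri_lin c f p) (near std_triangle p)"
  if fp: "f \<in> tris X" "p \<in> std_triangle" "fchar X f p \<in> U" for f p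
 proof -
  obtain R b where R: "open R" "p \<in> R"
   "\<forall>z\<in>R. z \<in> std_triangle --> fchar X f z \<in> U \<and> g (fchar X f z) = tri_lin c f z + b"
   using loc[OF fp] by metis
  have e: "eventually (%z. z \<in> R \<and> z \<in> std_triangle) (near std_triangle p)"
   by (intro eventually_conj eventually_near_open R eventually_near_in)
  show ?thesis
   by (intro conjI; rule eventually_mono[OF e]) (use R(2,3) fp(2) in auto)
 qed
 show ?thesis unfolding linear_chart_def
 proof (intro conjI ballI impI)
  show "openin T U" by (rule openin_T_I[OF U]) (use ev in blast)
 qed (use ev in blast)
qed

lemma tri_chart:
 assumes "f0 \<in> tris X" "p0 \<in> interior std_triangle"
 shows "\<exists>U g. linear_chart c U g \<and> FPt f0 p0 \<in> U"
proof -
 define U :: "('v, 'e, 'f) pt set" where "U = FPt f0 ` interior std_triangle"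
 define g :: "('v, 'e, 'f) pt => real" where "g x = (case x of FPt f p => tri_lin c f p | _ => 0)" for x
 have "linear_chart c U g"
 proof (rule linear_chartI)
  show "U \<subseteq> points X" using assms(1) by (auto simp: U_def points_def)
  fix f p assume fp: "f \<in> tris X" "p \<in> std_triangle" "fchar X f p \<in> U"
  have "p \<in> interior std_triangle"
   using fp(2)
  proof (cases rule: std_triangle_cases)
   case (2 k t)
   then show ?thesis using fp(3) fchar_side[OF fp(1) 2(1,2,3)] by (auto simp: U_def echar_def split: if_splits)
  qed
  moreover then have "f = f0" using fp(3) by (auto simp: U_def fchar_interior)
  ultimately show "\<exists>R b. open R \<and> p \<in> R \<and> (\<forall>z\<in>R. z \<in> std_triangle --> fchar X f z \<in> U \<and> g (fchar X f z) = tri_lin c f z + b)"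
   by (intro exI[of _ "interior std_triangle"] exI[of _ 0]) (auto simp: fchar_interior U_def g_def)
 qed
 then show ?thesis using assms(2) unfolding U_def by blast
qed

lemma edge_chart:
 assumes c: "cocycle X c" and e0: "e0 \<in> edges X" and t0: "0 < t0" "t0 < 1"
 shows "\<exists>U g. linear_chart c U g \<and> EPt e0 t0 \<in> U"
proof -
 \<comment> \<open>In barycentric coordinates \<open>(1 - s - t, s, t)\<close> this is the region
   where the coordinate opposite to the side \<open>k\<close> is the strictly smallest one. The
   regions of the three sides are disjoint, so no conflict arises when several sides of a triangle
   are glued to \<open>e0\<close>.\<close>
 define R :: "nat => (real \<times> real) set" where
  "R k = [{(s, t). 1 - s - t < s \<and> 1 - s - t < t}, {(s, t). s < 1 - s - t \<and> s < t}, {(s, t). t < 1 - s - t \<and> t < s}] ! k" for k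
 have oR: "open (R k)" if "k < 3" for k
 proof -
  have "open {(s, t). 1 - s - t < s \<and> 1 - s - t < (t::real)}" "open {(s, t). s < 1 - s - t \<and> s < (t::real)}"
   "open {(s, t). t < 1 - s - t \<and> t < (s::real)}"
   unfolding case_prod_unfold by (intro open_Collect_conj open_Collect_less continuous_intros)+
  then show ?thesis using that by (auto simp: R_def less_Suc_eq numeral_3_eq_3)
 qed
 define U :: "('v, 'e, 'f) pt set" where
  "U = EPt e0 ` {0<..<1} \<union> (\<Union>(f, k)\<in>edge_link X e0. FPt f ` (R k \<inter> interior std_triangle))"
 \<comment> \<open>Normalized to be 0 at the start of the edge. Sides 1 and 2 start at the vertex 0,
   where \<open>tri_lin\<close> already is 0; side 0 starts at the vertex 1 and needs a
   shift.\<close>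
 define g :: "('v, 'e, 'f) pt => real" where "g x = (case x of EPt e t => c e * t
   | FPt f p => if p \<in> R 0 then tri_lin c f p - tri_lin c f (tri_side 0 0) else tri_lin c f p | _ => 0)" for x
 have dis: "k = k'" if "p \<in> R k" "p \<in> R k'" "k < 3" "k' < 3" for k k' p
  using that by (auto simp: R_def less_Suc_eq numeral_3_eq_3)
 have side: "tri_side k t \<in> R j \<longleftrightarrow> j = k" if "k < 3" "j < 3" "0 < t" "t < 1" for k j t
  using that by (auto simp: R_def tri_side_def less_Suc_eq numeral_3_eq_3)
 have corner: "tri_side k t \<notin> R j" if "k < 3" "j < 3" "t = 0 \<or> t = 1" for k j t
  using that by (auto simp: R_def tri_side_def less_Suc_eq numeral_3_eq_3)
 have start: "tri_lin c f (tri_side k 0) = 0" if "k \<noteq> 0" "k < 3" for f k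
  using that by (auto simp: tri_lin_def tri_side_def less_Suc_eq numeral_3_eq_3)
 have val: "fchar X f z \<in> U \<and> g (fchar X f z) = tri_lin c f z + - tri_lin c f (tri_side k 0)"
  if f: "f \<in> tris X" "k < 3" "side X f k = e0" and z: "z \<in> R k" "z \<in> std_triangle" for f k z
  using z(2)
 proof (cases rule: std_triangle_cases)
  case 1
  have "(f, k) \<in> edge_link X e0" using f by (auto simp: edge_link_def)
  then have "FPt f z \<in> U" using z(1) 1 unfolding U_def by blast
  moreover have "z \<in> R 0 \<longleftrightarrow> k = 0" using dis[OF z(1) _ f(2), of 0] z(1) by auto
  ultimately show ?thesis using 1 start[OF _ f(2)] by (auto simp: fchar_interior g_def)
 next
  case (2 j t)
  have "0 < t" "t < 1" using corner[OF 2(1) f(2)] z(1) 2 by (force simp: less_le)+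
  moreover then have "j = k" using side[OF 2(1) f(2)] z(1) 2(4) by simp
  ultimately show ?thesis
   using fchar_side[OF f(1) 2(1,2,3)] f(3) 2(4) tri_lin_side[OF c f(1,2), of t]
   by (auto simp: echar_def U_def g_def)
 qed
 have "linear_chart c U g"
 proof (rule linear_chartI)
  show "U \<subseteq> points X" using e0 by (auto simp: U_def points_def edge_link_def)
  fix f p assume fp: "f \<in> tris X" "p \<in> std_triangle" "fchar X f p \<in> U"
  have "\<exists>k<3. side X f k = e0 \<and> p \<in> R k"
   using fp(2)
  proof (cases rule: std_triangle_cases)
   case 1
   then show ?thesis using fp(3) by (auto simp: fchar_interior U_def edge_link_def)
  next
   case (2 k t)
   have "t \<noteq> 0" "t \<noteq> 1" using fp(3) fchar_side[OF fp(1) 2(1,2,3)] 2(4) by (auto simp: U_def echar_def)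
   moreover then have "side X f k = e0" using fp(3) fchar_side[OF fp(1) 2(1,2,3)] 2(4) by (auto simp: U_def echar_def)
   ultimately show ?thesis using side[OF 2(1) 2(1), of t] 2 by auto
  qed
  then obtain k where k: "k < 3" "side X f k = e0" "p \<in> R k" by blast
  show "\<exists>R b. open R \<and> p \<in> R \<and> (\<forall>z\<in>R. z \<in> std_triangle --> fchar X f z \<in> U \<and> g (fchar X f z) = tri_lin c f z + b)"
   by (intro exI[of _ "R k"] exI[of _ "- tri_lin c f (tri_side k 0)"] conjI oR k ballI impI)
    (use val[OF fp(1) k(1,2)] in blast)+
 qed
 then show ?thesis using t0 unfolding U_def by (intro exI[of _ U] exI[of _ g]) (auto simp: U_def)
qed

lemma vertex_chart:
 assumes c: "cocycle X c" and v0: "v0 \<in> verts X"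
 shows "\<exists>U g. linear_chart c U g \<and> VPt v0 \<in> U"
proof -
 \<comment> \<open>The points whose barycentric coordinate at the vertex \<open>j\<close> exceeds
   1/2. These regions are disjoint and contain the half of each adjacent side, so they stay
   compatible even if several vertices of the triangle coincide.\<close>
 define R :: "nat => (real \<times> real) set" where
  "R j = [{(s, t). 1 - s - t > 1/2}, {(s, t). s > 1/2}, {(s, t). t > 1/2}] ! j" for j
 define vt where "vt f j = [endpt X (side X f 2) 0, endpt X (side X f 2) 1, endpt X (side X f 1) 1] ! j" for f j
 have oR: "open (R k)" if "k < 3" for k
 proof -
  have "open {(s::real, t). 1 - s - t > 1/2}" "open {(s::real, t::real). s > 1/2}" "open {(s::real, t::real). t > 1/2}"
   unfolding case_prod_unfold by (intro open_Collect_less continuous_intros)+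
  then show ?thesis using that by (auto simp: R_def less_Suc_eq numeral_3_eq_3)
 qed
 define U :: "('v, 'e, 'f) pt set" where
  "U = {VPt v0} \<union> {EPt e t |e t. e \<in> edges X \<and> 0 < t \<and> t < 1 \<and> ((t < 1/2 \<and> endpt X e 0 = v0) \<or> (t > 1/2 \<and> endpt X e 1 = v0))}
   \<union> {FPt f p |f p. f \<in> tris X \<and> p \<in> interior std_triangle \<and> (\<exists>j<3. p \<in> R j \<and> vt f j = v0)}"
 define g :: "('v, 'e, 'f) pt => real" where "g x = (case x of VPt _ => 0
   | EPt e t => if t < 1/2 then c e * t else c e * (t - 1)
   | FPt f p => tri_lin c f p - (if p \<in> R 1 then tri_lin c f (1, 0) else if p \<in> R 2 then tri_lin c f (0, 1) else 0))" for x
 have three: "j = 0 \<or> j = 1 \<or> j = 2" if "j < 3" for j :: nat using that by linarith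
 have coc: "c (side X f 1) = c (side X f 2) + c (side X f 0)" if "f \<in> tris X" for f
  using c that unfolding cocycle_def by blast
 have val: "fchar X f z \<in> U \<and> g (fchar X f z) = tri_lin c f z + - tri_lin c f (tri_corner j)"
  if f: "f \<in> tris X" "j < 3" "vt f j = v0" and z: "z \<in> R j" "z \<in> std_triangle" for f j z
  using z(2)
 proof (cases rule: std_triangle_cases)
  case 1
  then have "FPt f z \<in> U" using f z(1) unfolding U_def by blast
  then show ?thesis using three[OF f(2)] z 1
   by (auto simp: fchar_interior g_def R_def tri_corner_def tri_lin_def std_triangle_def)
 next
  case (2 k t)
  note tv = tri_verts[OF f(1)]
  note fs = fchar_side[OF f(1) 2(1,2,3)] and sin = side_in[OF f(1) 2(1)]
  show ?thesis
   using three[OF f(2)] three[OF 2(1)] z(1) 2(2,3,4) fs sin f(3) tv coc[OF f(1)]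
   by (elim disjE) (auto simp: R_def vt_def tri_side_def echar_def U_def g_def tri_corner_def tri_lin_def algebra_simps)
 qed
 have ex: "\<exists>j<3. vt f j = v0 \<and> p \<in> R j" if fp: "f \<in> tris X" "p \<in> std_triangle" "fchar X f p \<in> U" for f p
  using fp(2)
 proof (cases rule: std_triangle_cases)
  case 1
  then show ?thesis using fp(3) by (auto simp: fchar_interior U_def)
 next
  case (2 k t)
  note tv = tri_verts[OF fp(1)]
  have u: "echar X (side X f k) t \<in> U" using fp(3) fchar_side[OF fp(1) 2(1,2,3)] 2(4) by simp
  then have "(t < 1/2 \<and> endpt X (side X f k) 0 = v0) \<or> (t > 1/2 \<and> endpt X (side X f k) 1 = v0)"
   by (auto simp: U_def echar_def split: if_splits)
  then have "(vt f 0 = v0 \<and> p \<in> R 0) \<or> (vt f 1 = v0 \<and> p \<in> R 1) \<or> (vt f 2 = v0 \<and> p \<in> R 2)"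
   using three[OF 2(1)] tv 2(4) by (elim disjE) (auto simp: R_def vt_def tri_side_def)
  then show ?thesis by (metis zero_less_numeral one_less_numeral_iff numeral_less_iff semiring_norm(77) semiring_norm(79) lessI numeral_3_eq_3 less_Suc_eq numeral_2_eq_2)
 qed
 have "linear_chart c U g"
 proof (rule linear_chartI)
  show "U \<subseteq> points X" using v0 by (auto simp: U_def points_def)
  fix f p assume fp: "f \<in> tris X" "p \<in> std_triangle" "fchar X f p \<in> U"
  obtain j where j: "j < 3" "vt f j = v0" "p \<in> R j" using ex[OF fp] by blast
  show "\<exists>R b. open R \<and> p \<in> R \<and> (\<forall>z\<in>R. z \<in> std_triangle --> fchar X f z \<in> U \<and> g (fchar X f z) = tri_lin c f z + b)"
   by (intro exI[of _ "R j"] exI[of _ "- tri_lin c f (tri_corner j)"] conjI oR j ballI impI)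
    (use val[OF fp(1) j(1,2)] in blast)+
 qed
 moreover have "VPt v0 \<in> U" by (simp add: U_def)
 ultimately show ?thesis by blast
qed

lemma chart_exists:
 assumes "cocycle X c" "x \<in> points X"
 shows "\<exists>U g. linear_chart c U g \<and> x \<in> U"
proof -
 consider v where "x = VPt v" "v \<in> verts X" | e t where "x = EPt e t" "e \<in> edges X" "0 < t" "t < 1"
  | f p where "x = FPt f p" "f \<in> tris X" "p \<in> interior std_triangle"
  using assms(2) unfolding points_def by auto
 then show ?thesis
  by cases (use vertex_chart[OF assms(1)] edge_chart[OF assms(1)] tri_chart in blast)+
qed

lemma linear_chart_echar:
 assumes g: "linear_chart c U g" and c: "cocycle X c" and e: "e \<in> edges X" "0 \<le> t" "t \<le> 1" "echar X e t \<in> U"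
 shows "eventually (%s. g (echar X e s) = c e * s + (g (echar X e t) - c e * t)) (near {0..1} t)"
proof -
 obtain f k where fk: "f \<in> tris X" "k < 3" "side X f k = e" by (rule edge_linkE[OF e(1)])
 have "eventually (%z. g (fchar X f z) - tri_lin c f z = g (fchar X f (tri_side k t)) - tri_lin c f (tri_side k t)) (near std_triangle (tri_side k t))"
  by (rule linear_chartD[OF g fk(1) tri_side_in]) (use fk e fchar_side in auto)
 from near_tri_side[OF fk(2) e(2,3) this] eventually_near_in[of "{0..1}" t]
 show ?thesis
 proof eventually_elim
  case (elim s)
  then show ?case
   using fchar_side[OF fk(1,2), of s] fchar_side[OF fk(1,2), of t] fk(3) e
    tri_lin_side[OF c fk(1,2), of s] tri_lin_side[OF c fk(1,2), of t] by simp
 qed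
qed

text \<open>Inside triangles the chart is affine and does not bend, and on an edge its divisor
  coefficient is \<open>ldiv c e\<close>. Only the vertices, where no coefficient is defined, remain
  as exceptional points.\<close>

lemma linear_chart_linear:
 assumes g: "linear_chart c U g" and c: "cocycle X c"
  and int: "\<And>e. e \<in> edges X ==> c e \<in> \<int>" and z: "\<And>e. e \<in> edges X ==> ldiv c e = 0"
 shows "g \<in> linear_functions X \<alpha> U"
proof -
 have oU: "openin T U" using g unfolding linear_chart_def by blast
 have UP: "U \<subseteq> points X" using openin_subset[OF oU] topspace_T by blast
 have pl: "pl_on X U g" unfolding pl_on_def
 proof (intro conjI ballI impI)
  have tU: "topspace (subtopology T U) = U" using UP topspace_T by auto
  show "continuous_map (subtopology T U) euclideanreal g"
   unfolding continuous_map_def tU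
  proof (intro conjI allI impI)
   fix W :: "real set" assume "openin euclideanreal W"
   then have W: "open W" by simp
   have "openin T {x\<in>U. g x \<in> W}"
   proof (rule openin_T_I)
    show "{x\<in>U. g x \<in> W} \<subseteq> points X" using UP by blast
    fix f p assume fp: "f \<in> tris X" "p \<in> std_triangle" "fchar X f p \<in> {x\<in>U. g x \<in> W}"
    have fU: "fchar X f p \<in> U" using fp(3) by blast
    let ?G = "%z. tri_lin c f z + (g (fchar X f p) - tri_lin c f p)"
    have "continuous (at p) ?G"
     unfolding tri_lin_def by (intro continuous_intros)
    then have "filterlim ?G (nhds (?G p)) (nhds p)"
     unfolding continuous_at tendsto_at_iff_tendsto_nhds[of ?G p] .
    then have "filterlim ?G (nhds (g (fchar X f p))) (nhds p)" by simp
    moreover have "eventually (%y. y \<in> W) (nhds (g (fchar X f p)))"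
     using W fp(3) by (intro eventually_nhds_in_open) auto
    ultimately have "eventually (%z. tri_lin c f z + (g (fchar X f p) - tri_lin c f p) \<in> W) (nhds p)"
     by (rule eventually_compose_filterlim[rotated])
    then have "eventually (%z. tri_lin c f z + (g (fchar X f p) - tri_lin c f p) \<in> W) (near std_triangle p)"
     unfolding eventually_inf_principal by (auto elim: eventually_mono)
    moreover note near_fchar[OF oU fp(1,2) fU]
    moreover note linear_chartD[OF g fp(1,2) fU]
    ultimately show "eventually (%z. fchar X f z \<in> {x\<in>U. g x \<in> W}) (near std_triangle p)"
    proof eventually_elim
     case (elim z)
     have "g (fchar X f z) = tri_lin c f z + (g (fchar X f p) - tri_lin c f p)" using elim by linarith
     then have "g (fchar X f z) \<in> W" using elim(1) by (simp only:)
     then show ?case using elim by blast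
    qed
   qed
   then show "openin (subtopology T U) {x\<in>U. g x \<in> W}" by (auto simp: openin_subtopology intro!: exI[of _ "{x\<in>U. g x \<in> W}"])
  qed simp
 next
  fix e t assume e: "e \<in> edges X" "t \<in> {0..1::real}" "echar X e t \<in> U"
  show "int_pl_near {0..1} t (g \<circ> echar X e)"
   by (rule int_pl_near_affine[of _ "c e" "g (echar X e t) - c e * t"])
    (use linear_chart_echar[OF g c e(1) _ _ e(3)] e(2) int[OF e(1)] in auto)
 next
  fix f p assume fp: "f \<in> tris X" "p \<in> std_triangle" "fchar X f p \<in> U"
  show "int_pl_near std_triangle p (g \<circ> fchar X f)"
  proof (rule int_pl_near_affine)
   show "eventually (%y. (g \<circ> fchar X f) y = inner (c (side X f 2), c (side X f 1)) y + (g (fchar X f p) - tri_lin c f p)) (near std_triangle p)"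
    using linear_chartD[OF g fp] by eventually_elim (simp add: tri_lin_def)
   show "inner (c (side X f 2), c (side X f 1)) b \<in> \<int>" if "b \<in> Basis" for b
    using that int[OF side_in[OF fp(1)], of 2] int[OF side_in[OF fp(1)], of 1] by (auto simp: Basis_prod_def)
  qed
 qed
 have "eq_mult_div_on X \<alpha> U (%_. 0) 1 g" unfolding eq_mult_div_on_def
 proof
  fix x assume x: "x \<in> U"
  have d0: "div_coeff X \<alpha> g y 0" if y: "y \<in> U" "y \<notin> VPt ` verts X" for y
  proof -
   consider e t where "y = EPt e t" "e \<in> edges X" "0 < t" "t < 1"
    | f p where "y = FPt f p" "f \<in> tris X" "p \<in> interior std_triangle"
    using y UP unfolding points_def by auto
   then show ?thesis
   proof cases
    case (1 e t)
    have yt: "echar X e t = y" using 1 by (simp add: echar_def)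
    let ?w = "%fk. (c (side X (fst fk) 2), c (side X (fst fk) 1))"
    let ?c = "%fk. g y - tri_lin c (fst fk) (tri_side (snd fk) t)"
    have "eventually (%s. g (echar X e s) = c e * s + (g y - c e * t)) (nhds t)"
     by (rule eventually_near_nhds[of t "{0..1}"])
      (use linear_chart_echar[OF g c 1(2), of t] yt y 1 in auto)
    moreover have "\<forall>(f, k)\<in>edge_link X e. eventually (%y. g (fchar X f y) = inner (?w (f, k)) y + ?c (f, k)) (near std_triangle (tri_side k t))"
    proof clarify
     fix f k assume "(f, k) \<in> edge_link X e"
     then have fk: "f \<in> tris X" "k < 3" "side X f k = e" by (auto simp: edge_link_def)
     have fy: "fchar X f (tri_side k t) = y" using fchar_side[OF fk(1,2), of t] fk(3) yt 1 by simp
     have "eventually (%z. g (fchar X f z) - tri_lin c f z = g y - tri_lin c f (tri_side k t)) (near std_triangle (tri_side k t))"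
      using linear_chartD[OF g fk(1) tri_side_in[OF fk(2)], of t] fy y 1 by simp
     then show "eventually (%y. g (fchar X f y) = inner (?w (f, k)) y + ?c (f, k)) (near std_triangle (tri_side k t))"
      by eventually_elim (simp add: tri_lin_def)
    qed
    moreover have "of_int 0 = (\<Sum>(f, k)\<in>edge_link X e. inner (?w (f, k)) (tri_corner k) + ?c (f, k))
      - of_int (\<alpha> e 0) * (g y - c e * t) - of_int (\<alpha> e 1) * (c e + (g y - c e * t))"
    proof -
     have "(\<Sum>(f, k)\<in>edge_link X e. inner (?w (f, k)) (tri_corner k) + ?c (f, k))
       = (\<Sum>fk\<in>edge_link X e. cval c (adj_germ X 0 fk) + (g y - c e * t))"
     proof (rule sum.cong[OF refl])
      fix fk assume a: "fk \<in> edge_link X e"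
      obtain f k where fk: "fk = (f, k)" "f \<in> tris X" "k < 3" "side X f k = e"
       using a by (auto simp: edge_link_def)
      show "(case fk of (f, k) => inner (?w (f, k)) (tri_corner k) + ?c (f, k)) = cval c (adj_germ X 0 fk) + (g y - c e * t)"
       using tri_lin_side[OF c fk(2,3), of t] tri_lin_corner[OF fk(3), of c f] fk
       by (simp add: tri_lin_def)
     qed
     \<comment> \<open>The constant term of the chart is counted once for each triangle at
       \<open>e\<close>; it drops out below because the two integers at \<open>e\<close> have this
       number as their sum.\<close>
     also have "\<dots> = ldiv c e + of_int (\<alpha> e 1) * c e + of_int (\<alpha> e 0 + \<alpha> e 1) * (g y - c e * t)"
      unfolding alpha_sum[OF 1(2)] by (simp add: sum.distrib ldiv_def)
     finally show ?thesis using z[OF 1(2)] by (simp add: algebra_simps)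
    qed
    ultimately have "edge_coeff X \<alpha> g e t 0" unfolding edge_coeff_def
     by (intro exI[of _ "c e"] exI[of _ "g y - c e * t"] exI[of _ ?w] exI[of _ ?c]) simp
    then show ?thesis using 1 by (simp add: div_coeff_def)
   next
    case (2 f p)
    have p: "p \<in> std_triangle" using 2 interior_subset by blast
    have "eventually (%z. g (fchar X f z) - tri_lin c f z = g y - tri_lin c f p) (nhds p)"
     by (rule eventually_near_nhds[OF 2(3)]) (use linear_chartD[OF g 2(2) p] 2 y fchar_interior[OF 2(3), of X f] in simp)
    then have "eventually (%z. g (fchar X f z) = inner (c (side X f 2), c (side X f 1)) z + (g y - tri_lin c f p)
      + of_int 0 * max 0 (inner (1, 0) (z - p))) (nhds p)"
     by eventually_elim (simp add: tri_lin_def)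
    moreover have "primitive_vec (1, 0)" unfolding primitive_vec_def by (intro exI[of _ 1] exI[of _ 0]) simp
    ultimately have "tri_coeff X g f p 0" unfolding tri_coeff_def by blast
    then show ?thesis using 2 by (simp add: div_coeff_def)
   qed
  qed
  \<comment> \<open>The zero formal sum has multiplicity 0 everywhere, so a coefficient 0 off the
    vertices is all that has to be matched.\<close>
  have "{y\<in>U. \<not> (\<exists>m. div_coeff X \<alpha> g y m \<and> multiplicity_at (%_. 0) y = 1 * of_int m)} \<subseteq> VPt ` verts X"
   using d0 by (fastforce simp: multiplicity_at_def)
  then have "finite {y\<in>U. \<not> (\<exists>m. div_coeff X \<alpha> g y m \<and> multiplicity_at (%_. 0) y = 1 * of_int m)}"
   using finite_cells(1) by (meson finite_imageI finite_subset)
  then show "\<exists>N. openin T N \<and> x \<in> N \<and> N \<subseteq> U \<and>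
    finite {y\<in>N. \<not> (\<exists>m. div_coeff X \<alpha> g y m \<and> multiplicity_at (%_. 0) y = 1 * of_int m)}"
   using oU x by blast
 qed
 then show ?thesis using pl unfolding linear_functions_def by blast
qed

end

section \<open>The span of the image of the connecting map\<close>

context trop_surface
begin

abbreviation "\<A> \<equiv> linear_functions X \<alpha>"

lemma Q_subset_Z1: "quotient_sections T \<A> \<subseteq> Z1 T"
 unfolding Z1_def quotient_sections_def by blast

text \<open>The charts of \<open>c\<close> agree modulo local constants and so form a section of the
  quotient sheaf. On each triangle \<open>tri_lin c f\<close> is a primitive of it, whose increments
  along the sides are \<open>c\<close>.\<close>

lemma section_of_integral_cocycle:
 assumes c: "cocycle X c"
  and int: "\<And>e. e \<in> edges X ==> c e \<in> \<int>" and z: "\<And>e. e \<in> edges X ==> ldiv c e = 0"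
 obtains \<sigma> where "\<sigma> \<in> quotient_sections T \<A>" "\<And>e. e \<in> edges X ==> period \<sigma> e = c e"
proof -
 obtain U g where Ug: "\<And>x. x \<in> points X ==> linear_chart c (U x) (g x)" "\<And>x. x \<in> points X ==> x \<in> U x"
  using chart_exists[OF c] by metis
 define \<sigma> where "\<sigma> x = (if x \<in> points X then germ_mod_const T x (g x) else {})" for x
 have loc: "\<sigma> y = germ_mod_const T y (g x)" if "x \<in> points X" "y \<in> U x" for x y
 proof -
  have oU: "openin T (U x)" using Ug(1)[OF that(1)] unfolding linear_chart_def by blast
  have y: "y \<in> points X" using openin_subset[OF oU] topspace_T that by blast
  have "const_near T y (%z. g y z - g x z)"
   by (rule linear_chart_compat[OF Ug(1)[OF y] Ug(1)[OF that(1)] Ug(2)[OF y] that(2)])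
  then show ?thesis using germ_mod_const_eqI y by (simp add: \<sigma>_def)
 qed
 have Q: "\<sigma> \<in> quotient_sections T \<A>" unfolding quotient_sections_def mem_Collect_eq
 proof (intro conjI allI impI ballI)
  show "\<sigma> x = {}" if "x \<notin> topspace T" for x using that topspace_T by (simp add: \<sigma>_def)
  fix x assume "x \<in> topspace T"
  then have x: "x \<in> points X" using topspace_T by blast
  show "\<exists>U g. openin T U \<and> x \<in> U \<and> g \<in> \<A> U \<and> (\<forall>y\<in>U. \<sigma> y = germ_mod_const T y g)"
  proof (intro exI conjI ballI)
   show "openin T (U x)" using Ug(1)[OF x] unfolding linear_chart_def by blast
   show "x \<in> U x" by (rule Ug(2)[OF x])
   show "g x \<in> \<A> (U x)" by (rule linear_chart_linear[OF Ug(1)[OF x] c int z])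
   show "\<sigma> y = germ_mod_const T y (g x)" if "y \<in> U x" for y by (rule loc[OF x that])
  qed
 qed
 have Z: "\<sigma> \<in> Z1 T" using Q Q_subset_Z1 by blast
 have prim: "is_primitive \<sigma> f (tri_lin c f)" if f: "f \<in> tris X" for f
  unfolding is_primitive_def
 proof (intro ballI)
  fix p h assume p: "p \<in> std_triangle" and h: "h \<in> \<sigma> (fchar X f p)"
  have x: "fchar X f p \<in> points X" by (rule fchar_points[OF f p])
  have "const_near T (fchar X f p) (%y. h y - g (fchar X f p) y)"
   using h x by (simp add: \<sigma>_def germ_mod_const_def)
  from const_near_fchar[OF this f p] linear_chartD[OF Ug(1)[OF x] f p Ug(2)[OF x]]
  show "eventually (%z. tri_lin c f z - h (fchar X f z) = tri_lin c f p - h (fchar X f p)) (near std_triangle p)"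
   by eventually_elim linarith
 qed
 have "period \<sigma> e = c e" if e: "e \<in> edges X" for e
 proof -
  obtain f k where fk: "f \<in> tris X" "k < 3" "side X f k = e" by (rule edge_linkE[OF e])
  show ?thesis using period_eq[OF Z prim[OF fk(1)] fk(1,2)] tri_lin_side[OF c fk(1,2), of 1] fk(3) by simp
 qed
 with Q show ?thesis by (rule that)
qed

lemma ldiv_Rats: "(\<And>e. c e \<in> \<rat>) ==> ldiv c e \<in> \<rat>"
 unfolding ldiv_def cval_def
 by (intro Rats_diff Rats_sum Rats_mult) (auto simp: Rats_of_int)

lemma ldiv_sum: "ldiv (%e. \<Sum>b\<in>B. x b * c b e) e = (\<Sum>b\<in>B. x b * ldiv (c b) e)"
proof -
 have cv: "cval (%e. \<Sum>b\<in>B. x b * c b e) a = (\<Sum>b\<in>B. x b * cval (c b) a)" for a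
  by (simp add: cval_def sum_negf)
 show ?thesis unfolding ldiv_def cv
  by (simp add: right_diff_distrib sum_subtractf sum_distrib_left sum.swap[of _ _ B] mult_ac)
qed

lemma ldiv_cong: "(\<And>e. e \<in> edges X ==> c e = c' e) ==> e \<in> edges X ==> ldiv c e = ldiv c' e"
 unfolding ldiv_def
proof (intro arg_cong2[where f="(-)"] sum.cong refl)
 fix fk assume c: "\<And>e. e \<in> edges X ==> c e = c' e" and "fk \<in> edge_link X e"
 then obtain f k where fk: "fk = (f, k)" "f \<in> tris X" "k < 3" by (auto simp: edge_link_def)
 then have "k = 0 \<or> k = 1 \<or> k = 2" by linarith
 then have "fst (adj_germ X 0 fk) \<in> edges X" using side_in[OF fk(2)] fk(1) by (auto simp: adj_germ_def adj_def)
 then show "cval c (adj_germ X 0 fk) = cval c' (adj_germ X 0 fk)" using c by (simp add: cval_def)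
qed simp

text \<open>
 The real solutions of a homogeneous linear system with rational coefficients are spanned by the
 integral ones: expand the coordinates of a solution in a rational basis of their rational span.
\<close>

lemma integral_cocycles_span:
 assumes c: "cocycle X c" and z: "\<And>e. e \<in> edges X ==> ldiv c e = 0"
 obtains n :: nat and r :: "nat => real" and d where
  "\<And>i. i < n ==> cocycle X (d i)" "\<And>i e. i < n ==> e \<in> edges X ==> d i e \<in> \<int>"
  "\<And>i e. i < n ==> e \<in> edges X ==> ldiv (d i) e = 0"
  "\<And>e. e \<in> edges X ==> c e = (\<Sum>i<n. r i * d i e)"
proof -
 interpret Q: vector_space "%(q::rat) (x::real). of_rat q * x"
  by unfold_locales (auto simp: algebra_simps of_rat_add of_rat_mult)
 obtain B where B: "B \<subseteq> c ` edges X" "Q.independent B" "c ` edges X \<subseteq> Q.span B"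
  using Q.maximal_independent_subset by metis
 have finB: "finite B" using B(1) finite_cells(2) by (meson finite_imageI finite_subset)
 have "\<exists>u. c e = (\<Sum>b\<in>B. of_rat (u b) * b)" if "e \<in> edges X" for e
  using B(3) that unfolding Q.span_finite[OF finB] by blast
 then obtain q where q: "\<And>e. e \<in> edges X ==> c e = (\<Sum>b\<in>B. of_rat (q e b) * b)" by metis
 define d0 where "d0 b e = (if e \<in> edges X then q e b else 0)" for b e
 have cd: "c e = (\<Sum>b\<in>B. of_rat (d0 b e) * b)" if "e \<in> edges X" for e
  using q[OF that] that by (simp add: d0_def)
 have ind: "u b = 0" if "(\<Sum>b\<in>B. of_rat (u b) * b) = 0" "b \<in> B" for u b
  using Q.independentD[OF B(2) finB subset_refl that] .
 obtain N :: nat where N: "N > 0" "\<And>x. x \<in> (%(b, e). d0 b e) ` (B \<times> edges X) ==> of_nat N * x \<in> \<int>"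
  by (rule finite_common_denominator[of "(%(b, e). d0 b e) ` (B \<times> edges X)"])
   (use finB finite_cells(2) in auto)
 define d where "d b e = real_of_rat (of_nat N * d0 b e)" for b e
 have dc: "cocycle X (d b)" if b: "b \<in> B" for b
  unfolding cocycle_def
 proof
  fix f assume f: "f \<in> tris X"
  have "(\<Sum>b\<in>B. of_rat (d0 b (side X f 1) - d0 b (side X f 2) - d0 b (side X f 0)) * b) =
    c (side X f 1) - c (side X f 2) - c (side X f 0)"
   using cd side_in[OF f] by (simp add: of_rat_diff left_diff_distrib sum_subtractf)
  also have "\<dots> = 0" using c f unfolding cocycle_def by simp
  finally have "d0 b (side X f 1) - d0 b (side X f 2) - d0 b (side X f 0) = 0"
   by (rule ind[of "%b. d0 b (side X f 1) - d0 b (side X f 2) - d0 b (side X f 0)", OF _ b])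
  then have "d0 b (side X f 1) = d0 b (side X f 2) + d0 b (side X f 0)" by simp
  then show "d b (side X f 1) = d b (side X f 2) + d b (side X f 0)"
   by (simp add: d_def of_rat_add[symmetric] distrib_left)
 qed
 have dz: "ldiv (d b) e = 0" if b: "b \<in> B" and e: "e \<in> edges X" for b e
 proof -
  \<comment> \<open>Since the matrix of the condition is integral, it takes rational values on the
    rational coordinates, so the vanishing for \<open>c\<close> is a rational relation between
    elements of \<open>B\<close>.\<close>
  have "\<exists>y. ldiv (%e. of_rat (d0 b e)) e = of_rat y" for b
   using ldiv_Rats[of "%e. of_rat (d0 b e)" e] unfolding Rats_def by auto
  then obtain y where y: "\<And>b. ldiv (%e. of_rat (d0 b e)) e = of_rat (y b)" by metis
  have "(\<Sum>b\<in>B. of_rat (y b) * b) = ldiv (%e. \<Sum>b\<in>B. b * of_rat (d0 b e)) e"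
   unfolding ldiv_sum y by (simp add: mult.commute)
  also have "\<dots> = ldiv c e" by (rule ldiv_cong[OF _ e]) (simp add: cd mult.commute)
  also have "\<dots> = 0" by (rule z[OF e])
  finally have "y b = 0" by (rule ind[OF _ b])
  moreover have "ldiv (d b) e = real N * ldiv (%e. of_rat (d0 b e)) e"
   unfolding d_def using ldiv_sum[of "%_. real N" "%_ e. of_rat (d0 b e)" "{()}" e]
   by (simp add: of_rat_mult)
  ultimately show ?thesis using y[of b] by simp
 qed
 have di: "d b e \<in> \<int>" if "b \<in> B" "e \<in> edges X" for b e
 proof -
  have "of_nat N * d0 b e \<in> \<int>" using N(2) that by force
  then show ?thesis unfolding d_def by (auto elim!: Ints_cases)
 qed
 obtain xs where xs: "distinct xs" "set xs = B" using finite_distinct_list[OF finB] by blast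
 have bij: "bij_betw (%i. xs ! i) {..<length xs} B" using xs bij_betw_nth by blast
 show ?thesis
 proof (rule that[of "length xs" "%i. d (xs ! i)" "%i. xs ! i / real N"])
  fix e assume e: "e \<in> edges X"
  have "c e = (\<Sum>b\<in>B. b / real N * d b e)"
   unfolding cd[OF e] d_def using N(1) by (intro sum.cong) (auto simp: of_rat_mult)
  also have "\<dots> = (\<Sum>i<length xs. xs ! i / real N * d (xs ! i) e)"
   by (rule sum.reindex_bij_betw[OF bij, symmetric])
  finally show "c e = (\<Sum>i<length xs. xs ! i / real N * d (xs ! i) e)" .
 qed (use dc dz di xs in auto)
qed

lemma cocycle_0: "cocycle X (%_. 0)" by (simp add: cocycle_def)

lemma ldiv_0: "ldiv (%_. 0) e = 0" by (simp add: ldiv_def cval_def cong: if_cong)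

text \<open>The integral cocycles spanning \<open>k\<close> are periods of sections, and classes
  with equal periods up to a coboundary are equal. The additional generator \<open>\<sigma>0\<close>
  with free coefficient \<open>a\<close> is the class that completes the span in the obstructed
  case.\<close>

lemma H1_class_in_span:
 assumes S: "\<And>\<sigma>. \<sigma> \<in> quotient_sections T \<A> ==> H1_class T \<sigma> \<in> S"
  and \<sigma>0: "\<sigma>0 \<in> Z1 T" "H1_class T \<sigma>0 \<in> S" and \<tau>: "\<tau> \<in> Z1 T"
  and k: "cocycle X k" "\<And>e. e \<in> edges X ==> ldiv k e = 0"
  and per: "\<And>e. e \<in> edges X ==> period \<tau> e = a * period \<sigma>0 e + coboundary X \<phi> e + k e"
 shows "H1_class T \<tau> \<in> H1_span T S"
proof -
 obtain n :: nat and r d where d: "\<And>i. i < n ==> cocycle X (d i)" "\<And>i e. i < n ==> e \<in> edges X ==> d i e \<in> \<int>"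
  "\<And>i e. i < n ==> e \<in> edges X ==> ldiv (d i) e = 0"
  "\<And>e. e \<in> edges X ==> k e = (\<Sum>i<n. r i * d i e)"
  by (rule integral_cocycles_span[OF k(1)], erule k(2), rule that)
 have "\<exists>\<sigma>. \<sigma> \<in> quotient_sections T \<A> \<and> (\<forall>e\<in>edges X. period \<sigma> e = d i e)" if "i < n" for i
  by (rule section_of_integral_cocycle[OF d(1-3)[OF that]]) auto
 then obtain \<sigma> where \<sigma>: "\<And>i. i < n ==> \<sigma> i \<in> quotient_sections T \<A>"
  "\<And>i e. i < n ==> e \<in> edges X ==> period (\<sigma> i) e = d i e" by metis
 define s where "s i = (case i of 0 => \<sigma>0 | Suc j => \<sigma> j)" for i
 define t where "t i = (case i of 0 => a | Suc j => r j)" for i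
 have sZ: "s i \<in> Z1 T" "H1_class T (s i) \<in> S" if "i < Suc n" for i
  using that \<sigma>0 \<sigma>(1) S Q_subset_Z1 by (auto simp: s_def split: nat.split)
 have "H1_class T (lin_comb T (Suc n) t s) = H1_class T \<tau>"
 proof (rule H1_class_eq_of_period[OF lin_comb_Z1[OF sZ(1)] \<tau>])
  fix e assume e: "e \<in> edges X"
  have "period (lin_comb T (Suc n) t s) e = (\<Sum>i<Suc n. t i * period (s i) e)"
   by (rule period_lin_comb[OF sZ(1) e])
  also have "\<dots> = a * period \<sigma>0 e + (\<Sum>i<n. r i * d i e)"
   unfolding sum.lessThan_Suc_shift using \<sigma>(2) e by (simp add: s_def t_def)
  finally show "period \<tau> e = period (lin_comb T (Suc n) t s) e + coboundary X \<phi> e"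
   using per[OF e] d(4)[OF e] by simp
 qed
 then have "\<exists>n r \<sigma>. H1_class T \<tau> = H1_class T (lin_comb T n r \<sigma>) \<and> (\<forall>i<n. \<sigma> i \<in> Z1 T \<and> H1_class T (\<sigma> i) \<in> S)"
  using sZ by (intro exI[of _ "Suc n"] exI[of _ t] exI[of _ s]) simp
 then show ?thesis unfolding H1_span_def by blast
qed

lemma H1_span_subset: "H1_span T S \<subseteq> H1 T"
 unfolding H1_span_def H1_def using lin_comb_Z1 by blast

lemma zero_section: obtains \<sigma> where "\<sigma> \<in> quotient_sections T \<A>"
 "\<And>e. e \<in> edges X ==> period \<sigma> e = 0"
 by (rule section_of_integral_cocycle[OF cocycle_0 _ ldiv_0]) (auto intro: that)

lemma H1_class_in_span_0:
 assumes S: "\<And>\<sigma>. \<sigma> \<in> quotient_sections T \<A> ==> H1_class T \<sigma> \<in> S" and \<tau>: "\<tau> \<in> Z1 T"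
  and k: "cocycle X k" "\<And>e. e \<in> edges X ==> ldiv k e = 0"
  and per: "\<And>e. e \<in> edges X ==> period \<tau> e = coboundary X \<phi> e + k e"
 shows "H1_class T \<tau> \<in> H1_span T S"
proof -
 obtain \<sigma> where \<sigma>: "\<sigma> \<in> quotient_sections T \<A>" by (rule zero_section)
 show ?thesis
  by (rule H1_class_in_span[OF S _ S[OF \<sigma>] \<tau> k, where a=0 and \<phi>=\<phi>]) (use per \<sigma> Q_subset_Z1 in auto)
qed

text \<open>A class is \<open>good\<close> if its periods become a cocycle with trivial divisor
  after subtracting a coboundary. If some class is not good, its obstruction \<open>a0\<close> at a
  vertex is non-zero, and a multiple of it cancels the obstruction of any other class normalized at
  the same vertex.\<close>

lemma span_codim:
 defines "W \<equiv> H1_span T (connecting_map T \<A> ` quotient_sections T \<A>)"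
 shows "H1_codim_le T W 1"
  and "(\<And>v e i. v \<in> verts X ==> (e, i) \<in> germs X v ==> (\<Sum>b\<in>germs X v. lmat v (e, i) b * h b) = y e) ==>
   (\<Sum>v\<in>verts X. qform (germs X v) (lmat v) h h) > 0 ==> W = H1 T"
proof -
 let ?C = "connecting_map T \<A> ` quotient_sections T \<A>"
 have C: "H1_class T \<sigma> \<in> ?C" if "\<sigma> \<in> quotient_sections T \<A>" for \<sigma>
  using that unfolding connecting_map_def by (intro image_eqI[of _ _ \<sigma>]) auto
 have CW: "H1_class T \<sigma> \<in> W" if \<sigma>: "\<sigma> \<in> quotient_sections T \<A>" for \<sigma>
  unfolding W_def
  by (rule H1_class_in_span[OF C _ C[OF \<sigma>] _ cocycle_0 ldiv_0, where a=1 and \<phi>="%_. 0"])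
   (use \<sigma> Q_subset_Z1 in \<open>auto simp: coboundary_def\<close>)
 have WH: "W \<subseteq> H1 T" unfolding W_def by (rule H1_span_subset)
 define good where "good \<tau> \<longleftrightarrow> (\<exists>\<phi> k. cocycle X k \<and> (\<forall>e\<in>edges X. ldiv k e = 0) \<and>
   (\<forall>e\<in>edges X. period \<tau> e = coboundary X \<phi> e + k e))" for \<tau>
 have all: "W = H1 T" if g: "\<And>\<tau>. \<tau> \<in> Z1 T ==> good \<tau>"
 proof -
  have "H1_class T \<tau> \<in> W" if "\<tau> \<in> Z1 T" for \<tau>
   using g[OF that] H1_class_in_span_0[OF C that] unfolding good_def W_def by blast
  then show ?thesis using WH unfolding H1_def by blast
 qed
 have goodI: "good \<tau>" if \<tau>: "\<tau> \<in> Z1 T"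
  and z: "\<And>v. v \<in> verts X ==> inner_on (germs X v) weight (cval (%e. period \<tau> e - coboundary X \<phi> e)) = 0" for \<tau> \<phi>
 proof -
  have coc: "cocycle X (%e. period \<tau> e - coboundary X \<phi> e)"
   using cocycle_lin[OF period_cocycle[OF \<tau>] cocycle_coboundary[of \<phi>], of "-1"] by simp
  show ?thesis unfolding good_def
   by (intro exI[of _ \<phi>] exI[of _ "%e. period \<tau> e - coboundary X \<phi> e"])
    (use coc ldiv_zero[OF coc z] in auto)
 qed
 have noverts: "good \<tau>" if "verts X = {}" for \<tau>
 proof -
  have "edges X = {}" using endpt_in[of _ 0] that by auto
  then show ?thesis unfolding good_def using cocycle_0 by auto
 qed
 have bad: "\<exists>v0 \<phi> a. v0 \<in> verts X \<and> a \<noteq> 0 \<and> (\<forall>v\<in>verts X.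
   inner_on (germs X v) weight (cval (%e. period \<tau> e - coboundary X \<phi> e)) = (if v = v0 then a else 0))"
  if \<tau>: "\<tau> \<in> Z1 T" and nb: "\<not> good \<tau>" for \<tau>
 proof -
  obtain v0 where v0: "v0 \<in> verts X" using noverts nb by blast
  obtain \<phi> a where a: "\<And>v. v \<in> verts X ==>
   inner_on (germs X v) weight (cval (%e. period \<tau> e - coboundary X \<phi> e)) = (if v = v0 then a else 0)"
   by (rule normalize_cocycle[OF v0, of "period \<tau>"]) (rule that)
  have "a \<noteq> 0" using goodI[OF \<tau>, of \<phi>] a nb by auto
  then show ?thesis using v0 a by blast
 qed
 show "H1_codim_le T W 1"
 proof (cases "\<forall>\<tau>\<in>Z1 T. good \<tau>")
  case True
  then have "W = H1 T" using all by blast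
  moreover have "H1_span T W = H1 T"
  proof -
   have "H1_class T \<tau> \<in> H1_span T W" if "\<tau> \<in> Z1 T" for \<tau>
    using True that H1_class_in_span_0[OF CW that] unfolding good_def by blast
   then show ?thesis using H1_span_subset[of W] unfolding H1_def by blast
  qed
  ultimately show ?thesis unfolding H1_codim_le_def by (intro exI[of _ "{}"]) simp
 next
  case False
  then obtain \<sigma>0 where s0: "\<sigma>0 \<in> Z1 T" "\<not> good \<sigma>0" by blast
  obtain v0 \<phi>0 a0 where v0: "v0 \<in> verts X" and a0: "a0 \<noteq> 0" and n0: "\<And>v. v \<in> verts X ==>
    inner_on (germs X v) weight (cval (%e. period \<sigma>0 e - coboundary X \<phi>0 e)) = (if v = v0 then a0 else 0)"
   using bad[OF s0] by blast
  let ?S = "W \<union> {H1_class T \<sigma>0}"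
  have "H1_class T \<tau> \<in> H1_span T ?S" if \<tau>: "\<tau> \<in> Z1 T" for \<tau>
  proof -
   obtain \<phi> a where n: "\<And>v. v \<in> verts X ==>
    inner_on (germs X v) weight (cval (%e. period \<tau> e - coboundary X \<phi> e)) = (if v = v0 then a else 0)"
    by (rule normalize_cocycle[OF v0, of "period \<tau>"]) (rule that)
   define p where "p e = period \<tau> e - coboundary X \<phi> e" for e
   define p0 where "p0 e = period \<sigma>0 e - coboundary X \<phi>0 e" for e
   have pc: "cocycle X p" "cocycle X p0" unfolding p_def p0_def
    using cocycle_lin[OF period_cocycle[OF \<tau>] cocycle_coboundary[of \<phi>], of "-1"]
     cocycle_lin[OF period_cocycle[OF s0(1)] cocycle_coboundary[of \<phi>0], of "-1"] by simp_all
   \<comment> \<open>Both normalized cocycles pair to zero with the weights away from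
     \<open>v0\<close>; this combination does so at \<open>v0\<close> as well.\<close>
   define k where "k e = p e + (- (a / a0)) * p0 e" for e
   have kc: "cocycle X k" unfolding k_def by (rule cocycle_lin[OF pc])
   have kz: "inner_on (germs X v) weight (cval k) = 0" if "v \<in> verts X" for v
    using n[OF that] n0[OF that] a0 unfolding k_def cval_lin inner_on_add_right
    unfolding p_def[abs_def] p0_def[abs_def] by simp
   show ?thesis
   proof (rule H1_class_in_span[OF _ s0(1) _ \<tau> kc ldiv_zero[OF kc kz], where a="a / a0" and \<phi>="%v. \<phi> v - a / a0 * \<phi>0 v"])
    show "H1_class T \<sigma> \<in> ?S" if "\<sigma> \<in> quotient_sections T \<A>" for \<sigma> using CW[OF that] by blast
    show "period \<tau> e = a / a0 * period \<sigma>0 e + coboundary X (%v. \<phi> v - a / a0 * \<phi>0 v) e + k e" for e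
     unfolding k_def p_def p0_def coboundary_def by (simp add: algebra_simps)
   qed auto
  qed
  then have "H1_span T ?S = H1 T" using H1_span_subset[of ?S] unfolding H1_def by blast
  moreover have "H1_class T \<sigma>0 \<in> H1 T" using s0(1) unfolding H1_def by blast
  ultimately show ?thesis unfolding H1_codim_le_def by (intro exI[of _ "{H1_class T \<sigma>0}"]) simp
 qed
 assume h: "\<And>v e i. v \<in> verts X ==> (e, i) \<in> germs X v ==> (\<Sum>b\<in>germs X v. lmat v (e, i) b * h b) = y e"
  and pos: "(\<Sum>v\<in>verts X. qform (germs X v) (lmat v) h h) > 0"
 show "W = H1 T"
 proof (rule all, rule ccontr)
  fix \<tau> assume \<tau>: "\<tau> \<in> Z1 T" "\<not> good \<tau>"
  obtain v0 \<phi> a where v0: "v0 \<in> verts X" and a: "a \<noteq> 0" and n: "\<And>v. v \<in> verts X ==>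
    inner_on (germs X v) weight (cval (%e. period \<tau> e - coboundary X \<phi> e)) = (if v = v0 then a else 0)"
   using bad[OF \<tau>] by blast
  have coc: "cocycle X (%e. period \<tau> e - coboundary X \<phi> e)"
   using cocycle_lin[OF period_cocycle[OF \<tau>(1)] cocycle_coboundary[of \<phi>], of "-1"] by simp
  have "a = 0" by (rule positive_divisor_obstruction[OF h pos v0 coc n])
  with a show False by blast
 qed
qed

end

section \<open>Piecewise linear functions of one and two variables\<close>

definition rslope :: "(real => real) => real" where
 "rslope h = Lim (at_right 0) (%\<xi>. (h \<xi> - h 0) / \<xi>)"

definition jump :: "(real => real) => real => real" where
 "jump k t = rslope (%\<xi>. k (t + \<xi>)) + rslope (%\<xi>. k (t - \<xi>))"

text \<open>Near \<open>a\<close> the function is affine on every segment that starts at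
  \<open>a\<close>. This records the cone structure of a PL germ without choosing a subdivision into
  polyhedra.\<close>

definition conic_upto :: "'a::real_normed_vector set => ('a => real) => 'a => real => bool" where
 "conic_upto K g a d \<longleftrightarrow> d > 0 \<and>
   (\<forall>y\<in>K. dist y a < d --> (\<forall>s\<in>{0..1}. g (a + s *\<^sub>R (y - a)) = g a + s * (g y - g a)))"

definition conic :: "'a::real_normed_vector set => ('a => real) => 'a => bool" where
 "conic K g a \<longleftrightarrow> (\<exists>d. conic_upto K g a d)"

lemma conic_uptoD:
 assumes "conic_upto K g a d" "y \<in> K" "dist y a < d" "0 \<le> s" "s \<le> 1"
 shows "g (a + s *\<^sub>R (y - a)) = g a + s * (g y - g a)"
 using assms unfolding conic_upto_def by simp

lemma rslope_eqI:
 assumes "eventually (%\<xi>. h \<xi> = h 0 + \<xi> * r) (at_right 0)"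
 shows "rslope h = r"
 unfolding rslope_def
proof (rule tendsto_Lim)
 have "eventually (%\<xi>::real. \<xi> > 0) (at_right 0)" by (rule eventually_at_right_less)
 with assms have "eventually (%\<xi>. (h \<xi> - h 0) / \<xi> = r) (at_right 0)"
  by eventually_elim simp
 then show "((%\<xi>. (h \<xi> - h 0) / \<xi>) \<longlongrightarrow> r) (at_right 0)" by (rule tendsto_eventually)
qed (rule trivial_limit_at_right_real)

lemma eventually_at_right_0I:
 assumes "0 < (b::real)" "\<And>\<xi>. 0 < \<xi> ==> \<xi> < b ==> P \<xi>"
 shows "eventually P (at_right 0)"
 unfolding eventually_at_right_field using assms by blast

lemma eventually_at_right_0E:
 assumes "eventually P (at_right (0::real))" "0 < c"
 obtains \<xi> where "0 < \<xi>" "\<xi> < c" "P \<xi>"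
proof -
 obtain b where b: "b > 0" "\<forall>y>0. y < b --> P y" using assms(1) unfolding eventually_at_right_field by blast
 show ?thesis using that[of "min b c / 2"] b assms(2) by (auto simp: min_def)
qed

lemma eventually_at_right_0_scale:
 assumes "eventually P (at_right (0::real))" "0 < r"
 shows "eventually (%\<xi>. P (\<xi> * r)) (at_right 0)"
proof -
 obtain b where b: "b > 0" "\<forall>y>0. y < b --> P y" using assms(1) unfolding eventually_at_right_field by blast
 show ?thesis by (rule eventually_at_right_0I[of "b / r"]) (use b assms(2) in \<open>auto simp: field_simps\<close>)
qed

lemma eventually_near_ray:
 fixes a :: "'a::real_normed_vector"
 assumes "eventually P (near K a)" "eventually (%\<xi>. a + \<xi> *\<^sub>R v \<in> K) (at_right 0)"
 shows "eventually (%\<xi>. P (a + \<xi> *\<^sub>R v)) (at_right 0)"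
proof -
 have "((%\<xi>. a + \<xi> *\<^sub>R v) \<longlongrightarrow> a + 0 *\<^sub>R v) (at_right (0::real))" by (intro tendsto_intros)
 then have "filterlim (%\<xi>. a + \<xi> *\<^sub>R v) (nhds a) (at_right (0::real))" by simp
 then have "eventually (%\<xi>. a + \<xi> *\<^sub>R v \<in> K --> P (a + \<xi> *\<^sub>R v)) (at_right 0)"
  using assms(1) unfolding eventually_inf_principal by (rule eventually_compose_filterlim[rotated])
 with assms(2) show ?thesis by eventually_elim blast
qed

lemma rslope_affine:
 assumes aff: "\<And>s. a \<le> s ==> s \<le> b ==> k s = c + r * s"
 shows "a \<le> t ==> t < b ==> rslope (%\<xi>. k (t + \<xi>)) = r"
  and "a < t ==> t \<le> b ==> rslope (%\<xi>. k (t - \<xi>)) = - r"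
proof -
 assume t: "a \<le> t" "t < b"
 show "rslope (%\<xi>. k (t + \<xi>)) = r"
  by (rule rslope_eqI, rule eventually_at_right_0I[of "b - t"]) (use t in \<open>auto simp: aff algebra_simps\<close>)
next
 assume t: "a < t" "t \<le> b"
 show "rslope (%\<xi>. k (t - \<xi>)) = - r"
  by (rule rslope_eqI, rule eventually_at_right_0I[of "t - a"]) (use t in \<open>auto simp: aff algebra_simps\<close>)
qed

text \<open>Integration by parts of the second derivative of \<open>k\<close>, a sum of point
  masses, against the affine function \<open>p + q * t\<close>: what remains is derivative times
  function minus function times derivative at the two ends.\<close>

definition parts_formula :: "(real => real) => real => real => real => real => bool" where
 "parts_formula k p q a b \<longleftrightarrow> finite {t\<in>{a<..<b}. jump k t \<noteq> 0} \<and>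
   (\<Sum>t\<in>{t\<in>{a<..<b}. jump k t \<noteq> 0}. jump k t * (p + q * t)) =
    - rslope (%\<xi>. k (b - \<xi>)) * (p + q * b) - k b * q
    - (rslope (%\<xi>. k (a + \<xi>)) * (p + q * a) - k a * q)"

lemma parts_formula_affine:
 assumes ab: "a < b" and aff: "\<And>s. a \<le> s ==> s \<le> b ==> k s = c + r * s"
 shows "parts_formula k p q a b"
proof -
 have "jump k t = 0" if "a < t" "t < b" for t
  unfolding jump_def using rslope_affine[of a b k c r, OF aff] that by simp
 then have e: "{t\<in>{a<..<b}. jump k t \<noteq> 0} = {}" by auto
 have r: "rslope (%\<xi>. k (a + \<xi>)) = r" "rslope (%\<xi>. k (b - \<xi>)) = - r"
  using rslope_affine[of a b k c r, OF aff] ab by auto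
 have "k a = c + r * a" "k b = c + r * b" using aff ab by auto
 then show ?thesis unfolding parts_formula_def e r by (simp add: algebra_simps)
qed

text \<open>At the point \<open>b\<close> where the intervals meet, the boundary terms containing
  one-sided slopes combine into the jump at \<open>b\<close>, and those containing
  \<open>k b\<close> cancel.\<close>

lemma parts_formula_trans:
 assumes ab: "a < b" "b < c" and P: "parts_formula k p q a b" "parts_formula k p q b c"
 shows "parts_formula k p q a c"
proof -
 let ?S = "%a b. {t\<in>{a<..<b}. jump k t \<noteq> 0}"
 let ?F = "%t. jump k t * (p + q * t)"
 have fin: "finite (?S a b)" "finite (?S b c)" using P unfolding parts_formula_def by auto
 have e: "?S a c = (?S a b \<union> ?S b c) \<union> (if jump k b \<noteq> 0 then {b} else {})"
  using ab by (auto simp: not_less_iff_gr_or_eq)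
 have "(\<Sum>t\<in>?S a c. ?F t) = (\<Sum>t\<in>?S a b \<union> ?S b c. ?F t) + (\<Sum>t\<in>(if jump k b \<noteq> 0 then {b} else {}). ?F t)"
  unfolding e by (rule sum.union_disjoint) (use fin in auto)
 also have "(\<Sum>t\<in>?S a b \<union> ?S b c. ?F t) = (\<Sum>t\<in>?S a b. ?F t) + (\<Sum>t\<in>?S b c. ?F t)"
  by (rule sum.union_disjoint) (use fin in auto)
 also have "(\<Sum>t\<in>(if jump k b \<noteq> 0 then {b} else {}). ?F t) = ?F b" by simp
 finally have s: "(\<Sum>t\<in>?S a c. ?F t) = (\<Sum>t\<in>?S a b. ?F t) + (\<Sum>t\<in>?S b c. ?F t) + ?F b" .
 have "finite (?S a c)" unfolding e using fin by auto
 then show ?thesis unfolding parts_formula_def s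
  using P unfolding parts_formula_def by (simp add: jump_def algebra_simps)
qed

lemma conic_affine_right:
 fixes k :: "real => real"
 assumes c: "conic_upto K k x d" and b: "b \<in> K" "x < b" "b < x + d" and s: "x \<le> s" "s \<le> b"
 shows "k s = (k x - (k b - k x) / (b - x) * x) + (k b - k x) / (b - x) * s"
proof -
 have "0 \<le> (s - x) / (b - x)" "(s - x) / (b - x) \<le> 1" using b s by (auto simp: divide_simps)
 moreover have "dist b x < d" using b by (simp add: dist_real_def)
 ultimately have "k (x + ((s - x) / (b - x)) *\<^sub>R (b - x)) = k x + (s - x) / (b - x) * (k b - k x)"
  using conic_uptoD[OF c b(1)] by blast
 moreover have "x + ((s - x) / (b - x)) *\<^sub>R (b - x) = s" using b by simp
 ultimately have "k s = k x + (s - x) * ((k b - k x) / (b - x))" by simp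
 then show ?thesis by (simp only: left_diff_distrib mult.commute[of "(k b - k x) / (b - x)"])
qed

lemma conic_affine_left:
 fixes k :: "real => real"
 assumes c: "conic_upto K k x d" and a: "a \<in> K" "a < x" "x < a + d" and s: "a \<le> s" "s \<le> x"
 shows "k s = (k x - (k a - k x) / (a - x) * x) + (k a - k x) / (a - x) * s"
proof -
 have "0 \<le> (s - x) / (a - x)" "(s - x) / (a - x) \<le> 1" using a s by (auto simp: divide_simps)
 moreover have "dist a x < d" using a by (simp add: dist_real_def)
 ultimately have "k (x + ((s - x) / (a - x)) *\<^sub>R (a - x)) = k x + (s - x) / (a - x) * (k a - k x)"
  using conic_uptoD[OF c a(1)] by blast
 moreover have "x + ((s - x) / (a - x)) *\<^sub>R (a - x) = s" using a by simp
 ultimately have "k s = k x + (s - x) * ((k a - k x) / (a - x))" by simp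
 then show ?thesis by (simp only: left_diff_distrib mult.commute[of "(k a - k x) / (a - x)"])
qed

text \<open>Each point has a neighbourhood in which \<open>k\<close> is affine on either side, and
  bisection puts the short intervals together.\<close>

theorem summation_by_parts:
 assumes AB: "A < B" and con: "\<And>t. A \<le> t ==> t \<le> B ==> conic {A..B} k t"
 shows "parts_formula k p q A B"
proof -
 have "A \<le> A --> A < B --> B \<le> B --> parts_formula k p q A B"
 proof (rule Bolzano[of A B "%a b. A \<le> a --> a < b --> b \<le> B --> parts_formula k p q a b"])
  show "A \<le> B" using AB by simp
  fix a b c assume h: "A \<le> a --> a < b --> b \<le> B --> parts_formula k p q a b"
   "A \<le> b --> b < c --> c \<le> B --> parts_formula k p q b c" "a \<le> b" "b \<le> c"
  show "A \<le> a --> a < c --> c \<le> B --> parts_formula k p q a c"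
  proof (intro impI)
   assume ac: "A \<le> a" "a < c" "c \<le> B"
   consider "a = b" | "b = c" | "a < b" "b < c" using h(3,4) by linarith
   then show "parts_formula k p q a c"
   proof cases
    case 1 then show ?thesis using h(2) ac by simp
   next
    case 2 then show ?thesis using h(1) ac by simp
   next
    case 3
    then have "parts_formula k p q a b" "parts_formula k p q b c" using h ac by simp_all
    then show ?thesis by (rule parts_formula_trans[OF 3])
   qed
  qed
 next
  fix x assume x: "A \<le> x" "x \<le> B"
  obtain d where d: "conic_upto {A..B} k x d" using con[OF x] unfolding conic_def by blast
  have "parts_formula k p q a b" if ab: "a \<le> x" "x \<le> b" "b - a < d" "A \<le> a" "a < b" "b \<le> B" for a b
  proof -
   have r: "parts_formula k p q x b" if "x < b"
    by (rule parts_formula_affine[OF that], rule conic_affine_right[OF d]) (use ab x that in auto)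
   have l: "parts_formula k p q a x" if "a < x"
    by (rule parts_formula_affine[OF that], rule conic_affine_left[OF d]) (use ab x that in auto)
   consider "a = x" | "x = b" | "a < x" "x < b" using ab by linarith
   then show ?thesis
   proof cases
    case 1 then show ?thesis using r ab by simp
   next
    case 2 then show ?thesis using l ab by simp
   next
    case 3 then show ?thesis using parts_formula_trans[OF 3 l r] by blast
   qed
  qed
  then show "\<exists>d>0. \<forall>a b. a \<le> x \<and> x \<le> b \<and> b - a < d -->
    (A \<le> a --> a < b --> b \<le> B --> parts_formula k p q a b)"
   using d unfolding conic_upto_def by blast
 qed
 then show ?thesis using AB by simp
qed

lemma conic_lin:
 assumes "conic K g a" "conic K h a"
 shows "conic K (%z. g z + r * h z) a"
proof -
 obtain d e where "conic_upto K g a d" "conic_upto K h a e" using assms unfolding conic_def by blast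
 then have "conic_upto K (%z. g z + r * h z) a (min d e)"
  unfolding conic_upto_def by (simp add: distrib_left right_diff_distrib)
 then show ?thesis unfolding conic_def by blast
qed

lemma conic_affine: "conic K (%z. inner w z + c) a"
 unfolding conic_def conic_upto_def
 by (intro exI[of _ 1]) (auto simp: inner_add_right inner_diff_right algebra_simps)

lemma conic_scale: "conic K g a ==> conic K (%z. r * g z) a"
proof -
 assume "conic K g a"
 then obtain d where "conic_upto K g a d" unfolding conic_def by blast
 then have "conic_upto K (%z. r * g z) a d" unfolding conic_upto_def by (simp add: distrib_left right_diff_distrib)
 then show ?thesis unfolding conic_def by blast
qed

lemma conic_cong:
 assumes "conic K g a" "eventually (%z. h z = g z) (near K a)" "a \<in> K" "convex K"
 shows "conic K h a"
proof -
 obtain d where d: "conic_upto K g a d" using assms(1) unfolding conic_def by blast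
 obtain e where e: "e > 0" "\<And>z. z \<in> K ==> dist z a < e ==> h z = g z"
  using assms(2) unfolding eventually_near_metric by blast
 have "conic_upto K h a (min d e)"
  unfolding conic_upto_def
 proof (intro conjI ballI impI)
  show "min d e > 0" using d e(1) by (simp add: conic_upto_def)
  fix y s assume y: "y \<in> K" "dist y a < min d e" and s: "s \<in> {0..1::real}"
  have z: "a + s *\<^sub>R (y - a) \<in> K"
   using convexD_alt[OF assms(4) assms(3) y(1), of s] s by (simp add: algebra_simps)
  have "dist (a + s *\<^sub>R (y - a)) a \<le> dist y a"
   using s by (simp add: dist_norm mult_left_le_one_le)
  then show "h (a + s *\<^sub>R (y - a)) = h a + s * (h y - h a)"
   using e(2)[OF z] e(2)[OF y(1)] e(2)[OF assms(3)] y(2) d y(1) s e(1) unfolding conic_upto_def by auto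
 qed
 then show ?thesis unfolding conic_def by blast
qed

lemma conic_comp_line:
 assumes c: "conic K g (b + t *\<^sub>R d)" and J: "\<And>s. s \<in> J ==> b + s *\<^sub>R d \<in> K"
 shows "conic J (%s::real. g (b + s *\<^sub>R d)) t"
proof -
 obtain e where e: "conic_upto K g (b + t *\<^sub>R d) e" using c unfolding conic_def by blast
 have "conic_upto J (%s. g (b + s *\<^sub>R d)) t (e / (norm d + 1))"
  unfolding conic_upto_def
 proof (intro conjI ballI impI)
  have n: "norm d + 1 > 0" using norm_ge_zero[of d] by linarith
  then show "e / (norm d + 1) > 0" using e by (simp add: conic_upto_def)
  fix y s assume y: "y \<in> J" "dist y t < e / (norm d + 1)" and s: "s \<in> {0..1::real}"
  have "dist (b + y *\<^sub>R d) (b + t *\<^sub>R d) = \<bar>y - t\<bar> * norm d"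
   by (simp add: dist_norm scaleR_diff_left[symmetric])
  also have "\<dots> \<le> \<bar>y - t\<bar> * (norm d + 1)" by (intro mult_left_mono) auto
  also have "\<dots> < e" using y(2) n by (simp add: dist_real_def field_simps)
  finally have "g (b + t *\<^sub>R d + s *\<^sub>R (b + y *\<^sub>R d - (b + t *\<^sub>R d))) =
    g (b + t *\<^sub>R d) + s * (g (b + y *\<^sub>R d) - g (b + t *\<^sub>R d))"
   using e J[OF y(1)] s unfolding conic_upto_def by blast
  moreover have e: "b + t *\<^sub>R d + s *\<^sub>R (b + y *\<^sub>R d - (b + t *\<^sub>R d)) = b + (t + s *\<^sub>R (y - t)) *\<^sub>R d"
   by (simp add: algebra_simps)
  ultimately show "g (b + (t + s *\<^sub>R (y - t)) *\<^sub>R d) = g (b + t *\<^sub>R d) + s * (g (b + y *\<^sub>R d) - g (b + t *\<^sub>R d))"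
   by (simp only: e)
 qed
 then show ?thesis unfolding conic_def by blast
qed

text \<open>The finitely many polyhedra that miss \<open>a\<close> are closed and stay at positive
  distance. A nearby point lies in a polyhedron through \<open>a\<close>, which by convexity
  contains the whole segment to \<open>a\<close>, and \<open>g\<close> is affine there.\<close>

lemma int_pl_near_conic:
 assumes pl: "int_pl_near K a g" and K: "convex K" "a \<in> K"
 shows "conic K g a"
proof -
 obtain N \<P> where N: "open N" "a \<in> N" "finite \<P>" "\<And>P. P \<in> \<P> ==> polyhedron P" "N \<inter> K \<subseteq> \<Union>\<P>"
  "\<And>P. P \<in> \<P> ==> int_affine_on (P \<inter> N \<inter> K) g"
  using pl unfolding int_pl_near_def by blast
 have "closed (\<Union>{P\<in>\<P>. a \<notin> P})" using N(3,4) polyhedron_imp_closed by (intro closed_Union) auto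
 then have "open (N - \<Union>{P\<in>\<P>. a \<notin> P})" using N(1) by blast
 moreover have "a \<in> N - \<Union>{P\<in>\<P>. a \<notin> P}" using N(2) by blast
 ultimately obtain d where d: "d > 0" "ball a d \<subseteq> N - \<Union>{P\<in>\<P>. a \<notin> P}"
  using open_contains_ball by metis
 have "conic_upto K g a d" unfolding conic_upto_def
 proof (intro conjI ballI impI)
  fix y s assume y: "y \<in> K" "dist y a < d" and s: "s \<in> {0..1::real}"
  have yb: "y \<in> ball a d" using y(2) by (simp add: dist_commute)
  then obtain P where P: "P \<in> \<P>" "y \<in> P" using d(2) N(5) y(1) by blast
  then have aP: "a \<in> P" using d(2) yb by blast
  let ?z = "a + s *\<^sub>R (y - a)"
  have zP: "?z \<in> P" using convexD_alt[OF polyhedron_imp_convex[OF N(4)[OF P(1)]] aP P(2), of s] s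
   by (simp add: algebra_simps)
  have zK: "?z \<in> K" using convexD_alt[OF K y(1), of s] s by (simp add: algebra_simps)
  have "dist ?z a \<le> dist y a" using s by (simp add: dist_norm mult_left_le_one_le)
  then have "?z \<in> ball a d" using y(2) by (simp add: dist_commute)
  then have zN: "?z \<in> N" using d(2) by blast
  have yN: "y \<in> N" using d(2) yb by blast
  obtain w c where w: "\<And>x. x \<in> P \<inter> N \<inter> K ==> g x = inner w x + c"
   using N(6)[OF P(1)] unfolding int_affine_on_def by blast
  have "g ?z = inner w ?z + c" "g y = inner w y + c" "g a = inner w a + c"
   using w zP zN zK P(2) yN y(1) aP N(2) K(2) by blast+
  then show "g ?z = g a + s * (g y - g a)" by (simp add: inner_add_right inner_diff_right algebra_simps)
 qed (rule d(1))
 then show ?thesis unfolding conic_def by blast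
qed

lemma rslope_conic:
 assumes c: "conic K g a" and v: "eventually (%\<xi>. a + \<xi> *\<^sub>R v \<in> K) (at_right 0)"
 shows "eventually (%\<xi>. g (a + \<xi> *\<^sub>R v) = g a + \<xi> * rslope (%\<xi>. g (a + \<xi> *\<^sub>R v))) (at_right 0)"
proof -
 obtain d where d: "conic_upto K g a d" using c unfolding conic_def by blast
 then have dpos: "d > 0" by (simp add: conic_upto_def)
 have "eventually (%y. dist y a < d) (near K a)"
  unfolding eventually_near_metric using dpos by blast
 from eventually_near_ray[OF this v] have ev: "eventually (%\<xi>. dist (a + \<xi> *\<^sub>R v) a < d \<and> a + \<xi> *\<^sub>R v \<in> K) (at_right 0)"
  using v by (rule eventually_conj)
 obtain e where e: "e > 0" "dist (a + e *\<^sub>R v) a < d" "a + e *\<^sub>R v \<in> K"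
  by (rule eventually_at_right_0E[OF ev, of 1], simp, rule that, auto)
 have lin: "g (a + \<xi> *\<^sub>R v) = g a + \<xi> * ((g (a + e *\<^sub>R v) - g a) / e)" if "0 < \<xi>" "\<xi> < e" for \<xi>
 proof -
  have "\<xi> / e \<in> {0..1}" using that by auto
  then have "g (a + (\<xi> / e) *\<^sub>R (a + e *\<^sub>R v - a)) = g a + \<xi> / e * (g (a + e *\<^sub>R v) - g a)"
   using d e(2,3) unfolding conic_upto_def by blast
  then show ?thesis using e(1) by simp
 qed
 then have ev: "eventually (%\<xi>. g (a + \<xi> *\<^sub>R v) = g a + \<xi> * ((g (a + e *\<^sub>R v) - g a) / e)) (at_right 0)"
  by (rule eventually_at_right_0I[OF e(1)])
 then have "rslope (%\<xi>. g (a + \<xi> *\<^sub>R v)) = (g (a + e *\<^sub>R v) - g a) / e"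
  by (intro rslope_eqI) simp
 with ev show ?thesis by simp
qed


section \<open>Primitive vectors and break lines\<close>

definition det2 :: "real \<times> real => real \<times> real => real" where
 "det2 u v = fst u * snd v - snd u * fst v"

lemma primitive_nonzero: "primitive_vec u ==> u \<noteq> 0"
 unfolding primitive_vec_def zero_prod_def by auto

text \<open>The vanishing determinant makes the cross products of the coordinates equal; by
  coprimality corresponding coordinates divide each other and agree up to sign.\<close>

lemma primitive_parallel:
 assumes u: "primitive_vec u" and v: "primitive_vec v" and d: "det2 u v = 0"
 shows "u = v \<or> u = - v"
proof -
 obtain a b c e :: int where ab: "coprime a b" "u = (of_int a, of_int b)" "coprime c e" "v = (of_int c, of_int e)"
  using u v unfolding primitive_vec_def by blast
 have "of_int (a * e) = (of_int (b * c) :: real)" using d by (simp add: det2_def ab)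
 then have eq: "a * e = b * c" by (simp only: of_int_eq_iff)
 have "a dvd b * c" "c dvd a * e" "b dvd a * e" "e dvd b * c"
  using dvd_triv_left[of a e] dvd_triv_right[of c b] dvd_triv_left[of b c] dvd_triv_right[of e a] eq by simp_all
 then have "a dvd c" using ab(1) by (simp add: coprime_dvd_mult_right_iff)
 moreover have "c dvd a" using \<open>c dvd a * e\<close> ab(3) by (simp add: coprime_dvd_mult_left_iff)
 moreover have "b dvd e"
  using \<open>b dvd a * e\<close> ab(1) by (simp add: coprime_dvd_mult_right_iff coprime_commute)
 moreover have "e dvd b"
  using \<open>e dvd b * c\<close> ab(3) by (simp add: coprime_dvd_mult_left_iff coprime_commute)
 ultimately have abs: "\<bar>a\<bar> = \<bar>c\<bar>" "\<bar>b\<bar> = \<bar>e\<bar>" using zdvd_antisym_abs by blast+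
 show ?thesis
 proof (cases "a = c")
  case True
  then have "a = 0 \<or> b = e" using eq by (auto simp: mult.commute)
  then show ?thesis using True abs ab by (auto simp: abs_eq_iff)
 next
  case False
  then have "a = - c" "c \<noteq> 0" using abs by auto
  then have "c * (b + e) = 0" using eq by (simp add: algebra_simps)
  then have "b = - e" using \<open>c \<noteq> 0\<close> by auto
  then show ?thesis using \<open>a = - c\<close> ab by simp
 qed
qed

lemma primitive_same_ray:
 assumes "primitive_vec u" "primitive_vec v" "u = s *\<^sub>R v" "s > 0"
 shows "u = v"
proof -
 have "det2 u v = 0" by (simp add: assms(3) det2_def)
 then consider "u = v" | "u = - v" using primitive_parallel assms(1,2) by blast
 then show ?thesis
 proof cases
  case 2
  then have "(1 + s) *\<^sub>R v = 0" using assms(3) by (simp add: scaleR_add_left)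
  then show ?thesis using assms(4) primitive_nonzero[OF assms(2)] by auto
 qed
qed

lemma primitive_rotate: "primitive_vec (a, b) ==> primitive_vec (- b, a)"
proof -
 assume "primitive_vec (a, b)"
 then obtain x y :: int where "coprime x y" "a = of_int x" "b = of_int y" unfolding primitive_vec_def by auto
 then show ?thesis unfolding primitive_vec_def
  by (intro exI[of _ "- y"] exI[of _ x]) (auto simp: coprime_commute)
qed

lemma primitive_minus: "primitive_vec u ==> primitive_vec (- u)"
 using primitive_rotate[of "fst u" "snd u"] primitive_rotate[of "- snd u" "fst u"] by (cases u) simp

text \<open>The condition of \<open>tri_coeff\<close> with a real coefficient, so that it also
  applies to a local equation, which is a rational multiple of an integral PL function.\<close>

definition breaks_at :: "(real \<times> real => real) => real \<times> real => real => bool" where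
 "breaks_at g z \<mu> \<longleftrightarrow> (\<exists>n w c. primitive_vec n \<and>
   eventually (%y. g y = inner w y + c + \<mu> * max 0 (inner n (y - z))) (nhds z))"

lemma eventually_nhds_line:
 fixes z h :: "'a::real_normed_vector"
 assumes "eventually P (nhds z)"
 shows "eventually (%s. P (z + s *\<^sub>R h)) (nhds (0::real))"
proof -
 have "((%s::real. z + s *\<^sub>R h) \<longlongrightarrow> z + 0 *\<^sub>R h) (nhds 0)"
  by (intro tendsto_intros filterlim_ident)
 then show ?thesis using assms by (auto intro: eventually_compose_filterlim)
qed

lemma breaks_at_line:
 assumes "eventually (%y. g y = inner w y + c + \<mu> * max 0 (inner n (y - z))) (nhds z)"
 shows "eventually (%s. g (z + s *\<^sub>R h) = g z + s * (inner w h + \<mu> * max 0 (inner n h)) \<and>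
   g (z - s *\<^sub>R h) = g z + s * (- inner w h + \<mu> * max 0 (- inner n h))) (at_right 0)"
proof -
 have z: "g z = inner w z + c" using eventually_nhds_x_imp_x[OF assms] by simp
 have "eventually (%s. s > 0) (at_right (0::real))" by (rule eventually_at_right_less)
 moreover have "eventually (%s. g (z + s *\<^sub>R h) = inner w (z + s *\<^sub>R h) + c + \<mu> * max 0 (inner n (z + s *\<^sub>R h - z))) (at_right 0)"
  using eventually_nhds_line[OF assms, of h] by (rule filter_leD[rotated]) (simp add: at_within_def)
 moreover have "eventually (%s. g (z + s *\<^sub>R (- h)) = inner w (z + s *\<^sub>R (- h)) + c + \<mu> * max 0 (inner n (z + s *\<^sub>R (- h) - z))) (at_right 0)"
  using eventually_nhds_line[OF assms, of "- h"] by (rule filter_leD[rotated]) (simp add: at_within_def)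
 ultimately show ?thesis
 proof eventually_elim
  case (elim s)
  have "max 0 (s * x) = s * max 0 x" for x using elim(1) by (simp add: max_def zero_le_mult_iff)
  from this[of "inner n h"] this[of "- inner n h"] show ?case
   using elim(2,3) z by (simp add: inner_add_right inner_diff_right algebra_simps)
 qed
qed

text \<open>The slopes of \<open>g\<close> along \<open>n\<close> and against \<open>n\<close> add
  up to \<open>\<mu>\<close> times the squared length of \<open>n\<close>, and to 0 for an affine
  function.\<close>

lemma breaks_at_zero:
 assumes b: "breaks_at g z \<mu>" and a: "eventually (%y. g y = inner w y + c) (nhds z)"
 shows "\<mu> = 0"
proof -
 obtain n w' c' where n: "primitive_vec n"
  "eventually (%y. g y = inner w' y + c' + \<mu> * max 0 (inner n (y - z))) (nhds z)"
  using b unfolding breaks_at_def by (elim exE conjE) (rule that)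
 have a': "eventually (%y. g y = inner w y + c + 0 * max 0 (inner n (y - z))) (nhds z)" using a by simp
 have "eventually (%s. s > 0) (at_right (0::real))" by (rule eventually_at_right_less)
 with breaks_at_line[OF n(2), of n] breaks_at_line[OF a', of n]
 have "eventually (%s::real. \<mu> * inner n n = 0) (at_right 0)"
 proof eventually_elim
  case (elim s)
  define A where "A = inner w' n"
  define B where "B = inner w n"
  define C where "C = inner n n"
  have C: "C \<ge> 0" by (simp add: C_def)
  then have m: "max 0 C = C" "max 0 (- C) = 0" by auto
  have c: "t = t'" if "g z + s * t = g z + s * t'" for t t' using that elim(3) by simp
  have h: "g z + s * (A + \<mu> * C) = g z + s * B" "g z + s * (- A) = g z + s * (- B)"
   using elim(1,2) unfolding A_def[symmetric] B_def[symmetric] C_def[symmetric] m by argo+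
  from c[OF h(1)] c[OF h(2)] show ?case unfolding C_def[symmetric] by simp
 qed
 then have "\<mu> * inner n n = 0" by (simp add: eventually_const)
 then show ?thesis using primitive_nonzero[OF n(1)] by simp
qed

text \<open>The germ at \<open>a\<close> of a local equation on a triangle. \<open>D u\<close> is
  the coefficient of the divisor along the ray with primitive direction \<open>u\<close>. The
  divisor matches \<open>g\<close> only off finitely many points; these are avoided by going close
  to \<open>a\<close> along a ray, hence the eventual conditions.\<close>

locale pl_germ =
 fixes K :: "(real \<times> real) set" and a :: "real \<times> real" and g mult :: "real \<times> real => real"
  and D :: "real \<times> real => real" and d :: real
 assumes convex_K: "convex K" and a_in: "a \<in> K" and conic_a: "conic_upto K g a d"
  and conic_K: "\<And>y. y \<in> K ==> dist y a < d ==> conic K g y"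
  and breaks: "\<And>v. v \<noteq> 0 ==> eventually (%\<xi>. a + \<xi> *\<^sub>R v \<in> interior K) (at_right 0) ==>
    eventually (%\<xi>. breaks_at g (a + \<xi> *\<^sub>R v) (mult (a + \<xi> *\<^sub>R v))) (at_right 0)"
  and mult_D: "\<And>u. primitive_vec u ==> eventually (%\<xi>. a + \<xi> *\<^sub>R u \<in> interior K) (at_right 0) ==>
    eventually (%\<xi>. mult (a + \<xi> *\<^sub>R u) = D u) (at_right 0)"
begin

lemma interior_shrink:
 assumes "a + e *\<^sub>R x \<in> interior K" "0 < s" "s \<le> e"
 shows "a + s *\<^sub>R x \<in> interior K"
proof -
 have "a - (s / e) *\<^sub>R (a - (a + e *\<^sub>R x)) \<in> interior K"
  by (rule mem_interior_convex_shrink[OF convex_K assms(1) a_in]) (use assms(2,3) in simp_all)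
 then show ?thesis using assms by simp
qed

lemma conic_ray:
 assumes "a + e *\<^sub>R x \<in> K" "norm (e *\<^sub>R x) < d" "0 \<le> s" "s \<le> e" "0 < e"
 shows "g (a + s *\<^sub>R x) = g a + s / e * (g (a + e *\<^sub>R x) - g a)"
proof -
 have "g (a + (s / e) *\<^sub>R (a + e *\<^sub>R x - a)) = g a + s / e * (g (a + e *\<^sub>R x) - g a)"
  by (rule conic_uptoD[OF conic_a assms(1)]) (use assms in \<open>auto simp: dist_norm\<close>)
 then show ?thesis using assms by simp
qed

text \<open>The point at distance \<open>e\<close> may be exceptional, so the break is found at a
  generic point of the same ray closer to \<open>a\<close> and carried outwards by homogeneity of
  \<open>g\<close> about \<open>a\<close>.\<close>

lemma path_point:
 assumes e: "e > 0" and x: "a + e *\<^sub>R x \<in> interior K" and norm: "norm (e *\<^sub>R x) < d"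
  and ne: "x \<noteq> 0"
 obtains \<mu> n w \<xi> c where "primitive_vec n" "\<mu> = 0 \<or> inner n x = 0"
  "\<And>u r. primitive_vec u ==> r > 0 ==> x = r *\<^sub>R u ==> D u = \<mu>"
  "\<And>h. eventually (%s. g (a + e *\<^sub>R (x + s *\<^sub>R h)) = g (a + e *\<^sub>R x) + s * (e * (inner w h + \<mu> * max 0 (inner n h)))) (at_right 0)
   \<or> \<not> eventually (%s. a + e *\<^sub>R (x + s *\<^sub>R h) \<in> K \<and> norm (e *\<^sub>R (x + s *\<^sub>R h)) < d) (at_right 0)"
  "0 < \<xi>" "\<xi> < e"
  "eventually (%y. g y = inner w y + c + \<mu> * max 0 (inner n (y - (a + \<xi> *\<^sub>R x)))) (nhds (a + \<xi> *\<^sub>R x))"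
proof -
 have inward: "eventually (%\<xi>. a + \<xi> *\<^sub>R x \<in> interior K) (at_right 0)"
  by (rule eventually_at_right_0I[OF e]) (use interior_shrink[OF x] in auto)
 have mD: "eventually (%\<xi>. \<forall>u r. primitive_vec u --> r > 0 --> x = r *\<^sub>R u --> mult (a + \<xi> *\<^sub>R x) = D u) (at_right 0)"
 proof (cases "\<exists>u r. primitive_vec u \<and> r > 0 \<and> x = r *\<^sub>R u")
  case True
  then obtain u r where u: "primitive_vec u" "r > 0" "x = r *\<^sub>R u" by blast
  have "eventually (%\<xi>. a + \<xi> *\<^sub>R u \<in> interior K) (at_right 0)"
   using eventually_at_right_0_scale[OF inward, of "inverse r"] u(2) by (simp add: u(3) mult.assoc)
  from eventually_at_right_0_scale[OF mult_D[OF u(1) this] u(2)]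
  show ?thesis
  proof eventually_elim
   case (elim \<xi>)
   show ?case
   proof (intro allI impI)
    fix u' r' assume u': "primitive_vec u'" "r' > 0" "x = r' *\<^sub>R u'"
    have "u' = u" by (rule primitive_same_ray[OF u'(1) u(1), of "r / r'"]) (use u u' in \<open>auto simp: divide_inverse_commute\<close>, metis scaleR_scaleR left_inverse less_irrefl scaleR_one)
    then show "mult (a + \<xi> *\<^sub>R x) = D u'" using elim u(3) by simp
   qed
  qed
 qed auto
 obtain \<xi> where \<xi>: "0 < \<xi>" "\<xi> < e" "breaks_at g (a + \<xi> *\<^sub>R x) (mult (a + \<xi> *\<^sub>R x))"
  "\<And>u r. primitive_vec u ==> r > 0 ==> x = r *\<^sub>R u ==> mult (a + \<xi> *\<^sub>R x) = D u"
  by (rule eventually_at_right_0E[OF eventually_conj[OF breaks[OF ne inward] mD] e]) (rule that, auto)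
 define \<mu> where "\<mu> = mult (a + \<xi> *\<^sub>R x)"
 obtain n w c where n: "primitive_vec n"
  "eventually (%y. g y = inner w y + c + \<mu> * max 0 (inner n (y - (a + \<xi> *\<^sub>R x)))) (nhds (a + \<xi> *\<^sub>R x))"
  using \<xi>(3)[folded \<mu>_def] unfolding breaks_at_def by (elim exE conjE) (rule that)
 have xK: "a + e *\<^sub>R x \<in> K" using x interior_subset by blast
 \<comment> \<open>Along the ray \<open>g\<close> is affine, so its second difference is 0, whereas
   a break contributes \<open>\<mu>\<close> times the modulus of \<open>inner n x\<close>. Thus a
   genuine break runs along the ray.\<close>
 have par: "\<mu> = 0 \<or> inner n x = 0"
 proof -
  have "eventually (%s. s > 0 \<and> s < \<xi> \<and> s < e - \<xi>) (at_right (0::real))"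
   by (rule eventually_at_right_0I[of "min \<xi> (e - \<xi>)"]) (use \<xi> in auto)
  with breaks_at_line[OF n(2), of x] have "eventually (%s::real. \<mu> * \<bar>inner n x\<bar> = 0) (at_right 0)"
  proof eventually_elim
   case (elim s)
   have p: "a + \<xi> *\<^sub>R x + s *\<^sub>R x = a + (\<xi> + s) *\<^sub>R x" "a + \<xi> *\<^sub>R x - s *\<^sub>R x = a + (\<xi> - s) *\<^sub>R x"
    by (simp_all add: algebra_simps)
   let ?k = "(g (a + e *\<^sub>R x) - g a) / e"
   have k: "g (a + t *\<^sub>R x) = g a + t * ?k" if "0 \<le> t" "t \<le> e" for t
    using conic_ray[OF xK norm that e] by simp
   have "g (a + \<xi> *\<^sub>R x + s *\<^sub>R x) = g a + (\<xi> + s) * ?k" "g (a + \<xi> *\<^sub>R x - s *\<^sub>R x) = g a + (\<xi> - s) * ?k"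
    "g (a + \<xi> *\<^sub>R x) = g a + \<xi> * ?k"
    unfolding p by (rule k; use elim(2) \<xi> in linarith)+
   moreover have "(\<xi> + s) * r + (\<xi> - s) * r = 2 * (\<xi> * r)" for r
    by (simp add: distrib_right left_diff_distrib)
   note this[of ?k]
   ultimately have "g (a + \<xi> *\<^sub>R x + s *\<^sub>R x) + g (a + \<xi> *\<^sub>R x - s *\<^sub>R x) = 2 * g (a + \<xi> *\<^sub>R x)"
    by linarith
   then have "s * (inner w x + \<mu> * max 0 (inner n x)) + s * (- inner w x + \<mu> * max 0 (- inner n x)) = 0"
    using elim(1) by linarith
   then have "s * (\<mu> * max 0 (inner n x) + \<mu> * max 0 (- inner n x)) = 0"
    by (simp only: distrib_left)
   then have "\<mu> * max 0 (inner n x) + \<mu> * max 0 (- inner n x) = 0"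
    using elim(2) by (metis mult_eq_0_iff less_irrefl)
   then have "\<mu> * (max 0 (inner n x) + max 0 (- inner n x)) = 0" by (simp only: distrib_left)
   moreover have "max 0 t + max 0 (- t) = \<bar>t\<bar>" for t :: real by (simp add: max_def abs_if)
   ultimately show ?case by simp
  qed
  then show ?thesis by (simp add: eventually_const)
 qed
 show ?thesis
 proof (rule that[OF n(1) par])
  show "D u = \<mu>" if "primitive_vec u" "r > 0" "x = r *\<^sub>R u" for u r
   using \<xi>(4)[OF that] by (simp add: \<mu>_def)
  show "0 < \<xi>" "\<xi> < e" by (rule \<xi>)+
  show "eventually (%y. g y = inner w y + c + \<mu> * max 0 (inner n (y - (a + \<xi> *\<^sub>R x)))) (nhds (a + \<xi> *\<^sub>R x))"
   by (rule n(2))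
  fix h
  show "eventually (%s. g (a + e *\<^sub>R (x + s *\<^sub>R h)) = g (a + e *\<^sub>R x) + s * (e * (inner w h + \<mu> * max 0 (inner n h)))) (at_right 0)
   \<or> \<not> eventually (%s. a + e *\<^sub>R (x + s *\<^sub>R h) \<in> K \<and> norm (e *\<^sub>R (x + s *\<^sub>R h)) < d) (at_right 0)"
  proof (rule disjCI, unfold not_not)
   assume "eventually (%s. a + e *\<^sub>R (x + s *\<^sub>R h) \<in> K \<and> norm (e *\<^sub>R (x + s *\<^sub>R h)) < d) (at_right 0)"
   moreover have "eventually (%s. g (a + \<xi> *\<^sub>R x + (s * \<xi>) *\<^sub>R h) = g (a + \<xi> *\<^sub>R x) + (s * \<xi>) * (inner w h + \<mu> * max 0 (inner n h))) (at_right 0)"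
    using eventually_at_right_0_scale[OF breaks_at_line[OF n(2), of h] \<xi>(1)] by eventually_elim blast
   ultimately show "eventually (%s. g (a + e *\<^sub>R (x + s *\<^sub>R h)) = g (a + e *\<^sub>R x) + s * (e * (inner w h + \<mu> * max 0 (inner n h)))) (at_right 0)"
   proof eventually_elim
    case (elim s)
    let ?c = "inner w h + \<mu> * max 0 (inner n h)"
    have "g (a + \<xi> *\<^sub>R (x + s *\<^sub>R h)) = g a + \<xi> / e * (g (a + e *\<^sub>R (x + s *\<^sub>R h)) - g a)"
     by (rule conic_ray) (use elim \<xi> e in auto)
    moreover have "g (a + \<xi> *\<^sub>R x) = g a + \<xi> / e * (g (a + e *\<^sub>R x) - g a)"
     by (rule conic_ray) (use xK norm \<xi> e in auto)
    moreover have "a + \<xi> *\<^sub>R x + (s * \<xi>) *\<^sub>R h = a + \<xi> *\<^sub>R (x + s *\<^sub>R h)" by (simp add: algebra_simps)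
    ultimately have "\<xi> / e * g (a + e *\<^sub>R (x + s *\<^sub>R h)) = \<xi> / e * (g (a + e *\<^sub>R x) + s * (e * ?c))"
     using elim(2) e by (simp add: algebra_simps)
    then show ?case using \<xi> e by simp
   qed
  qed
 qed
qed

text \<open>By homogeneity the slope at the end of the segment, which is \<open>inner G x\<close>,
  is the slope of the whole segment from \<open>a\<close>.\<close>

lemma end_gradient:
 assumes x: "a + e *\<^sub>R x \<in> K" "norm (e *\<^sub>R x) < d" "0 < e"
  and G: "eventually (%y. g y = inner G y + c) (near K (a + e *\<^sub>R x))"
 shows "g (a + e *\<^sub>R x) = g a + e * inner G x"
proof -
 let ?z = "a + e *\<^sub>R x"
 have seg: "a + s *\<^sub>R x \<in> K" if "0 \<le> s" "s \<le> e" for s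
 proof -
  have "(1 - s / e) *\<^sub>R a + (s / e) *\<^sub>R ?z \<in> K"
   by (rule convexD_alt[OF convex_K a_in x(1)]) (use that x(3) in auto)
  then show ?thesis using x(3) by (simp add: algebra_simps)
 qed
 have sm: "eventually (%s. 0 < s \<and> s < e) (at_right 0)"
  by (rule eventually_at_right_0I[OF x(3)]) auto
 have p: "?z + s *\<^sub>R (- x) = a + (e - s) *\<^sub>R x" for s by (simp add: algebra_simps)
 have "eventually (%s. ?z + s *\<^sub>R (- x) \<in> K) (at_right 0)"
  using sm by eventually_elim (unfold p, rule seg, auto)
 from eventually_conj[OF eventually_near_ray[OF G this] sm]
 obtain s where s: "0 < s" "s < e" "g (?z + s *\<^sub>R (- x)) = inner G (?z + s *\<^sub>R (- x)) + c"
  by (rule eventually_at_right_0E[OF _ x(3)]) (rule that, auto)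
 have z: "g ?z = inner G ?z + c" by (rule eventually_near_self[OF G x(1)])
 have "g (?z + s *\<^sub>R (- x)) = g ?z - s * inner G x"
  unfolding s(3) z inner_add_right inner_scaleR_right inner_minus_right by linarith
 moreover have "g (?z + s *\<^sub>R (- x)) = g a + (e - s) / e * (g ?z - g a)"
  unfolding p by (rule conic_ray[OF x(1,2)]) (use s x(3) in auto)
 moreover have "(e - s) / e * (g ?z - g a) = (g ?z - g a) - s * ((g ?z - g a) / e)"
  using x(3) by (simp add: field_simps)
 ultimately have "s * ((g ?z - g a) / e) = s * inner G x" by linarith
 then have "(g ?z - g a) / e = inner G x" using s(1) by (metis mult_cancel_left less_irrefl)
 then show ?thesis using x(3) by (simp add: field_simps)
qed

text \<open>The path around \<open>a\<close> bends \<open>g\<close> exactly where it crosses a ray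
  of breaks. At the crossing \<open>A + \<tau> *\<^sub>R B = r *\<^sub>R u\<close> the jump is
  \<open>e * D u / r\<close>, while the affine weight \<open>inner w A + inner w B * \<tau>\<close>
  is \<open>r * inner w u\<close>; so \<open>r\<close> cancels, and summation by parts leaves only
  the gradients at the two ends.\<close>

theorem path_sum:
 assumes det: "\<bar>det2 A B\<bar> = 1" and \<tau>: "\<tau>0 < \<tau>1" and e: "e > 0"
  and x0: "a + e *\<^sub>R (A + \<tau>0 *\<^sub>R B) \<in> K" "norm (e *\<^sub>R (A + \<tau>0 *\<^sub>R B)) < d"
  and x1: "a + e *\<^sub>R (A + \<tau>1 *\<^sub>R B) \<in> K" "norm (e *\<^sub>R (A + \<tau>1 *\<^sub>R B)) < d"
  and inside: "\<And>\<tau>. \<tau>0 < \<tau> ==> \<tau> < \<tau>1 ==> a + e *\<^sub>R (A + \<tau> *\<^sub>R B) \<in> interior K"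
  and G0: "eventually (%y. g y = inner G0 y + c0) (near K (a + e *\<^sub>R (A + \<tau>0 *\<^sub>R B)))"
  and G1: "eventually (%y. g y = inner G1 y + c1) (near K (a + e *\<^sub>R (A + \<tau>1 *\<^sub>R B)))"
 defines "U \<equiv> {u. primitive_vec u \<and> D u \<noteq> 0 \<and> (\<exists>\<tau> r. \<tau>0 < \<tau> \<and> \<tau> < \<tau>1 \<and> r > 0 \<and> A + \<tau> *\<^sub>R B = r *\<^sub>R u)}"
 shows "finite U" and "(\<Sum>u\<in>U. D u * inner w u) =
   (inner G1 B * inner w A - inner G1 A * inner w B) - (inner G0 B * inner w A - inner G0 A * inner w B)"
proof -
 define k where "k \<tau> = g (a + e *\<^sub>R (A + \<tau> *\<^sub>R B))" for \<tau>
 have line: "a + e *\<^sub>R (A + \<tau> *\<^sub>R B) = (a + e *\<^sub>R A) + \<tau> *\<^sub>R (e *\<^sub>R B)" for \<tau> by (simp add: algebra_simps)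
 have comb: "A + \<tau> *\<^sub>R B = (1 - (\<tau> - \<tau>0) / (\<tau>1 - \<tau>0)) *\<^sub>R (A + \<tau>0 *\<^sub>R B) + ((\<tau> - \<tau>0) / (\<tau>1 - \<tau>0)) *\<^sub>R (A + \<tau>1 *\<^sub>R B)" for \<tau>
 proof -
  define r where "r = (\<tau> - \<tau>0) / (\<tau>1 - \<tau>0)"
  have "r * (\<tau>1 - \<tau>0) = \<tau> - \<tau>0" using \<tau> by (simp add: r_def)
  then have "\<tau> = \<tau>0 + r * (\<tau>1 - \<tau>0)" by simp
  then show ?thesis unfolding r_def[symmetric] by (simp only:) (simp add: algebra_simps)
 qed
 have inK: "a + e *\<^sub>R (A + \<tau> *\<^sub>R B) \<in> K" "norm (e *\<^sub>R (A + \<tau> *\<^sub>R B)) < d" if "\<tau>0 \<le> \<tau>" "\<tau> \<le> \<tau>1" for \<tau>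
 proof -
  define r where "r = (\<tau> - \<tau>0) / (\<tau>1 - \<tau>0)"
  have r: "0 \<le> r" "r \<le> 1" using that \<tau> by (auto simp: r_def)
  note comb' = comb[of \<tau>, folded r_def]
  have "(1 - r) *\<^sub>R (a + e *\<^sub>R (A + \<tau>0 *\<^sub>R B)) + r *\<^sub>R (a + e *\<^sub>R (A + \<tau>1 *\<^sub>R B)) \<in> K"
   by (rule convexD_alt[OF convex_K x0(1) x1(1) r])
  moreover have "(1 - r) *\<^sub>R (a + e *\<^sub>R (A + \<tau>0 *\<^sub>R B)) + r *\<^sub>R (a + e *\<^sub>R (A + \<tau>1 *\<^sub>R B)) = a + e *\<^sub>R (A + \<tau> *\<^sub>R B)"
   unfolding comb' by (simp add: algebra_simps)
  ultimately show "a + e *\<^sub>R (A + \<tau> *\<^sub>R B) \<in> K" by simp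
  have "(1 - r) *\<^sub>R (e *\<^sub>R (A + \<tau>0 *\<^sub>R B)) + r *\<^sub>R (e *\<^sub>R (A + \<tau>1 *\<^sub>R B)) \<in> ball 0 d"
   by (rule convexD_alt[OF convex_ball _ _ r]) (use x0(2) x1(2) in auto)
  moreover have "(1 - r) *\<^sub>R (e *\<^sub>R (A + \<tau>0 *\<^sub>R B)) + r *\<^sub>R (e *\<^sub>R (A + \<tau>1 *\<^sub>R B)) = e *\<^sub>R (A + \<tau> *\<^sub>R B)"
   unfolding comb' by (simp add: algebra_simps)
  ultimately show "norm (e *\<^sub>R (A + \<tau> *\<^sub>R B)) < d" by simp
 qed
 have ne: "A + \<tau> *\<^sub>R B \<noteq> 0" for \<tau>
 proof
  assume "A + \<tau> *\<^sub>R B = 0"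
  then have "A = - (\<tau> *\<^sub>R B)" by (simp add: eq_neg_iff_add_eq_0)
  then show False using det by (simp add: det2_def)
 qed
 have "parts_formula k (inner w A) (inner w B) \<tau>0 \<tau>1"
 proof (rule summation_by_parts[OF \<tau>])
  fix t assume t: "\<tau>0 \<le> t" "t \<le> \<tau>1"
  have con: "conic K g ((a + e *\<^sub>R A) + t *\<^sub>R (e *\<^sub>R B))"
   unfolding line[symmetric] by (rule conic_K) (use inK[OF t] in \<open>simp_all add: dist_norm\<close>)
  show "conic {\<tau>0..\<tau>1} k t"
   unfolding k_def line by (rule conic_comp_line[OF con]) (unfold line[symmetric], use inK in simp)
 qed
 note parts = this[unfolded parts_formula_def]
 have point: "(jump k \<tau> = 0 \<and> (\<forall>u r. primitive_vec u --> r > 0 --> A + \<tau> *\<^sub>R B = r *\<^sub>R u --> D u = 0)) \<or>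
   (\<exists>u r. primitive_vec u \<and> r > 0 \<and> A + \<tau> *\<^sub>R B = r *\<^sub>R u \<and> D u \<noteq> 0 \<and> jump k \<tau> = e * D u / r)"
  if t: "\<tau>0 < \<tau>" "\<tau> < \<tau>1" for \<tau>
 proof -
  let ?x = "A + \<tau> *\<^sub>R B"
  obtain \<mu> n v \<xi> c where n: "primitive_vec n" "\<mu> = 0 \<or> inner n ?x = 0"
   "\<And>u r. primitive_vec u ==> r > 0 ==> ?x = r *\<^sub>R u ==> D u = \<mu>"
   "\<And>h. eventually (%s. g (a + e *\<^sub>R (?x + s *\<^sub>R h)) = g (a + e *\<^sub>R ?x) + s * (e * (inner v h + \<mu> * max 0 (inner n h)))) (at_right 0)
    \<or> \<not> eventually (%s. a + e *\<^sub>R (?x + s *\<^sub>R h) \<in> K \<and> norm (e *\<^sub>R (?x + s *\<^sub>R h)) < d) (at_right 0)"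
   "0 < \<xi>" "\<xi> < e"
   "eventually (%y. g y = inner v y + c + \<mu> * max 0 (inner n (y - (a + \<xi> *\<^sub>R ?x)))) (nhds (a + \<xi> *\<^sub>R ?x))"
   by (rule path_point[OF e inside[OF t] _ ne]) (use inK(2)[of \<tau>] t in simp, rule that)
  have s1: "?x + s *\<^sub>R B = A + (\<tau> + s) *\<^sub>R B" "?x + s *\<^sub>R (- B) = A + (\<tau> - s) *\<^sub>R B" for s
   by (simp_all add: algebra_simps)
  have ev: "eventually (%s. a + e *\<^sub>R (?x + s *\<^sub>R B) \<in> K \<and> norm (e *\<^sub>R (?x + s *\<^sub>R B)) < d) (at_right 0)"
   "eventually (%s. a + e *\<^sub>R (?x + s *\<^sub>R (- B)) \<in> K \<and> norm (e *\<^sub>R (?x + s *\<^sub>R (- B))) < d) (at_right 0)"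
   unfolding s1
   by (rule eventually_at_right_0I[of "\<tau>1 - \<tau>"], use t inK in simp, use t inK in simp)
    (rule eventually_at_right_0I[of "\<tau> - \<tau>0"], use t inK in simp, use t inK in simp)
  have "rslope (%s. k (\<tau> + s)) = e * (inner v B + \<mu> * max 0 (inner n B))"
   by (rule rslope_eqI) (use n(4)[of B] ev(1) in \<open>simp add: k_def s1\<close>)
  moreover have "rslope (%s. k (\<tau> - s)) = e * (inner v (- B) + \<mu> * max 0 (inner n (- B)))"
   by (rule rslope_eqI) (use n(4)[of "- B"] ev(2) in \<open>simp add: k_def s1 del: scaleR_minus_right inner_minus_right\<close>)
  moreover have "max 0 t + max 0 (- t) = \<bar>t\<bar>" for t :: real by (simp add: max_def abs_if)
  note this[of "inner n B"]
  ultimately have jump: "jump k \<tau> = e * (\<mu> * \<bar>inner n B\<bar>)"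
   unfolding jump_def by (simp add: distrib_left[symmetric] flip: \<open>max 0 (inner n B) + max 0 (- inner n B) = \<bar>inner n B\<bar>\<close>)
  show ?thesis
  proof (cases "\<mu> = 0")
   case True
   then show ?thesis using jump n(3) by simp
  next
   case False
   then have nx: "inner n ?x = 0" using n(2) by simp
   obtain n1 n2 where nn: "n = (n1, n2)" by (cases n)
   have nne: "n1 \<noteq> 0 \<or> n2 \<noteq> 0" using primitive_nonzero[OF n(1)] nn by (auto simp: zero_prod_def)
   \<comment> \<open>The break line is orthogonal to \<open>n\<close>, so the point is a multiple of
     \<open>n\<close> rotated by a right angle; the sign of the multiple decides which of the two
     primitive directions \<open>u\<close> is met.\<close>
   define \<rho> where "\<rho> = (if n1 \<noteq> 0 then snd ?x / n1 else - fst ?x / n2)"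
   have x\<rho>: "?x = \<rho> *\<^sub>R (- n2, n1)"
    using nx nne by (cases ?x) (auto simp: \<rho>_def nn inner_prod_def field_simps eq_neg_iff_add_eq_0)
   define u where "u = (if \<rho> > 0 then (- n2, n1) else (n2, - n1))"
   have u: "primitive_vec u"
    using primitive_rotate[of n1 n2] primitive_minus[of "(- n2, n1)"] n(1) by (simp add: nn u_def)
   have r: "\<bar>\<rho>\<bar> > 0" using ne[of \<tau>] x\<rho> by (auto simp: zero_prod_def)
   have xu: "?x = \<bar>\<rho>\<bar> *\<^sub>R u" using x\<rho> r by (auto simp: u_def abs_if split: if_splits)
   \<comment> \<open>Up to sign this is the determinant of the point and \<open>B\<close>, which
     stays equal to the one of \<open>A\<close> and \<open>B\<close> all along the path. This is the
     reason for demanding determinant 1 up to sign.\<close>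
   have "\<bar>\<rho>\<bar> * \<bar>inner n B\<bar> = 1"
   proof -
    have "\<rho> * inner n B = - det2 ?x B \<or> \<rho> * inner n B = det2 ?x B"
     unfolding x\<rho> by (cases B) (auto simp: nn det2_def algebra_simps)
    moreover have "det2 ?x B = det2 A B" by (simp add: det2_def algebra_simps)
    ultimately show ?thesis using det by (auto simp: abs_mult[symmetric])
   qed
   then have "\<bar>inner n B\<bar> = 1 / \<bar>\<rho>\<bar>" using r by (simp add: field_simps)
   then show ?thesis using jump n(3)[OF u r xu] u r xu False by (intro disjI2 exI[of _ u] exI[of _ "\<bar>\<rho>\<bar>"]) simp
  qed
 qed
 define S where "S = {t\<in>{\<tau>0<..<\<tau>1}. jump k t \<noteq> 0}"
 have finS: "finite S" using parts unfolding S_def by blast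
 have "\<exists>u r. primitive_vec u \<and> r > 0 \<and> A + t *\<^sub>R B = r *\<^sub>R u \<and> D u \<noteq> 0 \<and> jump k t = e * D u / r" if "t \<in> S" for t
  using point[of t] that unfolding S_def by auto
 then obtain u r where ur: "\<And>t. t \<in> S ==> primitive_vec (u t)" "\<And>t. t \<in> S ==> r t > 0"
  "\<And>t. t \<in> S ==> A + t *\<^sub>R B = r t *\<^sub>R u t" "\<And>t. t \<in> S ==> D (u t) \<noteq> 0" "\<And>t. t \<in> S ==> jump k t = e * D (u t) / r t"
  by metis
 have ray_inj: "t = t'" if "A + t *\<^sub>R B = p *\<^sub>R v" "A + t' *\<^sub>R B = p' *\<^sub>R v" "p > 0" "p' > 0" for t t' p p' v
 proof -
  have "det2 (A + t *\<^sub>R B) (A + t' *\<^sub>R B) = 0" unfolding that by (simp add: det2_def)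
  then have "(t' - t) * det2 A B = 0" by (simp add: det2_def algebra_simps)
  then show ?thesis using det by auto
 qed
 have Ueq: "U = u ` S"
 proof (rule subset_antisym; rule subsetI)
  fix v assume v: "v \<in> U"
  then obtain t p where t: "\<tau>0 < t" "t < \<tau>1" "p > 0" "A + t *\<^sub>R B = p *\<^sub>R v" "primitive_vec v" "D v \<noteq> 0"
   unfolding U_def by blast
  have "jump k t \<noteq> 0" using point[OF t(1,2)]
  proof (elim disjE exE conjE)
   assume "\<forall>u r. primitive_vec u --> r > 0 --> A + t *\<^sub>R B = r *\<^sub>R u --> D u = 0"
   then have "D v = 0" using t(3-5) by blast
   then show ?thesis using t(6) by blast
  next
   fix u r assume "r > 0" "D u \<noteq> 0" "jump k t = e * D u / r"
   then show ?thesis using e by simp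
  qed
  then have tS: "t \<in> S" using t by (simp add: S_def)
  have "v = u t"
  proof (rule primitive_same_ray[OF t(5) ur(1)[OF tS], of "r t / p"])
   have "p *\<^sub>R v = r t *\<^sub>R u t" using t(4) ur(3)[OF tS] by simp
   then have "inverse p *\<^sub>R p *\<^sub>R v = inverse p *\<^sub>R r t *\<^sub>R u t" by simp
   then show "v = (r t / p) *\<^sub>R u t" using t(3) by (simp add: divide_inverse mult.commute)
  qed (use ur(2)[OF tS] t(3) in simp)
  then show "v \<in> u ` S" using tS by blast
 next
  fix v assume "v \<in> u ` S"
  then obtain t where t: "t \<in> S" "v = u t" by blast
  then have "\<tau>0 < t" "t < \<tau>1" by (auto simp: S_def)
  then show "v \<in> U" unfolding U_def using ur(1-4)[OF t(1)] t(2) by blast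
 qed
 show "finite U" unfolding Ueq using finS by blast
 have inj: "inj_on u S"
 proof (rule inj_onI)
  fix t t' assume t: "t \<in> S" "t' \<in> S" "u t = u t'"
  show "t = t'" by (rule ray_inj[OF ur(3)[OF t(1)] ur(3)[OF t(2), folded t(3)] ur(2)[OF t(1)] ur(2)[OF t(2)]])
 qed
 have "e * (\<Sum>u\<in>U. D u * inner w u) = (\<Sum>t\<in>S. e * (D (u t) * inner w (u t)))"
  unfolding Ueq sum.reindex[OF inj] by (simp add: sum_distrib_left)
 also have "\<dots> = (\<Sum>t\<in>S. jump k t * (inner w A + inner w B * t))"
 proof (rule sum.cong[OF refl])
  fix t assume t: "t \<in> S"
  have "inner w A + inner w B * t = inner w (A + t *\<^sub>R B)" by (simp add: inner_add_right)
  also have "\<dots> = r t * inner w (u t)" unfolding ur(3)[OF t] by simp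
  finally show "e * (D (u t) * inner w (u t)) = jump k t * (inner w A + inner w B * t)"
   using ur(2,5)[OF t] by simp
 qed
 also have "\<dots> = - rslope (%\<xi>. k (\<tau>1 - \<xi>)) * (inner w A + inner w B * \<tau>1) - k \<tau>1 * inner w B
    - (rslope (%\<xi>. k (\<tau>0 + \<xi>)) * (inner w A + inner w B * \<tau>0) - k \<tau>0 * inner w B)"
  using parts unfolding S_def by blast
 also have "rslope (%\<xi>. k (\<tau>0 + \<xi>)) = e * inner G0 B"
 proof (rule rslope_eqI)
  have p: "a + e *\<^sub>R (A + \<tau>0 *\<^sub>R B) + \<xi> *\<^sub>R (e *\<^sub>R B) = a + e *\<^sub>R (A + (\<tau>0 + \<xi>) *\<^sub>R B)" for \<xi> by (simp add: algebra_simps)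
  have "eventually (%\<xi>. a + e *\<^sub>R (A + \<tau>0 *\<^sub>R B) + \<xi> *\<^sub>R (e *\<^sub>R B) \<in> K) (at_right 0)"
   unfolding p by (rule eventually_at_right_0I[of "\<tau>1 - \<tau>0"]) (use \<tau> inK in auto)
  from eventually_near_ray[OF G0 this]
  show "eventually (%\<xi>. k (\<tau>0 + \<xi>) = k (\<tau>0 + 0) + \<xi> * (e * inner G0 B)) (at_right 0)"
  proof eventually_elim
   case (elim \<xi>)
   then show ?case unfolding p using eventually_near_self[OF G0 x0(1)]
    by (simp add: k_def inner_add_right algebra_simps)
  qed
 qed
 also have "rslope (%\<xi>. k (\<tau>1 - \<xi>)) = - (e * inner G1 B)"
 proof (rule rslope_eqI)
  have p: "a + e *\<^sub>R (A + \<tau>1 *\<^sub>R B) + \<xi> *\<^sub>R (- (e *\<^sub>R B)) = a + e *\<^sub>R (A + (\<tau>1 - \<xi>) *\<^sub>R B)" for \<xi> by (simp add: algebra_simps)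
  have "eventually (%\<xi>. a + e *\<^sub>R (A + \<tau>1 *\<^sub>R B) + \<xi> *\<^sub>R (- (e *\<^sub>R B)) \<in> K) (at_right 0)"
   unfolding p by (rule eventually_at_right_0I[of "\<tau>1 - \<tau>0"]) (use \<tau> inK in auto)
  from eventually_near_ray[OF G1 this]
  show "eventually (%\<xi>. k (\<tau>1 - \<xi>) = k (\<tau>1 - 0) + \<xi> * - (e * inner G1 B)) (at_right 0)"
  proof eventually_elim
   case (elim \<xi>)
   then show ?case unfolding p using eventually_near_self[OF G1 x1(1)]
    by (simp add: k_def inner_add_right algebra_simps)
  qed
 qed
 also have "k \<tau>0 = g a + e * (inner G0 A + \<tau>0 * inner G0 B)"
  unfolding k_def using end_gradient[OF x0 e G0] by (simp add: inner_add_right)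
 also have "k \<tau>1 = g a + e * (inner G1 A + \<tau>1 * inner G1 B)"
  unfolding k_def using end_gradient[OF x1 e G1] by (simp add: inner_add_right)
 finally have "e * (\<Sum>u\<in>U. D u * inner w u) = e * ((inner G1 B * inner w A - inner G1 A * inner w B) - (inner G0 B * inner w A - inner G0 A * inner w B))"
  by (simp add: algebra_simps)
 then show "(\<Sum>u\<in>U. D u * inner w u) =
   (inner G1 B * inner w A - inner G1 A * inner w B) - (inner G0 B * inner w A - inner G0 A * inner w B)"
  using e by simp
qed

end

text \<open>By the Cauchy--Binet identity this is \<open>det2 G w * det2 E V\<close>. It is
  antisymmetric in the two gradients, and this is what makes the reciprocity exchange the two
  functions.\<close>

definition boundary_term :: "real \<times> real => real \<times> real => real \<times> real => real \<times> real => real" where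
 "boundary_term G w E V = inner G E * inner w V - inner G V * inner w E"

section \<open>Sums over the break directions in an angle\<close>

context pl_germ
begin

text \<open>At a corner of \<open>K\<close>, the straight path from one side to the other meets
  every ray that points into \<open>K\<close>, once each.\<close>

lemma corner_sum:
 assumes det: "\<bar>det2 E1 E2\<bar> = 1" and e: "e > 0"
  and x1: "a + e *\<^sub>R E1 \<in> K" "norm (e *\<^sub>R E1) < d" and x2: "a + e *\<^sub>R E2 \<in> K" "norm (e *\<^sub>R E2) < d"
  and inside: "\<And>\<tau>. 0 < \<tau> ==> \<tau> < 1 ==> a + e *\<^sub>R ((1 - \<tau>) *\<^sub>R E1 + \<tau> *\<^sub>R E2) \<in> interior K"
  and inward: "\<And>p q. eventually (%\<xi>. a + \<xi> *\<^sub>R (p *\<^sub>R E1 + q *\<^sub>R E2) \<in> interior K) (at_right 0) \<longleftrightarrow> 0 < p \<and> 0 < q"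
  and G1: "eventually (%y. g y = inner G1 y + c1) (near K (a + e *\<^sub>R E1))"
  and G2: "eventually (%y. g y = inner G2 y + c2) (near K (a + e *\<^sub>R E2))"
 defines "U \<equiv> {u. primitive_vec u \<and> D u \<noteq> 0 \<and> eventually (%\<xi>. a + \<xi> *\<^sub>R u \<in> interior K) (at_right 0)}"
 shows "finite U" "(\<Sum>u\<in>U. D u * inner w u) = boundary_term G1 w E1 E2 + boundary_term G2 w E2 E1"
proof -
 have comb: "E1 + \<tau> *\<^sub>R (E2 - E1) = (1 - \<tau>) *\<^sub>R E1 + \<tau> *\<^sub>R E2" for \<tau> by (simp add: algebra_simps)
 have ex: "\<exists>p q. u = p *\<^sub>R E1 + q *\<^sub>R E2" for u
 proof -
  have d0: "det2 E1 E2 \<noteq> 0" using det by auto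
  have "det2 u E2 *\<^sub>R E1 + det2 E1 u *\<^sub>R E2 = det2 E1 E2 *\<^sub>R u"
   by (cases u; cases E1; cases E2) (simp add: det2_def algebra_simps)
  then have "(1 / det2 E1 E2) *\<^sub>R (det2 u E2 *\<^sub>R E1 + det2 E1 u *\<^sub>R E2) = u" using d0 by simp
  then have "u = (det2 u E2 / det2 E1 E2) *\<^sub>R E1 + (det2 E1 u / det2 E1 E2) *\<^sub>R E2"
   by (simp add: scaleR_add_right)
  then show ?thesis by blast
 qed
 let ?U = "{u. primitive_vec u \<and> D u \<noteq> 0 \<and> (\<exists>\<tau> r. 0 < \<tau> \<and> \<tau> < 1 \<and> r > 0 \<and> E1 + \<tau> *\<^sub>R (E2 - E1) = r *\<^sub>R u)}"
 have U: "U = ?U"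
 proof -
  have "eventually (%\<xi>. a + \<xi> *\<^sub>R u \<in> interior K) (at_right 0) \<longleftrightarrow>
    (\<exists>\<tau> r. 0 < \<tau> \<and> \<tau> < 1 \<and> r > 0 \<and> E1 + \<tau> *\<^sub>R (E2 - E1) = r *\<^sub>R u)" for u
  proof
   assume ev: "eventually (%\<xi>. a + \<xi> *\<^sub>R u \<in> interior K) (at_right 0)"
   obtain p q where u: "u = p *\<^sub>R E1 + q *\<^sub>R E2" using ex by blast
   have pq: "0 < p" "0 < q" using ev inward unfolding u by auto
   have "E1 + (q / (p + q)) *\<^sub>R (E2 - E1) = (1 / (p + q)) *\<^sub>R u"
   proof -
    have "1 - q / (p + q) = p / (p + q)" using pq by (simp add: field_simps)
    then show ?thesis unfolding comb u by (simp add: scaleR_add_right)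
   qed
   moreover have "0 < q / (p + q)" "q / (p + q) < 1" "1 / (p + q) > 0" using pq by auto
   ultimately show "\<exists>\<tau> r. 0 < \<tau> \<and> \<tau> < 1 \<and> r > 0 \<and> E1 + \<tau> *\<^sub>R (E2 - E1) = r *\<^sub>R u" by blast
  next
   assume "\<exists>\<tau> r. 0 < \<tau> \<and> \<tau> < 1 \<and> r > 0 \<and> E1 + \<tau> *\<^sub>R (E2 - E1) = r *\<^sub>R u"
   then obtain \<tau> r where t: "0 < \<tau>" "\<tau> < 1" "r > 0" "E1 + \<tau> *\<^sub>R (E2 - E1) = r *\<^sub>R u" by blast
   have "u = (1 / r) *\<^sub>R ((1 - \<tau>) *\<^sub>R E1 + \<tau> *\<^sub>R E2)"
    unfolding comb[symmetric] t(4) using t(3) by simp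
   then have "u = ((1 - \<tau>) / r) *\<^sub>R E1 + (\<tau> / r) *\<^sub>R E2" by (simp add: scaleR_add_right)
   then show "eventually (%\<xi>. a + \<xi> *\<^sub>R u \<in> interior K) (at_right 0)" using inward t by simp
  qed
  then show ?thesis unfolding U_def by simp
 qed
 have det': "\<bar>det2 E1 (E2 - E1)\<bar> = 1" using det by (simp add: det2_def algebra_simps)
 have z01: "(0::real) < 1" by simp
 note ps = path_sum[OF det' z01 e, of G1 c1 G2 c2, unfolded comb]
 have p0: "(1 - 0) *\<^sub>R E1 + 0 *\<^sub>R E2 = E1" "(1 - 1) *\<^sub>R E1 + 1 *\<^sub>R E2 = E2" by simp_all
 note ps' = ps[unfolded p0, OF x1 x2 inside G1 G2, simplified comb[symmetric]]
 show "finite U" unfolding U comb using ps'(1) unfolding comb by simp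
 have "(\<Sum>u\<in>?U. D u * inner w u) =
   (inner G2 (E2 - E1) * inner w E1 - inner G2 E1 * inner w (E2 - E1)) - (inner G1 (E2 - E1) * inner w E1 - inner G1 E1 * inner w (E2 - E1))"
  using ps'(2) unfolding comb by simp
 then show "(\<Sum>u\<in>U. D u * inner w u) = boundary_term G1 w E1 E2 + boundary_term G2 w E2 E1"
  unfolding U boundary_term_def by (simp add: inner_diff_right algebra_simps)
qed

text \<open>The path runs parallel to \<open>E\<close> at a small height above \<open>a\<close>. It
  misses the directions close to \<open>E\<close> and \<open>- E\<close>, but these carry no breaks:
  they lead into the neighbourhoods of the two end points in which \<open>g\<close> is
  affine.\<close>

lemma half_plane_sum:
 assumes det: "\<bar>det2 E V\<bar> = 1" and e: "e1 > 0" "e2 > 0" "e3 > 0"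
  and inside: "\<And>p q. - e2 \<le> p ==> p \<le> e1 ==> 0 < q ==> q \<le> e3 ==> a + p *\<^sub>R E + q *\<^sub>R V \<in> interior K"
  and norm: "norm (e1 *\<^sub>R E) + norm (e3 *\<^sub>R V) < d" "norm (e2 *\<^sub>R E) + norm (e3 *\<^sub>R V) < d"
  and ends: "a + e1 *\<^sub>R E \<in> K" "a - e2 *\<^sub>R E \<in> K"
  and G1: "eventually (%y. g y = inner G1 y + c1) (near K (a + e1 *\<^sub>R E))"
  and G2: "eventually (%y. g y = inner G2 y + c2) (near K (a - e2 *\<^sub>R E))"
 defines "U \<equiv> {u. primitive_vec u \<and> D u \<noteq> 0 \<and> (\<exists>p q. q > 0 \<and> u = p *\<^sub>R E + q *\<^sub>R V)}"
 shows "finite U" "(\<Sum>u\<in>U. D u * inner w u) = boundary_term G1 w E V - boundary_term G2 w E V"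
proof -
 obtain r1 where r1: "r1 > 0" "\<And>z. z \<in> K ==> dist z (a + e1 *\<^sub>R E) < r1 ==> eventually (%y. g y = inner G1 y + c1) (near K z)"
  using eventually_near_eventually[OF G1] unfolding eventually_near_metric[where p="a + e1 *\<^sub>R E"] by blast
 obtain r2 where r2: "r2 > 0" "\<And>z. z \<in> K ==> dist z (a - e2 *\<^sub>R E) < r2 ==> eventually (%y. g y = inner G2 y + c2) (near K z)"
  using eventually_near_eventually[OF G2] unfolding eventually_near_metric[where p="a - e2 *\<^sub>R E"] by blast
 \<comment> \<open>The height is so small that both ends of the path, moved by at most this height
   in the direction \<open>V\<close>, keep the gradients \<open>G1\<close> and
   \<open>G2\<close>.\<close>
 define e where "e = min e3 (min r1 r2 / (norm V + 1)) / 2"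
 have nV: "norm V + 1 > 0" using norm_ge_zero[of V] by linarith
 have ep: "e > 0" "e < e3"
 proof -
  define M where "M = min r1 r2 / (norm V + 1)"
  have "M > 0" using r1 r2 nV by (simp add: M_def)
  then have "min e3 M > 0" "min e3 M \<le> e3" using e by auto
  then show "e > 0" "e < e3" unfolding e_def M_def[symmetric] by linarith+
 qed
 have eV: "q * norm V < r1" "q * norm V < r2" if "0 \<le> q" "q \<le> e" for q
 proof -
  define M where "M = min r1 r2 / (norm V + 1)"
  have "M > 0" "min e3 M \<le> M" using r1 r2 nV by (auto simp: M_def)
  then have "e < min r1 r2 / (norm V + 1)" unfolding e_def M_def[symmetric] by linarith
  then have "e * (norm V + 1) < min r1 r2" using nV by (simp add: pos_less_divide_eq)
  moreover have "q * norm V \<le> e * (norm V + 1)" using that by (intro mult_mono) auto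
  ultimately show "q * norm V < r1" "q * norm V < r2" by auto
 qed
 have nb: "norm (p *\<^sub>R E + q *\<^sub>R V) < d" if "- e2 \<le> p" "p \<le> e1" "0 \<le> q" "q \<le> e3" for p q
 proof -
  have "norm (p *\<^sub>R E + q *\<^sub>R V) \<le> \<bar>p\<bar> * norm E + q * norm V"
   using norm_triangle_ineq[of "p *\<^sub>R E" "q *\<^sub>R V"] that by simp
  also have "\<dots> \<le> \<bar>p\<bar> * norm E + norm (e3 *\<^sub>R V)" using that e by (simp add: mult_right_mono)
  also have "\<dots> < d"
  proof (cases "p \<ge> 0")
   case True
   then have "\<bar>p\<bar> * norm E \<le> norm (e1 *\<^sub>R E)" using that by (simp add: mult_right_mono)
   then show ?thesis using norm by linarith
  next
   case False
   then have "\<bar>p\<bar> * norm E \<le> e2 * norm E" using that by (intro mult_right_mono) auto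
   then have "\<bar>p\<bar> * norm E \<le> norm (e2 *\<^sub>R E)" using e by simp
   then show ?thesis using norm by linarith
  qed
  finally show ?thesis .
 qed
 have x: "e *\<^sub>R (V + \<tau> *\<^sub>R (- E)) = (- e * \<tau>) *\<^sub>R E + e *\<^sub>R V" for e \<tau> by (simp add: algebra_simps)
 have gr1: "eventually (%y. g y = inner G1 y + c1) (near K (a + (e1 *\<^sub>R E + q *\<^sub>R V)))" if "0 < q" "q \<le> e" for q
 proof (rule r1(2))
  show "a + (e1 *\<^sub>R E + q *\<^sub>R V) \<in> K"
   using inside[of e1 q] that ep e interior_subset[of K] by (auto simp: add.assoc)
  have "dist (a + (e1 *\<^sub>R E + q *\<^sub>R V)) (a + e1 *\<^sub>R E) = q * norm V" using that by (simp add: dist_norm)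
  then show "dist (a + (e1 *\<^sub>R E + q *\<^sub>R V)) (a + e1 *\<^sub>R E) < r1" using eV that by simp
 qed
 have gr2: "eventually (%y. g y = inner G2 y + c2) (near K (a + ((- e2) *\<^sub>R E + q *\<^sub>R V)))" if "0 < q" "q \<le> e" for q
 proof (rule r2(2))
  have "a + (- e2) *\<^sub>R E + q *\<^sub>R V \<in> interior K" by (rule inside) (use that ep e in auto)
  then show "a + ((- e2) *\<^sub>R E + q *\<^sub>R V) \<in> K" unfolding add.assoc using interior_subset by blast
  have "dist (a + ((- e2) *\<^sub>R E + q *\<^sub>R V)) (a - e2 *\<^sub>R E) = q * norm V" using that by (simp add: dist_norm)
  then show "dist (a + ((- e2) *\<^sub>R E + q *\<^sub>R V)) (a - e2 *\<^sub>R E) < r2" using eV that by simp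
 qed
 let ?t0 = "- e1 / e" and ?t1 = "e2 / e"
 have m: "- e * ?t0 = e1" "- e * ?t1 = - e2" using ep by simp_all
 have det': "\<bar>det2 V (- E)\<bar> = 1" using det by (simp add: det2_def algebra_simps)
 let ?U = "{u. primitive_vec u \<and> D u \<noteq> 0 \<and> (\<exists>\<tau> r. ?t0 < \<tau> \<and> \<tau> < ?t1 \<and> r > 0 \<and> V + \<tau> *\<^sub>R (- E) = r *\<^sub>R u)}"
 have t01: "?t0 < ?t1" using ep e by (meson divide_pos_pos less_trans neg_less_0_iff_less divide_neg_pos)
 have "a + e1 *\<^sub>R E + e *\<^sub>R V \<in> interior K" "a + (- e2) *\<^sub>R E + e *\<^sub>R V \<in> interior K"
  by (rule inside; use ep e in simp)+
 then have in0: "a + (e1 *\<^sub>R E + e *\<^sub>R V) \<in> K" "a + ((- e2) *\<^sub>R E + e *\<^sub>R V) \<in> K"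
  unfolding add.assoc using interior_subset by blast+
 have ins: "a + e *\<^sub>R (V + \<tau> *\<^sub>R (- E)) \<in> interior K" if "?t0 < \<tau>" "\<tau> < ?t1" for \<tau>
 proof -
  have "- e2 \<le> - e * \<tau>" "- e * \<tau> \<le> e1" using that ep by (auto simp: field_simps)
  from inside[OF this ep(1) less_imp_le[OF ep(2)]] have "a + (- e * \<tau>) *\<^sub>R E + e *\<^sub>R V \<in> interior K" .
  then show ?thesis unfolding x add.assoc .
 qed
 have ps: "finite ?U" "(\<Sum>u\<in>?U. D u * inner w u) =
   (inner G2 (- E) * inner w V - inner G2 V * inner w (- E)) - (inner G1 (- E) * inner w V - inner G1 V * inner w (- E))"
  by (rule path_sum[OF det' t01 ep(1) _ _ _ _ ins, where ?c0.0=c1 and ?c1.0=c2],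
    unfold x m; (use in0 nb[of e1 e] nb[of "- e2" e] ep e gr1[of e] gr2[of e] in simp))+
 \<comment> \<open>Directions too flat to be met by the path. They reach an end of the box at a
   height at most \<open>e\<close>, where \<open>g\<close> is affine in all directions; a break
   along the ray would persist there.\<close>
 have outside: "D u = 0" if u: "primitive_vec u" "q > 0" "u = p *\<^sub>R E + q *\<^sub>R V"
  and out: "p / q \<ge> e1 / e \<or> - p / q \<ge> e2 / e" for u p q
 proof -
  define pp where "pp = (if p / q \<ge> e1 / e then e1 else - e2)"
  define GG where "GG = (if p / q \<ge> e1 / e then G1 else G2)"
  define cc where "cc = (if p / q \<ge> e1 / e then c1 else c2)"
  \<comment> \<open>The height at which the ray of \<open>u\<close> reaches the end of the box with
    \<open>E\<close>-coordinate \<open>pp\<close>.\<close>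
  define b where "b = pp * q / p"
  have e1e: "e1 / e > 0" "e2 / e > 0" using e ep by simp_all
  have pne: "p \<noteq> 0" using out e1e by auto
  have b: "0 < b" "b \<le> e"
  proof -
   consider "p / q \<ge> e1 / e" | "\<not> p / q \<ge> e1 / e" "- p / q \<ge> e2 / e" using out by blast
   then have "0 < b \<and> b \<le> e"
   proof cases
    case 1
    then have "p / q > 0" using e1e by linarith
    then have "p > 0" using u(2) by (simp add: zero_less_divide_iff)
    moreover have "e1 * q \<le> p * e" using 1 u(2) ep by (simp add: field_simps)
    ultimately show ?thesis using 1 e u(2) by (simp add: b_def pp_def field_simps)
   next
    case 2
    then have "- p / q > 0" using e1e by linarith
    then have "p < 0" using u(2) by (simp add: divide_less_0_iff)
    moreover have "e2 * q \<le> - p * e" using 2(2) u(2) ep by (simp add: field_simps)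
    ultimately show ?thesis using 2 e u(2) by (simp add: b_def pp_def field_simps)
   qed
   then show "0 < b" "b \<le> e" by auto
  qed
  have bu: "(b / q) *\<^sub>R u = pp *\<^sub>R E + b *\<^sub>R V"
   using u(2) pne unfolding u(3) by (simp add: scaleR_add_right b_def)
  have bq: "b / q > 0" using b u(2) by simp
  have pr: "- e2 \<le> pp" "pp \<le> e1" using e by (auto simp: pp_def)
  have int: "a + (b / q) *\<^sub>R u \<in> interior K" unfolding bu using inside[OF pr b(1)] b ep by (simp add: add.assoc)
  have nrm: "norm ((b / q) *\<^sub>R u) < d" unfolding bu by (rule nb[OF pr]) (use b ep in auto)
  have aff: "eventually (%y. g y = inner GG y + cc) (nhds (a + (b / q) *\<^sub>R u))"
  proof (rule eventually_near_nhds[OF int])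
   show "eventually (%y. g y = inner GG y + cc) (near K (a + (b / q) *\<^sub>R u))"
    unfolding bu using gr1[OF b] gr2[OF b] by (simp add: pp_def GG_def cc_def)
  qed
  obtain \<mu> n v \<xi> c where n: "primitive_vec n" "\<mu> = 0 \<or> inner n u = 0"
   "\<And>u' r. primitive_vec u' ==> r > 0 ==> u = r *\<^sub>R u' ==> D u' = \<mu>"
   "\<And>h. eventually (%s. g (a + (b / q) *\<^sub>R (u + s *\<^sub>R h)) = g (a + (b / q) *\<^sub>R u) + s * ((b / q) * (inner v h + \<mu> * max 0 (inner n h)))) (at_right 0)
    \<or> \<not> eventually (%s. a + (b / q) *\<^sub>R (u + s *\<^sub>R h) \<in> K \<and> norm ((b / q) *\<^sub>R (u + s *\<^sub>R h)) < d) (at_right 0)"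
   "0 < \<xi>" "\<xi> < b / q"
   "eventually (%y. g y = inner v y + c + \<mu> * max 0 (inner n (y - (a + \<xi> *\<^sub>R u)))) (nhds (a + \<xi> *\<^sub>R u))"
   by (rule path_point[OF bq int nrm primitive_nonzero[OF u(1)]]) (rule that)
  have slope: "inner v h + \<mu> * max 0 (inner n h) = inner GG h" for h
  proof -
   have ln: "a + (b / q) *\<^sub>R (u + s *\<^sub>R h) = a + (b / q) *\<^sub>R u + s *\<^sub>R ((b / q) *\<^sub>R h)" for s
    by (simp add: algebra_simps)
   have 1: "eventually (%s. a + (b / q) *\<^sub>R (u + s *\<^sub>R h) \<in> interior K) (nhds 0)"
    unfolding ln by (rule eventually_nhds_line) (use int in \<open>auto intro: eventually_nhds_in_open\<close>)
   have "open {y. norm (y - a) < d}" by (intro open_Collect_less continuous_intros)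
   then have "eventually (%y. y \<in> {y. norm (y - a) < d}) (nhds (a + (b / q) *\<^sub>R u))"
    by (rule eventually_nhds_in_open) (use nrm in simp)
   from eventually_nhds_line[OF this, of "(b / q) *\<^sub>R h"]
   have 2: "eventually (%s. norm ((b / q) *\<^sub>R (u + s *\<^sub>R h)) < d) (nhds 0)"
    unfolding ln[symmetric] by simp
   have "eventually (%s. a + (b / q) *\<^sub>R (u + s *\<^sub>R h) \<in> K \<and> norm ((b / q) *\<^sub>R (u + s *\<^sub>R h)) < d) (nhds 0)"
    using 1 2 by eventually_elim (use interior_subset in blast)
   then have "eventually (%s. a + (b / q) *\<^sub>R (u + s *\<^sub>R h) \<in> K \<and> norm ((b / q) *\<^sub>R (u + s *\<^sub>R h)) < d) (at_right 0)"
    by (rule filter_leD[rotated]) (simp add: at_within_def)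
   then have A: "eventually (%s. g (a + (b / q) *\<^sub>R (u + s *\<^sub>R h)) = g (a + (b / q) *\<^sub>R u) + s * ((b / q) * (inner v h + \<mu> * max 0 (inner n h)))) (at_right 0)"
    using n(4)[of h] by blast
   have B: "eventually (%s. g (a + (b / q) *\<^sub>R (u + s *\<^sub>R h)) = inner GG (a + (b / q) *\<^sub>R (u + s *\<^sub>R h)) + cc) (at_right 0)"
    using eventually_nhds_line[OF aff, of "(b / q) *\<^sub>R h"] unfolding ln by (rule filter_leD[rotated]) (simp add: at_within_def)
   have z: "g (a + (b / q) *\<^sub>R u) = inner GG (a + (b / q) *\<^sub>R u) + cc" using aff by (rule eventually_nhds_x_imp_x)
   obtain s where s: "0 < s" "g (a + (b / q) *\<^sub>R (u + s *\<^sub>R h)) = g (a + (b / q) *\<^sub>R u) + s * ((b / q) * (inner v h + \<mu> * max 0 (inner n h)))"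
    "g (a + (b / q) *\<^sub>R (u + s *\<^sub>R h)) = inner GG (a + (b / q) *\<^sub>R (u + s *\<^sub>R h)) + cc"
    by (rule eventually_at_right_0E[OF eventually_conj[OF A B], of 1], simp, rule that, auto)
   have "inner GG (a + (b / q) *\<^sub>R (u + s *\<^sub>R h)) = inner GG (a + (b / q) *\<^sub>R u) + s * ((b / q) * inner GG h)"
    unfolding ln inner_add_right by simp
   then have "s * ((b / q) * (inner v h + \<mu> * max 0 (inner n h))) = s * ((b / q) * inner GG h)" using s(2,3) z by linarith
   then show ?thesis using s(1) bq by (metis mult_cancel_left less_irrefl)
  qed
  have "\<mu> * inner n n = 0"
  proof -
   have "inner n n \<ge> 0" by simp
   then have "max 0 (inner n n) = inner n n" "max 0 (inner n (- n)) = 0" by auto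
   with slope[of n] slope[of "- n"] show ?thesis by simp
  qed
  then have "\<mu> = 0" using primitive_nonzero[OF n(1)] by simp
  then show ?thesis using n(3)[OF u(1), of 1] by simp
 qed
 have U: "U = ?U"
 proof (rule subset_antisym; rule subsetI)
  fix u assume "u \<in> U"
  then obtain p q where u: "primitive_vec u" "D u \<noteq> 0" "q > 0" "u = p *\<^sub>R E + q *\<^sub>R V" unfolding U_def by blast
  have "\<not> (p / q \<ge> e1 / e)" "\<not> (- p / q \<ge> e2 / e)" using outside[OF u(1,3,4)] u(2) by blast+
  moreover have "V + (- p / q) *\<^sub>R (- E) = (1 / q) *\<^sub>R u"
   using u(3) unfolding u(4) by (simp add: scaleR_add_right)
  moreover have "1 / q > 0" using u(3) by simp
  ultimately have "\<exists>\<tau> r. ?t0 < \<tau> \<and> \<tau> < ?t1 \<and> r > 0 \<and> V + \<tau> *\<^sub>R (- E) = r *\<^sub>R u"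
   by (intro exI[of _ "- p / q"] exI[of _ "1 / q"]) (auto simp: not_le)
  then show "u \<in> ?U" using u(1,2) by blast
 next
  fix u assume "u \<in> ?U"
  then obtain \<tau> r where u: "primitive_vec u" "D u \<noteq> 0" "r > 0" "V + \<tau> *\<^sub>R (- E) = r *\<^sub>R u" by blast
  have "u = (1 / r) *\<^sub>R (V + \<tau> *\<^sub>R (- E))" unfolding u(4) using u(3) by simp
  then have "u = (- \<tau> / r) *\<^sub>R E + (1 / r) *\<^sub>R V" by (simp add: algebra_simps)
  moreover have "1 / r > 0" using u(3) by simp
  ultimately show "u \<in> U" unfolding U_def using u(1,2) by blast
 qed
 show "finite U" unfolding U by (rule ps(1))
 show "(\<Sum>u\<in>U. D u * inner w u) = boundary_term G1 w E V - boundary_term G2 w E V"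
  unfolding U ps(2) boundary_term_def by (simp add: algebra_simps)
qed

end

section \<open>Reciprocity on the standard triangle\<close>

definition side_dir :: "nat => real \<times> real" where
 "side_dir k = tri_side k 1 - tri_side k 0"

lemma tri_side_affine: "k < 3 ==> tri_side k (t + s) = tri_side k t + s *\<^sub>R side_dir k"
 by (auto simp: tri_side_def side_dir_def less_Suc_eq numeral_3_eq_3)

lemma inner_side_dir: "k < 3 ==> inner w (tri_side k (t + s)) = inner w (tri_side k t) + s * inner w (side_dir k)"
 by (simp add: tri_side_affine inner_add_right)

text \<open>
 A triple (k, t, s) with s = 1 or s = -1 describes the direction at the point with parameter t of the
 side k of the standard triangle along that side.
\<close>

definition side_germs :: "real \<times> real => (nat \<times> real \<times> real) set" where
 "side_germs a = {(k, t, s). k < 3 \<and> 0 \<le> t \<and> t \<le> 1 \<and> tri_side k t = a \<and>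
   (s = 1 \<and> t < 1 \<or> s = -1 \<and> 0 < t)}"

text \<open>The vector along the side and the vector to the opposite vertex have determinant 1 or
  -1, as the sums over directions require.\<close>

definition side_term :: "(nat \<times> real \<times> real => real \<times> real) => real \<times> real => nat \<times> real \<times> real => real" where
 "side_term G w b = (case b of (k, t, s) =>
   boundary_term (G b) w (s *\<^sub>R side_dir k) (tri_corner k - tri_side k t))"

lemma interior_std_triangle_ray:
 "eventually (%\<xi>. a + \<xi> *\<^sub>R u \<in> interior std_triangle) (at_right 0) \<longleftrightarrow>
  (fst a > 0 \<or> fst a = 0 \<and> fst u > 0) \<and> (snd a > 0 \<or> snd a = 0 \<and> snd u > 0) \<and>
  (fst a + snd a < 1 \<or> fst a + snd a = 1 \<and> fst u + snd u < 0)"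
proof -
 have lin: "eventually (%\<xi>. x + \<xi> * y > 0) (at_right 0) \<longleftrightarrow> x > 0 \<or> x = 0 \<and> y > 0" for x y :: real
 proof
  assume ev: "eventually (%\<xi>. x + \<xi> * y > 0) (at_right 0)"
  have "((%\<xi>. x + \<xi> * y) \<longlongrightarrow> x + 0 * y) (at_right 0)" by (intro tendsto_intros)
  then have "((%\<xi>. x + \<xi> * y) \<longlongrightarrow> x) (at_right 0)" by simp
  from tendsto_lowerbound[OF this _ trivial_limit_at_right_real, of 0] have "x \<ge> 0"
   using eventually_mono[OF ev, of "%\<xi>. 0 \<le> x + \<xi> * y"] by simp
  moreover obtain \<xi> where "0 < \<xi>" "x + \<xi> * y > 0"
   by (rule eventually_at_right_0E[OF ev, of 1], simp, rule that)
  ultimately show "x > 0 \<or> x = 0 \<and> y > 0" by (auto simp: zero_less_mult_iff)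
 next
  assume "x > 0 \<or> x = 0 \<and> y > 0"
  then show "eventually (%\<xi>. x + \<xi> * y > 0) (at_right 0)"
  proof
   assume x: "x > 0"
   have "((%\<xi>. x + \<xi> * y) \<longlongrightarrow> x + 0 * y) (at_right 0)" by (intro tendsto_intros)
   then show ?thesis using x order_tendstoD(1)[of "%\<xi>. x + \<xi> * y" x "at_right 0" 0] by simp
  next
   assume "x = 0 \<and> y > 0"
   then show ?thesis by (intro eventually_at_right_0I[of 1]) auto
  qed
 qed
 have "(a + \<xi> *\<^sub>R u \<in> interior std_triangle) \<longleftrightarrow> fst a + \<xi> * fst u > 0 \<and> snd a + \<xi> * snd u > 0 \<and>
   (1 - fst a - snd a) + \<xi> * (- fst u - snd u) > 0" for \<xi>
  unfolding interior_std_triangle by (cases a; cases u) (auto simp: algebra_simps)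
 then show ?thesis unfolding eventually_conj_iff lin by (simp only: eventually_conj_iff lin) auto
qed

lemma exists_irrational: "\<exists>x::real. x \<notin> \<rat>"
proof (rule ccontr)
 assume "\<not> ?thesis"
 then have "(UNIV :: real set) = \<rat>" by blast
 then show False using countable_rat uncountable_UNIV_real by metis
qed

text \<open>Break lines have rational slope, so a line with irrational slope through the base point
  is never one of them.\<close>

lemma primitive_irrational:
 assumes "primitive_vec n" "x \<notin> \<rat>"
 shows "inner n (1, x) \<noteq> 0"
proof
 assume z: "inner n (1, x) = 0"
 obtain a b :: int where ab: "coprime a b" "n = (of_int a, of_int b)" using assms(1) unfolding primitive_vec_def by blast
 have e: "of_int a + of_int b * x = 0" using z by (simp add: ab)
 show False
 proof (cases "b = 0")
  case True
  then show ?thesis using e ab(1) by simp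
 next
  case False
  then have "x = - of_int a / of_int b" using e by (simp add: field_simps eq_neg_iff_add_eq_0)
  then have "x \<in> \<rat>" by simp
  then show ?thesis using assms(2) by blast
 qed
qed

locale triangle_germ = pl_germ std_triangle a g mult D d for a g mult D d
begin

definition inward :: "(real \<times> real) set" where
 "inward = {u. primitive_vec u \<and> D u \<noteq> 0 \<and> eventually (%\<xi>. a + \<xi> *\<^sub>R u \<in> interior std_triangle) (at_right 0)}"

text \<open>The balancing condition. A line of irrational slope through \<open>a\<close> contains no
  rational direction, and \<open>g\<close> is affine near suitable points of it on both sides of
  \<open>a\<close>. The two half planes then contribute the same boundary terms with opposite
  signs.\<close>

lemma interior_sum:
 assumes a: "a \<in> interior std_triangle"
 shows "finite inward" "(\<Sum>u\<in>inward. D u * inner w u) = 0"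
proof -
 have d: "d > 0" using conic_a by (simp add: conic_upto_def)
 obtain r where r: "r > 0" "cball a r \<subseteq> interior std_triangle"
  using a open_interior open_contains_cball by blast
 define \<rho> where "\<rho> = min r (d / 2)"
 have \<rho>: "\<rho> > 0" "\<rho> < d" "\<And>z. norm z \<le> \<rho> ==> a + z \<in> interior std_triangle"
 proof -
  show "\<rho> > 0" "\<rho> < d" using r d by (auto simp: \<rho>_def)
  fix z :: "real \<times> real" assume "norm z \<le> \<rho>"
  then have "norm z \<le> r" by (simp add: \<rho>_def)
  then have "a + z \<in> cball a r" by (simp only: mem_cball dist_norm) simp
  then show "a + z \<in> interior std_triangle" using r(2) by blast
 qed
 obtain x :: real where x: "x \<notin> \<rat>" using exists_irrational by blast
 define E where "E = (1::real, x)"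
 define V where "V = (0::real, 1::real)"
 have nE: "norm E > 0" by (simp add: E_def zero_prod_def)
 have nV: "norm V = 1" by (simp add: V_def)
 have ex: "\<exists>\<xi> G c. 0 < \<xi> \<and> \<xi> * norm E < \<rho> / 2 \<and>
   eventually (%y. g y = inner G y + c) (nhds (a + \<xi> *\<^sub>R F))" if F: "F = E \<or> F = - E" for F
 proof -
  define e where "e = \<rho> / 2 / norm E"
  have e: "e > 0" "e * norm E = \<rho> / 2" using \<rho>(1) nE by (simp_all add: e_def)
  have nF: "norm F = norm E" using F by auto
  have 1: "a + e *\<^sub>R F \<in> interior std_triangle" by (rule \<rho>(3)) (use e nF \<rho>(1) in simp)
  have 2: "norm (e *\<^sub>R F) < d" using e nF \<rho> by simp
  have 3: "F \<noteq> 0" using nF nE by auto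
  obtain \<mu> n v \<xi> c where n: "primitive_vec n" "\<mu> = 0 \<or> inner n F = 0"
   "\<And>u r. primitive_vec u ==> r > 0 ==> F = r *\<^sub>R u ==> D u = \<mu>"
   "\<And>h. eventually (%s. g (a + e *\<^sub>R (F + s *\<^sub>R h)) = g (a + e *\<^sub>R F) + s * (e * (inner v h + \<mu> * max 0 (inner n h)))) (at_right 0)
    \<or> \<not> eventually (%s. a + e *\<^sub>R (F + s *\<^sub>R h) \<in> std_triangle \<and> norm (e *\<^sub>R (F + s *\<^sub>R h)) < d) (at_right 0)"
   "0 < \<xi>" "\<xi> < e"
   "eventually (%y. g y = inner v y + c + \<mu> * max 0 (inner n (y - (a + \<xi> *\<^sub>R F)))) (nhds (a + \<xi> *\<^sub>R F))"
   by (rule path_point[OF e(1) 1 2 3]) (rule that)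
  have "inner n E \<noteq> 0" using primitive_irrational[OF n(1) x] by (simp add: E_def)
  then have "inner n F \<noteq> 0" using F by auto
  then have "\<mu> = 0" using n(2) by blast
  then have "eventually (%y. g y = inner v y + c) (nhds (a + \<xi> *\<^sub>R F))" using n(7) by simp
  moreover have "\<xi> * norm E < \<rho> / 2" using n(6) nE unfolding e(2)[symmetric] by simp
  ultimately show ?thesis using n(5) by blast
 qed
 obtain e1 G1 c1 where 1: "0 < e1" "e1 * norm E < \<rho> / 2" "eventually (%y. g y = inner G1 y + c1) (nhds (a + e1 *\<^sub>R E))"
  using ex[of E] by blast
 obtain e2 G2 c2 where 2: "0 < e2" "e2 * norm E < \<rho> / 2" "eventually (%y. g y = inner G2 y + c2) (nhds (a + e2 *\<^sub>R (- E)))"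
  using ex[of "- E"] by blast
 have nl: "eventually P (near K z)" if "eventually P (nhds z)" for P K and z :: "real \<times> real"
  using that unfolding eventually_inf_principal by (auto elim: eventually_mono)
 have nG2: "eventually (%y. g y = inner G2 y + c2) (near std_triangle (a - e2 *\<^sub>R E))" using nl[OF 2(3)] by simp
 have bound: "norm (p *\<^sub>R E + q *\<^sub>R V) \<le> \<rho>" if "- e2 \<le> p" "p \<le> e1" "\<bar>q\<bar> \<le> \<rho> / 2" for p q
 proof -
  have "\<bar>p\<bar> * norm E \<le> \<rho> / 2"
  proof (cases "p \<ge> 0")
   case True
   then have "\<bar>p\<bar> * norm E \<le> e1 * norm E" using that by (intro mult_right_mono) auto
   then show ?thesis using 1 by linarith
  next
   case False
   then have "\<bar>p\<bar> * norm E \<le> e2 * norm E" using that by (intro mult_right_mono) auto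
   then show ?thesis using 2 by linarith
  qed
  then show ?thesis using norm_triangle_ineq[of "p *\<^sub>R E" "q *\<^sub>R V"] that nV by simp
 qed
 have ins: "a + p *\<^sub>R E + q *\<^sub>R W \<in> interior std_triangle" if "- e2 \<le> p" "p \<le> e1" "0 < q" "q \<le> \<rho> / 2" "W = V \<or> W = - V" for p q W
 proof -
  have "a + (p *\<^sub>R E + q *\<^sub>R W) \<in> interior std_triangle"
   using \<rho>(3)[OF bound[of p q]] \<rho>(3)[OF bound[of p "- q"]] that by auto
  then show ?thesis by (simp only: add.assoc)
 qed
 have ends: "a + e1 *\<^sub>R E \<in> std_triangle" "a - e2 *\<^sub>R E \<in> std_triangle"
  using \<rho>(3)[of "e1 *\<^sub>R E"] \<rho>(3)[of "- (e2 *\<^sub>R E)"] 1 2 \<rho>(1) interior_subset by auto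
 have det: "\<bar>det2 E W\<bar> = 1" if "W = V \<or> W = - V" for W using that by (auto simp: E_def V_def det2_def)
 have nrm: "norm (e1 *\<^sub>R E) + norm ((\<rho> / 2) *\<^sub>R W) < d" "norm (e2 *\<^sub>R E) + norm ((\<rho> / 2) *\<^sub>R W) < d" if "W = V \<or> W = - V" for W
  using that 1 2 \<rho> nV by auto
 have \<rho>2: "\<rho> / 2 > 0" using \<rho>(1) by simp
 define H where "H W = {u. primitive_vec u \<and> D u \<noteq> 0 \<and> (\<exists>p q. q > 0 \<and> u = p *\<^sub>R E + q *\<^sub>R W)}" for W
 have H: "finite (H W)" "(\<Sum>u\<in>H W. D u * inner w u) = boundary_term G1 w E W - boundary_term G2 w E W" if W: "W = V \<or> W = - V" for W
  unfolding H_def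
  by (rule half_plane_sum[OF det[OF W] 1(1) 2(1) \<rho>2 ins[OF _ _ _ _ W] nrm[OF W] ends nl[OF 1(3)] nG2]; assumption)+
 have eq: "inward = H V \<union> H (- V)"
 proof (rule subset_antisym; rule subsetI)
  fix u assume "u \<in> inward"
  then have u: "primitive_vec u" "D u \<noteq> 0" by (auto simp: inward_def)
  define p where "p = fst u"
  define q where "q = snd u - p * x"
  have uE: "u = p *\<^sub>R E + q *\<^sub>R V" by (cases u) (simp add: p_def q_def E_def V_def)
  have "q \<noteq> 0"
  proof
   assume "q = 0"
   then have uu: "u = p *\<^sub>R (1, x)" using uE by (simp add: E_def)
   have "primitive_vec (- snd u, fst u)" using primitive_rotate[of "fst u" "snd u"] u(1) by simp
   from primitive_irrational[OF this x] show False using uu by simp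
  qed
  then consider "q > 0" | "- q > 0" by linarith
  then show "u \<in> H V \<union> H (- V)"
  proof cases
   case 1
   then show ?thesis using u uE unfolding H_def by blast
  next
   case 2
   moreover have "u = p *\<^sub>R E + (- q) *\<^sub>R (- V)" using uE by simp
   ultimately have "u \<in> H (- V)" using u unfolding H_def by blast
   then show ?thesis by blast
  qed
 next
  fix u assume "u \<in> H V \<union> H (- V)"
  then have "primitive_vec u" "D u \<noteq> 0" by (auto simp: H_def)
  then show "u \<in> inward" using a unfolding inward_def interior_std_triangle_ray
   unfolding interior_std_triangle by auto
 qed
 have dis: "H V \<inter> H (- V) = {}"
 proof -
  have "False" if u: "u \<in> H V" "u \<in> H (- V)" for u
  proof -
   obtain p q p' q' where "q > 0" "u = p *\<^sub>R E + q *\<^sub>R V" "q' > 0" "u = p' *\<^sub>R E + q' *\<^sub>R (- V)"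
    using u unfolding H_def by blast
   then show False by (auto simp: E_def V_def)
  qed
  then show ?thesis by blast
 qed
 show "finite inward" unfolding eq using H(1)[of V] H(1)[of "- V"] by simp
 have "(\<Sum>u\<in>inward. D u * inner w u) = (\<Sum>u\<in>H V. D u * inner w u) + (\<Sum>u\<in>H (- V). D u * inner w u)"
  unfolding eq by (rule sum.union_disjoint) (use H(1)[of V] H(1)[of "- V"] dis in auto)
 also have "\<dots> = 0" using H(2)[of V] H(2)[of "- V"] by (simp add: boundary_term_def)
 finally show "(\<Sum>u\<in>inward. D u * inner w u) = 0" .
qed

text \<open>At an interior point there are no side germs and the sum is balanced; at a vertex the
  two sides are the ends of a path across the corner, each pointing to the opposite vertex of the
  other; inside a side the two directions bound a half plane. The factor 4 bounds the vectors
  involved, so that all points used lie within the conic radius \<open>d\<close>.\<close>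

theorem local_reciprocity:
 assumes e: "0 < e" "e < 1" "4 * e < d"
  and small: "\<And>k t s. (k, t, s) \<in> side_germs a ==> 0 < t + e * s \<and> t + e * s < 1"
  and G: "\<And>k t s. (k, t, s) \<in> side_germs a ==>
   eventually (%y. g y = inner (G (k, t, s)) y + c (k, t, s)) (near std_triangle (tri_side k (t + e * s)))"
 shows "finite inward" "(\<Sum>u\<in>inward. D u * inner w u) = (\<Sum>b\<in>side_germs a. side_term G w b)"
proof -
 have "finite inward \<and> (\<Sum>u\<in>inward. D u * inner w u) = (\<Sum>b\<in>side_germs a. side_term G w b)"
  using a_in
 proof (cases rule: std_triangle_cases)
  case 1
  have "side_germs a = {}" using 1 unfolding interior_std_triangle side_germs_def
   by (auto simp: tri_side_def less_Suc_eq numeral_3_eq_3)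
  then show ?thesis using interior_sum[OF 1] by simp
 next
  case (2 k t)
  have k3: "k = 0 \<or> k = 1 \<or> k = 2" using 2(1) by linarith
  have corner: ?thesis if b1: "side_germs a = {(k1, t1, s1), (k2, t2, s2)}" "(k1, t1, s1) \<noteq> (k2, t2, s2)"
   and E: "s1 *\<^sub>R side_dir k1 = E1" "tri_corner k1 - tri_side k1 t1 = E2"
    "s2 *\<^sub>R side_dir k2 = E2" "tri_corner k2 - tri_side k2 t2 = E1"
   and det: "\<bar>det2 E1 E2\<bar> = 1" and nrm: "norm E1 \<le> 4" "norm E2 \<le> 4"
   and inside: "\<And>\<tau>. 0 < \<tau> ==> \<tau> < 1 ==> a + e *\<^sub>R ((1 - \<tau>) *\<^sub>R E1 + \<tau> *\<^sub>R E2) \<in> interior std_triangle"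
   and inw: "\<And>p q. eventually (%\<xi>. a + \<xi> *\<^sub>R (p *\<^sub>R E1 + q *\<^sub>R E2) \<in> interior std_triangle) (at_right 0) \<longleftrightarrow> 0 < p \<and> 0 < q"
   for k1 t1 s1 k2 t2 s2 E1 E2
  proof -
   have m: "(k1, t1, s1) \<in> side_germs a" "(k2, t2, s2) \<in> side_germs a" using b1 by auto
   have p1: "tri_side k1 (t1 + e * s1) = a + e *\<^sub>R E1" using m(1) unfolding E(1)[symmetric] side_germs_def
    by (auto simp: tri_side_affine)
   have p2: "tri_side k2 (t2 + e * s2) = a + e *\<^sub>R E2" using m(2) unfolding E(3)[symmetric] side_germs_def
    by (auto simp: tri_side_affine)
   have i1: "a + e *\<^sub>R E1 \<in> std_triangle" unfolding p1[symmetric]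
    using tri_side_in[of k1 "t1 + e * s1"] small[OF m(1)] m(1) by (auto simp: side_germs_def)
   have i2: "a + e *\<^sub>R E2 \<in> std_triangle" unfolding p2[symmetric]
    using tri_side_in[of k2 "t2 + e * s2"] small[OF m(2)] m(2) by (auto simp: side_germs_def)
   have n1: "norm (e *\<^sub>R E1) < d"
   proof -
    have "e * norm E1 \<le> e * 4" using nrm e by (intro mult_left_mono) auto
    then have "e * norm E1 < d" using e(3) by linarith
    then show ?thesis using e by simp
   qed
   have n2: "norm (e *\<^sub>R E2) < d"
   proof -
    have "e * norm E2 \<le> e * 4" using nrm e by (intro mult_left_mono) auto
    then have "e * norm E2 < d" using e(3) by linarith
    then show ?thesis using e by simp
   qed
   note cs = corner_sum[OF det e(1) i1 n1 i2 n2 inside inw G[OF m(1), unfolded p1] G[OF m(2), unfolded p2], folded inward_def]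
   show ?thesis using cs b1(2) unfolding b1(1) by (simp add: side_term_def E)
  qed
  have "t = 0 \<or> t = 1 \<or> 0 < t \<and> t < 1" using 2 by linarith
  then consider "a = (0, 0)" | "a = (1, 0)" | "a = (0, 1)" | "0 < t" "t < 1"
   using k3 unfolding 2(4) tri_side_def by (elim disjE) simp_all
  then show ?thesis
  proof cases
   case 1
   show ?thesis
    by (rule corner[of 2 0 1 1 0 1 "(1, 0)" "(0, 1)"]; (unfold interior_std_triangle_ray)?)
     (use e in \<open>auto simp: 1 side_germs_def tri_side_def side_dir_def tri_corner_def det2_def less_Suc_eq numeral_3_eq_3 interior_std_triangle algebra_simps\<close>)
  next
   case 2
   show ?thesis
    by (rule corner[of 2 1 "- 1" 0 0 1 "(- 1, 0)" "(- 1, 1)"]; (unfold interior_std_triangle_ray)?)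
     (use e in \<open>auto simp: 2 side_germs_def tri_side_def side_dir_def tri_corner_def det2_def less_Suc_eq numeral_3_eq_3 interior_std_triangle algebra_simps norm_Pair real_le_lsqrt\<close>)
  next
   case 3
   show ?thesis
    by (rule corner[of 1 1 "- 1" 0 1 "- 1" "(0, - 1)" "(1, - 1)"]; (unfold interior_std_triangle_ray)?)
     (use e in \<open>auto simp: 3 side_germs_def tri_side_def side_dir_def tri_corner_def det2_def less_Suc_eq numeral_3_eq_3 interior_std_triangle algebra_simps norm_Pair real_le_lsqrt\<close>)
  next
   case 4
   let ?E = "side_dir k" and ?V = "tri_corner k - tri_side k t"
   have sg: "side_germs a = {(k, t, 1), (k, t, - 1)}"
    using k3 2 4 unfolding side_germs_def by (auto simp: tri_side_def less_Suc_eq numeral_3_eq_3)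
   have m: "(k, t, 1) \<in> side_germs a" "(k, t, - 1) \<in> side_germs a" unfolding sg by auto
   have te: "0 < t - e" "t + e < 1" using small[OF m(1)] small[OF m(2)] by auto
   have det: "\<bar>det2 ?E ?V\<bar> = 1"
    using k3 by (auto simp: det2_def side_dir_def tri_corner_def tri_side_def)
   have p1: "tri_side k (t + e * 1) = a + e *\<^sub>R ?E" "tri_side k (t + e * - 1) = a - e *\<^sub>R ?E"
    using tri_side_affine[OF 2(1), of t e] tri_side_affine[OF 2(1), of t "- e"] 2(4) by simp_all
   have i: "a + e *\<^sub>R ?E \<in> std_triangle" "a - e *\<^sub>R ?E \<in> std_triangle"
    unfolding p1[symmetric] using tri_side_in[OF 2(1)] te e by auto
   \<comment> \<open>A height for which the box over the piece of the side of length
     \<open>e\<close> in both directions still fits into the triangle.\<close>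
   define e3 where "e3 = min e (min (t - e) (1 - t - e)) / 2"
   have e3: "e3 > 0" "e3 < e" "e3 < t - e" "e3 < 1 - t - e" using te e by (auto simp: e3_def)
   have V: "?V = - t *\<^sub>R ?E + (tri_corner k - tri_side k 0)"
    using tri_side_affine[OF 2(1), of 0 t] by simp
   have ins: "a + p *\<^sub>R ?E + q *\<^sub>R ?V \<in> interior std_triangle" if pq: "- e \<le> p" "p \<le> e" "0 < q" "q \<le> e3" for p q
   proof -
    have qt: "q * t \<le> q" "0 \<le> q * t" using pq(3) 4 by (auto simp: mult_left_le)
    have "0 < t + p - q * t" "q < 1 - (t + p - q * t)"  using pq e3 qt by linarith+
    then show ?thesis
     using k3 pq(3) unfolding 2(4) interior_std_triangle
     by (auto simp: side_dir_def tri_corner_def tri_side_def algebra_simps)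
   qed
   have nE: "norm ?E \<le> 2" "norm ?V \<le> 2"
   proof -
    have *: "norm (x, y) \<le> 2" if "\<bar>x\<bar> \<le> 1" "\<bar>y\<bar> \<le> 1" for x y :: real
    proof -
     have "norm (x, y) \<le> \<bar>x\<bar> + \<bar>y\<bar>" using sqrt_sum_squares_le_sum_abs[of x y] by (simp add: norm_Pair)
     then show ?thesis using that by linarith
    qed
    show "norm ?E \<le> 2" using k3 by (auto simp: side_dir_def tri_side_def intro!: *)
    show "norm ?V \<le> 2" using k3 4 by (auto simp: tri_corner_def tri_side_def intro!: *)
   qed
   have nrm: "norm (e *\<^sub>R ?E) + norm (e3 *\<^sub>R ?V) < d"
   proof -
    have "e * norm ?E \<le> e * 2" "e3 * norm ?V \<le> e3 * 2" using nE e e3 by (intro mult_left_mono; simp)+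
    then have "e * norm ?E + e3 * norm ?V < d" using e(3) e3(2) by linarith
    then show ?thesis using e e3 by simp
   qed
   have inw: "inward = {u. primitive_vec u \<and> D u \<noteq> 0 \<and> (\<exists>p q. q > 0 \<and> u = p *\<^sub>R ?E + q *\<^sub>R ?V)}"
   proof -
    have "eventually (%\<xi>. a + \<xi> *\<^sub>R u \<in> interior std_triangle) (at_right 0) \<longleftrightarrow> (\<exists>p q. q > 0 \<and> u = p *\<^sub>R ?E + q *\<^sub>R ?V)" for u
    proof
     assume ev: "eventually (%\<xi>. a + \<xi> *\<^sub>R u \<in> interior std_triangle) (at_right 0)"
     define q where "q = (if k = 0 then - fst u - snd u else if k = 1 then fst u else snd u)"
     define p where "p = (if k = 2 then fst u + t * q else snd u + t * q)"
     have "q > 0" using ev k3 4 unfolding interior_std_triangle_ray 2(4) by (auto simp: q_def tri_side_def)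
     moreover have "u = p *\<^sub>R ?E + q *\<^sub>R ?V"
      using k3 by (cases u) (auto simp: p_def q_def side_dir_def tri_side_def tri_corner_def algebra_simps)
     ultimately show "\<exists>p q. q > 0 \<and> u = p *\<^sub>R ?E + q *\<^sub>R ?V" by blast
    next
     assume "\<exists>p q. q > 0 \<and> u = p *\<^sub>R ?E + q *\<^sub>R ?V"
     then obtain p q where q: "q > 0" "u = p *\<^sub>R ?E + q *\<^sub>R ?V" by blast
     show "eventually (%\<xi>. a + \<xi> *\<^sub>R u \<in> interior std_triangle) (at_right 0)"
      using k3 4 q(1) unfolding interior_std_triangle_ray 2(4) q(2)
      by (auto simp: side_dir_def tri_side_def tri_corner_def algebra_simps)
    qed
    then show ?thesis unfolding inward_def by simp
   qed
   note hp = half_plane_sum[OF det e(1) e(1) e3(1) ins nrm nrm i G[OF m(1), unfolded p1] G[OF m(2), unfolded p1], folded inw]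
   show ?thesis using hp unfolding sg by (simp add: side_term_def boundary_term_def)
  qed
 qed
 then show "finite inward" "(\<Sum>u\<in>inward. D u * inner w u) = (\<Sum>b\<in>side_germs a. side_term G w b)" by auto
qed

end

section \<open>Local equations of divisors\<close>

lemma eventually_near_of_nhds: "eventually P (nhds z) ==> eventually P (near K z)"
 unfolding eventually_inf_principal by (auto elim: eventually_mono)

lemma eventually_at_right_0_ex: "eventually P (at_right (0::real)) ==> \<exists>\<xi>>0. P \<xi>"
 unfolding eventually_at_right_field by (meson dense)

lemma affine_near_unique:
 assumes a: "a \<in> std_triangle"
  and ev: "eventually (%y. inner w y + c = inner w' y + c') (near std_triangle a)"
 shows "w = w'" "c = c'"
proof -
 have 0: "inner w a + c = inner w' a + c'" by (rule eventually_near_self[OF ev a])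
 have z: "inner (w - w') (b - a) = 0" if b: "b \<in> std_triangle" for b
 proof -
  have "eventually (%\<xi>. a + \<xi> *\<^sub>R (b - a) \<in> std_triangle) (at_right 0)"
  proof (rule eventually_at_right_0I[of 1])
   fix \<xi> :: real assume "0 < \<xi>" "\<xi> < 1"
   then show "a + \<xi> *\<^sub>R (b - a) \<in> std_triangle"
    using convexD_alt[OF convex_std_triangle a b, of \<xi>] by (simp add: algebra_simps)
  qed simp
  from eventually_near_ray[OF ev this] obtain \<xi> where e: "0 < \<xi>"
   "inner w (a + \<xi> *\<^sub>R (b - a)) + c = inner w' (a + \<xi> *\<^sub>R (b - a)) + c'"
   using eventually_at_right_0_ex by blast
  have "\<xi> * inner w (b - a) = \<xi> * inner w' (b - a)"
   using e(2) 0 unfolding inner_add_right inner_scaleR_right by linarith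
  then show ?thesis using e(1) by (simp add: inner_diff_left)
 qed
 have "(0, 0) \<in> std_triangle" "(1, 0) \<in> std_triangle" "(0, 1) \<in> std_triangle" by (auto simp: std_triangle_def)
 note zs = z[OF this(1), unfolded inner_diff_right[of "w - w'"]] z[OF this(2), unfolded inner_diff_right[of "w - w'"]]
  z[OF this(3), unfolded inner_diff_right[of "w - w'"]]
 have "inner (w - w') (0, 0) = 0" by (simp add: zero_prod_def[symmetric])
 then have "inner (w - w') (1, 0) = 0" "inner (w - w') (0, 1) = 0" using zs by linarith+
 then show "w = w'" by (cases w; cases w') simp
 then show "c = c'" using 0 by simp
qed

lemma affine_nhds_unique:
 fixes w w' :: "real \<times> real"
 assumes ev: "eventually (%y. inner w y + c = inner w' y + c') (nhds a)"
 shows "w = w'" "c = c'"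
proof -
 have 0: "inner w a + c = inner w' a + c'" by (rule eventually_nhds_x_imp_x[OF ev])
 have "eventually (%s. inner w (a + s *\<^sub>R (w - w')) + c = inner w' (a + s *\<^sub>R (w - w')) + c') (at_right 0)"
  using eventually_nhds_line[OF ev, of "w - w'"] by (rule filter_leD[rotated]) (simp add: at_within_def)
 then obtain s where s: "0 < s" "inner w (a + s *\<^sub>R (w - w')) + c = inner w' (a + s *\<^sub>R (w - w')) + c'"
  using eventually_at_right_0_ex by blast
 have "s * inner w (w - w') = s * inner w' (w - w')"
  using s(2) 0 unfolding inner_add_right inner_scaleR_right by linarith
 then have "inner (w - w') (w - w') = 0" using s(1) by (simp add: inner_diff_left)
 then show "w = w'" by simp
 then show "c = c'" using 0 by simp
qed

text \<open>Off the finite set both functions bend along the same line by the same amount, so their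
  difference is locally affine. A convex open set of the plane stays connected without finitely many
  points, so it is one affine function, and continuity extends the equation to the boundary and to
  the exceptional points.\<close>

lemma breaks_difference_affine:
 fixes g g' \<mu> :: "real \<times> real => real"
 assumes z: "z \<in> std_triangle" and r: "r > 0" and fin: "finite Exc"
  and b: "\<And>y. y \<in> ball z r ==> y \<in> interior std_triangle ==> y \<notin> Exc ==> breaks_at g y (\<mu> y)"
  and b': "\<And>y. y \<in> ball z r ==> y \<in> interior std_triangle ==> y \<notin> Exc ==> breaks_at g' y (\<mu> y)"
  and lim: "\<And>y. y \<in> ball z r ==> y \<in> std_triangle ==> (g \<longlongrightarrow> g y) (near std_triangle y)"
  and lim': "\<And>y. y \<in> ball z r ==> y \<in> std_triangle ==> (g' \<longlongrightarrow> g' y) (near std_triangle y)"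
 obtains w c where "\<And>y. y \<in> ball z r ==> y \<in> std_triangle ==> g y - g' y = inner w y + c"
proof -
 define Dom where "Dom = ball z r \<inter> interior std_triangle - Exc"
 have opO: "open Dom" unfolding Dom_def using fin by (intro open_Diff open_Int finite_imp_closed) auto
 have conv: "convex (ball z r \<inter> interior std_triangle)"
  by (intro convex_Int convex_ball convex_interior convex_std_triangle)
 have conO: "connected Dom"
  unfolding Dom_def
  by (rule path_connected_imp_connected, rule path_connected_open_diff_countable)
   (use fin conv in \<open>auto simp: convex_connected countable_finite\<close>)
 have loc: "\<exists>w c. eventually (%y'. g y' - g' y' = inner w y' + c) (nhds y)" if y: "y \<in> Dom" for y
 proof -
  obtain n w c where n: "primitive_vec n"
   "eventually (%y'. g y' = inner w y' + c + \<mu> y * max 0 (inner n (y' - y))) (nhds y)"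
   using b[of y] y unfolding breaks_at_def Dom_def by blast
  obtain n' w' c' where n': "primitive_vec n'"
   "eventually (%y'. g' y' = inner w' y' + c' + \<mu> y * max 0 (inner n' (y' - y))) (nhds y)"
   using b'[of y] y unfolding breaks_at_def Dom_def by blast
  show ?thesis
  proof (cases "\<mu> y = 0")
   case True
   have "eventually (%y'. g y' - g' y' = inner (w - w') y' + (c - c')) (nhds y)"
    using n(2) n'(2) by eventually_elim (simp add: True inner_diff_left)
   then show ?thesis by blast
  next
   case False
   \<comment> \<open>The direction of the break line of \<open>g\<close>. If \<open>g'\<close> had
     another break line, it would be affine at the nearby points \<open>y + s *\<^sub>R h\<close>;
     so the common coefficient there would be 0, although \<open>g\<close> bends at these
     points.\<close>
   define h where "h = (- snd n, fst n)"
   have nh: "inner n h = 0" by (cases n) (simp add: h_def)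
   have "inner n' h = 0"
   proof (rule ccontr)
    assume n'h: "inner n' h \<noteq> 0"
    have "eventually (%y'. y' \<in> Dom) (nhds y)" using y opO by (rule eventually_nhds_in_open[rotated])
    moreover have "eventually (%y'. eventually (%y'. g y' = inner w y' + c + \<mu> y * max 0 (inner n (y' - y))) (nhds y')) (nhds y)"
     using n(2) by (simp add: eventually_eventually)
    moreover have "eventually (%y'. eventually (%y'. g' y' = inner w' y' + c' + \<mu> y * max 0 (inner n' (y' - y))) (nhds y')) (nhds y)"
     using n'(2) by (simp add: eventually_eventually)
    ultimately have "eventually (%y'. y' \<in> Dom \<and>
      eventually (%y'. g y' = inner w y' + c + \<mu> y * max 0 (inner n (y' - y))) (nhds y') \<and>
      eventually (%y'. g' y' = inner w' y' + c' + \<mu> y * max 0 (inner n' (y' - y))) (nhds y')) (nhds y)"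
     by eventually_elim simp
    from eventually_nhds_line[OF this, of h]
    have "eventually (%s. y + s *\<^sub>R h \<in> Dom \<and>
      eventually (%y'. g y' = inner w y' + c + \<mu> y * max 0 (inner n (y' - y))) (nhds (y + s *\<^sub>R h)) \<and>
      eventually (%y'. g' y' = inner w' y' + c' + \<mu> y * max 0 (inner n' (y' - y))) (nhds (y + s *\<^sub>R h))) (at_right 0)"
     by (rule filter_leD[rotated]) (simp add: at_within_def)
    then obtain s where s: "s > 0" "y + s *\<^sub>R h \<in> Dom \<and>
      eventually (%y'. g y' = inner w y' + c + \<mu> y * max 0 (inner n (y' - y))) (nhds (y + s *\<^sub>R h)) \<and>
      eventually (%y'. g' y' = inner w' y' + c' + \<mu> y * max 0 (inner n' (y' - y))) (nhds (y + s *\<^sub>R h))"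
     using eventually_at_right_0_ex by blast
    let ?y = "y + s *\<^sub>R h"
    have yO: "?y \<in> Dom" and gy: "eventually (%y'. g y' = inner w y' + c + \<mu> y * max 0 (inner n (y' - y))) (nhds ?y)"
     and gy': "eventually (%y'. g' y' = inner w' y' + c' + \<mu> y * max 0 (inner n' (y' - y))) (nhds ?y)"
     using s(2) by blast+
    have ne: "inner n' (?y - y) \<noteq> 0" using n'h s(1) by simp
    have "\<exists>v d. eventually (%y'. g' y' = inner v y' + d) (nhds ?y)"
    proof (cases "inner n' (?y - y) > 0")
     case True
     have "open {y'. inner n' (y' - y) > 0}" by (intro open_Collect_less continuous_intros)
     then have "eventually (%y'. y' \<in> {y'. inner n' (y' - y) > 0}) (nhds ?y)"
      by (rule eventually_nhds_in_open) (use True in simp)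
     with gy' have "eventually (%y'. g' y' = inner (w' + \<mu> y *\<^sub>R n') y' + (c' - \<mu> y * inner n' y)) (nhds ?y)"
      by eventually_elim (simp add: inner_add_left inner_diff_right algebra_simps)
     then show ?thesis by blast
    next
     case False
     have lt: "inner n' (?y - y) < 0" using False ne by linarith
     have "open {y'. inner n' (y' - y) < 0}" by (intro open_Collect_less continuous_intros)
     then have "eventually (%y'. y' \<in> {y'. inner n' (y' - y) < 0}) (nhds ?y)"
      by (rule eventually_nhds_in_open) (rule CollectI, rule lt)
     with gy' have "eventually (%y'. g' y' = inner w' y' + c') (nhds ?y)"
      by eventually_elim simp
     then show ?thesis by blast
    qed
    then have "\<mu> ?y = 0" using breaks_at_zero b'[of ?y] yO unfolding Dom_def by blast
    then have "breaks_at g ?y 0" using b[of ?y] yO unfolding Dom_def by auto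
    then obtain v d where v: "eventually (%y'. g y' = inner v y' + d) (nhds ?y)"
     unfolding breaks_at_def by auto
    have sh: "inner n (y' - y) = inner n (y' - ?y)" for y' using nh by (simp add: inner_diff_right inner_add_right)
    have "breaks_at g ?y (\<mu> y)" unfolding breaks_at_def
     by (intro exI[of _ n] exI[of _ w] exI[of _ c] conjI n(1) gy[unfolded sh])
    from breaks_at_zero[OF this v] False show False by blast
   qed
   then have "det2 n n' = 0" by (cases n; cases n') (simp add: h_def det2_def algebra_simps)
   then consider "n = n'" | "n = - n'" using primitive_parallel n(1) n'(1) by blast
   then show ?thesis
   proof cases
    case 1
    have "eventually (%y'. g y' - g' y' = inner (w - w') y' + (c - c')) (nhds y)"
     using n(2) n'(2) by eventually_elim (simp add: 1 inner_diff_left)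
    then show ?thesis by blast
   next
    case 2
    \<comment> \<open>Reversing the normal vector of a break changes the function by a linear one
      only.\<close>
    have m: "max 0 (- t) = max 0 t - t" for t :: real by (simp add: max_def)
    have "eventually (%y'. g y' - g' y' = inner (w - w' - \<mu> y *\<^sub>R n') y' + (c - c' + \<mu> y * inner n' y)) (nhds y)"
     using n(2) n'(2)
    proof eventually_elim
     case (elim x)
     have "inner n (x - y) = - inner n' (x - y)" by (simp add: 2)
     then have "g x = inner w x + c + \<mu> y * (max 0 (inner n' (x - y)) - inner n' (x - y))"
      using elim(1) m by metis
     then show ?case using elim(2) by (simp add: inner_diff_left inner_diff_right algebra_simps)
    qed
    then show ?thesis by blast
   qed
  qed
 qed
 then obtain W C where WC: "\<And>y. y \<in> Dom ==> eventually (%y'. g y' - g' y' = inner (W y) y' + C y) (nhds y)" by metis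
 have const: "(W x, C x) = (W y, C y)" if xy: "x \<in> Dom" "y \<in> Dom" for x y
 proof (rule near_local_const[OF conO xy])
  fix x assume x: "x \<in> Dom"
  have 1: "eventually (%y. eventually (%y'. g y' - g' y' = inner (W x) y' + C x) (nhds y)) (nhds x)"
   using WC[OF x] by (simp add: eventually_eventually)
  have 2: "eventually (%y. y \<in> Dom) (nhds x)" using opO x by (rule eventually_nhds_in_open)
  have "eventually (%y. (W x, C x) = (W y, C y)) (nhds x)"
   using 1 2
  proof eventually_elim
   case (elim y)
   have "eventually (%y'. inner (W x) y' + C x = inner (W y) y' + C y) (nhds y)"
    using elim(1) WC[OF elim(2)] by eventually_elim simp
   from affine_nhds_unique[OF this] show ?case by simp
  qed
  then show "eventually (%y. (W x, C x) = (W y, C y)) (near Dom x)" by (rule eventually_near_of_nhds)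
 qed
 \<comment> \<open>Every point is the end of a segment in the good domain. Two candidates for the
   other end ensure that one of them differs from the point itself.\<close>
 have approach: "\<exists>v. eventually (%s. y + s *\<^sub>R v \<in> Dom) (at_right 0)" if y: "y \<in> ball z r" "y \<in> std_triangle" for y
 proof -
  have "(1/3, 1/3) \<in> interior std_triangle" "(1/4, 1/4) \<in> interior std_triangle" by (auto simp: interior_std_triangle)
  then obtain q where q: "q \<in> interior std_triangle" "q \<noteq> y" by (cases "y = (1/3, 1/3)") auto
  let ?v = "q - y"
  have lim: "((%s. y + s *\<^sub>R ?v) \<longlongrightarrow> y) (at_right (0::real))"
  proof -
   have "((%s. y + s *\<^sub>R ?v) \<longlongrightarrow> y + 0 *\<^sub>R ?v) (at_right (0::real))" by (intro tendsto_intros)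
   then show ?thesis by simp
  qed
  have 1: "eventually (%s. y + s *\<^sub>R ?v \<in> ball z r) (at_right 0)"
   using topological_tendstoD[OF lim open_ball y(1)] .
  have 2: "eventually (%s. y + s *\<^sub>R ?v \<in> interior std_triangle) (at_right 0)"
  proof (rule eventually_at_right_0I[of 1])
   fix s :: real assume s: "0 < s" "s < 1"
   have "y - s *\<^sub>R (y - q) \<in> interior std_triangle"
    by (rule mem_interior_convex_shrink[OF convex_std_triangle q(1) y(2)]) (use s in auto)
   then show "y + s *\<^sub>R ?v \<in> interior std_triangle" by (simp add: algebra_simps)
  qed simp
  have "open (- (Exc - {y}))" using fin by (intro open_Compl finite_imp_closed) auto
  from topological_tendstoD[OF lim this]
  have 3: "eventually (%s. y + s *\<^sub>R ?v \<in> - (Exc - {y})) (at_right 0)" by simp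
  have 4: "eventually (%s::real. s > 0) (at_right 0)" by (rule eventually_at_right_less)
  show ?thesis
   by (rule exI[of _ ?v]) (use 1 2 3 4 in \<open>eventually_elim, use q(2) in \<open>auto simp: Dom_def\<close>\<close>)
 qed
 obtain y0 where y0: "y0 \<in> Dom"
 proof -
  obtain v where v: "eventually (%s. z + s *\<^sub>R v \<in> Dom) (at_right 0)" using approach[of z] r z by auto
  show ?thesis by (rule eventually_at_right_0E[OF v, of 1], simp, rule that)
 qed
 have eqO: "g y - g' y = inner (W y0) y + C y0" if y: "y \<in> Dom" for y
  using eventually_nhds_x_imp_x[OF WC[OF y]] const[OF y y0] by simp
 have "g y - g' y = inner (W y0) y + C y0" if y: "y \<in> ball z r" "y \<in> std_triangle" for y
 proof -
  obtain v where v: "eventually (%s. y + s *\<^sub>R v \<in> Dom) (at_right 0)" using approach[OF y] by blast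
  have vK: "eventually (%s. y + s *\<^sub>R v \<in> std_triangle) (at_right 0)"
   using v by eventually_elim (use interior_subset in \<open>auto simp: Dom_def\<close>)
  have fl: "filterlim (%s. y + s *\<^sub>R v) (near std_triangle y) (at_right 0)"
   unfolding filterlim_iff using eventually_near_ray[OF _ vK] by blast
  have "((%s. g (y + s *\<^sub>R v) - g' (y + s *\<^sub>R v) - (inner (W y0) (y + s *\<^sub>R v) + C y0)) \<longlongrightarrow>
    g y - g' y - (inner (W y0) (y + 0 *\<^sub>R v) + C y0)) (at_right 0)"
   by (intro tendsto_intros filterlim_compose[OF lim[OF y] fl] filterlim_compose[OF lim'[OF y] fl])
  moreover have "((%s. g (y + s *\<^sub>R v) - g' (y + s *\<^sub>R v) - (inner (W y0) (y + s *\<^sub>R v) + C y0)) \<longlongrightarrow> 0) (at_right 0)"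
   by (rule tendsto_eventually) (use v in \<open>eventually_elim, use eqO in simp\<close>)
  ultimately have "g y - g' y - (inner (W y0) (y + 0 *\<^sub>R v) + C y0) = 0"
   by (rule tendsto_unique[OF trivial_limit_at_right_real])
  then show ?thesis by simp
 qed
 then show ?thesis by (rule that)
qed

lemma near_interval_slope_unique:
 assumes t: "0 \<le> t" "t \<le> 1" and ev: "eventually (%s. (s - t) * p = (s - t) * q) (near {0..1::real} t)"
 shows "p = q"
proof -
 obtain r where r: "r > 0" "\<And>s. s \<in> {0..1} ==> dist s t < r ==> (s - t) * p = (s - t) * q"
  using ev unfolding eventually_near_metric by blast
 define s where "s = (if t < 1 then t + min r (1 - t) / 2 else t - min r 1 / 2)"
 have "s \<in> {0..1}" "dist s t < r" "s \<noteq> t"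
 proof -
  have "0 \<le> s \<and> s \<le> 1 \<and> \<bar>s - t\<bar> < r \<and> s \<noteq> t"
  proof (cases "t < 1")
   case True
   define m where "m = min r (1 - t)"
   have "m > 0" "m \<le> r" "m \<le> 1 - t" using True r(1) by (auto simp: m_def)
   moreover have "s = t + m / 2" using True by (simp add: s_def m_def)
   ultimately show ?thesis using t by (simp add: field_simps)
  next
   case False
   define m where "m = min r 1"
   have "m > 0" "m \<le> r" "m \<le> 1" using r(1) by (auto simp: m_def)
   moreover have "s = t - m / 2" using False by (simp add: s_def m_def)
   ultimately show ?thesis using t False by (simp add: field_simps)
  qed
  then show "s \<in> {0..1}" "dist s t < r" "s \<noteq> t" by (auto simp: dist_real_def)
 qed
 then show ?thesis using r(2)[of s] by simp
qed

section \<open>Slopes and divisor coefficients along edges\<close>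

context trop_surface
begin

definition wing :: "'e => 'f \<times> nat" where
 "wing e = (SOME fk. fk \<in> edge_link X e)"

lemma wing_in: "e \<in> edges X ==> wing e \<in> edge_link X e"
 unfolding wing_def using edge_link_nonempty by (simp add: some_in_eq)

definition edge_slope :: "'e => ('f \<times> nat => real \<times> real) => real" where
 "edge_slope e G = inner (G (wing e)) (side_dir (snd (wing e)))"

text \<open>The coefficient of \<open>edge_coeff\<close> expressed by slopes alone: evaluated
  relative to the point with parameter \<open>t\<close> of the edge, the constants of the affine
  functions cancel, as the integers at \<open>e\<close> add up to the number of triangles
  there.\<close>

definition edge_value :: "'e => real => ('f \<times> nat => real \<times> real) => real" where
 "edge_value e t G = (\<Sum>fk\<in>edge_link X e. inner (G fk) (tri_corner (snd fk) - tri_side (snd fk) t))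
   + (of_int (\<alpha> e 0) * t - of_int (\<alpha> e 1) * (1 - t)) * edge_slope e G"

definition edge_gradients :: "(('v, 'e, 'f) pt => real) => 'e => real => ('f \<times> nat => real \<times> real) => bool" where
 "edge_gradients h e t G \<longleftrightarrow> (\<forall>fk\<in>edge_link X e. \<exists>c.
   eventually (%y. h (fchar X (fst fk) y) = inner (G fk) y + c) (near std_triangle (tri_side (snd fk) t)))"

lemma edge_gradients_echar:
 assumes G: "edge_gradients h e t G" and e: "e \<in> edges X" "0 \<le> t" "t \<le> 1" and fk: "fk \<in> edge_link X e"
 shows "eventually (%s. h (echar X e s) = h (echar X e t) + (s - t) * inner (G fk) (side_dir (snd fk))) (near {0..1} t)"
proof -
 obtain f k where fk': "fk = (f, k)" "f \<in> tris X" "k < 3" "side X f k = e" using fk by (auto simp: edge_link_def)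
 obtain c where c: "eventually (%y. h (fchar X f y) = inner (G fk) y + c) (near std_triangle (tri_side k t))"
  using G fk unfolding edge_gradients_def fk' by auto
 have 0: "h (echar X e t) = inner (G fk) (tri_side k t) + c"
  using eventually_near_self[OF c tri_side_in[OF fk'(3) e(2,3)]] fchar_side[OF fk'(2,3) e(2,3)] fk'(4) by simp
 from near_tri_side[OF fk'(3) e(2,3) c] eventually_near_in[of "{0..1}" t]
 show ?thesis
 proof eventually_elim
  case (elim s)
  have "inner (G fk) (tri_side k s) = inner (G fk) (tri_side k t) + (s - t) * inner (G fk) (side_dir k)"
   using inner_side_dir[OF fk'(3), of "G fk" t "s - t"] by simp
  then show ?case using elim fchar_side[OF fk'(2,3), of s] fk' 0 by simp
 qed
qed

lemma edge_slope_eq: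
 assumes G: "edge_gradients h e t G" and e: "e \<in> edges X" "0 \<le> t" "t \<le> 1" and fk: "fk \<in> edge_link X e"
 shows "inner (G fk) (side_dir (snd fk)) = edge_slope e G"
 unfolding edge_slope_def
proof (rule near_interval_slope_unique[OF e(2,3)])
 show "eventually (%s. (s - t) * inner (G fk) (side_dir (snd fk)) =
  (s - t) * inner (G (wing e)) (side_dir (snd (wing e)))) (near {0..1} t)"
  using edge_gradients_echar[OF G e fk] edge_gradients_echar[OF G e wing_in[OF e(1)]]
  by eventually_elim linarith
qed

text \<open>Moving the base point changes every triangle's summand by the same multiple of the slope
  along \<open>e\<close>, and the term with the integers at \<open>e\<close> compensates for all of
  them.\<close>

lemma edge_value_shift:
 assumes G: "\<And>fk. fk \<in> edge_link X e ==> inner (G fk) (side_dir (snd fk)) = edge_slope e G" and e: "e \<in> edges X"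
 shows "edge_value e s G = edge_value e t G"
proof -
 have "(\<Sum>fk\<in>edge_link X e. inner (G fk) (tri_corner (snd fk) - tri_side (snd fk) s)) =
  (\<Sum>fk\<in>edge_link X e. inner (G fk) (tri_corner (snd fk) - tri_side (snd fk) t) - (s - t) * edge_slope e G)"
 proof (rule sum.cong[OF refl])
  fix fk assume fk: "fk \<in> edge_link X e"
  then have k: "snd fk < 3" by (auto simp: edge_link_def)
  show "inner (G fk) (tri_corner (snd fk) - tri_side (snd fk) s) =
   inner (G fk) (tri_corner (snd fk) - tri_side (snd fk) t) - (s - t) * edge_slope e G"
   using inner_side_dir[OF k, of "G fk" t "s - t"] G[OF fk] by (simp add: inner_diff_right)
 qed
 also have "\<dots> = (\<Sum>fk\<in>edge_link X e. inner (G fk) (tri_corner (snd fk) - tri_side (snd fk) t))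
   - of_int (\<alpha> e 0 + \<alpha> e 1) * ((s - t) * edge_slope e G)"
  unfolding alpha_sum[OF e] by (simp add: sum_subtractf)
 finally show ?thesis unfolding edge_value_def by (simp add: algebra_simps)
qed

lemma edge_gradients_unique:
 assumes "edge_gradients h e t G" "edge_gradients h e t G'" "0 \<le> t" "t \<le> 1" "fk \<in> edge_link X e"
 shows "G fk = G' fk"
proof -
 have k: "snd fk < 3" using assms(5) by (auto simp: edge_link_def)
 obtain c c' where c: "eventually (%y. h (fchar X (fst fk) y) = inner (G fk) y + c) (near std_triangle (tri_side (snd fk) t))"
  "eventually (%y. h (fchar X (fst fk) y) = inner (G' fk) y + c') (near std_triangle (tri_side (snd fk) t))"
  using assms(1,2,5) unfolding edge_gradients_def by blast
 have "eventually (%y. inner (G fk) y + c = inner (G' fk) y + c') (near std_triangle (tri_side (snd fk) t))"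
  using c by eventually_elim simp
 then show ?thesis by (rule affine_near_unique(1)[OF tri_side_in[OF k assms(3,4)]])
qed

lemma edge_value_cong: "(\<And>fk. fk \<in> edge_link X e ==> G fk = G' fk) ==> e \<in> edges X ==> edge_value e t G = edge_value e t G'"
 unfolding edge_value_def edge_slope_def using wing_in by simp

lemma edge_value_diff: "edge_value e t (%fk. G fk - G' fk) = edge_value e t G - edge_value e t G'"
proof -
 have "(\<Sum>fk\<in>edge_link X e. inner (G fk - G' fk) (tri_corner (snd fk) - tri_side (snd fk) t)) =
  (\<Sum>fk\<in>edge_link X e. inner (G fk) (tri_corner (snd fk) - tri_side (snd fk) t)) -
  (\<Sum>fk\<in>edge_link X e. inner (G' fk) (tri_corner (snd fk) - tri_side (snd fk) t))"
  by (simp only: inner_diff_left sum_subtractf)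
 moreover have "edge_slope e (%fk. G fk - G' fk) = edge_slope e G - edge_slope e G'"
  by (simp add: edge_slope_def inner_diff_left)
 ultimately show ?thesis unfolding edge_value_def by (simp only: right_diff_distrib)
qed

text \<open>Restates a local equation in terms of \<open>\<psi>\<close> alone: the rational factor
  is absorbed into slopes and coefficients, the polyhedral subdivision is replaced by conic germs,
  and the coefficients of the divisor become breaks and edge values off finite sets.\<close>

lemma local_equation_properties:
 assumes le: "local_equation X \<alpha> D p \<psi>" and p: "p \<in> points X"
 obtains U where "openin T U" "p \<in> U"
  "\<And>f a. f \<in> tris X ==> a \<in> std_triangle ==> fchar X f a \<in> U ==> conic std_triangle (%z. \<psi> (fchar X f z)) a"
  "\<And>f a. f \<in> tris X ==> a \<in> std_triangle ==> fchar X f a \<in> U ==>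
    ((%z. \<psi> (fchar X f z)) \<longlongrightarrow> \<psi> (fchar X f a)) (near std_triangle a)"
  "\<And>x. x \<in> U ==> \<exists>N Exc. openin T N \<and> x \<in> N \<and> N \<subseteq> U \<and> finite Exc \<and>
    (\<forall>f\<in>tris X. \<forall>z\<in>interior std_triangle. FPt f z \<in> N - Exc -->
     breaks_at (%y. \<psi> (fchar X f y)) z (of_rat (multiplicity_at D (FPt f z)))) \<and>
    (\<forall>e\<in>edges X. \<forall>t\<in>{0<..<1}. EPt e t \<in> N - Exc -->
     (\<exists>G. edge_gradients \<psi> e t G \<and> edge_value e t G = of_rat (multiplicity_at D (EPt e t))))"
proof -
 obtain U q \<phi> where U: "openin T U" "p \<in> U" and pl: "pl_on X U \<phi>" and eq: "eq_mult_div_on X \<alpha> U D q \<phi>"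
  and \<psi>: "\<psi> = (%x. of_rat q * \<phi> x)"
  using le unfolding local_equation_def by blast
 have con: "conic std_triangle (%z. \<psi> (fchar X f z)) a"
  if "f \<in> tris X" "a \<in> std_triangle" "fchar X f a \<in> U" for f a
 proof -
  have "int_pl_near std_triangle a (\<phi> \<circ> fchar X f)" using pl that unfolding pl_on_def by blast
  from int_pl_near_conic[OF this convex_std_triangle that(2)]
  show ?thesis unfolding \<psi> comp_def by (rule conic_scale)
 qed
 have lim: "((%z. \<psi> (fchar X f z)) \<longlongrightarrow> \<psi> (fchar X f a)) (near std_triangle a)"
  if fa: "f \<in> tris X" "a \<in> std_triangle" "fchar X f a \<in> U" for f a
 proof -
  have cm: "continuous_map (subtopology T U) euclideanreal \<phi>" using pl unfolding pl_on_def by blast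
  have "((%z. \<phi> (fchar X f z)) \<longlongrightarrow> \<phi> (fchar X f a)) (near std_triangle a)"
  proof (rule topological_tendstoI)
   fix S :: "real set" assume S: "open S" "\<phi> (fchar X f a) \<in> S"
   have tU: "topspace (subtopology T U) = U" using openin_subset[OF U(1)] by auto
   have "openin (subtopology T U) {x\<in>U. \<phi> x \<in> S}" using cm S(1) unfolding continuous_map_def tU by simp
   then have "openin T {x\<in>U. \<phi> x \<in> S}" by (rule openin_trans_full[OF _ U(1)])
   from near_fchar[OF this fa(1,2)] show "eventually (%z. \<phi> (fchar X f z) \<in> S) (near std_triangle a)"
    using S fa(3) by (simp add: eventually_mono)
  qed
  then show ?thesis unfolding \<psi> by (intro tendsto_intros)
 qed
 have br: "\<exists>N Exc. openin T N \<and> x \<in> N \<and> N \<subseteq> U \<and> finite Exc \<and>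
    (\<forall>f\<in>tris X. \<forall>z\<in>interior std_triangle. FPt f z \<in> N - Exc -->
     breaks_at (%y. \<psi> (fchar X f y)) z (of_rat (multiplicity_at D (FPt f z)))) \<and>
    (\<forall>e\<in>edges X. \<forall>t\<in>{0<..<1}. EPt e t \<in> N - Exc -->
     (\<exists>G. edge_gradients \<psi> e t G \<and> edge_value e t G = of_rat (multiplicity_at D (EPt e t))))" if x: "x \<in> U" for x
 proof -
  obtain N where N: "openin T N" "x \<in> N" "N \<subseteq> U"
   "finite {y\<in>N. \<not> (\<exists>m. div_coeff X \<alpha> \<phi> y m \<and> multiplicity_at D y = q * of_int m)}"
   using eq x unfolding eq_mult_div_on_def by blast
  define Exc where "Exc = {y\<in>N. \<not> (\<exists>m. div_coeff X \<alpha> \<phi> y m \<and> multiplicity_at D y = q * of_int m)}"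
  have m: "\<exists>m. div_coeff X \<alpha> \<phi> y m \<and> multiplicity_at D y = q * of_int m" if "y \<in> N - Exc" for y
   using that by (auto simp: Exc_def)
  have 1: "breaks_at (%y. \<psi> (fchar X f y)) z (of_rat (multiplicity_at D (FPt f z)))"
   if f: "f \<in> tris X" "z \<in> interior std_triangle" "FPt f z \<in> N - Exc" for f z
  proof -
   obtain m where m: "tri_coeff X \<phi> f z m" "multiplicity_at D (FPt f z) = q * of_int m"
    using m[OF f(3)] unfolding div_coeff_def by auto
   obtain w c n where n: "primitive_vec n"
    "eventually (%y. \<phi> (fchar X f y) = inner w y + c + of_int m * max 0 (inner n (y - z))) (nhds z)"
    using m(1) unfolding tri_coeff_def by blast
   have "eventually (%y. \<psi> (fchar X f y) = inner (of_rat q *\<^sub>R w) y + of_rat q * c + of_rat (q * of_int m) * max 0 (inner n (y - z))) (nhds z)"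
    using n(2) by eventually_elim (simp add: \<psi> of_rat_mult algebra_simps)
   then show ?thesis unfolding breaks_at_def m(2) using n(1) by blast
  qed
  have 2: "\<exists>G. edge_gradients \<psi> e t G \<and> edge_value e t G = of_rat (multiplicity_at D (EPt e t))"
   if e: "e \<in> edges X" "t \<in> {0<..<1}" "EPt e t \<in> N - Exc" for e t
  proof -
   have t: "0 \<le> t" "t \<le> 1" using e(2) by auto
   obtain m where m: "edge_coeff X \<alpha> \<phi> e t m" "multiplicity_at D (EPt e t) = q * of_int m"
    using m[OF e(3)] unfolding div_coeff_def by auto
   obtain a b w c where ab: "eventually (%s. \<phi> (echar X e s) = a * s + b) (nhds t)"
    and w: "\<forall>(f, k)\<in>edge_link X e. eventually (%y. \<phi> (fchar X f y) = inner (w (f, k)) y + c (f, k)) (near std_triangle (tri_side k t))"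
    and mm: "of_int m = (\<Sum>(f, k)\<in>edge_link X e. inner (w (f, k)) (tri_corner k) + c (f, k))
     - of_int (\<alpha> e 0) * b - of_int (\<alpha> e 1) * (a + b)"
    using m(1) unfolding edge_coeff_def by blast
   have gw: "edge_gradients \<phi> e t w" unfolding edge_gradients_def using w by fastforce
   have at: "\<phi> (echar X e t) = a * t + b" using eventually_nhds_x_imp_x[OF ab] .
   have "edge_slope e w = a"
   proof (rule near_interval_slope_unique[OF t])
    show "eventually (%s. (s - t) * edge_slope e w = (s - t) * a) (near {0..1} t)"
     using edge_gradients_echar[OF gw e(1) t wing_in[OF e(1)]] eventually_near_of_nhds[OF ab]
     by eventually_elim (simp add: edge_slope_def at algebra_simps)
   qed
   note sl = this
   have "(\<Sum>(f, k)\<in>edge_link X e. inner (w (f, k)) (tri_corner k) + c (f, k)) =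
    (\<Sum>fk\<in>edge_link X e. inner (w fk) (tri_corner (snd fk) - tri_side (snd fk) t) + (a * t + b))"
   proof (rule sum.cong[OF refl])
    fix fk assume fk: "fk \<in> edge_link X e"
    obtain f k where fk': "fk = (f, k)" "f \<in> tris X" "k < 3" "side X f k = e" using fk by (auto simp: edge_link_def)
    have "eventually (%y. \<phi> (fchar X f y) = inner (w fk) y + c fk) (near std_triangle (tri_side k t))"
     using w fk unfolding fk' by auto
    from eventually_near_self[OF this tri_side_in[OF fk'(3) t]]
    have "inner (w fk) (tri_side k t) + c fk = a * t + b"
     using fchar_side[OF fk'(2,3) t] fk'(4) at by simp
    then show "(case fk of (f, k) => inner (w (f, k)) (tri_corner k) + c (f, k)) =
      inner (w fk) (tri_corner (snd fk) - tri_side (snd fk) t) + (a * t + b)"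
     by (simp add: fk' inner_diff_right)
   qed
   also have "\<dots> = (\<Sum>fk\<in>edge_link X e. inner (w fk) (tri_corner (snd fk) - tri_side (snd fk) t))
     + of_int (\<alpha> e 0 + \<alpha> e 1) * (a * t + b)"
    unfolding alpha_sum[OF e(1)] by (simp add: sum.distrib)
   finally have ev: "of_int m = edge_value e t w"
    unfolding edge_value_def sl using mm by (simp add: algebra_simps)
   have "edge_gradients \<psi> e t (%fk. of_rat q *\<^sub>R w fk)"
    unfolding edge_gradients_def
   proof
    fix fk assume "fk \<in> edge_link X e"
    then obtain c where "eventually (%y. \<phi> (fchar X (fst fk) y) = inner (w fk) y + c) (near std_triangle (tri_side (snd fk) t))"
     using gw unfolding edge_gradients_def by blast
    then have "eventually (%y. \<psi> (fchar X (fst fk) y) = inner (of_rat q *\<^sub>R w fk) y + of_rat q * c) (near std_triangle (tri_side (snd fk) t))"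
     by eventually_elim (simp add: \<psi> distrib_left)
    then show "\<exists>c. eventually (%y. \<psi> (fchar X (fst fk) y) = inner (of_rat q *\<^sub>R w fk) y + c) (near std_triangle (tri_side (snd fk) t))" by blast
   qed
   moreover have "edge_value e t (%fk. of_rat q *\<^sub>R w fk) = of_rat q * edge_value e t w"
    unfolding edge_value_def edge_slope_def by (simp add: distrib_left sum_distrib_left)
   ultimately show ?thesis unfolding m(2) using ev by (metis of_rat_mult of_rat_of_int_eq)
  qed
  show ?thesis
   by (rule exI[of _ N], rule exI[of _ Exc]) (use N 1 2 in \<open>auto simp: Exc_def\<close>)
 qed
 show ?thesis by (rule that[OF U con lim br])
qed

end

lemma near_interval_exists:
 assumes s: "0 \<le> s" "s \<le> 1" and ev: "eventually P (near {0..1::real} s)" and fin: "finite S"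
 obtains x where "0 < x" "x < 1" "x \<notin> S" "P x"
proof -
 obtain r where r: "r > 0" "\<And>x. x \<in> {0..1} ==> dist x s < r ==> P x"
  using ev unfolding eventually_near_metric by blast
 have "max 0 (s - r) < min 1 (s + r)" using s r(1) by auto
 then have "infinite ({max 0 (s - r)<..<min 1 (s + r)} - S)" using fin by (simp add: infinite_Ioo)
 then obtain x where "x \<in> {max 0 (s - r)<..<min 1 (s + r)} - S" by (metis finite.emptyI ex_in_conv)
 then have "0 < x" "x < 1" "x \<notin> S" "dist x s < r" by (auto simp: dist_real_def)
 then show ?thesis using that r(2)[of x] by simp
qed

lemma affine_real_near_unique:
 assumes t: "0 \<le> t" "t \<le> 1" and ev: "eventually (%s. A * s + B = A' * s + B') (near {0..1::real} t)"
 shows "A = A'" "B = B'"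
proof -
 have 0: "A * t + B = A' * t + B'" by (rule eventually_near_self[OF ev]) (use t in simp)
 have "eventually (%s. (s - t) * A = (s - t) * A') (near {0..1} t)"
  using ev by eventually_elim (use 0 in \<open>simp add: algebra_simps\<close>)
 from near_interval_slope_unique[OF t this] show "A = A'" .
 then show "B = B'" using 0 by simp
qed

section \<open>The correction \<open>theta\<close> and the slopes that remain\<close>

locale surface_divisor = trop_surface X \<alpha> for X :: "('v, 'e, 'f) delta_complex" and \<alpha> +
 fixes D :: "('v, 'e, 'f) pt set => rat" and \<psi> :: "('v, 'e, 'f) pt => ('v, 'e, 'f) pt => real"
 assumes formal_D: "formal_sum X D"
  and local_eq: "\<And>p. p \<in> points X ==> local_equation X \<alpha> D p (\<psi> p)"
begin

definition mult :: "('v, 'e, 'f) pt => real" where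
 "mult x = of_rat (multiplicity_at D x)"

definition regular_nbhd :: "('v, 'e, 'f) pt => ('v, 'e, 'f) pt set => bool" where
 "regular_nbhd p U \<longleftrightarrow> openin T U \<and> p \<in> U \<and>
  (\<forall>f\<in>tris X. \<forall>a\<in>std_triangle. fchar X f a \<in> U --> conic std_triangle (%z. \<psi> p (fchar X f z)) a \<and>
    ((%z. \<psi> p (fchar X f z)) \<longlongrightarrow> \<psi> p (fchar X f a)) (near std_triangle a)) \<and>
  (\<forall>x\<in>U. \<exists>N S. openin T N \<and> x \<in> N \<and> N \<subseteq> U \<and> finite S \<and>
    (\<forall>f\<in>tris X. \<forall>z\<in>interior std_triangle. FPt f z \<in> N - S -->
     breaks_at (%y. \<psi> p (fchar X f y)) z (mult (FPt f z))) \<and>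
    (\<forall>e\<in>edges X. \<forall>t\<in>{0<..<1}. EPt e t \<in> N - S -->
     (\<exists>G. edge_gradients (\<psi> p) e t G \<and> edge_value e t G = mult (EPt e t))))"

definition dom :: "('v, 'e, 'f) pt => ('v, 'e, 'f) pt set" where
 "dom p = (SOME U. regular_nbhd p U)"

lemma regular_dom: "p \<in> points X ==> regular_nbhd p (dom p)"
 unfolding dom_def
proof (rule someI_ex)
 assume p: "p \<in> points X"
 obtain U where U: "openin T U" "p \<in> U"
  "\<And>f a. f \<in> tris X ==> a \<in> std_triangle ==> fchar X f a \<in> U ==> conic std_triangle (%z. \<psi> p (fchar X f z)) a"
  "\<And>f a. f \<in> tris X ==> a \<in> std_triangle ==> fchar X f a \<in> U ==>
    ((%z. \<psi> p (fchar X f z)) \<longlongrightarrow> \<psi> p (fchar X f a)) (near std_triangle a)"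
  "\<And>x. x \<in> U ==> \<exists>N Exc. openin T N \<and> x \<in> N \<and> N \<subseteq> U \<and> finite Exc \<and>
    (\<forall>f\<in>tris X. \<forall>z\<in>interior std_triangle. FPt f z \<in> N - Exc -->
     breaks_at (%y. \<psi> p (fchar X f y)) z (of_rat (multiplicity_at D (FPt f z)))) \<and>
    (\<forall>e\<in>edges X. \<forall>t\<in>{0<..<1}. EPt e t \<in> N - Exc -->
     (\<exists>G. edge_gradients (\<psi> p) e t G \<and> edge_value e t G = of_rat (multiplicity_at D (EPt e t))))"
  by (rule local_equation_properties[OF local_eq[OF p] p]) (rule that)
 show "\<exists>U. regular_nbhd p U"
  unfolding regular_nbhd_def mult_def
  by (rule exI[of _ U], intro conjI ballI impI; (rule U; assumption))
qed

lemma open_dom: "p \<in> points X ==> openin T (dom p)"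
 and in_dom: "p \<in> points X ==> p \<in> dom p"
 using regular_dom unfolding regular_nbhd_def by blast+

lemma conic_dom: "p \<in> points X ==> f \<in> tris X ==> a \<in> std_triangle ==> fchar X f a \<in> dom p ==>
  conic std_triangle (%z. \<psi> p (fchar X f z)) a"
 and lim_dom: "p \<in> points X ==> f \<in> tris X ==> a \<in> std_triangle ==> fchar X f a \<in> dom p ==>
  ((%z. \<psi> p (fchar X f z)) \<longlongrightarrow> \<psi> p (fchar X f a)) (near std_triangle a)"
 using regular_dom[of p] unfolding regular_nbhd_def by simp_all

lemma generic_dom:
 assumes "p \<in> points X" "x \<in> dom p"
 obtains N S where "openin T N" "x \<in> N" "N \<subseteq> dom p" "finite (S :: ('v, 'e, 'f) pt set)"
  "\<And>f z. f \<in> tris X ==> z \<in> interior std_triangle ==> FPt f z \<in> N ==> FPt f z \<notin> S ==>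
    breaks_at (%y. \<psi> p (fchar X f y)) z (mult (FPt f z))"
  "\<And>e t. e \<in> edges X ==> 0 < t ==> t < 1 ==> EPt e t \<in> N ==> EPt e t \<notin> S ==>
    \<exists>G. edge_gradients (\<psi> p) e t G \<and> edge_value e t G = mult (EPt e t)"
proof -
 have "\<exists>N S. openin T N \<and> x \<in> N \<and> N \<subseteq> dom p \<and> finite S \<and>
    (\<forall>f\<in>tris X. \<forall>z\<in>interior std_triangle. FPt f z \<in> N - S -->
     breaks_at (%y. \<psi> p (fchar X f y)) z (mult (FPt f z))) \<and>
    (\<forall>e\<in>edges X. \<forall>t\<in>{0<..<1}. EPt e t \<in> N - S -->
     (\<exists>G. edge_gradients (\<psi> p) e t G \<and> edge_value e t G = mult (EPt e t)))"
  using regular_dom[OF assms(1)] assms(2) unfolding regular_nbhd_def by simp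
 then obtain N S where NS: "openin T N" "x \<in> N" "N \<subseteq> dom p" "finite S"
  and 1: "\<forall>f\<in>tris X. \<forall>z\<in>interior std_triangle. FPt f z \<in> N - S -->
     breaks_at (%y. \<psi> p (fchar X f y)) z (mult (FPt f z))"
  and 2: "\<forall>e\<in>edges X. \<forall>t\<in>{0<..<1}. EPt e t \<in> N - S -->
     (\<exists>G. edge_gradients (\<psi> p) e t G \<and> edge_value e t G = mult (EPt e t))"
  by (elim exE conjE) (rule that)
 show ?thesis by (rule that[OF NS]) (use 1 2 in \<open>simp_all del: split_paired_All\<close>)
qed

lemma local_equations_differ:
 assumes p: "p \<in> points X" "p' \<in> points X" and f: "f \<in> tris X" and z: "z \<in> std_triangle"
  and dom: "fchar X f z \<in> dom p" "fchar X f z \<in> dom p'"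
 shows "\<exists>w c. eventually (%y. \<psi> p (fchar X f y) - \<psi> p' (fchar X f y) = inner w y + c) (near std_triangle z)"
proof -
 obtain N S where N: "openin T N" "fchar X f z \<in> N" "N \<subseteq> dom p" "finite (S :: ('v, 'e, 'f) pt set)"
  "\<And>f z. f \<in> tris X ==> z \<in> interior std_triangle ==> FPt f z \<in> N ==> FPt f z \<notin> S ==>
    breaks_at (%y. \<psi> p (fchar X f y)) z (mult (FPt f z))"
  "\<And>e s. e \<in> edges X ==> 0 < s ==> s < 1 ==> EPt e s \<in> N ==> EPt e s \<notin> S ==>
    \<exists>G. edge_gradients (\<psi> p) e s G \<and> edge_value e s G = mult (EPt e s)"
  by (rule generic_dom[OF p(1) dom(1)]) (rule that)
 obtain N' S' where N': "openin T N'" "fchar X f z \<in> N'" "N' \<subseteq> dom p'" "finite (S' :: ('v, 'e, 'f) pt set)"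
  "\<And>f z. f \<in> tris X ==> z \<in> interior std_triangle ==> FPt f z \<in> N' ==> FPt f z \<notin> S' ==>
    breaks_at (%y. \<psi> p' (fchar X f y)) z (mult (FPt f z))"
  "\<And>e s. e \<in> edges X ==> 0 < s ==> s < 1 ==> EPt e s \<in> N' ==> EPt e s \<notin> S' ==>
    \<exists>G. edge_gradients (\<psi> p') e s G \<and> edge_value e s G = mult (EPt e s)"
  by (rule generic_dom[OF p(2) dom(2)]) (rule that)
 have "eventually (%y. fchar X f y \<in> N \<and> fchar X f y \<in> N') (near std_triangle z)"
  by (intro eventually_conj near_fchar N N' f z)
 then obtain r where r: "r > 0" "\<And>y. y \<in> std_triangle ==> dist y z < r ==> fchar X f y \<in> N \<and> fchar X f y \<in> N'"
  unfolding eventually_near_metric by blast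
 define E where "E = FPt f -` (S \<union> S')"
 have finE: "finite E" unfolding E_def by (rule finite_vimageI) (use N(4) N'(4) in \<open>auto intro: injI\<close>)
 have mem: "fchar X f y \<in> N" "fchar X f y \<in> N'" if "y \<in> ball z r" "y \<in> std_triangle" for y
  using r(2)[OF that(2)] that(1) by (auto simp: dist_commute)
 have int: "y \<in> std_triangle" if "y \<in> interior std_triangle" for y :: "real \<times> real" using that interior_subset by blast
 obtain w c where wc: "\<And>y. y \<in> ball z r ==> y \<in> std_triangle ==> \<psi> p (fchar X f y) - \<psi> p' (fchar X f y) = inner w y + c"
 proof (rule breaks_difference_affine[OF z r(1) finE, of "%y. \<psi> p (fchar X f y)" "%y. mult (FPt f y)" "%y. \<psi> p' (fchar X f y)"])
  fix y assume y: "y \<in> ball z r" "y \<in> interior std_triangle" "y \<notin> E"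
  show "breaks_at (%y. \<psi> p (fchar X f y)) y (mult (FPt f y))"
   using N(5)[OF f y(2)] mem(1)[OF y(1) int[OF y(2)]] y(3) fchar_interior[OF y(2), of X f] by (simp add: E_def)
  show "breaks_at (%y. \<psi> p' (fchar X f y)) y (mult (FPt f y))"
   using N'(5)[OF f y(2)] mem(2)[OF y(1) int[OF y(2)]] y(3) fchar_interior[OF y(2), of X f] by (simp add: E_def)
 next
  fix y assume y: "y \<in> ball z r" "y \<in> std_triangle"
  show "((%y. \<psi> p (fchar X f y)) \<longlongrightarrow> \<psi> p (fchar X f y)) (near std_triangle y)"
   by (rule lim_dom[OF p(1) f y(2)]) (use mem(1)[OF y] N(3) in blast)
  show "((%y. \<psi> p' (fchar X f y)) \<longlongrightarrow> \<psi> p' (fchar X f y)) (near std_triangle y)"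
   by (rule lim_dom[OF p(2) f y(2)]) (use mem(2)[OF y] N'(3) in blast)
 qed (rule that)
 have "eventually (%y. \<psi> p (fchar X f y) - \<psi> p' (fchar X f y) = inner w y + c) (near std_triangle z)"
  unfolding eventually_near_metric using r(1) wc by (metis dist_commute mem_ball)
 then show ?thesis by blast
qed

text \<open>Local equations of the same divisor differ by affine functions on the triangle, so
  adjusting them to each other is the gluing problem for the group of affine functions.\<close>

lemma tri_theta_exists:
 assumes f: "f \<in> tris X"
 shows "\<exists>\<theta>. \<theta> (0, 0) = (0::real) \<and> \<theta> (1, 0) = 0 \<and> \<theta> (0, 1) = 0 \<and> (\<forall>a\<in>std_triangle. \<exists>w c.
   eventually (%z. \<psi> (fchar X f a) (fchar X f z) = \<theta> z + (inner w z + c)) (near std_triangle a))"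
proof -
 define G where "G a = {\<phi>. \<exists>w c. eventually (%z. \<phi> z = \<psi> (fchar X f a) (fchar X f z) + (inner w z + c)) (near std_triangle a)}" for a
 define L where "L = {l. \<exists>w c. l = (%z::real \<times> real. inner w z + c)}"
 interpret germ_torsor std_triangle G L
 proof
  show "convex std_triangle" "closed std_triangle" "std_triangle \<subseteq> {0..1} \<times> {0..1}"
   by (rule convex_std_triangle closed_std_triangle std_triangle_box)+
  fix a \<phi> \<eta> assume a: "a \<in> std_triangle" "\<phi> \<in> G a" "eventually (%z. \<eta> z = \<phi> z) (near std_triangle a)"
  then obtain w c where "eventually (%z. \<phi> z = \<psi> (fchar X f a) (fchar X f z) + (inner w z + c)) (near std_triangle a)"
   unfolding G_def by blast
  with a(3) have "eventually (%z. \<eta> z = \<psi> (fchar X f a) (fchar X f z) + (inner w z + c)) (near std_triangle a)"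
   by eventually_elim simp
  then show "\<eta> \<in> G a" unfolding G_def by blast
 next
  fix a \<phi> \<eta> assume a: "a \<in> std_triangle" "\<phi> \<in> G a" "\<eta> \<in> G a"
  then obtain w c w' c' where "eventually (%z. \<phi> z = \<psi> (fchar X f a) (fchar X f z) + (inner w z + c)) (near std_triangle a)"
   "eventually (%z. \<eta> z = \<psi> (fchar X f a) (fchar X f z) + (inner w' z + c')) (near std_triangle a)"
   unfolding G_def by blast
  then have "eventually (%z. \<eta> z - \<phi> z = inner (w' - w) z + (c' - c)) (near std_triangle a)"
   by eventually_elim (simp add: inner_diff_left)
  then show "\<exists>l\<in>L. eventually (%z. \<eta> z - \<phi> z = l z) (near std_triangle a)"
   unfolding L_def by (intro bexI[of _ "%z. inner (w' - w) z + (c' - c)"]) blast+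
 next
  fix a \<phi> l assume a: "a \<in> std_triangle" "\<phi> \<in> G a" "l \<in> L"
  then obtain w c w' c' where 1: "eventually (%z. \<phi> z = \<psi> (fchar X f a) (fchar X f z) + (inner w z + c)) (near std_triangle a)"
   "l = (%z. inner w' z + c')"
   unfolding G_def L_def by blast
  from 1(1) have "eventually (%z. \<phi> z - l z = \<psi> (fchar X f a) (fchar X f z) + (inner (w - w') z + (c - c'))) (near std_triangle a)"
   by eventually_elim (simp add: 1(2) inner_diff_left)
  then show "(%z. \<phi> z - l z) \<in> G a" unfolding G_def by blast
 next
  fix a l l' assume a: "a \<in> std_triangle" "l \<in> L" "l' \<in> L" "eventually (%z. l z = l' z) (near std_triangle a)"
  then obtain w c w' c' where l: "l = (%z. inner w z + c)" "l' = (%z. inner w' z + c')" unfolding L_def by blast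
  show "l = l'" using affine_near_unique[OF a(1) a(4)[unfolded l]] l by simp
 next
  fix a assume a: "a \<in> std_triangle"
  have p: "fchar X f a \<in> points X" by (rule fchar_points[OF f a])
  have "eventually (%z. (%z. \<psi> (fchar X f a) (fchar X f z)) \<in> G z) (near std_triangle a)"
   using near_fchar[OF open_dom[OF p] f a in_dom[OF p]] eventually_near_in[of std_triangle a]
  proof eventually_elim
   case (elim z)
   have p': "fchar X f z \<in> points X" by (rule fchar_points[OF f elim(2)])
   obtain w c where "eventually (%y. \<psi> (fchar X f a) (fchar X f y) - \<psi> (fchar X f z) (fchar X f y) = inner w y + c) (near std_triangle z)"
    using local_equations_differ[OF p p' f elim(2,1) in_dom[OF p']] by blast
   then have "eventually (%y. \<psi> (fchar X f a) (fchar X f y) = \<psi> (fchar X f z) (fchar X f y) + (inner w y + c)) (near std_triangle z)"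
    by eventually_elim linarith
   then show ?case unfolding G_def by blast
  qed
  then show "\<exists>\<phi>. eventually (%z. \<phi> \<in> G z) (near std_triangle a)" by blast
 qed
 obtain \<phi> where \<phi>: "\<And>a. a \<in> std_triangle ==> \<phi> \<in> G a" using global_solution by blast
 \<comment> \<open>The gradient of the affine function that interpolates \<open>\<phi>\<close> at
   the three vertices; removing it normalizes the solution.\<close>
 define v where "v = (\<phi> (1, 0) - \<phi> (0, 0), \<phi> (0, 1) - \<phi> (0, 0))"
 define \<theta> where "\<theta> z = \<phi> z - (inner v z + \<phi> (0, 0))" for z
 have "\<exists>w c. eventually (%z. \<psi> (fchar X f a) (fchar X f z) = \<theta> z + (inner w z + c)) (near std_triangle a)"
  if a: "a \<in> std_triangle" for a
 proof -
  obtain w c where "eventually (%z. \<phi> z = \<psi> (fchar X f a) (fchar X f z) + (inner w z + c)) (near std_triangle a)"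
   using \<phi>[OF a] unfolding G_def by blast
  then have "eventually (%z. \<psi> (fchar X f a) (fchar X f z) = \<theta> z + (inner (v - w) z + (\<phi> (0, 0) - c))) (near std_triangle a)"
   by eventually_elim (simp add: \<theta>_def inner_diff_left)
  then show ?thesis by blast
 qed
 moreover have "\<theta> (0, 0) = 0" "\<theta> (1, 0) = 0" "\<theta> (0, 1) = 0" by (simp_all add: \<theta>_def v_def)
 ultimately show ?thesis by blast
qed

definition tri_theta :: "'f => real \<times> real => real" where
 "tri_theta f = (SOME \<theta>. \<theta> (0, 0) = (0::real) \<and> \<theta> (1, 0) = 0 \<and> \<theta> (0, 1) = 0 \<and> (\<forall>a\<in>std_triangle. \<exists>w c.
   eventually (%z. \<psi> (fchar X f a) (fchar X f z) = \<theta> z + (inner w z + c)) (near std_triangle a)))"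

lemma tri_theta:
 assumes "f \<in> tris X"
 shows "tri_theta f (0, 0) = 0" "tri_theta f (1, 0) = 0" "tri_theta f (0, 1) = 0"
  "\<And>a. a \<in> std_triangle ==> \<exists>w c. eventually (%z. \<psi> (fchar X f a) (fchar X f z) = tri_theta f z + (inner w z + c)) (near std_triangle a)"
 using someI_ex[OF tri_theta_exists[OF assms], folded tri_theta_def] by blast+

text \<open>
 A piecewise linear function that vanishes at the vertices and differs from every local equation of
 the divisor by functions that are affine on simplices.
\<close>

definition theta :: "('v, 'e, 'f) pt => real" where
 "theta x = (case x of VPt _ => 0 | EPt e t => tri_theta (fst (wing e)) (tri_side (snd (wing e)) t) | FPt f z => tri_theta f z)"

lemma tri_theta_end: "f \<in> tris X ==> k < 3 ==> t = 0 \<or> t = 1 ==> tri_theta f (tri_side k t) = 0"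
 using tri_theta(1-3)[of f] by (auto simp: tri_side_def less_Suc_eq numeral_3_eq_3)

text \<open>On the common side both functions differ from the same local equation by affine
  functions, so their difference is affine along the side, and it vanishes at both ends. This is the
  purpose of the normalization at the vertices.\<close>

lemma tri_theta_side:
 assumes f: "f \<in> tris X" "k < 3" and f': "f' \<in> tris X" "k' < 3" and e: "side X f k = side X f' k'" and t: "0 \<le> t" "t \<le> 1"
 shows "tri_theta f (tri_side k t) = tri_theta f' (tri_side k' t)"
proof -
 define \<delta> where "\<delta> t = tri_theta f (tri_side k t) - tri_theta f' (tri_side k' t)" for t
 have "\<exists>A B. eventually (%s. \<delta> s = A * s + B) (near {0..1} t)" if t: "0 \<le> t" "t \<le> 1" for t
 proof -
  define p where "p = echar X (side X f k) t"
  have p: "fchar X f (tri_side k t) = p" "fchar X f' (tri_side k' t) = p" using fchar_side f f' e t by (auto simp: p_def)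
  obtain w c where w: "eventually (%z. \<psi> p (fchar X f z) = tri_theta f z + (inner w z + c)) (near std_triangle (tri_side k t))"
   using tri_theta(4)[OF f(1) tri_side_in[OF f(2) t]] p by auto
  obtain w' c' where w': "eventually (%z. \<psi> p (fchar X f' z) = tri_theta f' z + (inner w' z + c')) (near std_triangle (tri_side k' t))"
   using tri_theta(4)[OF f'(1) tri_side_in[OF f'(2) t]] p by auto
  have "eventually (%s. \<delta> s = (inner w' (side_dir k') - inner w (side_dir k)) * s +
    (inner w' (tri_side k' 0) + c' - inner w (tri_side k 0) - c)) (near {0..1} t)"
   using near_tri_side[OF f(2) t w] near_tri_side[OF f'(2) t w'] eventually_near_in[of "{0..1}" t]
  proof eventually_elim
   case (elim s)
   have "fchar X f (tri_side k s) = fchar X f' (tri_side k' s)" using fchar_side f f' e elim(3) by auto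
   then show ?case using elim(1,2) inner_side_dir[OF f(2), of w 0 s] inner_side_dir[OF f'(2), of w' 0 s]
    by (simp add: \<delta>_def algebra_simps)
  qed
  then show ?thesis by blast
 qed
 then obtain A B where AB: "\<And>t. 0 \<le> t ==> t \<le> 1 ==> eventually (%s. \<delta> s = A t * s + B t) (near {0..1} t)" by metis
 have const: "(A s, B s) = (A u, B u)" if su: "s \<in> {0..1}" "u \<in> {0..1}" for s u
 proof (rule near_local_const[OF _ su])
  show "connected {0..1::real}" by simp
  fix x :: real assume x: "x \<in> {0..1}"
  have "eventually (%y. eventually (%s. \<delta> s = A x * s + B x) (near {0..1} y)) (near {0..1} x)"
   using x by (intro eventually_near_eventually AB) auto
  with eventually_near_in[of "{0..1}" x] show "eventually (%y. (A x, B x) = (A y, B y)) (near {0..1} x)"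
  proof eventually_elim
   case (elim y)
   have y: "0 \<le> y" "y \<le> 1" using elim(1) by auto
   have "eventually (%s. A x * s + B x = A y * s + B y) (near {0..1} y)"
    using elim(2) AB[OF y] by eventually_elim simp
   from affine_real_near_unique[OF y this] show ?case by simp
  qed
 qed
 have \<delta>: "\<delta> s = A 0 * s + B 0" if "0 \<le> s" "s \<le> 1" for s
  using eventually_near_self[OF AB[OF that]] const[of s 0] that by simp
 have "\<delta> 0 = 0" "\<delta> 1 = 0" unfolding \<delta>_def using tri_theta_end f f' by simp_all
 then have "B 0 = 0" "A 0 = 0" using \<delta>[of 0] \<delta>[of 1] by simp_all
 then show ?thesis using \<delta>[OF t] by (simp add: \<delta>_def)
qed

lemma theta_fchar:
 assumes f: "f \<in> tris X" and z: "z \<in> std_triangle"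
 shows "theta (fchar X f z) = tri_theta f z"
 using z
proof (cases rule: std_triangle_cases)
 case 1
 then show ?thesis by (simp add: fchar_interior theta_def)
next
 case (2 k t)
 have w: "wing (side X f k) \<in> edge_link X (side X f k)" by (rule wing_in[OF side_in[OF f 2(1)]])
 then have w': "fst (wing (side X f k)) \<in> tris X" "snd (wing (side X f k)) < 3"
  "side X (fst (wing (side X f k))) (snd (wing (side X f k))) = side X f k" by (auto simp: edge_link_def)
 show ?thesis
 proof (cases "t = 0 \<or> t = 1")
  case True
  then show ?thesis using fchar_side[OF f 2(1,2,3)] 2(4) tri_theta_end[OF f 2(1) True] by (auto simp: echar_def theta_def)
 next
  case False
  then show ?thesis using fchar_side[OF f 2(1,2,3)] 2(4) tri_theta_side[OF w'(1,2) f 2(1) w'(3) 2(2,3)]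
   by (simp add: echar_def theta_def)
 qed
qed

text \<open>The gradient on the triangle \<open>f\<close> of the local equation at the image of
  \<open>a\<close> minus \<open>theta\<close>, a function that is affine near
  \<open>a\<close>.\<close>

definition grad :: "'f => real \<times> real => real \<times> real" where
 "grad f a = (SOME w. \<exists>c. eventually (%z. \<psi> (fchar X f a) (fchar X f z) - theta (fchar X f z) = inner w z + c) (near std_triangle a))"

lemma grad:
 assumes f: "f \<in> tris X" and a: "a \<in> std_triangle"
 shows "\<exists>c. eventually (%z. \<psi> (fchar X f a) (fchar X f z) - theta (fchar X f z) = inner (grad f a) z + c) (near std_triangle a)"
 unfolding grad_def
proof (rule someI_ex)
 obtain w c where "eventually (%z. \<psi> (fchar X f a) (fchar X f z) = tri_theta f z + (inner w z + c)) (near std_triangle a)"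
  using tri_theta(4)[OF f a] by blast
 with eventually_near_in[of std_triangle a]
 have "eventually (%z. \<psi> (fchar X f a) (fchar X f z) - theta (fchar X f z) = inner w z + c) (near std_triangle a)"
  by eventually_elim (simp add: theta_fchar[OF f])
 then show "\<exists>w c. eventually (%z. \<psi> (fchar X f a) (fchar X f z) - theta (fchar X f z) = inner w z + c) (near std_triangle a)"
  by blast
qed

lemma conic_theta:
 assumes f: "f \<in> tris X" and a: "a \<in> std_triangle"
 shows "conic std_triangle (%z. theta (fchar X f z)) a"
proof -
 have p: "fchar X f a \<in> points X" by (rule fchar_points[OF f a])
 obtain c where c: "eventually (%z. \<psi> (fchar X f a) (fchar X f z) - theta (fchar X f z) = inner (grad f a) z + c) (near std_triangle a)"
  using grad[OF f a] by blast
 have "conic std_triangle (%z. \<psi> (fchar X f a) (fchar X f z) + (-1) * (inner (grad f a) z + c)) a"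
  by (rule conic_lin[OF conic_dom[OF p f a in_dom[OF p]] conic_affine])
 moreover have "eventually (%z. theta (fchar X f z) = \<psi> (fchar X f a) (fchar X f z) + (-1) * (inner (grad f a) z + c)) (near std_triangle a)"
  using c by eventually_elim simp
 ultimately show ?thesis by (rule conic_cong[OF _ _ a convex_std_triangle])
qed

definition edge_grad :: "'e => real => 'f \<times> nat => real \<times> real" where
 "edge_grad e t fk = grad (fst fk) (tri_side (snd fk) t)"

lemma edge_gradients_diff:
 assumes "edge_gradients h e t G" "edge_gradients h' e t G'"
 shows "edge_gradients (%x. h x - h' x) e t (%fk. G fk - G' fk)"
 unfolding edge_gradients_def
proof
 fix fk assume "fk \<in> edge_link X e"
 then obtain c c' where "eventually (%y. h (fchar X (fst fk) y) = inner (G fk) y + c) (near std_triangle (tri_side (snd fk) t))"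
  "eventually (%y. h' (fchar X (fst fk) y) = inner (G' fk) y + c') (near std_triangle (tri_side (snd fk) t))"
  using assms unfolding edge_gradients_def by blast
 then have "eventually (%y. h (fchar X (fst fk) y) - h' (fchar X (fst fk) y) = inner (G fk - G' fk) y + (c - c')) (near std_triangle (tri_side (snd fk) t))"
  by eventually_elim (simp add: inner_diff_left)
 then show "\<exists>c. eventually (%y. h (fchar X (fst fk) y) - h' (fchar X (fst fk) y) = inner (G fk - G' fk) y + c) (near std_triangle (tri_side (snd fk) t))"
  by blast
qed

lemma edge_gradients_near:
 assumes G: "edge_gradients h e t G" and t: "0 \<le> t" "t \<le> 1"
 shows "eventually (%s. edge_gradients h e s G) (near {0..1} t)"
 unfolding edge_gradients_def
proof (subst eventually_ball_finite_distrib[OF fin_edge_link], intro ballI)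
 fix fk assume fk: "fk \<in> edge_link X e"
 then have k: "snd fk < 3" by (auto simp: edge_link_def)
 obtain c where c: "eventually (%y. h (fchar X (fst fk) y) = inner (G fk) y + c) (near std_triangle (tri_side (snd fk) t))"
  using G fk unfolding edge_gradients_def by blast
 from near_tri_side[OF k t eventually_near_eventually[OF c]]
 show "eventually (%s. \<exists>c. eventually (%y. h (fchar X (fst fk) y) = inner (G fk) y + c) (near std_triangle (tri_side (snd fk) s))) (near {0..1} t)"
  by eventually_elim blast
qed

lemma edge_grad_gradients:
 assumes e: "e \<in> edges X" and t: "0 \<le> t" "t \<le> 1"
 shows "edge_gradients (%x. \<psi> (echar X e t) x - theta x) e t (edge_grad e t)"
 unfolding edge_gradients_def
proof
 fix fk assume "fk \<in> edge_link X e"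
 then obtain f k where fk: "fk = (f, k)" "f \<in> tris X" "k < 3" "side X f k = e" by (auto simp: edge_link_def)
 show "\<exists>c. eventually (%y. \<psi> (echar X e t) (fchar X (fst fk) y) - theta (fchar X (fst fk) y) = inner (edge_grad e t fk) y + c) (near std_triangle (tri_side (snd fk) t))"
  using grad[OF fk(2) tri_side_in[OF fk(3) t]] fchar_side[OF fk(2,3) t] fk(1,4) by (simp add: edge_grad_def)
qed

lemma generic_edge_value:
 assumes e: "e \<in> edges X" and t: "0 \<le> t" "t \<le> 1"
 shows "eventually (%s. 0 < s \<and> s < 1 \<and> s \<noteq> t --> (\<exists>G. edge_gradients (\<psi> (echar X e t)) e s G \<and> edge_value e s G = mult (EPt e s))) (near {0..1} t)"
proof -
 let ?p = "echar X e t"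
 have p: "?p \<in> points X" by (rule echar_points[OF e t])
 obtain N S where N: "openin T N" "?p \<in> N" "N \<subseteq> dom ?p" "finite (S :: ('v, 'e, 'f) pt set)"
  "\<And>f z. f \<in> tris X ==> z \<in> interior std_triangle ==> FPt f z \<in> N ==> FPt f z \<notin> S ==>
    breaks_at (%y. \<psi> ?p (fchar X f y)) z (mult (FPt f z))"
  "\<And>e s. e \<in> edges X ==> 0 < s ==> s < 1 ==> EPt e s \<in> N ==> EPt e s \<notin> S ==>
    \<exists>G. edge_gradients (\<psi> ?p) e s G \<and> edge_value e s G = mult (EPt e s)"
  by (rule generic_dom[OF p in_dom[OF p]]) (rule that)
 define E where "E = EPt e -` S"
 have "finite E" unfolding E_def by (rule finite_vimageI) (use N(4) in \<open>auto intro: injI\<close>)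
 \<comment> \<open>Exceptional parameters other than \<open>t\<close> keep a positive distance from
   \<open>t\<close>; only \<open>t\<close> itself has to be left out.\<close>
 then have "open (- (E - {t}))" by (intro open_Compl finite_imp_closed) auto
 then have "eventually (%s. s \<in> - (E - {t})) (near {0..1} t)" by (rule eventually_near_open) simp
 with near_echar[OF N(1) e t N(2)] show ?thesis
 proof eventually_elim
  case (elim s)
  then show ?case using N(6)[OF e, of s] by (auto simp: echar_def E_def split: if_splits)
 qed
qed

text \<open>The divisor coefficient along \<open>e\<close> of the local equation at the parameter
  \<open>t\<close> minus \<open>theta\<close>.\<close>

definition edge_y :: "'e => real => real" where
 "edge_y e t = edge_value e t (edge_grad e t)"

lemma edge_y_theta:
 assumes e: "e \<in> edges X" and t: "0 \<le> t" "t \<le> 1"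
 shows "eventually (%s. 0 < s \<and> s < 1 \<and> s \<noteq> t -->
   (\<exists>G. edge_gradients theta e s G \<and> edge_value e s G = mult (EPt e s) - edge_y e t)) (near {0..1} t)"
 using generic_edge_value[OF e t] edge_gradients_near[OF edge_grad_gradients[OF e t] t]
proof eventually_elim
 case (elim s)
 show ?case
 proof
  assume s: "0 < s \<and> s < 1 \<and> s \<noteq> t"
  then obtain G where G: "edge_gradients (\<psi> (echar X e t)) e s G" "edge_value e s G = mult (EPt e s)"
   using elim(1) by blast
  have "edge_gradients (%x. \<psi> (echar X e t) x - (\<psi> (echar X e t) x - theta x)) e s (%fk. G fk - edge_grad e t fk)"
   by (rule edge_gradients_diff[OF G(1) elim(2)])
  moreover have "edge_value e s (edge_grad e t) = edge_y e t"
   unfolding edge_y_def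
   by (rule edge_value_shift[OF edge_slope_eq[OF edge_grad_gradients[OF e t] e t] e])
  ultimately show "\<exists>G. edge_gradients theta e s G \<and> edge_value e s G = mult (EPt e s) - edge_y e t"
   using G(2) edge_value_diff[of e s G "edge_grad e t"] by auto
 qed
qed

text \<open>At a generic point near \<open>t\<close>, the coefficient of \<open>theta\<close> is
  \<open>mult\<close> minus \<open>edge_y e t\<close>. The coefficient of \<open>theta\<close> does
  not involve a local equation, so two nearby parameters can be compared at a common generic
  point.\<close>

lemma edge_y_const:
 assumes e: "e \<in> edges X" and st: "s \<in> {0..1}" "t \<in> {0..1}"
 shows "edge_y e s = edge_y e t"
proof (rule near_local_const[OF _ st])
 show "connected {0..1::real}" by simp
 fix x :: real assume x: "x \<in> {0..1}"
 have x': "0 \<le> x" "x \<le> 1" using x by auto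
 from eventually_near_eventually[OF edge_y_theta[OF e x']] eventually_near_in[of "{0..1}" x]
 show "eventually (%y. edge_y e x = edge_y e y) (near {0..1} x)"
 proof eventually_elim
  case (elim y)
  have y: "0 \<le> y" "y \<le> 1" using elim(2) by auto
  obtain u where u: "0 < u" "u < 1" "u \<notin> {x, y}" and
   "(0 < u \<and> u < 1 \<and> u \<noteq> x --> (\<exists>G. edge_gradients theta e u G \<and> edge_value e u G = mult (EPt e u) - edge_y e x)) \<and>
    (0 < u \<and> u < 1 \<and> u \<noteq> y --> (\<exists>G. edge_gradients theta e u G \<and> edge_value e u G = mult (EPt e u) - edge_y e y))"
   by (rule near_interval_exists[OF y eventually_conj[OF elim(1) edge_y_theta[OF e y]], of "{x, y}"]) (simp, rule that)
  then obtain G G' where G: "edge_gradients theta e u G" "edge_value e u G = mult (EPt e u) - edge_y e x"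
   "edge_gradients theta e u G'" "edge_value e u G' = mult (EPt e u) - edge_y e y" by blast
  have "edge_value e u G = edge_value e u G'"
   by (rule edge_value_cong[OF edge_gradients_unique[OF G(1,3)] e]) (use u in auto)
  then show ?case using G by simp
 qed
qed

text \<open>The outgoing slope of the local equation at the vertex minus \<open>theta\<close>; the
  factor is 1 at endpoint 0 and -1 at endpoint 1.\<close>

definition vertex_slope :: "'e \<times> nat => real" where
 "vertex_slope a = (1 - 2 * real (snd a)) * edge_slope (fst a) (edge_grad (fst a) (real (snd a)))"

text \<open>In contrast to a cocycle, the slopes at the two ends of \<open>e\<close> belong to
  different local equations. That both rows have the same value is the constancy of
  \<open>edge_y\<close> along the edge.\<close>

lemma vertex_slope_row:
 assumes a: "(e, i) \<in> germs X v"
 shows "(\<Sum>b\<in>germs X v. lmat v (e, i) b * vertex_slope b) = edge_y e 0"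
proof -
 have e: "e \<in> edges X" and i: "i = 0 \<or> i = 1" using a by (auto simp: germs_def)
 have adj: "vertex_slope (adj_germ X i fk) = inner (edge_grad e i fk) (tri_corner (snd fk) - tri_side (snd fk) i)"
  if fk: "fk \<in> edge_link X e" for fk
 proof -
  obtain f k where fk': "fk = (f, k)" "f \<in> tris X" "k < 3" "side X f k = e" using fk by (auto simp: edge_link_def)
  \<comment> \<open>The other side of the triangle at this corner. It leaves the corner towards the
    vertex opposite to \<open>e\<close>, so its slope is read off from the same gradient of
    \<open>f\<close>.\<close>
  obtain j b where jb: "adj k i = (j, b)" by fastforce
  have k3: "k = 0 \<or> k = 1 \<or> k = 2" using fk'(3) by linarith
  have j: "j < 3" "b = 0 \<or> b = 1" "tri_side j (real b) = tri_side k (real i)"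
   "(1 - 2 * real b) *\<^sub>R side_dir j = tri_corner k - tri_side k (real i)"
   using k3 i jb by (auto simp: adj_def tri_side_def side_dir_def tri_corner_def)
  let ?e = "side X f j"
  have ee: "?e \<in> edges X" by (rule side_in[OF fk'(2) j(1)])
  have b01: "0 \<le> real b" "real b \<le> 1" using j(2) by auto
  have "(f, j) \<in> edge_link X ?e" using fk'(2) j(1) by (simp add: edge_link_def)
  from edge_slope_eq[OF edge_grad_gradients[OF ee b01] ee b01 this]
  have "edge_slope ?e (edge_grad ?e (real b)) = inner (grad f (tri_side k (real i))) (side_dir j)"
   by (simp add: edge_grad_def j(3))
  then have "vertex_slope (?e, b) = inner (grad f (tri_side k (real i))) ((1 - 2 * real b) *\<^sub>R side_dir j)"
   by (simp add: vertex_slope_def)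
  then show ?thesis unfolding j(4) by (simp add: fk'(1) adj_germ_def jb edge_grad_def)
 qed
 have "(\<Sum>b\<in>germs X v. lmat v (e, i) b * vertex_slope b) =
   (\<Sum>fk\<in>edge_link X e. inner (edge_grad e i fk) (tri_corner (snd fk) - tri_side (snd fk) i))
   - of_int (\<alpha> e (1 - i)) * vertex_slope (e, i)"
  unfolding lmat_row[OF a] using adj by simp
 also have "\<dots> = edge_y e (real i)"
  unfolding edge_y_def edge_value_def using i by (auto simp: vertex_slope_def)
 also have "\<dots> = edge_y e 0" by (rule edge_y_const[OF e]) (use i in auto)
 finally show ?thesis .
qed

end

section \<open>Segments and rays\<close>

text \<open>The points of the interval together with a direction that stays in the interval for a
  while.\<close>

definition line_germs :: "real => real => (real \<times> real) set" where
 "line_germs A B = {(t, s). A \<le> t \<and> t \<le> B \<and> (s = 1 \<and> t < B \<or> s = - 1 \<and> A < t)}"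

text \<open>If the ray meets the convex set arbitrarily close to its origin, then it contains all
  points between such a point and one fixed further meeting point.\<close>

lemma convex_settles:
 fixes a v :: "'a::real_vector"
 assumes C: "convex C"
 shows "eventually (%\<xi>. a + \<xi> *\<^sub>R v \<in> C) (at_right (0::real)) \<or> eventually (%\<xi>. a + \<xi> *\<^sub>R v \<notin> C) (at_right 0)"
proof (rule disjCI)
 assume n: "\<not> eventually (%\<xi>. a + \<xi> *\<^sub>R v \<notin> C) (at_right 0)"
 have fr: "\<exists>\<xi>. 0 < \<xi> \<and> \<xi> < b \<and> a + \<xi> *\<^sub>R v \<in> C" if "0 < b" for b :: real
  using n eventually_at_right_0I[OF that, of "%\<xi>. a + \<xi> *\<^sub>R v \<notin> C"] by blast
 obtain e1 :: real where e1: "0 < e1" "a + e1 *\<^sub>R v \<in> C" using fr[of 1] by auto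
 show "eventually (%\<xi>. a + \<xi> *\<^sub>R v \<in> C) (at_right 0)"
 proof (rule eventually_at_right_0I[OF e1(1)])
  fix \<xi> :: real assume e: "0 < \<xi>" "\<xi> < e1"
  obtain e0 where e0: "0 < e0" "e0 < \<xi>" "a + e0 *\<^sub>R v \<in> C" using fr[OF e(1)] by blast
  define u where "u = (\<xi> - e0) / (e1 - e0)"
  have u: "0 \<le> u" "u \<le> 1" using e e0 by (auto simp: u_def field_simps)
  have *: "(1 - u) *\<^sub>R (a + e0 *\<^sub>R v) + u *\<^sub>R (a + e1 *\<^sub>R v) \<in> C"
   using convexD[OF C e0(3) e1(2), of "1 - u" u] u by simp
  have "e0 + u * (e1 - e0) = \<xi>" using e e0 by (simp add: u_def)
  moreover have "(1 - u) *\<^sub>R (a + e0 *\<^sub>R v) + u *\<^sub>R (a + e1 *\<^sub>R v) = a + (e0 + u * (e1 - e0)) *\<^sub>R v"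
   by (simp add: algebra_simps)
  ultimately show "a + \<xi> *\<^sub>R v \<in> C" using * by simp
 qed
qed

lemma line_germs_eventually:
 assumes "s = 1 \<or> s = - 1"
 shows "eventually (%\<xi>. t + \<xi> * s \<in> {A..B}) (at_right 0) \<longleftrightarrow> (t, s) \<in> line_germs A B"
proof
 assume "(t, s) \<in> line_germs A B"
 then consider "s = 1" "A \<le> t" "t < B" | "s = - 1" "A < t" "t \<le> B" by (auto simp: line_germs_def)
 then show "eventually (%\<xi>. t + \<xi> * s \<in> {A..B}) (at_right 0)"
 proof cases
  case 1 then show ?thesis by (intro eventually_at_right_0I[of "B - t"]) auto
 next
  case 2 then show ?thesis by (intro eventually_at_right_0I[of "t - A"]) auto
 qed
next
 assume ev: "eventually (%\<xi>. t + \<xi> * s \<in> {A..B}) (at_right 0)"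
 have "((%\<xi>. t + \<xi> * s) \<longlongrightarrow> t) (at_right 0)" by (auto intro!: tendsto_eq_intros)
 from Lim_in_closed_set[OF closed_atLeastAtMost ev trivial_limit_at_right_real this] have "t \<in> {A..B}" .
 moreover obtain \<xi> where "0 < \<xi>" "t + \<xi> * s \<in> {A..B}" using eventually_at_right_0_ex[OF ev] by blast
 ultimately show "(t, s) \<in> line_germs A B" using assms by (auto simp: line_germs_def)
qed

lemma line_germs_interior:
 assumes "(t, s) \<in> line_germs A B"
 shows "eventually (%\<xi>. t + \<xi> * s \<in> {A<..<B}) (at_right 0)"
proof -
 consider "s = 1" "A \<le> t" "t < B" | "s = - 1" "A < t" "t \<le> B" using assms by (auto simp: line_germs_def)
 then show ?thesis
 proof cases
  case 1 then show ?thesis by (intro eventually_at_right_0I[of "B - t"]) auto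
 next
  case 2 then show ?thesis by (intro eventually_at_right_0I[of "t - A"]) auto
 qed
qed

lemma line_germs_sign: "(t, s) \<in> line_germs A B ==> s = 1 \<or> s = - 1"
 by (auto simp: line_germs_def)

text \<open>The slopes in both directions at all points of an interval telescope. They are grouped
  by the image point, because a loop passes through its vertex twice. All but finitely many groups
  vanish, and \<open>has_sum\<close> makes sums over all points additive without tracking the
  exceptional sets.\<close>

theorem curve_sum:
 assumes AB: "A < B" and con: "\<And>t. A \<le> t ==> t \<le> B ==> conic {A..B} k t"
  and fib: "\<And>p. finite {t\<in>{A..B}. c t = p}"
 shows "finite {g\<in>line_germs A B. c (fst g) = p}"
  "((%p. \<Sum>g\<in>{g\<in>line_germs A B. c (fst g) = p}. rslope (%\<xi>. k (fst g + \<xi> * snd g))) has_sum 0) UNIV"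
proof -
 define J where "J t = (\<Sum>s\<in>{s. (t, s) \<in> line_germs A B}. rslope (%\<xi>. k (t + \<xi> * s)))" for t
 have sub: "{g\<in>line_germs A B. c (fst g) = p} = (SIGMA t:{t\<in>{A..B}. c t = p}. {s. (t, s) \<in> line_germs A B})" for p
  by (auto simp: line_germs_def)
 have fs: "finite {s. (t, s) \<in> line_germs A B}" for t
  by (rule finite_subset[of _ "{1, - 1}"]) (auto simp: line_germs_def)
 show "finite {g\<in>line_germs A B. c (fst g) = p}" unfolding sub by (intro finite_SigmaI fib fs)
 have F: "(\<Sum>g\<in>{g\<in>line_germs A B. c (fst g) = p}. rslope (%\<xi>. k (fst g + \<xi> * snd g))) =
   (\<Sum>t\<in>{t\<in>{A..B}. c t = p}. J t)" for p
  unfolding sub J_def by (subst sum.Sigma) (use fib fs in \<open>simp_all add: case_prod_unfold\<close>)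
 have mid: "J t = jump k t" if "A < t" "t < B" for t
 proof -
  have "{s. (t, s) \<in> line_germs A B} = {1, - 1}" using that by (auto simp: line_germs_def)
  then show ?thesis by (simp add: J_def jump_def)
 qed
 have "{s. (A, s) \<in> line_germs A B} = {1}" "{s. (B, s) \<in> line_germs A B} = {- 1}" using AB by (auto simp: line_germs_def)
 then have ends: "J A = rslope (%\<xi>. k (A + \<xi>))" "J B = rslope (%\<xi>. k (B - \<xi>))" by (simp_all add: J_def)
 define M where "M = {t\<in>{A<..<B}. jump k t \<noteq> 0}"
 have P: "finite M" "(\<Sum>t\<in>M. jump k t) = - J B - J A"
  using summation_by_parts[OF AB con, of 1 0] unfolding parts_formula_def M_def ends by simp_all
 define Z where "Z = insert A (insert B M)"
 have Z: "finite Z" "Z \<subseteq> {A..B}" using P(1) AB by (auto simp: Z_def M_def)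
 have Jz: "J t = 0" if "t \<in> {A..B}" "t \<notin> Z" for t
  using that mid[of t] by (auto simp: Z_def M_def order_less_le)
 have "sum J M = (\<Sum>t\<in>M. jump k t)" by (rule sum.cong) (use mid in \<open>auto simp: M_def\<close>)
 moreover have "A \<notin> insert B M" "B \<notin> M" using AB by (auto simp: M_def)
 ultimately have JZ: "sum J Z = 0" using P by (simp add: Z_def)
 have fibZ: "(\<Sum>t\<in>{t\<in>{A..B}. c t = p}. J t) = (\<Sum>t\<in>{t\<in>Z. c t = p}. J t)" for p
  by (rule sum.mono_neutral_right[OF fib]) (use Z(2) Jz in auto)
 show "((%p. \<Sum>g\<in>{g\<in>line_germs A B. c (fst g) = p}. rslope (%\<xi>. k (fst g + \<xi> * snd g))) has_sum 0) UNIV"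
  unfolding F fibZ
 proof (rule has_sum_finite_neutralI[of "c ` Z"])
  show "0 = (\<Sum>p\<in>c ` Z. \<Sum>t\<in>{t\<in>Z. c t = p}. J t)" using sum.image_gen[OF Z(1), of J c] JZ by simp
  fix p assume "p \<in> UNIV - c ` Z"
  then have "{t\<in>Z. c t = p} = {}" by auto
  then show "(\<Sum>t\<in>{t\<in>Z. c t = p}. J t) = 0" by (simp only: sum.empty)
 qed (use Z in auto)
qed

lemma ray_determined:
 fixes a a' v v' :: "'a::real_vector"
 assumes "eventually (%\<xi>. a + \<xi> *\<^sub>R v = a' + \<xi> *\<^sub>R v') (at_right (0::real))"
 shows "a = a'" "v = v'"
proof -
 obtain b :: real where b: "b > 0" "\<And>\<xi>. 0 < \<xi> ==> \<xi> < b ==> a + \<xi> *\<^sub>R v = a' + \<xi> *\<^sub>R v'"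
  using assms unfolding eventually_at_right_field by blast
 define r where "r = b / 4"
 have r: "r > 0" "r < b" "r + r < b" using b(1) by (auto simp: r_def)
 have 1: "a + r *\<^sub>R v = a' + r *\<^sub>R v'" by (rule b(2)) (use r in auto)
 have "a + (r + r) *\<^sub>R v = a' + (r + r) *\<^sub>R v'" by (rule b(2)) (use r in auto)
 then have "(a + r *\<^sub>R v) + r *\<^sub>R v = (a' + r *\<^sub>R v') + r *\<^sub>R v'" by (simp only: scaleR_add_left add.assoc)
 then have "r *\<^sub>R v = r *\<^sub>R v'" unfolding 1 by simp
 then show "v = v'" using r(1) by simp
 then show "a = a'" using 1 by simp
qed

lemma conic_subset: "conic K g a ==> J \<subseteq> K ==> conic J g a"
 unfolding conic_def conic_upto_def by blast

lemma tri_side_convex_comb: "k < 3 ==> tri_side k ((1 - u) * s + u * t) = (1 - u) *\<^sub>R tri_side k s + u *\<^sub>R tri_side k t"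
 by (auto simp: tri_side_def less_Suc_eq numeral_3_eq_3 algebra_simps)

lemma closed_segment_tri_side:
 assumes "k < 3" "s \<le> t"
 shows "closed_segment (tri_side k s) (tri_side k t) = tri_side k ` {s..t}"
proof -
 have "tri_side k ` closed_segment s t = {tri_side k ((1 - u) * s + u * t) |u. 0 \<le> u \<and> u \<le> 1}"
  unfolding closed_segment_def by auto
 also have "\<dots> = closed_segment (tri_side k s) (tri_side k t)"
  unfolding tri_side_convex_comb[OF assms(1)] closed_segment_def ..
 finally have "closed_segment (tri_side k s) (tri_side k t) = tri_side k ` closed_segment s t" ..
 then show ?thesis using assms(2) by (simp add: closed_segment_eq_real_ivl)
qed

text \<open>If an inner point of the segment has a barycentric coordinate 0, then both ends have
  that coordinate 0. So each segment of a divisor either is part of an edge or has all inner points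
  inside a triangle.\<close>

lemma std_triangle_segment:
 assumes p: "p \<in> std_triangle" and q: "q \<in> std_triangle"
  and z: "z \<in> open_segment p q" "z \<notin> interior std_triangle"
 obtains k s t where "k < 3" "0 \<le> s" "s \<le> 1" "0 \<le> t" "t \<le> 1" "p = tri_side k s" "q = tri_side k t"
proof -
 obtain p1 p2 q1 q2 where pq: "p = (p1, p2)" "q = (q1, q2)" by (cases p, cases q)
 have P: "0 \<le> p1" "0 \<le> p2" "p1 + p2 \<le> 1" "0 \<le> q1" "0 \<le> q2" "q1 + q2 \<le> 1"
  using p q by (auto simp: pq std_triangle_def)
 obtain u where u: "0 < u" "u < 1" "z = ((1 - u) * p1 + u * q1, (1 - u) * p2 + u * q2)"
  using z(1) unfolding in_segment pq by auto
 have zero: "x = 0 \<and> y = 0" if "0 \<le> x" "0 \<le> y" "\<not> 0 < (1 - u) * x + u * y" for x y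
 proof -
  have "0 \<le> (1 - u) * x" "0 \<le> u * y" using u that by auto
  then have "(1 - u) * x = 0" "u * y = 0" using that(3) by linarith+
  then show ?thesis using u by simp
 qed
 have "\<not> (0 < (1 - u) * p1 + u * q1 \<and> 0 < (1 - u) * p2 + u * q2 \<and> 0 < (1 - u) * (1 - p1 - p2) + u * (1 - q1 - q2))"
  using z(2) unfolding interior_std_triangle u(3) by (auto simp: algebra_simps)
 then consider "p1 = 0 \<and> q1 = 0" | "p2 = 0 \<and> q2 = 0" | "1 - p1 - p2 = 0 \<and> 1 - q1 - q2 = 0"
  using zero[of p1 q1] zero[of p2 q2] zero[of "1 - p1 - p2" "1 - q1 - q2"] P by auto
 then show ?thesis
 proof cases
  case 1 then show ?thesis using P by (intro that[of 1 p2 q2]) (auto simp: pq tri_side_def)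
 next
  case 2 then show ?thesis using P by (intro that[of 2 p1 q1]) (auto simp: pq tri_side_def)
 next
  case 3 then show ?thesis using P by (intro that[of 0 p2 q2]) (auto simp: pq tri_side_def)
 qed
qed

section \<open>Rays and the segments that contain them\<close>

context trop_surface
begin

lemma echar_eq_EPt: "0 < x ==> x < 1 ==> echar X e' y = EPt e x \<longleftrightarrow> e' = e \<and> y = x"
 by (auto simp: echar_def)

lemma FPt_neq_echar [simp]: "FPt f z \<noteq> echar X e y" "echar X e y \<noteq> FPt f z"
 by (auto simp: echar_def)

lemma fchar_eq_FPt:
 assumes "f' \<in> tris X" "z' \<in> std_triangle"
 shows "fchar X f' z' = FPt f z \<longleftrightarrow> f' = f \<and> z' = z \<and> z \<in> interior std_triangle"
 using assms(2)
proof (cases rule: std_triangle_cases)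
 case 1 then show ?thesis by (auto simp: fchar_interior)
next
 case (2 k t)
 have "tri_side k t \<notin> interior std_triangle"
  using 2(1) by (auto simp: interior_std_triangle tri_side_def less_Suc_eq numeral_3_eq_3)
 then show ?thesis using fchar_side[OF assms(1) 2(1-3)] 2(4) by auto
qed

lemma segment_cases:
 assumes "S \<in> segments X"
 obtains e s t where "e \<in> edges X" "0 \<le> s" "s < t" "t \<le> 1" "S = echar X e ` {s..t}"
 | f p q where "f \<in> tris X" "p \<in> std_triangle" "q \<in> std_triangle" "p \<noteq> q"
   "open_segment p q \<subseteq> interior std_triangle" "S = fchar X f ` closed_segment p q"
proof -
 consider e s t where "e \<in> edges X" "0 \<le> s" "s < t" "t \<le> 1" "S = echar X e ` {s..t}"
  | f p q where "f \<in> tris X" "p \<in> std_triangle" "q \<in> std_triangle" "p \<noteq> q" "S = fchar X f ` closed_segment p q"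
  using assms unfolding segments_def by blast
 then show ?thesis
 proof cases
  case 1 then show ?thesis by (rule that(1))
 next
  case (2 f p q)
  show ?thesis
  proof (cases "open_segment p q \<subseteq> interior std_triangle")
   case True
   show ?thesis by (rule that(2)[OF 2(1-4) True 2(5)])
  next
   case False
   then obtain z where z: "z \<in> open_segment p q" "z \<notin> interior std_triangle" by blast
   obtain k s t where k: "k < 3" "0 \<le> s" "s \<le> 1" "0 \<le> t" "t \<le> 1" "p = tri_side k s" "q = tri_side k t"
    by (rule std_triangle_segment[OF 2(2,3) z]) (rule that)
   have im: "fchar X f ` tri_side k ` {x..y} = echar X (side X f k) ` {x..y}" if "0 \<le> x" "y \<le> 1" for x y
    unfolding image_image by (rule image_cong[OF refl], rule fchar_side[OF 2(1) k(1)]) (use that in auto)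
   have "s \<noteq> t" using k(6,7) 2(4) by blast
   then consider "s < t" | "t < s" by linarith
   then show ?thesis
   proof cases
    case 1
    have "S = echar X (side X f k) ` {s..t}"
     unfolding 2(5) k(6,7) using closed_segment_tri_side[OF k(1), of s t] im[OF k(2,5)] 1 by simp
    then show ?thesis by (rule that(1)[OF side_in[OF 2(1) k(1)] k(2) 1 k(5)])
   next
    case r: 2
    have "S = echar X (side X f k) ` {t..s}"
     unfolding 2(5) k(6,7) closed_segment_commute[of "tri_side k s"] using closed_segment_tri_side[OF k(1), of t s] im[OF k(4,3)] r by simp
    then show ?thesis by (rule that(1)[OF side_in[OF 2(1) k(1)] k(4) r k(3)])
   qed
  qed
 qed
qed

definition edge_germs :: "('v, 'e, 'f) pt => ('e \<times> real \<times> real) set" where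
 "edge_germs p = {(e, t, s). e \<in> edges X \<and> (t, s) \<in> line_germs 0 1 \<and> echar X e t = p}"

definition tri_germs :: "('v, 'e, 'f) pt => ('f \<times> (real \<times> real) \<times> (real \<times> real)) set" where
 "tri_germs p = {(f, a, u). f \<in> tris X \<and> a \<in> std_triangle \<and> fchar X f a = p \<and> primitive_vec u \<and>
   eventually (%\<xi>. a + \<xi> *\<^sub>R u \<in> interior std_triangle) (at_right 0)}"

definition edge_ray :: "'e \<times> real \<times> real => real => ('v, 'e, 'f) pt" where
 "edge_ray g \<xi> = (case g of (e, t, s) => echar X e (t + \<xi> * s))"

definition tri_ray :: "'f \<times> (real \<times> real) \<times> (real \<times> real) => real => ('v, 'e, 'f) pt" where
 "tri_ray h \<xi> = (case h of (f, a, u) => fchar X f (a + \<xi> *\<^sub>R u))"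

lemma edge_ray_eventually:
 assumes "(t, s) \<in> line_germs 0 1"
 shows "eventually (%\<xi>. 0 < t + \<xi> * s \<and> t + \<xi> * s < 1 \<and> edge_ray (e, t, s) \<xi> = EPt e (t + \<xi> * s)) (at_right 0)"
 using line_germs_interior[OF assms] by eventually_elim (simp add: edge_ray_def echar_def)

lemma tri_ray_eventually:
 assumes "eventually (%\<xi>. a + \<xi> *\<^sub>R u \<in> interior std_triangle) (at_right 0)"
 shows "eventually (%\<xi>. a + \<xi> *\<^sub>R u \<in> interior std_triangle \<and> tri_ray (f, a, u) \<xi> = FPt f (a + \<xi> *\<^sub>R u)) (at_right 0)"
 using assms by eventually_elim (simp add: tri_ray_def fchar_interior)

lemma rays_eq: "rays X p = edge_ray ` edge_germs p \<union> tri_ray ` tri_germs p"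
proof (rule subset_antisym; rule subsetI)
 fix \<gamma> assume g: "\<gamma> \<in> rays X p"
 then have g0: "\<gamma> 0 = p" by (simp add: rays_def)
 from g consider e t u where "e \<in> edges X" "t \<in> {0..1}" "u \<in> {1, -1}"
   "eventually (%\<xi>. t + \<xi> * u \<in> {0<..<1}) (at_right 0)" "\<gamma> = (%\<xi>. echar X e (t + \<xi> * u))"
  | f a u where "f \<in> tris X" "a \<in> std_triangle" "primitive_vec u"
   "eventually (%\<xi>. a + \<xi> *\<^sub>R u \<in> interior std_triangle) (at_right 0)" "\<gamma> = (%\<xi>. fchar X f (a + \<xi> *\<^sub>R u))"
  unfolding rays_def by blast
 then show "\<gamma> \<in> edge_ray ` edge_germs p \<union> tri_ray ` tri_germs p"
 proof cases
  case (1 e t u)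
  have "eventually (%\<xi>. t + \<xi> * u \<in> {0..1}) (at_right 0)" using 1(4) by eventually_elim auto
  then have "(t, u) \<in> line_germs 0 1" using line_germs_eventually 1(3) by auto
  then have "(e, t, u) \<in> edge_germs p" using 1(1,5) g0 by (simp add: edge_germs_def)
  moreover have "\<gamma> = edge_ray (e, t, u)" unfolding 1(5) by (rule ext) (simp add: edge_ray_def)
  ultimately show ?thesis by blast
 next
  case (2 f a u)
  have "(f, a, u) \<in> tri_germs p" using 2 g0 by (simp add: tri_germs_def)
  moreover have "\<gamma> = tri_ray (f, a, u)" unfolding 2(5) by (rule ext) (simp add: tri_ray_def)
  ultimately show ?thesis by blast
 qed
next
 fix \<gamma> assume "\<gamma> \<in> edge_ray ` edge_germs p \<union> tri_ray ` tri_germs p"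
 then consider e t s where "e \<in> edges X" "(t, s) \<in> line_germs 0 1" "echar X e t = p" "\<gamma> = edge_ray (e, t, s)"
  | f a u where "f \<in> tris X" "a \<in> std_triangle" "fchar X f a = p" "primitive_vec u"
   "eventually (%\<xi>. a + \<xi> *\<^sub>R u \<in> interior std_triangle) (at_right 0)" "\<gamma> = tri_ray (f, a, u)"
  unfolding edge_germs_def tri_germs_def by blast
 then show "\<gamma> \<in> rays X p"
 proof cases
  case (1 e t s)
  have g: "\<gamma> = (%\<xi>. echar X e (t + \<xi> * s))" unfolding 1(4) by (rule ext) (simp add: edge_ray_def)
  have "t \<in> {0..1}" "s \<in> {1, - 1}" using 1(2) by (auto simp: line_germs_def)
  moreover have "\<gamma> 0 = p" by (simp add: g 1(3))
  ultimately show ?thesis using 1(1) line_germs_interior[OF 1(2)] g unfolding rays_def by blast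
 next
  case (2 f a u)
  have g: "\<gamma> = (%\<xi>. fchar X f (a + \<xi> *\<^sub>R u))" unfolding 2(6) by (rule ext) (simp add: tri_ray_def)
  have "\<gamma> 0 = p" by (simp add: g 2(3))
  then show ?thesis using 2 g unfolding rays_def by blast
 qed
qed

lemma edge_ray_inj: "inj_on edge_ray (edge_germs p)"
proof (rule inj_onI)
 fix g g' assume "g \<in> edge_germs p" "g' \<in> edge_germs p" and eq: "edge_ray g = edge_ray g'"
 then obtain e t s e' t' s' where g: "g = (e, t, s)" "(t, s) \<in> line_germs 0 1" "g' = (e', t', s')" "(t', s') \<in> line_germs 0 1"
  by (auto simp: edge_germs_def)
 have ev: "eventually (%\<xi>. e = e' \<and> t + \<xi> *\<^sub>R s = t' + \<xi> *\<^sub>R s') (at_right 0)"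
  using edge_ray_eventually[OF g(2), of e] edge_ray_eventually[OF g(4), of e']
 proof eventually_elim
  case (elim \<xi>)
  have "edge_ray (e, t, s) \<xi> = edge_ray (e', t', s') \<xi>" using eq g by simp
  then have "EPt e (t + \<xi> * s) = (EPt e' (t' + \<xi> * s') :: ('v, 'e, 'f) pt)" using elim by simp
  then show ?case by simp
 qed
 then have "eventually (%\<xi>. t + \<xi> *\<^sub>R s = t' + \<xi> *\<^sub>R s') (at_right 0)" by eventually_elim simp
 from ray_determined[OF this] eventually_at_right_0_ex[OF ev] show "g = g'" using g by auto
qed

lemma tri_ray_inj: "inj_on tri_ray (tri_germs p)"
proof (rule inj_onI)
 fix g g' assume "g \<in> tri_germs p" "g' \<in> tri_germs p" and eq: "tri_ray g = tri_ray g'"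
 then obtain f a u f' a' u' where g: "g = (f, a, u)" "eventually (%\<xi>. a + \<xi> *\<^sub>R u \<in> interior std_triangle) (at_right 0)"
  "g' = (f', a', u')" "eventually (%\<xi>. a' + \<xi> *\<^sub>R u' \<in> interior std_triangle) (at_right 0)"
  by (auto simp: tri_germs_def)
 have ev: "eventually (%\<xi>. f = f' \<and> a + \<xi> *\<^sub>R u = a' + \<xi> *\<^sub>R u') (at_right 0)"
  using tri_ray_eventually[OF g(2), of f] tri_ray_eventually[OF g(4), of f']
 proof eventually_elim
  case (elim \<xi>)
  have "tri_ray (f, a, u) \<xi> = tri_ray (f', a', u') \<xi>" using eq g by simp
  then have "FPt f (a + \<xi> *\<^sub>R u) = (FPt f' (a' + \<xi> *\<^sub>R u') :: ('v, 'e, 'f) pt)" using elim by simp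
  then show ?case by simp
 qed
 then have "eventually (%\<xi>. a + \<xi> *\<^sub>R u = a' + \<xi> *\<^sub>R u') (at_right 0)" by eventually_elim simp
 from ray_determined[OF this] eventually_at_right_0_ex[OF ev] show "g = g'" using g by auto
qed

lemma edge_ray_neq_tri_ray:
 assumes "g \<in> edge_germs p" "h \<in> tri_germs p"
 shows "edge_ray g \<noteq> tri_ray h"
proof
 assume eq: "edge_ray g = tri_ray h"
 obtain e t s f a u where g: "g = (e, t, s)" "(t, s) \<in> line_germs 0 1" "h = (f, a, u)"
  "eventually (%\<xi>. a + \<xi> *\<^sub>R u \<in> interior std_triangle) (at_right 0)"
  using assms by (auto simp: edge_germs_def tri_germs_def)
 have "eventually (%\<xi>::real. False) (at_right 0)"
  using edge_ray_eventually[OF g(2), of e] tri_ray_eventually[OF g(4), of f]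
 proof eventually_elim
  case (elim \<xi>)
  have "edge_ray (e, t, s) \<xi> = tri_ray (f, a, u) \<xi>" using eq g by simp
  then show ?case using elim by simp
 qed
 then show False using eventually_at_right_0_ex by blast
qed

definition along :: "('v, 'e, 'f) pt set => (real => ('v, 'e, 'f) pt) => bool" where
 "along S \<gamma> \<longleftrightarrow> eventually (%\<xi>. \<gamma> \<xi> \<in> S) (at_right 0)"

lemma edge_segment_edge_ray:
 assumes S: "S = echar X e' ` {A..B}" and ts: "(t, s) \<in> line_germs 0 1"
 shows "eventually (%\<xi>. edge_ray (e, t, s) \<xi> \<in> S \<longleftrightarrow> e = e' \<and> t + \<xi> * s \<in> {A..B}) (at_right 0)"
 using edge_ray_eventually[OF ts, of e]
 by eventually_elim (auto simp: S image_iff eq_commute[of "EPt _ _"] echar_eq_EPt)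

lemma edge_segment_tri_ray:
 assumes S: "S = echar X e' ` {A..B}" and u: "eventually (%\<xi>. a + \<xi> *\<^sub>R u \<in> interior std_triangle) (at_right 0)"
 shows "eventually (%\<xi>. tri_ray (f, a, u) \<xi> \<notin> S) (at_right 0)"
 using tri_ray_eventually[OF u, of f] by eventually_elim (auto simp: S)

lemma tri_segment_edge_ray:
 assumes f: "f \<in> tris X" "open_segment p q \<subseteq> interior std_triangle" and S: "S = fchar X f ` closed_segment p q"
  and ts: "(t, s) \<in> line_germs 0 1"
 shows "eventually (%\<xi>. edge_ray (e, t, s) \<xi> \<notin> S) (at_right 0)"
proof -
 have s0: "s \<noteq> 0" using line_germs_sign[OF ts] by auto
 have sub: "{\<xi>. EPt e (t + \<xi> * s) \<in> S} \<subseteq> (%\<xi>. EPt e (t + \<xi> * s)) -` {fchar X f p, fchar X f q}"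
 proof
  fix \<xi> assume "\<xi> \<in> {\<xi>. EPt e (t + \<xi> * s) \<in> S}"
  then obtain z where z: "z \<in> closed_segment p q" "EPt e (t + \<xi> * s) = fchar X f z" unfolding S by blast
  have "z \<notin> open_segment p q" using z(2) f(2) fchar_interior[of z X f] by auto
  then have "z = p \<or> z = q" using z(1) by (simp add: open_segment_def)
  then show "\<xi> \<in> (%\<xi>. EPt e (t + \<xi> * s)) -` {fchar X f p, fchar X f q}" using z(2) by auto
 qed
 have "finite ((%\<xi>. EPt e (t + \<xi> * s)) -` {fchar X f p, fchar X f q})"
  by (rule finite_vimageI) (use s0 in \<open>auto intro: injI\<close>)
 then have "finite {\<xi>. EPt e (t + \<xi> * s) \<in> S}" using sub finite_subset by blast
 then have "open (- ({\<xi>. EPt e (t + \<xi> * s) \<in> S} - {0}))" by (intro open_Compl finite_imp_closed) auto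
 then have "eventually (%\<xi>. \<xi> \<in> - ({\<xi>. EPt e (t + \<xi> * s) \<in> S} - {0})) (nhds 0)"
  by (rule eventually_nhds_in_open) simp
 then have "eventually (%\<xi>. \<xi> \<in> - ({\<xi>. EPt e (t + \<xi> * s) \<in> S} - {0})) (at_right 0)"
  by (rule filter_leD[rotated]) (simp add: at_within_def)
 moreover have "eventually (%\<xi>::real. \<xi> > 0) (at_right 0)" by (rule eventually_at_right_less)
 ultimately show ?thesis using edge_ray_eventually[OF ts, of e] by eventually_elim auto
qed

lemma tri_segment_tri_ray:
 assumes f: "f \<in> tris X" and p: "p \<in> std_triangle" "q \<in> std_triangle" and S: "S = fchar X f ` closed_segment p q"
  and u: "eventually (%\<xi>. a + \<xi> *\<^sub>R u \<in> interior std_triangle) (at_right 0)"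
 shows "eventually (%\<xi>. tri_ray (f', a, u) \<xi> \<in> S \<longleftrightarrow> f' = f \<and> a + \<xi> *\<^sub>R u \<in> closed_segment p q) (at_right 0)"
 using tri_ray_eventually[OF u, of f']
proof eventually_elim
 case (elim \<xi>)
 have sub: "closed_segment p q \<subseteq> std_triangle" by (rule closed_segment_subset[OF p convex_std_triangle])
 have "FPt f' (a + \<xi> *\<^sub>R u) \<in> S \<longleftrightarrow> (\<exists>z\<in>closed_segment p q. fchar X f z = FPt f' (a + \<xi> *\<^sub>R u))"
  unfolding S by (auto simp: image_iff eq_commute)
 also have "\<dots> \<longleftrightarrow> (\<exists>z\<in>closed_segment p q. f = f' \<and> z = a + \<xi> *\<^sub>R u)"
  using fchar_eq_FPt[OF f] sub elim by blast
 finally show ?case using elim by auto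
qed

text \<open>Along a ray, membership in a segment is decided by a convex set or holds for finitely
  many parameters at most, so it is eventually constant. Therefore the limit in
  \<open>coeff_along\<close> exists.\<close>

lemma ray_settles:
 assumes S: "S \<in> segments X" and g: "\<gamma> \<in> rays X p"
 shows "eventually (%\<xi>. \<gamma> \<xi> \<in> S \<longleftrightarrow> along S \<gamma>) (at_right 0)"
proof -
 have "along S \<gamma> \<or> eventually (%\<xi>. \<gamma> \<xi> \<notin> S) (at_right 0)"
 proof -
  have cvx: "along S \<gamma> \<or> eventually (%\<xi>. \<gamma> \<xi> \<notin> S) (at_right 0)"
   if "convex C" "eventually (%\<xi>. \<gamma> \<xi> \<in> S \<longleftrightarrow> Q \<and> b + \<xi> *\<^sub>R v \<in> C) (at_right 0)" for C and b v :: "'z::real_vector" and Q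
  proof (cases Q)
   case False
   have "eventually (%\<xi>. \<gamma> \<xi> \<notin> S) (at_right 0)" using that(2) by eventually_elim (use False in simp)
   then show ?thesis ..
  next
   case True
   from convex_settles[OF that(1), of b v] show ?thesis
   proof
    assume "eventually (%\<xi>. b + \<xi> *\<^sub>R v \<in> C) (at_right 0)"
    with that(2) have "along S \<gamma>" unfolding along_def by eventually_elim (use True in simp)
    then show ?thesis ..
   next
    assume "eventually (%\<xi>. b + \<xi> *\<^sub>R v \<notin> C) (at_right 0)"
    with that(2) have "eventually (%\<xi>. \<gamma> \<xi> \<notin> S) (at_right 0)" by eventually_elim simp
    then show ?thesis ..
   qed
  qed
  from g consider e t s where "(t, s) \<in> line_germs 0 1" "\<gamma> = edge_ray (e, t, s)"
   | f a u where "eventually (%\<xi>. a + \<xi> *\<^sub>R u \<in> interior std_triangle) (at_right 0)" "\<gamma> = tri_ray (f, a, u)"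
   unfolding rays_eq edge_germs_def tri_germs_def by blast
  then show ?thesis
  proof cases
   case g: (1 e t s)
   from S show ?thesis
   proof (cases rule: segment_cases)
    case (1 e' A B)
    show ?thesis
     by (rule cvx[of "{A..B}" "e = e'" t s]) (use edge_segment_edge_ray[OF 1(5) g(1), of e] g(2) in simp_all)
   next
    case (2 f p q)
    show ?thesis using tri_segment_edge_ray[OF 2(1,5,6) g(1), of e] g(2) by simp
   qed
  next
   case g: (2 f' a u)
   from S show ?thesis
   proof (cases rule: segment_cases)
    case (1 e' A B)
    show ?thesis using edge_segment_tri_ray[OF 1(5) g(1), of f'] g(2) by simp
   next
    case (2 f p q)
    show ?thesis
     by (rule cvx[of "closed_segment p q" "f' = f" a u])
      (use tri_segment_tri_ray[OF 2(1-3,6) g(1), of f'] g(2) in simp_all)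
   qed
  qed
 qed
 then show ?thesis
 proof
  assume a: "along S \<gamma>"
  then have "eventually (%\<xi>. \<gamma> \<xi> \<in> S) (at_right 0)" by (simp add: along_def)
  then show ?thesis by eventually_elim (use a in simp)
 next
  assume e: "eventually (%\<xi>. \<gamma> \<xi> \<notin> S) (at_right 0)"
  have "\<not> along S \<gamma>"
  proof
   assume "along S \<gamma>"
   then have "eventually (%\<xi>. \<gamma> \<xi> \<in> S) (at_right 0)" by (simp add: along_def)
   with e have "eventually (%\<xi>::real. False) (at_right 0)" by eventually_elim simp
   then show False using eventually_at_right_0_ex by blast
  qed
  with e show ?thesis by simp
 qed
qed

end

lemma segment_ray:
 fixes a u p q :: "'a::real_normed_vector"
 assumes ev: "eventually (%\<xi>. a + \<xi> *\<^sub>R u \<in> closed_segment p q) (at_right (0::real))"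
 shows "a \<in> closed_segment p q" "\<exists>r. u = r *\<^sub>R (q - p)"
proof -
 have "((%\<xi>. a + \<xi> *\<^sub>R u) \<longlongrightarrow> a) (at_right 0)" by (auto intro!: tendsto_eq_intros)
 from Lim_in_closed_set[OF closed_segment ev trivial_limit_at_right_real this] show "a \<in> closed_segment p q" .
 obtain b :: real where b: "b > 0" "\<And>\<xi>. 0 < \<xi> ==> \<xi> < b ==> a + \<xi> *\<^sub>R u \<in> closed_segment p q"
  using ev unfolding eventually_at_right_field by blast
 define x where "x = b / 4"
 have x: "x > 0" "x < b" "x + x < b" using b(1) by (auto simp: x_def)
 obtain v where v: "a + x *\<^sub>R u = (1 - v) *\<^sub>R p + v *\<^sub>R q" using b(2)[of x] x by (auto simp: in_segment)
 obtain w where w: "a + (x + x) *\<^sub>R u = (1 - w) *\<^sub>R p + w *\<^sub>R q" using b(2)[of "x + x"] x by (auto simp: in_segment)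
 have "x *\<^sub>R u = (a + (x + x) *\<^sub>R u) - (a + x *\<^sub>R u)" by (simp only: scaleR_add_left) simp
 also have "\<dots> = (w - v) *\<^sub>R (q - p)" unfolding v w by (simp add: algebra_simps)
 finally have "(1 / x) *\<^sub>R (x *\<^sub>R u) = (1 / x) *\<^sub>R ((w - v) *\<^sub>R (q - p))" by simp
 then have "u = ((w - v) / x) *\<^sub>R (q - p)" using x(1) by simp
 then show "\<exists>r. u = r *\<^sub>R (q - p)" ..
qed

lemma finite_fibre:
 fixes c :: "real => 'z"
 assumes "inj_on c {A<..<B}"
 shows "finite {t\<in>{A..B}. c t = p}"
proof -
 have "{t\<in>{A..B}. c t = p} \<subseteq> {A, B} \<union> (c -` {p} \<inter> {A<..<B})" by auto
 moreover have "finite (c -` {p} \<inter> {A<..<B})" by (rule finite_vimage_IntI) (use assms in auto)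
 ultimately show ?thesis by (auto intro: finite_subset)
qed

lemma has_sum_zero_combination:
 fixes f :: "'i => 'z => real"
 assumes "finite I" "\<And>i. i \<in> I ==> (f i has_sum 0) A"
 shows "((%p. \<Sum>i\<in>I. c i * f i p) has_sum 0) A"
 using assms
proof (induction I)
 case empty
 then show ?case by simp
next
 case (insert i I)
 have "((%p. c i * f i p + (\<Sum>i\<in>I. c i * f i p)) has_sum (c i * 0 + 0)) A"
  by (intro has_sum_add has_sum_cmult_right insert.IH insert.prems) auto
 then show ?case using insert.hyps by simp
qed

lemma sum_filter_combination:
 fixes d :: "'i => real"
 assumes "finite I" "finite G"
 shows "(\<Sum>g\<in>G. (\<Sum>S\<in>I. d S * of_bool (P S g)) * r g) = (\<Sum>S\<in>I. d S * (\<Sum>g\<in>{g\<in>G. P S g}. r g))"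
proof -
 have "(\<Sum>g\<in>G. (\<Sum>S\<in>I. d S * of_bool (P S g)) * r g) = (\<Sum>S\<in>I. \<Sum>g\<in>G. d S * of_bool (P S g) * r g)"
  unfolding sum_distrib_right by (rule sum.swap)
 also have "\<dots> = (\<Sum>S\<in>I. d S * (\<Sum>g\<in>{g\<in>G. P S g}. r g))"
  unfolding sum_distrib_left sum.inter_filter[OF assms(2)] by (intro sum.cong refl) auto
 finally show ?thesis .
qed

context trop_surface
begin

lemma along_edge_segment:
 assumes S: "S = echar X e ` {A..B}" and ts: "(t, s) \<in> line_germs 0 1"
 shows "along S (edge_ray (e', t, s)) \<longleftrightarrow> e' = e \<and> (t, s) \<in> line_germs A B"
proof -
 have "along S (edge_ray (e', t, s)) \<longleftrightarrow> eventually (%\<xi>. e' = e \<and> t + \<xi> * s \<in> {A..B}) (at_right 0)"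
  unfolding along_def by (rule eventually_subst[OF edge_segment_edge_ray[OF S ts]])
 also have "\<dots> \<longleftrightarrow> e' = e \<and> (t, s) \<in> line_germs A B"
  unfolding line_germs_eventually[OF line_germs_sign[OF ts], symmetric] by (cases "e' = e") auto
 finally show ?thesis .
qed

lemma along_tri_segment:
 assumes "f \<in> tris X" "p \<in> std_triangle" "q \<in> std_triangle" "S = fchar X f ` closed_segment p q"
  and "eventually (%\<xi>. a + \<xi> *\<^sub>R u \<in> interior std_triangle) (at_right 0)"
 shows "along S (tri_ray (f', a, u)) \<longleftrightarrow> f' = f \<and> eventually (%\<xi>. a + \<xi> *\<^sub>R u \<in> closed_segment p q) (at_right 0)"
proof -
 have "along S (tri_ray (f', a, u)) \<longleftrightarrow> eventually (%\<xi>. f' = f \<and> a + \<xi> *\<^sub>R u \<in> closed_segment p q) (at_right 0)"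
  unfolding along_def by (rule eventually_subst[OF tri_segment_tri_ray[OF assms]])
 also have "\<dots> \<longleftrightarrow> f' = f \<and> eventually (%\<xi>. a + \<xi> *\<^sub>R u \<in> closed_segment p q) (at_right 0)"
  by (cases "f' = f") auto
 finally show ?thesis .
qed

lemma not_along: "eventually (%\<xi>. \<gamma> \<xi> \<notin> S) (at_right 0) ==> \<not> along S \<gamma>"
 unfolding along_def
proof
 assume "eventually (%\<xi>. \<gamma> \<xi> \<notin> S) (at_right 0)" "eventually (%\<xi>. \<gamma> \<xi> \<in> S) (at_right 0)"
 then have "eventually (%\<xi>::real. False) (at_right 0)" by eventually_elim simp
 then show False using eventually_at_right_0_ex by blast
qed

lemma finite_echar_fibre: "0 \<le> A ==> B \<le> 1 ==> finite {t\<in>{A..B}. echar X e t = p}"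
 by (rule finite_fibre) (auto simp: inj_on_def echar_def split: if_splits)

end

section \<open>Cancellation of the slopes of the correction\<close>

context surface_divisor
begin

definition supp :: "('v, 'e, 'f) pt set set" where
 "supp = {S. D S \<noteq> 0}"

lemma fin_supp: "finite supp" and supp_segments: "S \<in> supp ==> S \<in> segments X"
 using formal_D unfolding formal_sum_def supp_def by auto

lemma coeff_ray:
 assumes g: "\<gamma> \<in> rays X p"
 shows "eventually (%\<xi>. mult (\<gamma> \<xi>) = coeff_along D \<gamma>) (at_right 0)"
  "coeff_along D \<gamma> = (\<Sum>S\<in>supp. of_rat (D S) * of_bool (along S \<gamma>))"
proof -
 have "eventually (%\<xi>. \<forall>S\<in>supp. \<gamma> \<xi> \<in> S \<longleftrightarrow> along S \<gamma>) (at_right 0)"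
  by (rule eventually_ball_finite[OF fin_supp]) (use ray_settles[OF supp_segments g] in blast)
 then have ev: "eventually (%\<xi>. mult (\<gamma> \<xi>) = (\<Sum>S\<in>supp. of_rat (D S) * of_bool (along S \<gamma>))) (at_right 0)"
 proof eventually_elim
  case (elim \<xi>)
  have "{S. D S \<noteq> 0 \<and> \<gamma> \<xi> \<in> S} = {S\<in>supp. along S \<gamma>}" using elim by (auto simp: supp_def)
  then have "multiplicity_at D (\<gamma> \<xi>) = (\<Sum>S\<in>supp. if along S \<gamma> then D S else 0)"
   unfolding multiplicity_at_def by (simp add: sum.inter_filter[OF fin_supp])
  then have "mult (\<gamma> \<xi>) = (\<Sum>S\<in>supp. of_rat (if along S \<gamma> then D S else 0))" unfolding mult_def by (simp only: of_rat_sum)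
  also have "\<dots> = (\<Sum>S\<in>supp. of_rat (D S) * of_bool (along S \<gamma>))" by (intro sum.cong refl) auto
  finally show ?case .
 qed
 show 2: "coeff_along D \<gamma> = (\<Sum>S\<in>supp. of_rat (D S) * of_bool (along S \<gamma>))"
  unfolding coeff_along_def
  by (rule tendsto_Lim[OF trivial_limit_at_right_real tendsto_eventually]) (use ev in \<open>simp add: mult_def\<close>)
 show "eventually (%\<xi>. mult (\<gamma> \<xi>) = coeff_along D \<gamma>) (at_right 0)" using ev unfolding 2 .
qed

lemma conic_theta_edge:
 assumes e: "e \<in> edges X" and AB: "0 \<le> A" "B \<le> 1" and t: "A \<le> t" "t \<le> B"
 shows "conic {A..B} (%s. theta (echar X e s)) t"
proof -
 obtain f k where fk: "f \<in> tris X" "k < 3" "side X f k = e" by (rule edge_linkE[OF e]) (rule that)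
 have line: "tri_side k 0 + s *\<^sub>R side_dir k = tri_side k s" for s using tri_side_affine[OF fk(2), of 0 s] by simp
 have t01: "0 \<le> t" "t \<le> 1" using AB t by auto
 have "conic {0..1} (%s. theta (fchar X f (tri_side k 0 + s *\<^sub>R side_dir k))) t"
  by (rule conic_comp_line[of std_triangle "%z. theta (fchar X f z)"])
   (use conic_theta[OF fk(1) tri_side_in[OF fk(2) t01]] tri_side_in[OF fk(2)] in \<open>auto simp: line\<close>)
 moreover have "eventually (%s. theta (echar X e s) = theta (fchar X f (tri_side k 0 + s *\<^sub>R side_dir k))) (near {0..1} t)"
  using eventually_near_in[of "{0..1}" t] by eventually_elim (use fchar_side[OF fk(1,2)] fk(3) in \<open>simp add: line\<close>)
 ultimately have "conic {0..1} (%s. theta (echar X e s)) t"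
  by (rule conic_cong) (use t01 in auto)
 then show ?thesis by (rule conic_subset) (use AB in auto)
qed

lemma edge_interval_sum:
 assumes e: "e \<in> edges X" and AB: "0 \<le> A" "A < B" "B \<le> 1"
 shows "finite {g\<in>line_germs A B. echar X e (fst g) = p}"
  "((%p. \<Sum>g\<in>{g\<in>line_germs A B. echar X e (fst g) = p}. rslope (%\<xi>. theta (edge_ray (e, g) \<xi>))) has_sum 0) UNIV"
proof -
 note cs = curve_sum[OF AB(2) conic_theta_edge[OF e AB(1,3)], of "echar X e", OF _ _ finite_echar_fibre[OF AB(1,3)]]
 show "finite {g\<in>line_germs A B. echar X e (fst g) = p}" by (rule cs)
 show "((%p. \<Sum>g\<in>{g\<in>line_germs A B. echar X e (fst g) = p}. rslope (%\<xi>. theta (edge_ray (e, g) \<xi>))) has_sum 0) UNIV"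
  using cs(2) unfolding edge_ray_def by (simp add: case_prod_unfold)
qed

text \<open>The contribution of one segment, with coefficient 1, to the pairing of the divisor with
  the slopes of \<open>theta\<close> at \<open>p\<close>.\<close>

definition segment_part :: "('v, 'e, 'f) pt set => ('v, 'e, 'f) pt => real" where
 "segment_part S p =
   (\<Sum>g\<in>{g\<in>edge_germs p. along S (edge_ray g)}. rslope (%\<xi>. theta (edge_ray g \<xi>))) +
   (\<Sum>h\<in>{h\<in>tri_germs p. along S (tri_ray h)}. rslope (%\<xi>. theta (tri_ray h \<xi>)))"

lemma segment_part_edge:
 assumes e: "e \<in> edges X" "0 \<le> A" "A < B" "B \<le> 1" and S: "S = echar X e ` {A..B}"
 shows "{h\<in>tri_germs p. along S (tri_ray h)} = {}" "(segment_part S has_sum 0) UNIV"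
proof -
 show no: "{h\<in>tri_germs p. along S (tri_ray h)} = {}" for p
  using not_along[OF edge_segment_tri_ray[OF S]] by (auto simp: tri_germs_def)
 have im: "{g\<in>edge_germs p. along S (edge_ray g)} = Pair e ` {g\<in>line_germs A B. echar X e (fst g) = p}" for p
 proof -
  have "line_germs A B \<subseteq> line_germs 0 1" using e by (auto simp: line_germs_def)
  then show ?thesis using along_edge_segment[OF S] e(1) unfolding edge_germs_def by fastforce
 qed
 have "segment_part S p = (\<Sum>g\<in>{g\<in>line_germs A B. echar X e (fst g) = p}. rslope (%\<xi>. theta (edge_ray (e, g) \<xi>)))" for p
  unfolding segment_part_def no im by (subst sum.reindex) (auto simp: inj_on_def)
 then have "segment_part S = (%p. \<Sum>g\<in>{g\<in>line_germs A B. echar X e (fst g) = p}. rslope (%\<xi>. theta (edge_ray (e, g) \<xi>)))"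
  by (rule ext)
 then show "(segment_part S has_sum 0) UNIV" using edge_interval_sum(2)[OF e] by simp
qed

text \<open>Rays have rational directions. Only a segment with such a direction contains rays, and
  then it is parametrized by a primitive vector, which makes slopes along the parameter equal to
  slopes along the rays.\<close>

lemma segment_part_tri:
 assumes f: "f \<in> tris X" and p: "p \<in> std_triangle" "q \<in> std_triangle" "p \<noteq> q"
  and op: "open_segment p q \<subseteq> interior std_triangle" and S: "S = fchar X f ` closed_segment p q"
 shows "finite {h\<in>tri_germs x. along S (tri_ray h)} \<and> (segment_part S has_sum 0) UNIV"
proof -
 have no: "{g\<in>edge_germs x. along S (edge_ray g)} = {}" for x
  using not_along[OF tri_segment_edge_ray[OF f op S]] by (auto simp: edge_germs_def)
 have part: "segment_part S = (%x. \<Sum>h\<in>{h\<in>tri_germs x. along S (tri_ray h)}. rslope (%\<xi>. theta (tri_ray h \<xi>)))"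
  by (rule ext) (simp only: segment_part_def no sum.empty add_0)
 note al = along_tri_segment[OF f p(1,2) S]
 show ?thesis
 proof (cases "\<exists>x. {h\<in>tri_germs x. along S (tri_ray h)} \<noteq> {}")
  \<comment> \<open>No ray runs along the segment, so nothing is to be summed.\<close>
  case False
  then have "{h\<in>tri_germs x. along S (tri_ray h)} = {}" for x by blast
  then show ?thesis unfolding part by (simp only:) simp
 next
  case True
  then obtain x f0 a0 u0 where h0: "(f0, a0, u0) \<in> tri_germs x" "along S (tri_ray (f0, a0, u0))" by fast
  have h1: "primitive_vec u0" "eventually (%\<xi>. a0 + \<xi> *\<^sub>R u0 \<in> interior std_triangle) (at_right 0)"
   using h0(1) by (auto simp: tri_germs_def)
  obtain r where r: "u0 = r *\<^sub>R (q - p)" using segment_ray(2) al[OF h1(2)] h0(2) by blast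
  have r0: "r \<noteq> 0" using r primitive_nonzero[OF h1(1)] by auto
  have "\<exists>u \<rho>. primitive_vec u \<and> \<rho> > 0 \<and> q - p = \<rho> *\<^sub>R u"
  proof (cases "r > 0")
   case True
   then show ?thesis using r h1(1) by (intro exI[of _ u0] exI[of _ "1 / r"]) simp
  next
   case False
   then show ?thesis using r r0 primitive_minus[OF h1(1)] by (intro exI[of _ "- u0"] exI[of _ "- (1 / r)"]) simp
  qed
  then obtain u \<rho> where u: "primitive_vec u" "\<rho> > 0" "q - p = \<rho> *\<^sub>R u" by blast
  have q: "q = p + \<rho> *\<^sub>R u" using u(3) by (simp add: algebra_simps)
  have un: "u \<noteq> 0" by (rule primitive_nonzero[OF u(1)])
  have seg: "p + \<tau> *\<^sub>R u \<in> closed_segment p q \<longleftrightarrow> \<tau> \<in> {0..\<rho>}" for \<tau>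
  proof -
   have "p + \<tau> *\<^sub>R u \<in> closed_segment p q \<longleftrightarrow> (\<exists>v. 0 \<le> v \<and> v \<le> 1 \<and> p + \<tau> *\<^sub>R u = p + (v * \<rho>) *\<^sub>R u)"
    unfolding in_segment q by (simp add: algebra_simps conj_ac)
   also have "\<dots> \<longleftrightarrow> (\<exists>v. 0 \<le> v \<and> v \<le> 1 \<and> \<tau> = v * \<rho>)" using un by simp
   also have "\<dots> \<longleftrightarrow> \<tau> \<in> {0..\<rho>}"
   proof
    assume "\<tau> \<in> {0..\<rho>}"
    then show "\<exists>v. 0 \<le> v \<and> v \<le> 1 \<and> \<tau> = v * \<rho>" using u(2) by (intro exI[of _ "\<tau> / \<rho>"]) auto
   next
    assume "\<exists>v. 0 \<le> v \<and> v \<le> 1 \<and> \<tau> = v * \<rho>"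
    then obtain v where v: "0 \<le> v" "v \<le> 1" "\<tau> = v * \<rho>" by blast
    then show "\<tau> \<in> {0..\<rho>}" using u(2) mult_right_mono[of v 1 \<rho>] by auto
   qed
   finally show ?thesis .
  qed
  have ex: "\<exists>\<tau>\<in>{0..\<rho>}. z = p + \<tau> *\<^sub>R u" if "z \<in> closed_segment p q" for z
  proof -
   obtain v where v: "z = (1 - v) *\<^sub>R p + v *\<^sub>R q" using \<open>z \<in> _\<close> unfolding in_segment by blast
   then have "z = p + (v * \<rho>) *\<^sub>R u" unfolding q by (simp add: algebra_simps)
   then show ?thesis using that seg by blast
  qed
  have opn: "p + \<tau> *\<^sub>R u \<in> interior std_triangle" if "\<tau> \<in> {0<..<\<rho>}" for \<tau>
  proof -
   have "p + \<tau> *\<^sub>R u \<in> closed_segment p q" using seg that by simp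
   moreover have "p + \<tau> *\<^sub>R u \<noteq> p" "p + \<tau> *\<^sub>R u \<noteq> q" using that un by (auto simp: q)
   ultimately show ?thesis using op by (auto simp: open_segment_def)
  qed
  define c where "c \<tau> = fchar X f (p + \<tau> *\<^sub>R u)" for \<tau>
  define \<Phi> where "\<Phi> g = (f, p + fst g *\<^sub>R u, snd g *\<^sub>R u)" for g :: "real \<times> real"
  have sub: "closed_segment p q \<subseteq> std_triangle" by (rule closed_segment_subset[OF p(1,2) convex_std_triangle])
  have shift: "p + \<tau> *\<^sub>R u + \<xi> *\<^sub>R (\<sigma> *\<^sub>R u) = p + (\<tau> + \<xi> * \<sigma>) *\<^sub>R u" for \<tau> \<xi> \<sigma> by (simp add: scaleR_add_left)
  have im: "{h\<in>tri_germs x. along S (tri_ray h)} = \<Phi> ` {g\<in>line_germs 0 \<rho>. c (fst g) = x}" for x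
  proof (rule subset_antisym; rule subsetI)
   fix h assume "h \<in> {h\<in>tri_germs x. along S (tri_ray h)}"
   then obtain f' a w where h: "h = (f', a, w)" "fchar X f' a = x" "primitive_vec w"
    "eventually (%\<xi>. a + \<xi> *\<^sub>R w \<in> interior std_triangle) (at_right 0)" "along S (tri_ray (f', a, w))"
    by (auto simp: tri_germs_def)
   have f': "f' = f" and ev: "eventually (%\<xi>. a + \<xi> *\<^sub>R w \<in> closed_segment p q) (at_right 0)"
    using al[OF h(4)] h(5) by auto
   obtain \<tau> where \<tau>: "\<tau> \<in> {0..\<rho>}" "a = p + \<tau> *\<^sub>R u" using ex[OF segment_ray(1)[OF ev]] by blast
   obtain r where "w = r *\<^sub>R (q - p)" using segment_ray(2)[OF ev] by blast
   then have "det2 w u = 0" unfolding u(3) by (simp add: det2_def)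
   then have "w = u \<or> w = - u" by (rule primitive_parallel[OF h(3) u(1)])
   then obtain \<sigma> where \<sigma>: "\<sigma> = 1 \<or> \<sigma> = - 1" "w = \<sigma> *\<^sub>R u" by force
   have "eventually (%\<xi>. \<tau> + \<xi> * \<sigma> \<in> {0..\<rho>}) (at_right 0)"
    using ev unfolding \<tau>(2) \<sigma>(2) shift seg .
   then have "(\<tau>, \<sigma>) \<in> line_germs 0 \<rho>" unfolding line_germs_eventually[OF \<sigma>(1)] .
   then have "(\<tau>, \<sigma>) \<in> {g\<in>line_germs 0 \<rho>. c (fst g) = x}" using h(2) f' \<tau>(2) by (simp add: c_def)
   moreover have "h = \<Phi> (\<tau>, \<sigma>)" by (simp add: \<Phi>_def h(1) f' \<tau>(2) \<sigma>(2))
   ultimately show "h \<in> \<Phi> ` {g\<in>line_germs 0 \<rho>. c (fst g) = x}" by blast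
  next
   fix h assume "h \<in> \<Phi> ` {g\<in>line_germs 0 \<rho>. c (fst g) = x}"
   then obtain \<tau> \<sigma> where g: "(\<tau>, \<sigma>) \<in> line_germs 0 \<rho>" "c \<tau> = x" "h = (f, p + \<tau> *\<^sub>R u, \<sigma> *\<^sub>R u)"
    by (auto simp: \<Phi>_def)
   have inw: "eventually (%\<xi>. p + \<tau> *\<^sub>R u + \<xi> *\<^sub>R (\<sigma> *\<^sub>R u) \<in> interior std_triangle) (at_right 0)"
    using line_germs_interior[OF g(1)] unfolding shift by eventually_elim (rule opn)
   have "eventually (%\<xi>. p + \<tau> *\<^sub>R u + \<xi> *\<^sub>R (\<sigma> *\<^sub>R u) \<in> closed_segment p q) (at_right 0)"
    using line_germs_interior[OF g(1)] unfolding shift seg by eventually_elim auto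
   then have "along S (tri_ray h)" unfolding g(3) al[OF inw] by simp
   moreover have "p + \<tau> *\<^sub>R u \<in> std_triangle" using sub seg[of \<tau>] g(1) by (auto simp: line_germs_def)
   moreover have "primitive_vec (\<sigma> *\<^sub>R u)" using line_germs_sign[OF g(1)] u(1) primitive_minus[OF u(1)] by auto
   ultimately show "h \<in> {h\<in>tri_germs x. along S (tri_ray h)}"
    using inw g(2,3) f by (simp add: tri_germs_def c_def)
  qed
  have inj: "inj_on \<Phi> Z" for Z using un by (auto simp: inj_on_def \<Phi>_def)
  have "inj_on c {0<..<\<rho>}" unfolding c_def inj_on_def using un by (auto simp: fchar_interior[OF opn])
  note fib = finite_fibre[OF this]
  have con: "conic {0..\<rho>} (%\<tau>. theta (c \<tau>)) \<tau>" if "0 \<le> \<tau>" "\<tau> \<le> \<rho>" for \<tau>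
   unfolding c_def
  proof (rule conic_comp_line[of std_triangle "%z. theta (fchar X f z)"])
   have inS: "p + \<sigma> *\<^sub>R u \<in> std_triangle" if "\<sigma> \<in> {0..\<rho>}" for \<sigma> using sub seg[of \<sigma>] that by blast
   show "conic std_triangle (%z. theta (fchar X f z)) (p + \<tau> *\<^sub>R u)" by (rule conic_theta[OF f inS]) (use that in simp)
   show "p + \<sigma> *\<^sub>R u \<in> std_triangle" if "\<sigma> \<in> {0..\<rho>}" for \<sigma> using inS[OF that] .
  qed
  note cs = curve_sum[OF u(2) con fib]
  have "segment_part S = (%x. \<Sum>g\<in>{g\<in>line_germs 0 \<rho>. c (fst g) = x}. rslope (%\<xi>. theta (c (fst g + \<xi> * snd g))))"
   unfolding part im sum.reindex[OF inj] by (simp add: \<Phi>_def tri_ray_def c_def scaleR_add_left add.assoc)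
  then show ?thesis using cs unfolding im by simp
 qed
qed

lemma segment_part:
 assumes "S \<in> segments X"
 shows "finite {h\<in>tri_germs p. along S (tri_ray h)}" "(segment_part S has_sum 0) UNIV"
proof -
 have "finite {h\<in>tri_germs p. along S (tri_ray h)} \<and> (segment_part S has_sum 0) UNIV"
  using assms
 proof (cases rule: segment_cases)
  case (1 e A B)
  show ?thesis using segment_part_edge[OF 1] by (simp only:) simp
 next
  case (2 f a b)
  show ?thesis by (rule segment_part_tri[OF 2])
 qed
 then show "finite {h\<in>tri_germs p. along S (tri_ray h)}" "(segment_part S has_sum 0) UNIV" by auto
qed

lemma edge_germs_Sigma: "edge_germs p = (SIGMA e:edges X. {g\<in>line_germs 0 1. echar X e (fst g) = p})"
 by (auto simp: edge_germs_def)

lemma fin_edge_germs: "finite (edge_germs p)"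
 unfolding edge_germs_Sigma by (rule finite_SigmaI[OF finite_cells(2)]) (rule edge_interval_sum(1); simp)

text \<open>The weight \<open>edge_y e 0\<close> is constant on each edge, so the slopes of
  \<open>theta\<close> along the edge cancel as on any segment.\<close>

lemma edge_total:
 "((%p. \<Sum>g\<in>edge_germs p. edge_y (fst g) 0 * rslope (%\<xi>. theta (edge_ray g \<xi>))) has_sum 0) UNIV"
proof -
 have z: "(0::real) \<le> 0" "(0::real) < 1" "(1::real) \<le> 1" by simp_all
 have "(\<Sum>g\<in>edge_germs p. edge_y (fst g) 0 * rslope (%\<xi>. theta (edge_ray g \<xi>))) =
  (\<Sum>e\<in>edges X. edge_y e 0 * (\<Sum>g\<in>{g\<in>line_germs 0 1. echar X e (fst g) = p}. rslope (%\<xi>. theta (edge_ray (e, g) \<xi>))))" for p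
 proof -
  have fin: "\<forall>e\<in>edges X. finite {g\<in>line_germs 0 1. echar X e (fst g) = p}"
   using edge_interval_sum(1)[OF _ z] by blast
  show ?thesis
   unfolding edge_germs_Sigma sum_distrib_left sum.Sigma[OF finite_cells(2) fin]
   by (rule sum.cong[OF refl]) (simp add: case_prod_unfold)
 qed
 then show ?thesis
  using has_sum_zero_combination[OF finite_cells(2) edge_interval_sum(2)[OF _ z], where c = "%e. edge_y e 0"] by simp
qed

definition theta_part :: "('v, 'e, 'f) pt => real" where
 "theta_part p = (\<Sum>g\<in>edge_germs p. coeff_along D (edge_ray g) * rslope (%\<xi>. theta (edge_ray g \<xi>))) +
   (\<Sum>h\<in>{h\<in>tri_germs p. coeff_along D (tri_ray h) \<noteq> 0}. coeff_along D (tri_ray h) * rslope (%\<xi>. theta (tri_ray h \<xi>)))"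

text \<open>The coefficient along a ray is the sum of the coefficients of the segments containing
  it. Exchanging the two sums reduces the claim to single segments.\<close>

lemma theta_total: "(theta_part has_sum 0) UNIV"
proof -
 let ?c = "coeff_along D"
 have ce: "?c (edge_ray g) = (\<Sum>S\<in>supp. of_rat (D S) * of_bool (along S (edge_ray g)))" if "g \<in> edge_germs p" for g p
  by (rule coeff_ray(2)[of _ p]) (use that in \<open>simp add: rays_eq\<close>)
 have ct: "?c (tri_ray h) = (\<Sum>S\<in>supp. of_rat (D S) * of_bool (along S (tri_ray h)))" if "h \<in> tri_germs p" for h p
  by (rule coeff_ray(2)[of _ p]) (use that in \<open>simp add: rays_eq\<close>)
 have "theta_part p = (\<Sum>S\<in>supp. of_rat (D S) * segment_part S p)" for p
 proof -
  define U where "U = (\<Union>S\<in>supp. {h\<in>tri_germs p. along S (tri_ray h)})"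
  have U: "finite U" unfolding U_def using fin_supp segment_part(1)[OF supp_segments] by blast
  have UU: "{h\<in>U. along S (tri_ray h)} = {h\<in>tri_germs p. along S (tri_ray h)}" if "S \<in> supp" for S
   using that by (auto simp: U_def)
  have sub: "{h\<in>tri_germs p. ?c (tri_ray h) \<noteq> 0} \<subseteq> U"
  proof
   fix h assume h: "h \<in> {h\<in>tri_germs p. ?c (tri_ray h) \<noteq> 0}"
   then have hp: "h \<in> tri_germs p" by simp
   have "(\<Sum>S\<in>supp. of_rat (D S) * of_bool (along S (tri_ray h))) \<noteq> (0::real)"
    using ct[OF hp] h by simp
   then obtain S where S: "S \<in> supp" "of_rat (D S) * of_bool (along S (tri_ray h)) \<noteq> (0::real)"
    using sum.not_neutral_contains_not_neutral[of _ supp] by blast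
   then have "along S (tri_ray h)" by (cases "along S (tri_ray h)") simp_all
   then show "h \<in> U" using hp S(1) by (auto simp: U_def)
  qed
  have 1: "(\<Sum>g\<in>edge_germs p. ?c (edge_ray g) * rslope (%\<xi>. theta (edge_ray g \<xi>))) =
    (\<Sum>S\<in>supp. of_rat (D S) * (\<Sum>g\<in>{g\<in>edge_germs p. along S (edge_ray g)}. rslope (%\<xi>. theta (edge_ray g \<xi>))))"
   unfolding sum_filter_combination[OF fin_supp fin_edge_germs, symmetric] by (rule sum.cong) (simp_all add: ce)
  have "(\<Sum>h\<in>{h\<in>tri_germs p. ?c (tri_ray h) \<noteq> 0}. ?c (tri_ray h) * rslope (%\<xi>. theta (tri_ray h \<xi>))) =
    (\<Sum>h\<in>U. ?c (tri_ray h) * rslope (%\<xi>. theta (tri_ray h \<xi>)))"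
   by (rule sum.mono_neutral_left[OF U sub]) (auto simp: U_def)
  also have "\<dots> = (\<Sum>h\<in>U. (\<Sum>S\<in>supp. of_rat (D S) * of_bool (along S (tri_ray h))) * rslope (%\<xi>. theta (tri_ray h \<xi>)))"
   by (rule sum.cong[OF refl], subst ct[of _ p]) (auto simp: U_def)
  also have "\<dots> = (\<Sum>S\<in>supp. of_rat (D S) * (\<Sum>h\<in>{h\<in>U. along S (tri_ray h)}. rslope (%\<xi>. theta (tri_ray h \<xi>))))"
   by (rule sum_filter_combination[OF fin_supp U])
  also have "\<dots> = (\<Sum>S\<in>supp. of_rat (D S) * (\<Sum>h\<in>{h\<in>tri_germs p. along S (tri_ray h)}. rslope (%\<xi>. theta (tri_ray h \<xi>))))"
   by (rule sum.cong[OF refl]) (simp only: UU)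
  finally show ?thesis unfolding theta_part_def 1 segment_part_def distrib_left sum.distrib by simp
 qed
 then have "theta_part = (%p. \<Sum>S\<in>supp. of_rat (D S) * segment_part S p)" by (rule ext)
 then show ?thesis using has_sum_zero_combination[OF fin_supp segment_part(2)[OF supp_segments]] by simp
qed

end

section \<open>The self-intersection as a sum over vertices\<close>

lemma finite_avoid: "finite E ==> eventually (%\<xi>. \<xi> \<notin> E) (at_right (0::real))"
proof -
 assume "finite E"
 then have "open (- (E - {0}))" by (intro open_Compl finite_imp_closed) auto
 then have "eventually (%\<xi>. \<xi> \<in> - (E - {0})) (nhds 0)" by (rule eventually_nhds_in_open) simp
 then have "eventually (%\<xi>. \<xi> \<in> - (E - {0})) (at_right 0)"
  by (rule filter_leD[rotated]) (simp add: at_within_def)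
 moreover have "eventually (%\<xi>::real. \<xi> > 0) (at_right 0)" by (rule eventually_at_right_less)
 ultimately show ?thesis by eventually_elim auto
qed

lemma finite_side_germs: "finite (side_germs a)"
proof (rule finite_subset)
 show "side_germs a \<subseteq> {..<3} \<times> {fst a, snd a} \<times> {1, - 1}"
  unfolding side_germs_def by (auto simp: tri_side_def less_Suc_eq numeral_3_eq_3)
qed auto

context surface_divisor
begin

text \<open>All points of closed triangles lying over \<open>p\<close>. A vertex or a point of an
  edge may occur several times, even in one triangle.\<close>

definition fibre :: "('v, 'e, 'f) pt => ('f \<times> real \<times> real) set" where
 "fibre p = (SIGMA f:tris X. {a\<in>std_triangle. fchar X f a = p})"

lemma fin_fibre: "finite (fibre p)"
 unfolding fibre_def
proof (rule finite_SigmaI[OF finite_cells(3)])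
 fix f assume f: "f \<in> tris X"
 have "{a\<in>std_triangle. fchar X f a = p} \<subseteq> FPt f -` {p} \<union> (\<Union>k\<in>{..<3}. tri_side k ` {t\<in>{0..1}. echar X (side X f k) t = p})"
 proof
  fix a assume a: "a \<in> {a\<in>std_triangle. fchar X f a = p}"
  then have "a \<in> std_triangle" by simp
  then show "a \<in> FPt f -` {p} \<union> (\<Union>k\<in>{..<3}. tri_side k ` {t\<in>{0..1}. echar X (side X f k) t = p})"
  proof (cases rule: std_triangle_cases)
   case 1 then show ?thesis using a by (simp add: fchar_interior)
  next
   case (2 k t)
   then have "echar X (side X f k) t = p" using a fchar_side[OF f 2(1-3)] by simp
   then show ?thesis using 2 by auto
  qed
 qed
 moreover have "finite (FPt f -` {p})" by (rule finite_vimageI) (auto intro: injI)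
 then have "finite (FPt f -` {p} \<union> (\<Union>k\<in>{..<3}. tri_side k ` {t\<in>{0..1}. echar X (side X f k) t = p}))"
  by (intro finite_UnI finite_UN_I finite_imageI finite_echar_fibre) simp_all
 ultimately show "finite {a\<in>std_triangle. fchar X f a = p}" by (rule finite_subset)
qed

definition theta_slope :: "(real => ('v, 'e, 'f) pt) => real" where
 "theta_slope \<gamma> = rslope (%\<xi>. theta (\<gamma> \<xi>))"

text \<open>The outgoing slope along an edge of the local equation at the base point minus
  \<open>theta\<close>; it generalizes \<open>vertex_slope\<close> to all points of the
  edge.\<close>

definition germ_slope :: "'e \<times> real \<times> real => real" where
 "germ_slope g = snd (snd g) * edge_slope (fst g) (edge_grad (fst g) (fst (snd g)))"

lemma tri_slope:
 assumes h: "(f, a, u) \<in> tri_germs p"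
 shows "rslope (%\<xi>. \<psi> p (tri_ray (f, a, u) \<xi>)) = theta_slope (tri_ray (f, a, u)) + inner (grad f a) u"
proof -
 have f: "f \<in> tris X" and a: "a \<in> std_triangle" and p: "fchar X f a = p"
  and inw: "eventually (%\<xi>. a + \<xi> *\<^sub>R u \<in> interior std_triangle) (at_right 0)" using h by (auto simp: tri_germs_def)
 have inK: "eventually (%\<xi>. a + \<xi> *\<^sub>R u \<in> std_triangle) (at_right 0)"
  using inw by eventually_elim (use interior_subset in blast)
 obtain c where c: "eventually (%z. \<psi> p (fchar X f z) - theta (fchar X f z) = inner (grad f a) z + c) (near std_triangle a)"
  using grad[OF f a] p by auto
 show ?thesis
 proof (rule rslope_eqI)
  show "eventually (%\<xi>. \<psi> p (tri_ray (f, a, u) \<xi>) = \<psi> p (tri_ray (f, a, u) 0) +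
    \<xi> * (theta_slope (tri_ray (f, a, u)) + inner (grad f a) u)) (at_right 0)"
   using eventually_near_ray[OF c inK] rslope_conic[OF conic_theta[OF f a] inK]
   by eventually_elim (use eventually_near_self[OF c a] in \<open>simp add: tri_ray_def theta_slope_def inner_add_right algebra_simps\<close>)
 qed
qed

lemma edge_ray_slope:
 assumes g: "(e, t, s) \<in> edge_germs p"
 shows "eventually (%\<xi>. \<psi> p (echar X e (t + \<xi> * s)) = \<psi> p p + \<xi> * (theta_slope (edge_ray (e, t, s)) + germ_slope (e, t, s))) (at_right 0)"
  and "rslope (%\<xi>. \<psi> p (edge_ray (e, t, s) \<xi>)) = theta_slope (edge_ray (e, t, s)) + germ_slope (e, t, s)"
proof -
 have e: "e \<in> edges X" and ts: "(t, s) \<in> line_germs 0 1" and p: "echar X e t = p" using g by (auto simp: edge_germs_def)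
 have t: "0 \<le> t" "t \<le> 1" using ts by (auto simp: line_germs_def)
 have inK: "eventually (%\<xi>. t + \<xi> *\<^sub>R s \<in> {0..1}) (at_right 0)"
  using line_germs_interior[OF ts] by eventually_elim auto
 have b: "inner (edge_grad e t (wing e)) (side_dir (snd (wing e))) = edge_slope e (edge_grad e t)"
  by (rule edge_slope_eq[OF edge_grad_gradients[OF e t] e t wing_in[OF e]])
 have c: "eventually (%y. \<psi> p (echar X e y) - theta (echar X e y) = \<psi> p p - theta p + (y - t) * edge_slope e (edge_grad e t)) (near {0..1} t)"
  using edge_gradients_echar[OF edge_grad_gradients[OF e t] e t wing_in[OF e]] unfolding b p .
 have con: "conic {0..1} (%y. theta (echar X e y)) t" by (rule conic_theta_edge[OF e _ _ t]) simp_all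
 show ev: "eventually (%\<xi>. \<psi> p (echar X e (t + \<xi> * s)) = \<psi> p p + \<xi> * (theta_slope (edge_ray (e, t, s)) + germ_slope (e, t, s))) (at_right 0)"
  using eventually_near_ray[OF c inK] rslope_conic[OF con inK]
  by eventually_elim (simp add: theta_slope_def germ_slope_def edge_ray_def p algebra_simps)
 show "rslope (%\<xi>. \<psi> p (edge_ray (e, t, s) \<xi>)) = theta_slope (edge_ray (e, t, s)) + germ_slope (e, t, s)"
  by (rule rslope_eqI) (use ev in \<open>simp add: edge_ray_def p\<close>)
qed

text \<open>Along the germ the local equation is linear near \<open>p\<close>, so a generic nearby
  point shows the slope of the germ, and its multiplicity is already the coefficient along the
  ray.\<close>

lemma edge_germ_generic:
 assumes g: "(e, t, s) \<in> edge_germs p"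
 shows "eventually (%\<xi>. 0 < t + \<xi> * s \<and> t + \<xi> * s < 1 \<and> (\<exists>G. edge_gradients (\<psi> p) e (t + \<xi> * s) G \<and>
   edge_value e (t + \<xi> * s) G = coeff_along D (edge_ray (e, t, s)) \<and>
   s * edge_slope e G = theta_slope (edge_ray (e, t, s)) + germ_slope (e, t, s))) (at_right 0)"
proof -
 have e: "e \<in> edges X" and ts: "(t, s) \<in> line_germs 0 1" and p: "echar X e t = p" using g by (auto simp: edge_germs_def)
 have t: "0 \<le> t" "t \<le> 1" using ts by (auto simp: line_germs_def)
 have s: "s = 1 \<or> s = - 1" by (rule line_germs_sign[OF ts])
 define r where "r = theta_slope (edge_ray (e, t, s)) + germ_slope (e, t, s)"
 obtain b where b: "b > 0" "\<And>\<xi>. 0 < \<xi> ==> \<xi> < b ==> \<psi> p (echar X e (t + \<xi> * s)) = \<psi> p p + \<xi> * r"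
  using edge_ray_slope(1)[OF g] unfolding eventually_at_right_field r_def by blast
 have lin: "\<psi> p (echar X e y) = \<psi> p p + s * (y - t) * r" if "0 < s * (y - t)" "s * (y - t) < b" for y
 proof -
  have "t + s * (y - t) * s = y" using s by auto
  then show ?thesis using b(2)[OF that] by simp
 qed
 have sl: "s * edge_slope e G = r"
  if \<xi>: "0 < \<xi>" "\<xi> < b" "0 < t + \<xi> * s" "t + \<xi> * s < 1" and G: "edge_gradients (\<psi> p) e (t + \<xi> * s) G" for \<xi> G
 proof -
  define x where "x = t + \<xi> * s"
  have x: "0 \<le> x" "x \<le> 1" "s * (x - t) = \<xi>" using \<xi> s by (auto simp: x_def)
  have "open {y. 0 < s * (y - t) \<and> s * (y - t) < b}"
   by (intro open_Collect_conj open_Collect_less continuous_intros)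
  then have "eventually (%y. y \<in> {y. 0 < s * (y - t) \<and> s * (y - t) < b}) (near {0..1} x)"
   by (rule eventually_near_open) (use x \<xi> in simp)
  moreover have "eventually (%y. \<psi> p (echar X e y) = \<psi> p (echar X e x) + (y - x) * edge_slope e G) (near {0..1} x)"
   using edge_gradients_echar[OF G[folded x_def] e x(1,2) wing_in[OF e]] unfolding edge_slope_def .
  ultimately have "eventually (%y. (y - x) * edge_slope e G = (y - x) * (s * r)) (near {0..1} x)"
  proof eventually_elim
   case (elim y)
   then have "\<psi> p (echar X e y) = \<psi> p p + s * (y - t) * r" using lin by simp
   moreover have "\<psi> p (echar X e x) = \<psi> p p + s * (x - t) * r" using lin x(3) \<xi> by simp
   ultimately show ?case using elim(2) by (simp add: algebra_simps)
  qed
  from near_interval_slope_unique[OF x(1,2) this] have "edge_slope e G = s * r" .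
  then show ?thesis using s by auto
 qed
 have inK: "eventually (%\<xi>. t + \<xi> *\<^sub>R s \<in> {0..1}) (at_right 0)"
  using line_germs_interior[OF ts] by eventually_elim auto
 have "eventually (%\<xi>. mult (edge_ray (e, t, s) \<xi>) = coeff_along D (edge_ray (e, t, s))) (at_right 0)"
  by (rule coeff_ray(1)[of _ p]) (use g in \<open>auto simp: rays_eq\<close>)
 moreover have "eventually (%\<xi>. 0 < \<xi> \<and> \<xi> < b) (at_right 0)" by (rule eventually_at_right_0I[OF b(1)]) simp
 ultimately show ?thesis
  using eventually_near_ray[OF generic_edge_value[OF e t] inK] edge_ray_eventually[OF ts, of e]
 proof eventually_elim
  case (elim \<xi>)
  have x: "0 < t + \<xi> * s" "t + \<xi> * s < 1" "t + \<xi> * s \<noteq> t" using elim(2,4) s by auto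
  then obtain G where G: "edge_gradients (\<psi> p) e (t + \<xi> * s) G" "edge_value e (t + \<xi> * s) G = mult (EPt e (t + \<xi> * s))"
   using elim(3) by (auto simp: p)
  have "mult (EPt e (t + \<xi> * s)) = coeff_along D (edge_ray (e, t, s))" using elim(1,4) by simp
  then show ?case using x G sl[of \<xi> G] elim(2) unfolding r_def by auto
 qed
qed

text \<open>Each ray from \<open>a\<close> meets the finite exceptional set in finitely many points,
  hence none of them very close to \<open>a\<close>.\<close>

lemma triangle_germ_exists:
 assumes p: "p \<in> points X" and fa: "(f, a) \<in> fibre p"
 shows "\<exists>d. triangle_germ a (%z. \<psi> p (fchar X f z)) (%z. mult (fchar X f z)) (%u. coeff_along D (tri_ray (f, a, u))) d"
proof -
 have f: "f \<in> tris X" and a: "a \<in> std_triangle" and fp: "fchar X f a = p" using fa by (auto simp: fibre_def)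
 have ad: "fchar X f a \<in> dom p" using in_dom[OF p] fp by simp
 obtain d1 where d1: "conic_upto std_triangle (%z. \<psi> p (fchar X f z)) a d1"
  using conic_dom[OF p f a ad] unfolding conic_def by blast
 obtain r where r: "r > 0" "\<And>y. y \<in> std_triangle ==> dist y a < r ==> fchar X f y \<in> dom p"
  using near_fchar[OF open_dom[OF p] f a ad] unfolding eventually_near_metric by blast
 have "triangle_germ a (%z. \<psi> p (fchar X f z)) (%z. mult (fchar X f z)) (%u. coeff_along D (tri_ray (f, a, u))) (min d1 r)"
 proof (unfold_locales, rule convex_std_triangle, rule a)
  show "conic_upto std_triangle (%z. \<psi> p (fchar X f z)) a (min d1 r)"
   using d1 r(1) unfolding conic_upto_def by simp
  show "conic std_triangle (%z. \<psi> p (fchar X f z)) y" if y: "y \<in> std_triangle" "dist y a < min d1 r" for y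
   by (rule conic_dom[OF p f y(1) r(2)[OF y(1)]]) (use y in simp)
  show "eventually (%\<xi>. breaks_at (%z. \<psi> p (fchar X f z)) (a + \<xi> *\<^sub>R v) (mult (fchar X f (a + \<xi> *\<^sub>R v)))) (at_right 0)"
   if v: "v \<noteq> 0" "eventually (%\<xi>. a + \<xi> *\<^sub>R v \<in> interior std_triangle) (at_right 0)" for v
  proof -
   obtain N S where N: "openin T N" "p \<in> N" "N \<subseteq> dom p" "finite (S :: ('v, 'e, 'f) pt set)"
    "\<And>f z. f \<in> tris X ==> z \<in> interior std_triangle ==> FPt f z \<in> N ==> FPt f z \<notin> S ==>
      breaks_at (%y. \<psi> p (fchar X f y)) z (mult (FPt f z))"
    "\<And>e s. e \<in> edges X ==> 0 < s ==> s < 1 ==> EPt e s \<in> N ==> EPt e s \<notin> S ==>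
      \<exists>G. edge_gradients (\<psi> p) e s G \<and> edge_value e s G = mult (EPt e s)"
    by (rule generic_dom[OF p in_dom[OF p]]) (rule that)
   have inK: "eventually (%\<xi>. a + \<xi> *\<^sub>R v \<in> std_triangle) (at_right 0)"
    using v(2) by eventually_elim (use interior_subset in blast)
   have "finite ((%\<xi>. FPt f (a + \<xi> *\<^sub>R v)) -` S)" by (rule finite_vimageI[OF N(4)]) (use v(1) in \<open>auto intro: injI\<close>)
   from finite_avoid[OF this] v(2) eventually_near_ray[OF near_fchar[OF N(1) f a] inK, unfolded fp, OF N(2)]
   show ?thesis
   proof eventually_elim
    case (elim \<xi>)
    have "fchar X f (a + \<xi> *\<^sub>R v) = FPt f (a + \<xi> *\<^sub>R v)" using elim(2) by (rule fchar_interior)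
    then show ?case using N(5)[OF f elim(2)] elim(1,3) by simp
   qed
  qed
  show "eventually (%\<xi>. mult (fchar X f (a + \<xi> *\<^sub>R u)) = coeff_along D (tri_ray (f, a, u))) (at_right 0)"
   if u: "primitive_vec u" "eventually (%\<xi>. a + \<xi> *\<^sub>R u \<in> interior std_triangle) (at_right 0)" for u
  proof -
   have "(f, a, u) \<in> tri_germs p" using u f a fp by (simp add: tri_germs_def)
   then have "tri_ray (f, a, u) \<in> rays X p" by (simp add: rays_eq)
   from coeff_ray(1)[OF this] show ?thesis by (simp add: tri_ray_def)
  qed
 qed
 then show ?thesis ..
qed

end

lemma side_germs_iff: "(k, t, s) \<in> side_germs a \<longleftrightarrow> k < 3 \<and> (t, s) \<in> line_germs 0 1 \<and> tri_side k t = a"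
 by (auto simp: side_germs_def line_germs_def)

lemma line_germs_unit: "(t, s) \<in> line_germs 0 1 ==> 0 \<le> t \<and> t \<le> 1"
 by (simp add: line_germs_def)

context surface_divisor
begin

text \<open>Reciprocity is applied at every point over \<open>p\<close>, with the gradient of the
  local equation minus \<open>theta\<close> as \<open>w\<close>. Regrouped by edge germs, the
  boundary terms add up over the triangles at the edge to two divisor coefficients: that of the
  local equation times the slope of the affine part, and \<open>edge_y\<close> times the slope of
  the local equation, with opposite signs.\<close>

lemma local_pairing:
 assumes p: "p \<in> points X"
 shows "finite {h\<in>tri_germs p. coeff_along D (tri_ray h) \<noteq> 0}"
  and "(\<Sum>h\<in>{h\<in>tri_germs p. coeff_along D (tri_ray h) \<noteq> 0}.
    coeff_along D (tri_ray h) * inner (grad (fst h) (fst (snd h))) (snd (snd h))) =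
   (\<Sum>g\<in>edge_germs p. edge_y (fst g) 0 * (theta_slope (edge_ray g) + germ_slope g) - coeff_along D (edge_ray g) * germ_slope g)"
proof -
 let ?C = "coeff_along D"
 let ?F = "%h. ?C (tri_ray h) * inner (grad (fst h) (fst (snd h))) (snd (snd h))"
 define sl where "sl g = theta_slope (edge_ray g) + germ_slope g" for g
 have "\<exists>d. \<forall>fa\<in>fibre p. triangle_germ (snd fa) (%z. \<psi> p (fchar X (fst fa) z)) (%z. mult (fchar X (fst fa) z))
   (%u. ?C (tri_ray (fst fa, snd fa, u))) (d fa)"
 proof (intro bchoice ballI)
  fix fa assume "fa \<in> fibre p"
  then show "\<exists>d. triangle_germ (snd fa) (%z. \<psi> p (fchar X (fst fa) z)) (%z. mult (fchar X (fst fa) z))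
   (%u. ?C (tri_ray (fst fa, snd fa, u))) d"
   using triangle_germ_exists[OF p, of "fst fa" "snd fa"] by simp
 qed
 then obtain d where d: "\<And>fa. fa \<in> fibre p ==> triangle_germ (snd fa) (%z. \<psi> p (fchar X (fst fa) z))
   (%z. mult (fchar X (fst fa) z)) (%u. ?C (tri_ray (fst fa, snd fa, u))) (d fa)" by blast
 have d0: "d fa > 0" if "fa \<in> fibre p" for fa
  using pl_germ.conic_a[OF d[OF that, unfolded triangle_germ_def]] by (simp add: conic_upto_def)
 define good where "good g \<xi> \<longleftrightarrow> 0 < fst (snd g) + \<xi> * snd (snd g) \<and> fst (snd g) + \<xi> * snd (snd g) < 1 \<and>
   (\<exists>G. edge_gradients (\<psi> p) (fst g) (fst (snd g) + \<xi> * snd (snd g)) G \<and>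
    edge_value (fst g) (fst (snd g) + \<xi> * snd (snd g)) G = ?C (edge_ray g) \<and>
    snd (snd g) * edge_slope (fst g) G = sl g)" for g \<xi>
 have "eventually (good g) (at_right 0)" if "g \<in> edge_germs p" for g
  using edge_germ_generic[of "fst g" "fst (snd g)" "snd (snd g)" p] that unfolding good_def sl_def by simp
 \<comment> \<open>One distance must serve all triangles at \<open>p\<close> at once, since an edge
   germ shares its gradients among them; there are finitely many germs and preimages.\<close>
 then have "eventually (%\<xi>. \<forall>g\<in>edge_germs p. good g \<xi>) (at_right 0)"
  by (intro eventually_ball_finite[OF fin_edge_germs]) blast
 moreover have "eventually (%\<xi>. \<forall>fa\<in>fibre p. 4 * \<xi> < d fa) (at_right 0)"
 proof (intro eventually_ball_finite[OF fin_fibre] ballI)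
  fix fa assume "fa \<in> fibre p"
  then show "eventually (%\<xi>. 4 * \<xi> < d fa) (at_right 0)"
   using d0[of fa] by (intro eventually_at_right_0I[of "d fa / 4"]) auto
 qed
 moreover have "eventually (%\<xi>::real. \<xi> < 1) (at_right 0)" by (rule eventually_at_right_0I[of 1]) auto
 ultimately have "eventually (%\<xi>. (\<forall>g\<in>edge_germs p. good g \<xi>) \<and> (\<forall>fa\<in>fibre p. 4 * \<xi> < d fa) \<and> \<xi> < 1) (at_right 0)"
  by eventually_elim blast
 then obtain \<xi> where e0: "0 < \<xi>" and e1: "\<xi> < 1" and ed: "\<And>fa. fa \<in> fibre p ==> 4 * \<xi> < d fa"
  and good: "\<And>g. g \<in> edge_germs p ==> good g \<xi>"
  using eventually_at_right_0_ex by blast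
 define x where "x g = fst (snd g) + \<xi> * snd (snd g)" for g :: "'e \<times> real \<times> real"
 have "\<exists>Gf. \<forall>g\<in>edge_germs p. edge_gradients (\<psi> p) (fst g) (x g) (Gf g) \<and>
    edge_value (fst g) (x g) (Gf g) = ?C (edge_ray g) \<and> snd (snd g) * edge_slope (fst g) (Gf g) = sl g"
  by (intro bchoice ballI) (use good in \<open>simp add: good_def x_def\<close>)
 then obtain Gf where Gf: "\<And>g. g \<in> edge_germs p ==> edge_gradients (\<psi> p) (fst g) (x g) (Gf g)"
  "\<And>g. g \<in> edge_germs p ==> edge_value (fst g) (x g) (Gf g) = ?C (edge_ray g)"
  "\<And>g. g \<in> edge_germs p ==> snd (snd g) * edge_slope (fst g) (Gf g) = sl g" by blast
 have x01: "0 < x g" "x g < 1" if "g \<in> edge_germs p" for g using good[OF that] by (simp_all add: good_def x_def)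
 define tm where "tm g fk = boundary_term (Gf g fk) (edge_grad (fst g) (fst (snd g)) fk) (snd (snd g) *\<^sub>R side_dir (snd fk))
   (tri_corner (snd fk) - tri_side (snd fk) (fst (snd g)))" for g fk
 define I where "I fa = {u. primitive_vec u \<and> ?C (tri_ray (fst fa, snd fa, u)) \<noteq> 0 \<and>
   eventually (%\<xi>. snd fa + \<xi> *\<^sub>R u \<in> interior std_triangle) (at_right 0)}" for fa :: "'f \<times> real \<times> real"
 have recip: "finite (I fa) \<and> (\<Sum>u\<in>I fa. ?F (fst fa, snd fa, u)) =
   (\<Sum>b\<in>side_germs (snd fa). tm (side X (fst fa) (fst b), snd b) (fst fa, fst b))" if fap: "fa \<in> fibre p" for fa
 proof -
  obtain f a where fa: "fa = (f, a)" by (cases fa)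
  have f: "f \<in> tris X" and fp: "fchar X f a = p" using fap by (auto simp: fa fibre_def)
  interpret tg: triangle_germ a "%z. \<psi> p (fchar X f z)" "%z. mult (fchar X f z)" "%u. ?C (tri_ray (f, a, u))" "d fa"
   using d[OF fap] by (simp add: fa)
  define G' where "G' b = Gf (side X f (fst b), snd b) (f, fst b)" for b :: "nat \<times> real \<times> real"
  have mem: "(side X f k, t, s) \<in> edge_germs p" if "(k, t, s) \<in> side_germs a" for k t s
   using that side_in[OF f, of k] fchar_side[OF f, of k t] fp line_germs_unit[of t s]
   unfolding side_germs_iff edge_germs_def by auto
  have "\<exists>c. \<forall>b\<in>side_germs a. eventually (%y. \<psi> p (fchar X f y) = inner (G' b) y + c b)
    (near std_triangle (tri_side (fst b) (fst (snd b) + \<xi> * snd (snd b))))"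
  proof (intro bchoice ballI)
   fix b assume b: "b \<in> side_germs a"
   obtain k t s where kts: "b = (k, t, s)" by (cases b)
   have k: "k < 3" using b by (simp add: kts side_germs_iff)
   have "(f, k) \<in> edge_link X (side X f k)" using f k by (simp add: edge_link_def)
   then show "\<exists>c. eventually (%y. \<psi> p (fchar X f y) = inner (G' b) y + c)
    (near std_triangle (tri_side (fst b) (fst (snd b) + \<xi> * snd (snd b))))"
    using Gf(1)[OF mem[OF b[unfolded kts]]] unfolding edge_gradients_def x_def G'_def kts by fastforce
  qed
  then obtain c where c: "\<And>b. b \<in> side_germs a ==> eventually (%y. \<psi> p (fchar X f y) = inner (G' b) y + c b)
    (near std_triangle (tri_side (fst b) (fst (snd b) + \<xi> * snd (snd b))))" by blast
  have c': "eventually (%y. \<psi> p (fchar X f y) = inner (G' (k, t, s)) y + c (k, t, s)) (near std_triangle (tri_side k (t + \<xi> * s)))"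
   if "(k, t, s) \<in> side_germs a" for k t s using c[OF that] by simp
  have small: "0 < t + \<xi> * s \<and> t + \<xi> * s < 1" if "(k, t, s) \<in> side_germs a" for k t s
   using x01[OF mem[OF that]] by (simp add: x_def)
  have inw: "tg.inward = I fa" unfolding tg.inward_def I_def by (simp add: fa)
  note lr = tg.local_reciprocity(1)[OF e0 e1 ed[OF fap] small c', unfolded inw]
   tg.local_reciprocity(2)[where w = "grad f a", OF e0 e1 ed[OF fap] small c', unfolded inw]
  have "side_term G' (grad f a) b = tm (side X f (fst b), snd b) (f, fst b)" if "b \<in> side_germs a" for b
  proof -
   obtain k t s where kts: "b = (k, t, s)" by (cases b)
   have "tri_side k t = a" using that by (simp add: kts side_germs_iff)
   then show ?thesis by (simp add: kts side_term_def tm_def G'_def edge_grad_def)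
  qed
  then have "(\<Sum>b\<in>side_germs a. side_term G' (grad f a) b) = (\<Sum>b\<in>side_germs a. tm (side X f (fst b), snd b) (f, fst b))"
   by (rule sum.cong[OF refl])
  then show ?thesis using lr by (simp add: fa)
 qed
 define \<Phi> where "\<Phi> y = (fst (fst y), snd (fst y), snd y)" for y :: "('f \<times> real \<times> real) \<times> real \<times> real"
 have H: "{h\<in>tri_germs p. ?C (tri_ray h) \<noteq> 0} = \<Phi> ` Sigma (fibre p) I"
 proof (rule subset_antisym; rule subsetI)
  fix h assume h: "h \<in> {h\<in>tri_germs p. ?C (tri_ray h) \<noteq> 0}"
  have "h = \<Phi> ((fst h, fst (snd h)), snd (snd h))" by (simp add: \<Phi>_def)
  moreover have "((fst h, fst (snd h)), snd (snd h)) \<in> Sigma (fibre p) I"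
   using h by (cases h) (simp add: tri_germs_def fibre_def I_def)
  ultimately show "h \<in> \<Phi> ` Sigma (fibre p) I" by blast
 next
  fix h assume "h \<in> \<Phi> ` Sigma (fibre p) I"
  then obtain fa u where h: "fa \<in> fibre p" "u \<in> I fa" "h = (fst fa, snd fa, u)" unfolding \<Phi>_def by auto
  then show "h \<in> {h\<in>tri_germs p. ?C (tri_ray h) \<noteq> 0}" by (cases fa) (simp add: tri_germs_def fibre_def I_def)
 qed
 have fI: "\<forall>fa\<in>fibre p. finite (I fa)" using recip by blast
 then have "finite (Sigma (fibre p) I)" using fin_fibre by blast
 then show "finite {h\<in>tri_germs p. ?C (tri_ray h) \<noteq> 0}" unfolding H by (rule finite_imageI)
 have inj: "inj_on \<Phi> (Sigma (fibre p) I)" by (auto simp: inj_on_def \<Phi>_def)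
 have "(\<Sum>h\<in>{h\<in>tri_germs p. ?C (tri_ray h) \<noteq> 0}. ?F h) = (\<Sum>(fa, u)\<in>Sigma (fibre p) I. ?F (fst fa, snd fa, u))"
  unfolding H sum.reindex[OF inj] by (simp add: \<Phi>_def case_prod_unfold)
 also have "\<dots> = (\<Sum>fa\<in>fibre p. \<Sum>u\<in>I fa. ?F (fst fa, snd fa, u))"
  by (rule sum.Sigma[OF fin_fibre fI, symmetric])
 also have "\<dots> = (\<Sum>fa\<in>fibre p. \<Sum>b\<in>side_germs (snd fa). tm (side X (fst fa) (fst b), snd b) (fst fa, fst b))"
  by (rule sum.cong[OF refl]) (use recip in blast)
 also have "\<dots> = (\<Sum>(fa, b)\<in>(SIGMA fa:fibre p. side_germs (snd fa)). tm (side X (fst fa) (fst b), snd b) (fst fa, fst b))"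
  by (rule sum.Sigma[OF fin_fibre]) (use finite_side_germs in blast)
 \<comment> \<open>A point over \<open>p\<close> together with a side direction there is the same as
   an edge germ at \<open>p\<close> together with an occurrence of the edge in a triangle.\<close>
 also have "\<dots> = (\<Sum>(g, fk)\<in>(SIGMA g:edge_germs p. edge_link X (fst g)). tm g fk)"
 proof -
  define i where "i y = ((fst (snd y), tri_side (snd (snd y)) (fst (snd (fst y)))), (snd (snd y), snd (fst y)))"
   for y :: "('e \<times> real \<times> real) \<times> ('f \<times> nat)"
  define j where "j y = ((side X (fst (fst y)) (fst (snd y)), snd (snd y)), (fst (fst y), fst (snd y)))"
   for y :: "('f \<times> real \<times> real) \<times> (nat \<times> real \<times> real)"
  have S: "i (j y) = y \<and> j y \<in> (SIGMA g:edge_germs p. edge_link X (fst g))" if yS: "y \<in> (SIGMA fa:fibre p. side_germs (snd fa))" for y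
  proof -
   obtain f a k t s where y: "y = ((f, a), (k, t, s))" "f \<in> tris X" "fchar X f a = p"
    "k < 3" "(t, s) \<in> line_germs 0 1" "tri_side k t = a"
    using yS by (cases y) (auto simp: fibre_def side_germs_iff)
   have "echar X (side X f k) t = p" using fchar_side[OF y(2,4), of t] line_germs_unit[OF y(5)] y(3,6) by simp
   then show ?thesis using y side_in[OF y(2,4)] by (simp add: i_def j_def edge_germs_def edge_link_def)
  qed
  have R: "j (i y) = y \<and> i y \<in> (SIGMA fa:fibre p. side_germs (snd fa))" if yS: "y \<in> (SIGMA g:edge_germs p. edge_link X (fst g))" for y
  proof -
   obtain e t s f k where y: "y = ((e, t, s), (f, k))" "(t, s) \<in> line_germs 0 1" "echar X e t = p"
    "f \<in> tris X" "k < 3" "side X f k = e"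
    using yS by (cases y) (auto simp: edge_germs_def edge_link_def)
   then show ?thesis using fchar_side[OF y(4,5), of t] tri_side_in[OF y(5), of t] line_germs_unit[OF y(2)]
    by (simp add: i_def j_def fibre_def side_germs_iff)
  qed
  show ?thesis
   by (rule sum.reindex_bij_witness[where i = i and j = j]) (use S R in \<open>auto simp: j_def case_prod_unfold\<close>)
 qed
 also have "\<dots> = (\<Sum>g\<in>edge_germs p. \<Sum>fk\<in>edge_link X (fst g). tm g fk)"
  by (rule sum.Sigma[OF fin_edge_germs, symmetric]) (use fin_edge_link in blast)
 also have "\<dots> = (\<Sum>g\<in>edge_germs p. edge_y (fst g) 0 * (theta_slope (edge_ray g) + germ_slope g) - ?C (edge_ray g) * germ_slope g)"
 proof (rule sum.cong[OF refl])
  fix g assume g: "g \<in> edge_germs p"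
  obtain e t s where ets: "g = (e, t, s)" by (cases g)
  have e: "e \<in> edges X" and t: "0 \<le> t" "t \<le> 1" using g line_germs_unit[of t s] by (auto simp: ets edge_germs_def)
  have xg: "0 \<le> x g" "x g \<le> 1" using x01[OF g] by auto
  let ?w = "edge_grad e t" and ?G = "Gf g"
  let ?V = "%fk. tri_corner (snd fk) - tri_side (snd fk) t"
  define \<sigma> b where "\<sigma> = edge_slope e ?G" and "b = edge_slope e ?w"
  have G: "edge_gradients (\<psi> p) e (x g) ?G" using Gf(1)[OF g] by (simp add: ets)
  have s1: "inner (?G fk) (side_dir (snd fk)) = \<sigma>" if "fk \<in> edge_link X e" for fk
   unfolding \<sigma>_def by (rule edge_slope_eq[OF G e xg that])
  have s2: "inner (?w fk) (side_dir (snd fk)) = b" if "fk \<in> edge_link X e" for fk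
   unfolding b_def by (rule edge_slope_eq[OF edge_grad_gradients[OF e t] e t that])
  have "(\<Sum>fk\<in>edge_link X e. tm g fk) = (\<Sum>fk\<in>edge_link X e. s * \<sigma> * inner (?w fk) (?V fk) - s * b * inner (?G fk) (?V fk))"
   by (rule sum.cong[OF refl]) (use s1 s2 in \<open>simp add: tm_def boundary_term_def ets algebra_simps\<close>)
  also have "\<dots> = s * \<sigma> * (\<Sum>fk\<in>edge_link X e. inner (?w fk) (?V fk)) - s * b * (\<Sum>fk\<in>edge_link X e. inner (?G fk) (?V fk))"
   by (simp only: sum_subtractf sum_distrib_left)
  finally have 1: "(\<Sum>fk\<in>edge_link X e. tm g fk) =
   s * \<sigma> * (\<Sum>fk\<in>edge_link X e. inner (?w fk) (?V fk)) - s * b * (\<Sum>fk\<in>edge_link X e. inner (?G fk) (?V fk))" .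
  \<comment> \<open>The term with the integers at \<open>e\<close> enters both sums as
    \<open>A\<close> times a slope. In the antisymmetric combination these products cancel.\<close>
  define A where "A = of_int (\<alpha> e 0) * t - of_int (\<alpha> e 1) * (1 - t)"
  have "edge_y e t = edge_y e 0" by (rule edge_y_const[OF e]) (use t in auto)
  then have 2: "(\<Sum>fk\<in>edge_link X e. inner (?w fk) (?V fk)) = edge_y e 0 - A * b"
   unfolding edge_y_def[of e t] edge_value_def A_def b_def by simp
  have "edge_value e t ?G = edge_value e (x g) ?G" by (rule edge_value_shift[OF s1[unfolded \<sigma>_def] e])
  also have "\<dots> = ?C (edge_ray g)" using Gf(2)[OF g] by (simp add: ets)
  finally have 3: "(\<Sum>fk\<in>edge_link X e. inner (?G fk) (?V fk)) = ?C (edge_ray g) - A * \<sigma>"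
   unfolding edge_value_def[of e t] A_def \<sigma>_def by simp
  have 4: "s * \<sigma> = sl g" using Gf(3)[OF g] by (simp add: ets \<sigma>_def)
  have 5: "germ_slope g = s * b" by (simp add: germ_slope_def ets b_def)
  have "(\<Sum>fk\<in>edge_link X e. tm g fk) = edge_y e 0 * (s * \<sigma>) - ?C (edge_ray g) * (s * b)"
   unfolding 1 2 3 by (simp add: algebra_simps)
  then show "(\<Sum>fk\<in>edge_link X (fst g). tm g fk) =
   edge_y (fst g) 0 * (theta_slope (edge_ray g) + germ_slope g) - ?C (edge_ray g) * germ_slope g"
   unfolding 4 5[symmetric] sl_def by (simp add: ets)
 qed
 finally show "(\<Sum>h\<in>{h\<in>tri_germs p. ?C (tri_ray h) \<noteq> 0}. ?F h) =
   (\<Sum>g\<in>edge_germs p. edge_y (fst g) 0 * (theta_slope (edge_ray g) + germ_slope g) - ?C (edge_ray g) * germ_slope g)" .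
qed

definition germ_part :: "('v, 'e, 'f) pt => real" where
 "germ_part p = (\<Sum>g\<in>edge_germs p. edge_y (fst g) 0 * germ_slope g)"

text \<open>The local equation is split into \<open>theta\<close> and an affine part along every
  ray. By the local pairing, the affine part on rays inside triangles cancels the one on edges
  weighted by the coefficients of the divisor, and sums weighted by \<open>edge_y\<close> take its
  place.\<close>

lemma local_formula:
 assumes p: "p \<in> points X"
 shows "local_self_intersection X D (\<psi> p) p =
  theta_part p + (\<Sum>g\<in>edge_germs p. edge_y (fst g) 0 * rslope (%\<xi>. theta (edge_ray g \<xi>))) + germ_part p"
proof -
 let ?C = "coeff_along D"
 let ?E = "{g\<in>edge_germs p. ?C (edge_ray g) \<noteq> 0}" and ?H = "{h\<in>tri_germs p. ?C (tri_ray h) \<noteq> 0}"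
 let ?f = "%\<gamma>. ?C \<gamma> * outgoing_slope (\<psi> p) \<gamma>"
 have os: "outgoing_slope (\<psi> p) \<gamma> = rslope (%\<xi>. \<psi> p (\<gamma> \<xi>))" for \<gamma> by (simp add: outgoing_slope_def rslope_def)
 have R: "{\<gamma>. \<gamma> \<in> rays X p \<and> ?C \<gamma> \<noteq> 0} = edge_ray ` ?E \<union> tri_ray ` ?H" unfolding rays_eq by blast
 have inj: "inj_on edge_ray ?E" "inj_on tri_ray ?H"
  by (rule inj_on_subset[OF edge_ray_inj] inj_on_subset[OF tri_ray_inj], blast)+
 have finE: "finite ?E" using fin_edge_germs by simp
 have "local_self_intersection X D (\<psi> p) p = sum ?f (edge_ray ` ?E) + sum ?f (tri_ray ` ?H)"
  unfolding local_self_intersection_def R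
  by (rule sum.union_disjoint) (use finE local_pairing(1)[OF p] edge_ray_neq_tri_ray in blast)+
 also have "sum ?f (edge_ray ` ?E) = (\<Sum>g\<in>?E. ?f (edge_ray g))" by (simp add: sum.reindex[OF inj(1)])
 also have "\<dots> = (\<Sum>g\<in>edge_germs p. ?f (edge_ray g))" by (rule sum.mono_neutral_left[OF fin_edge_germs]) auto
 also have "\<dots> = (\<Sum>g\<in>edge_germs p. ?C (edge_ray g) * theta_slope (edge_ray g) + ?C (edge_ray g) * germ_slope g)"
 proof (rule sum.cong[OF refl])
  fix g assume "g \<in> edge_germs p"
  then show "?f (edge_ray g) = ?C (edge_ray g) * theta_slope (edge_ray g) + ?C (edge_ray g) * germ_slope g"
   using edge_ray_slope(2)[of "fst g" "fst (snd g)" "snd (snd g)" p] unfolding os by (simp add: distrib_left)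
 qed
 also have "sum ?f (tri_ray ` ?H) = (\<Sum>h\<in>?H. ?f (tri_ray h))" by (simp add: sum.reindex[OF inj(2)])
 also have "\<dots> = (\<Sum>h\<in>?H. ?C (tri_ray h) * theta_slope (tri_ray h) + ?C (tri_ray h) * inner (grad (fst h) (fst (snd h))) (snd (snd h)))"
 proof (rule sum.cong[OF refl])
  fix h assume "h \<in> ?H"
  then show "?f (tri_ray h) = ?C (tri_ray h) * theta_slope (tri_ray h) + ?C (tri_ray h) * inner (grad (fst h) (fst (snd h))) (snd (snd h))"
   using tri_slope[of "fst h" "fst (snd h)" "snd (snd h)" p] unfolding os by (simp add: distrib_left)
 qed
 finally show ?thesis
  unfolding sum.distrib local_pairing(2)[OF p] theta_part_def germ_part_def theta_slope_def[symmetric] sum_subtractf distrib_left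
  by simp
qed

lemma germ_part_vertex: "germ_part (VPt v) = qform (germs X v) (lmat v) vertex_slope vertex_slope"
proof -
 define \<Phi> where "\<Phi> a = (fst a, real (snd a), 1 - 2 * real (snd a))" for a :: "'e \<times> nat"
 have im: "edge_germs (VPt v) = \<Phi> ` germs X v"
 proof (rule subset_antisym; rule subsetI)
  fix g assume g: "g \<in> edge_germs (VPt v)"
  obtain e t s where ets: "g = (e, t, s)" by (cases g)
  have e: "e \<in> edges X" "(t, s) \<in> line_germs 0 1" "echar X e t = VPt v" using g by (auto simp: ets edge_germs_def)
  then have "t = 0 \<and> s = 1 \<and> endpt X e 0 = v \<or> t = 1 \<and> s = - 1 \<and> endpt X e 1 = v"
   by (auto simp: echar_def line_germs_def split: if_splits)
  then show "g \<in> \<Phi> ` germs X v"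
  proof
   assume "t = 0 \<and> s = 1 \<and> endpt X e 0 = v"
   then show ?thesis using e(1) by (intro image_eqI[of _ _ "(e, 0)"]) (auto simp: \<Phi>_def ets germs_def)
  next
   assume "t = 1 \<and> s = - 1 \<and> endpt X e 1 = v"
   then show ?thesis using e(1) by (intro image_eqI[of _ _ "(e, 1)"]) (auto simp: \<Phi>_def ets germs_def)
  qed
 next
  fix g assume "g \<in> \<Phi> ` germs X v"
  then obtain e i where g: "g = \<Phi> (e, i)" "e \<in> edges X" "i < 2" "endpt X e i = v" by (auto simp: germs_def)
  then have "i = 0 \<or> i = 1" by auto
  then show "g \<in> edge_germs (VPt v)" using g by (auto simp: \<Phi>_def edge_germs_def line_germs_def echar_def)
 qed
 have inj: "inj_on \<Phi> (germs X v)" by (auto simp: inj_on_def \<Phi>_def)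
 have "germ_part (VPt v) = (\<Sum>a\<in>germs X v. edge_y (fst a) 0 * vertex_slope a)"
  unfolding germ_part_def im sum.reindex[OF inj] by (simp add: \<Phi>_def germ_slope_def vertex_slope_def)
 also have "\<dots> = (\<Sum>a\<in>germs X v. vertex_slope a * (\<Sum>b\<in>germs X v. lmat v a b * vertex_slope b))"
 proof (rule sum.cong[OF refl])
  fix a assume "a \<in> germs X v"
  then show "edge_y (fst a) 0 * vertex_slope a = vertex_slope a * (\<Sum>b\<in>germs X v. lmat v a b * vertex_slope b)"
   using vertex_slope_row[of "fst a" "snd a" v] by simp
 qed
 finally show ?thesis unfolding qform_def .
qed

text \<open>In the interior of an edge the local equation minus \<open>theta\<close> is affine, so
  its slopes in the two directions are opposite.\<close>

lemma germ_part_other: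
 assumes "p \<notin> VPt ` verts X"
 shows "germ_part p = 0"
proof (cases p)
 case (VPt v)
 then have "germs X v = {}" using assms endpt_in by (auto simp: germs_def)
 then show ?thesis unfolding VPt germ_part_vertex by (simp add: qform_def)
next
 case (EPt e t)
 show ?thesis
 proof (cases "e \<in> edges X \<and> 0 < t \<and> t < 1")
  case True
  then have "edge_germs p = {(e, t, 1), (e, t, - 1)}"
   unfolding EPt edge_germs_def by (auto simp: echar_def line_germs_def split: if_splits)
  then show ?thesis by (simp add: germ_part_def germ_slope_def)
 next
  case False
  then have "edge_germs p = {}"
   unfolding EPt edge_germs_def by (auto simp: echar_def line_germs_def split: if_splits)
  then show ?thesis by (simp add: germ_part_def)
 qed
next
 case (FPt f z)
 then have "edge_germs p = {}" by (auto simp: edge_germs_def)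
 then show ?thesis by (simp add: germ_part_def)
qed

text \<open>Of the three parts of the local formula, the two with slopes of \<open>theta\<close> sum
  to zero over all points, and the third is concentrated at the vertices. Uniqueness of
  \<open>has_sum\<close> identifies the total with the degree.\<close>

theorem self_intersection_eq_qform:
 assumes m: "m = (\<Sum>p | p \<in> points X \<and> local_self_intersection X D (\<psi> p) p \<noteq> 0. local_self_intersection X D (\<psi> p) p)"
  and pos: "m > 0"
 shows "(\<Sum>v\<in>verts X. qform (germs X v) (lmat v) vertex_slope vertex_slope) = m"
proof -
 let ?L = "%p. local_self_intersection X D (\<psi> p) p"
 let ?M = "%p. theta_part p + (\<Sum>g\<in>edge_germs p. edge_y (fst g) 0 * rslope (%\<xi>. theta (edge_ray g \<xi>))) + germ_part p"
 let ?B = "{p. p \<in> points X \<and> ?L p \<noteq> 0}"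
 have "(germ_part has_sum (\<Sum>v\<in>verts X. qform (germs X v) (lmat v) vertex_slope vertex_slope)) UNIV"
 proof (rule has_sum_finite_neutralI[of "VPt ` verts X"])
  show "(\<Sum>v\<in>verts X. qform (germs X v) (lmat v) vertex_slope vertex_slope) = sum germ_part (VPt ` verts X)"
   by (subst sum.reindex) (auto simp: inj_on_def germ_part_vertex)
 qed (use finite_cells germ_part_other in auto)
 from has_sum_add[OF has_sum_add[OF theta_total edge_total] this]
 have 1: "(?M has_sum (\<Sum>v\<in>verts X. qform (germs X v) (lmat v) vertex_slope vertex_slope)) UNIV" by simp
 have out: "?M p = 0" if "p \<notin> points X" for p
 proof -
  have "edge_germs p = {}"
  proof (rule equals0I)
   fix g assume "g \<in> edge_germs p"
   then obtain e t s where g: "e \<in> edges X" "(t, s) \<in> line_germs 0 1" "echar X e t = p" by (auto simp: edge_germs_def)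
   then show False using echar_points[of e t] line_germs_unit[OF g(2)] that by simp
  qed
  moreover have "tri_germs p = {}" using that fchar_points by (auto simp: tri_germs_def)
  ultimately show ?thesis by (simp add: theta_part_def germ_part_def)
 qed
 \<comment> \<open>A sum over an infinite set is 0 by convention, so the positive value of
   \<open>m\<close> forces finiteness.\<close>
 have fin: "finite ?B"
 proof (rule ccontr)
  assume "infinite ?B"
  then have "m = 0" unfolding m by (rule sum.infinite)
  then show False using pos by simp
 qed
 have "(?M has_sum m) UNIV"
 proof (rule has_sum_finite_neutralI[OF fin])
  show "m = sum ?M ?B" unfolding m by (rule sum.cong[OF refl]) (rule local_formula, simp)
  fix p assume p: "p \<in> UNIV - ?B"
  show "?M p = 0"
  proof (cases "p \<in> points X")
   case True
   then show ?thesis using p local_formula[OF True] by simp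
  qed (rule out)
 qed simp
 from has_sum_unique[OF 1 this] show ?thesis .
qed

end

theorem theorem4p7:
  fixes \<Delta> :: "('v, 'e, 'f) delta_complex"
    and \<alpha> :: "'e \<Rightarrow> nat \<Rightarrow> int"
  assumes "tropical_surface \<Delta> \<alpha>"
    and "loc_connected_codim1 \<Delta>"
  shows "let T = realization \<Delta>;
             \<A> = linear_functions \<Delta> \<alpha>;
             W = H1_span T (connecting_map T \<A> ` quotient_sections T \<A>)
         in H1_codim_le T W 1 \<and>
            ((\<exists>D m. divisor_on \<Delta> \<alpha> D \<and> has_self_intersection \<Delta> \<alpha> D m \<and> m > 0) \<longrightarrow> W = H1 T)"
proof -
  interpret ts: trop_surface \<Delta> \<alpha> by unfold_locales (rule assms)+
  have "H1_span (realization \<Delta>) (connecting_map (realization \<Delta>) (linear_functions \<Delta> \<alpha>) `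
      quotient_sections (realization \<Delta>) (linear_functions \<Delta> \<alpha>)) = H1 (realization \<Delta>)"
    if D: "divisor_on \<Delta> \<alpha> D" "has_self_intersection \<Delta> \<alpha> D m" "m > 0" for D m
  proof -
    obtain \<psi> where \<psi>: "\<And>p. p \<in> points \<Delta> \<Longrightarrow> local_equation \<Delta> \<alpha> D p (\<psi> p)"
      and m: "m = (\<Sum>p | p \<in> points \<Delta> \<and> local_self_intersection \<Delta> D (\<psi> p) p \<noteq> 0. local_self_intersection \<Delta> D (\<psi> p) p)"
      using D(2) unfolding has_self_intersection_def by blast
    interpret sd: surface_divisor \<Delta> \<alpha> D \<psi>
      by unfold_locales (use D(1) \<psi> in \<open>auto simp: divisor_on_def\<close>)
    show ?thesis
      by (rule ts.span_codim(2)[OF sd.vertex_slope_row]) (simp_all add: sd.self_intersection_eq_qform[OF m D(3)] D(3))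
  qed
  then show ?thesis using ts.span_codim(1) unfolding Let_def by blast
qed

end
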